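(* Work in ZFC and assume that every real is an element of a countable transitive model of ZFC. Let $\mathcal{L}^+$ be any fixed countable language extending $\mathcal{L}_\in^\Diamond$ and interpreted in every world of $\mathcal{C}$. Then every world $U\in\mathcal{C}$ is contained in some world $W\in\mathcal{C}$ (with $U\subseteq W$) such that $\mathrm{Val}_{\mathcal{C}}(W,\mathcal{L}^+)=\mathrm{S5}$.
   Context: $\mathcal{C}$ is the potentialist system whose worlds are the countable transitive models of ZFC, with $W$ accessing $U$ iff $W\subseteq U$; $\Diamond\varphi$ at $W$ means $\varphi$ holds at some accessible world, $\Box\varphi$ at all accessible worlds; quantifiers range over the current world. $\mathcal{L}_\in^\Diamond$ is the language of set theory with $\Diamond,\Box$. $\mathrm{Val}_{\mathcal{C}}(W,\mathcal{L}')$ is the set of propositional modal formulas all of whose substitution instances by $\mathcal{L}'$-sentences are true at $W$. *)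

theory Defs
  imports Main "HOL-Library.Countable_Set_Type"
begin

section \<open>Hereditarily countable sets\<close>

text \<open>
  The initial algebra of the countable powerset functor: its elements are exactly the
  hereditarily countable sets. A countable transitive set has only hereditarily countable
  elements, so the countable transitive sets of the ambient universe are the countable
  transitive subsets of this type.
\<close>

datatype hcset = HCSet (elts: "hcset cset")

definition hmem :: "hcset \<Rightarrow> hcset \<Rightarrow> bool" (infix "\<epsilon>" 50) where
  "x \<epsilon> y \<longleftrightarrow> cin x (elts y)"

lemma hmem_extensional:
  assumes "\<And>z. z \<epsilon> x \<longleftrightarrow> z \<epsilon> y"
  shows "x = y"
proof -
  have "elts x = elts y"
    using assms unfolding hmem_def cset_eq_iff by simp
  then show ?thesis by (rule hcset.expand)
qed

lemma hmem_induct: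
  assumes "\<And>x. (\<And>y. y \<epsilon> x \<Longrightarrow> P y) \<Longrightarrow> P x"
  shows "P x"
proof (induction x)
  case (HCSet X)
  show ?case
    by (rule assms) (use HCSet in \<open>simp add: hmem_def cin.rep_eq\<close>)
qed

lemma countable_set_is_hcset: "countable A \<Longrightarrow> \<exists>x. \<forall>y. y \<epsilon> x \<longleftrightarrow> y \<in> A"
  by (rule exI[of _ "HCSet (acset A)"]) (simp add: hmem_def cin.rep_eq acset_inverse)

primrec omega_nat :: "nat \<Rightarrow> hcset" where
  "omega_nat 0 = HCSet cempty"
| "omega_nat (Suc n) = HCSet (cinsert (omega_nat n) (elts (omega_nat n)))"

text \<open>As usual in set theory, a real is a subset of \<open>\<omega>\<close>.\<close>

definition is_real :: "hcset \<Rightarrow> bool" where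
  "is_real x \<longleftrightarrow> (\<forall>y. y \<epsilon> x \<longrightarrow> y \<in> range omega_nat)"


section \<open>First-order set theory and ZFC\<close>

text \<open>Variables are named by natural numbers; \<open>FAll n\<close> binds the variable \<open>n\<close>.\<close>

datatype sfm =
    FMem nat nat
  | FEq nat nat
  | FFls
  | FImp sfm sfm
  | FAll nat sfm

definition "FNeg \<phi> = FImp \<phi> FFls"
definition "FOr \<phi> \<psi> = FImp (FNeg \<phi>) \<psi>"
definition "FAnd \<phi> \<psi> = FNeg (FImp \<phi> (FNeg \<psi>))"
definition "FIff \<phi> \<psi> = FAnd (FImp \<phi> \<psi>) (FImp \<psi> \<phi>)"
definition "FEx n \<phi> = FNeg (FAll n (FNeg \<phi>))"

primrec fv :: "sfm \<Rightarrow> nat set" where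
  "fv (FMem i j) = {i, j}"
| "fv (FEq i j) = {i, j}"
| "fv FFls = {}"
| "fv (FImp \<phi> \<psi>) = fv \<phi> \<union> fv \<psi>"
| "fv (FAll n \<phi>) = fv \<phi> - {n}"

primrec ssat :: "hcset set \<Rightarrow> (nat \<Rightarrow> hcset) \<Rightarrow> sfm \<Rightarrow> bool" where
  "ssat M e (FMem i j) \<longleftrightarrow> e i \<epsilon> e j"
| "ssat M e (FEq i j) \<longleftrightarrow> e i = e j"
| "ssat M e FFls \<longleftrightarrow> False"
| "ssat M e (FImp \<phi> \<psi>) \<longleftrightarrow> (ssat M e \<phi> \<longrightarrow> ssat M e \<psi>)"
| "ssat M e (FAll n \<phi>) \<longleftrightarrow> (\<forall>x\<in>M. ssat M (e(n := x)) \<phi>)"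

definition extensionality_ax :: sfm where
  "extensionality_ax = FAll 0 (FAll 1 (FImp (FAll 2 (FIff (FMem 2 0) (FMem 2 1))) (FEq 0 1)))"

definition foundation_ax :: sfm where
  "foundation_ax = FAll 0 (FImp (FEx 1 (FMem 1 0))
     (FEx 1 (FAnd (FMem 1 0) (FNeg (FEx 2 (FAnd (FMem 2 1) (FMem 2 0)))))))"

definition pairing_ax :: sfm where
  "pairing_ax = FAll 0 (FAll 1 (FEx 2 (FAll 3 (FIff (FMem 3 2) (FOr (FEq 3 0) (FEq 3 1))))))"

definition union_ax :: sfm where
  "union_ax = FAll 0 (FEx 1 (FAll 2 (FIff (FMem 2 1) (FEx 3 (FAnd (FMem 3 0) (FMem 2 3))))))"

definition powerset_ax :: sfm where
  "powerset_ax = FAll 0 (FEx 1 (FAll 2 (FIff (FMem 2 1) (FAll 3 (FImp (FMem 3 2) (FMem 3 0))))))"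

definition infinity_ax :: sfm where
  "infinity_ax = FEx 0 (FAnd
     (FEx 1 (FAnd (FMem 1 0) (FAll 2 (FNeg (FMem 2 1)))))
     (FAll 1 (FImp (FMem 1 0)
       (FEx 2 (FAnd (FMem 2 0) (FAll 3 (FIff (FMem 3 2) (FOr (FMem 3 1) (FEq 3 1)))))))))"

text \<open>Every family of nonempty pairwise disjoint sets has a transversal.\<close>

definition choice_ax :: sfm where
  "choice_ax = FAll 0 (FImp
     (FAnd (FAll 1 (FImp (FMem 1 0) (FEx 2 (FMem 2 1))))
          (FAll 1 (FAll 2 (FImp (FAnd (FMem 1 0) (FMem 2 0))
            (FImp (FEx 3 (FAnd (FMem 3 1) (FMem 3 2))) (FEq 1 2))))))
     (FEx 4 (FAll 1 (FImp (FMem 1 0) (FEx 2 (FAll 3 (FIff (FAnd (FMem 3 1) (FMem 3 4)) (FEq 3 2))))))))"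

text \<open>
  In the schemes, the variables of \<open>\<phi>\<close> not bound by the axiom are parameters. Separation
  forms \<open>{x\<^sub>2 \<in> x\<^sub>0. \<phi>}\<close>; replacement forms \<open>{x\<^sub>3. \<exists>x\<^sub>2 \<in> x\<^sub>0. \<phi>}\<close> provided that for every
  \<open>x\<^sub>2 \<in> x\<^sub>0\<close> there is exactly one \<open>x\<^sub>3\<close> with \<open>\<phi>\<close> (this one being called \<open>x\<^sub>4\<close>).
\<close>

definition separation_ax :: "sfm \<Rightarrow> sfm" where
  "separation_ax \<phi> = FAll 0 (FEx 1 (FAll 2 (FIff (FMem 2 1) (FAnd (FMem 2 0) \<phi>))))"

definition replacement_ax :: "sfm \<Rightarrow> sfm" where
  "replacement_ax \<phi> = FAll 0 (FImp
     (FAll 2 (FImp (FMem 2 0) (FEx 4 (FAll 3 (FIff \<phi> (FEq 3 4))))))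
     (FEx 1 (FAll 3 (FIff (FMem 3 1) (FEx 2 (FAnd (FMem 2 0) \<phi>))))))"

definition ZFC :: "sfm set" where
  "ZFC = {extensionality_ax, foundation_ax, pairing_ax, union_ax, powerset_ax,
          infinity_ax, choice_ax}
     \<union> {separation_ax \<phi> |\<phi>. 1 \<notin> fv \<phi>}
     \<union> {replacement_ax \<phi> |\<phi>. 1 \<notin> fv \<phi> \<and> 4 \<notin> fv \<phi>}"

text \<open>
  Axioms with free variables are read as their universal closures. Nonemptiness of the
  structure is required explicitly, as an empty \<open>M\<close> admits no assignment at all.
\<close>

definition models_ZFC :: "hcset set \<Rightarrow> bool" where
  "models_ZFC M \<longleftrightarrow> M \<noteq> {} \<and> (\<forall>\<phi>\<in>ZFC. \<forall>e. range e \<subseteq> M \<longrightarrow> ssat M e \<phi>)"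

definition transitive_set :: "hcset set \<Rightarrow> bool" where
  "transitive_set M \<longleftrightarrow> (\<forall>x\<in>M. \<forall>y. y \<epsilon> x \<longrightarrow> y \<in> M)"

text \<open>The worlds of the potentialist system; accessibility is inclusion.\<close>

definition ctms :: "hcset set set" where
  "ctms = {M. countable M \<and> transitive_set M \<and> models_ZFC M}"


section \<open>Modal languages of set theory\<close>

text \<open>
  An extension of the modal language of set theory by further relation and function symbols
  (constants being nullary function symbols), together with an interpretation of these in
  every world. Nothing relates the interpretations in different worlds. With no symbols this
  is the modal language of set theory itself.
\<close>

record ('r, 'f) lang =
  rels :: "'r set"
  funs :: "'f set"
  rel_arity :: "'r \<Rightarrow> nat"
  fun_arity :: "'f \<Rightarrow> nat"
  rel_interp :: "hcset set \<Rightarrow> 'r \<Rightarrow> hcset list \<Rightarrow> bool"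
  fun_interp :: "hcset set \<Rightarrow> 'f \<Rightarrow> hcset list \<Rightarrow> hcset"

definition interpreted_in_worlds :: "('r, 'f) lang \<Rightarrow> bool" where
  "interpreted_in_worlds L \<longleftrightarrow>
     (\<forall>W\<in>ctms. \<forall>f\<in>funs L. \<forall>xs.
        set xs \<subseteq> W \<and> length xs = fun_arity L f \<longrightarrow> fun_interp L W f xs \<in> W)"

definition countable_lang :: "('r, 'f) lang \<Rightarrow> bool" where
  "countable_lang L \<longleftrightarrow> countable (rels L) \<and> countable (funs L)"

datatype 'f tm = TVar nat | TFun 'f "'f tm list"

datatype ('r, 'f) mfm =
    MMem "'f tm" "'f tm"
  | MEq "'f tm" "'f tm"
  | MRel 'r "'f tm list"
  | MFls
  | MImp "('r, 'f) mfm" "('r, 'f) mfm"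
  | MAll nat "('r, 'f) mfm"
  | MBox "('r, 'f) mfm"
  | MDia "('r, 'f) mfm"

primrec tm_fv :: "'f tm \<Rightarrow> nat set" where
  "tm_fv (TVar n) = {n}"
| "tm_fv (TFun f ts) = \<Union> (set (map tm_fv ts))"

primrec mfv :: "('r, 'f) mfm \<Rightarrow> nat set" where
  "mfv (MMem s t) = tm_fv s \<union> tm_fv t"
| "mfv (MEq s t) = tm_fv s \<union> tm_fv t"
| "mfv (MRel r ts) = \<Union> (set (map tm_fv ts))"
| "mfv MFls = {}"
| "mfv (MImp \<phi> \<psi>) = mfv \<phi> \<union> mfv \<psi>"
| "mfv (MAll n \<phi>) = mfv \<phi> - {n}"
| "mfv (MBox \<phi>) = mfv \<phi>"
| "mfv (MDia \<phi>) = mfv \<phi>"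

primrec wf_tm :: "('r, 'f) lang \<Rightarrow> 'f tm \<Rightarrow> bool" where
  "wf_tm L (TVar n) \<longleftrightarrow> True"
| "wf_tm L (TFun f ts) \<longleftrightarrow>
     f \<in> funs L \<and> length ts = fun_arity L f \<and> list_all (wf_tm L) ts"

primrec wf_mfm :: "('r, 'f) lang \<Rightarrow> ('r, 'f) mfm \<Rightarrow> bool" where
  "wf_mfm L (MMem s t) \<longleftrightarrow> wf_tm L s \<and> wf_tm L t"
| "wf_mfm L (MEq s t) \<longleftrightarrow> wf_tm L s \<and> wf_tm L t"
| "wf_mfm L (MRel r ts) \<longleftrightarrow>
     r \<in> rels L \<and> length ts = rel_arity L r \<and> list_all (wf_tm L) ts"
| "wf_mfm L MFls \<longleftrightarrow> True"
| "wf_mfm L (MImp \<phi> \<psi>) \<longleftrightarrow> wf_mfm L \<phi> \<and> wf_mfm L \<psi>"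
| "wf_mfm L (MAll n \<phi>) \<longleftrightarrow> wf_mfm L \<phi>"
| "wf_mfm L (MBox \<phi>) \<longleftrightarrow> wf_mfm L \<phi>"
| "wf_mfm L (MDia \<phi>) \<longleftrightarrow> wf_mfm L \<phi>"

definition sentences :: "('r, 'f) lang \<Rightarrow> ('r, 'f) mfm set" where
  "sentences L = {\<phi>. wf_mfm L \<phi> \<and> mfv \<phi> = {}}"

primrec tm_val :: "('r, 'f) lang \<Rightarrow> hcset set \<Rightarrow> (nat \<Rightarrow> hcset) \<Rightarrow> 'f tm \<Rightarrow> hcset" where
  "tm_val L W e (TVar n) = e n"
| "tm_val L W e (TFun f ts) = fun_interp L W f (map (tm_val L W e) ts)"

text \<open>
  Under a modal operator variables keep their values, while relation and function symbols are
  interpreted in the accessed world.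
\<close>

primrec msat :: "('r, 'f) lang \<Rightarrow> hcset set \<Rightarrow> (nat \<Rightarrow> hcset) \<Rightarrow> ('r, 'f) mfm \<Rightarrow> bool" where
  "msat L W e (MMem s t) \<longleftrightarrow> tm_val L W e s \<epsilon> tm_val L W e t"
| "msat L W e (MEq s t) \<longleftrightarrow> tm_val L W e s = tm_val L W e t"
| "msat L W e (MRel r ts) \<longleftrightarrow> rel_interp L W r (map (tm_val L W e) ts)"
| "msat L W e MFls \<longleftrightarrow> False"
| "msat L W e (MImp \<phi> \<psi>) \<longleftrightarrow> (msat L W e \<phi> \<longrightarrow> msat L W e \<psi>)"
| "msat L W e (MAll n \<phi>) \<longleftrightarrow> (\<forall>x\<in>W. msat L W (e(n := x)) \<phi>)"
| "msat L W e (MBox \<phi>) \<longleftrightarrow> (\<forall>U\<in>ctms. W \<subseteq> U \<longrightarrow> msat L U e \<phi>)"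
| "msat L W e (MDia \<phi>) \<longleftrightarrow> (\<exists>U\<in>ctms. W \<subseteq> U \<and> msat L U e \<phi>)"

definition true_at :: "('r, 'f) lang \<Rightarrow> hcset set \<Rightarrow> ('r, 'f) mfm \<Rightarrow> bool" where
  "true_at L W \<phi> \<longleftrightarrow> (\<forall>e. range e \<subseteq> W \<longrightarrow> msat L W e \<phi>)"


section \<open>Propositional modal logic\<close>

datatype pfm =
    PVar nat
  | PFls
  | PImp pfm pfm
  | PBox pfm
  | PDia pfm

definition PNeg :: "pfm \<Rightarrow> pfm" where
  "PNeg p = PImp p PFls"

primrec subst_inst :: "(nat \<Rightarrow> ('r, 'f) mfm) \<Rightarrow> pfm \<Rightarrow> ('r, 'f) mfm" where
  "subst_inst \<sigma> (PVar n) = \<sigma> n"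
| "subst_inst \<sigma> PFls = MFls"
| "subst_inst \<sigma> (PImp p q) = MImp (subst_inst \<sigma> p) (subst_inst \<sigma> q)"
| "subst_inst \<sigma> (PBox p) = MBox (subst_inst \<sigma> p)"
| "subst_inst \<sigma> (PDia p) = MDia (subst_inst \<sigma> p)"

definition Val :: "hcset set \<Rightarrow> ('r, 'f) lang \<Rightarrow> pfm set" where
  "Val W L = {p. \<forall>\<sigma>. (\<forall>n. \<sigma> n \<in> sentences L) \<longrightarrow> true_at L W (subst_inst \<sigma> p)}"

text \<open>Truth-functional evaluation: \<open>v\<close> treats variables and modalised formulas as atoms.\<close>

primrec peval :: "(pfm \<Rightarrow> bool) \<Rightarrow> pfm \<Rightarrow> bool" where
  "peval v (PVar n) = v (PVar n)"
| "peval v PFls = False"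
| "peval v (PImp p q) = (peval v p \<longrightarrow> peval v q)"
| "peval v (PBox p) = v (PBox p)"
| "peval v (PDia p) = v (PDia p)"

definition tautology :: "pfm \<Rightarrow> bool" where
  "tautology p \<longleftrightarrow> (\<forall>v. peval v p)"

inductive_set S5 :: "pfm set" where
  taut: "tautology p \<Longrightarrow> p \<in> S5"
| K: "PImp (PBox (PImp p q)) (PImp (PBox p) (PBox q)) \<in> S5"
| Dual1: "PImp (PDia p) (PNeg (PBox (PNeg p))) \<in> S5"
| Dual2: "PImp (PNeg (PBox (PNeg p))) (PDia p) \<in> S5"
| T: "PImp (PBox p) p \<in> S5"
| Four: "PImp (PBox p) (PBox (PBox p)) \<in> S5"
| Five: "PImp (PDia p) (PBox (PDia p)) \<in> S5"
| MP: "PImp p q \<in> S5 \<Longrightarrow> p \<in> S5 \<Longrightarrow> q \<in> S5"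
| Nec: "p \<in> S5 \<Longrightarrow> PBox p \<in> S5"

end

theory Submission
  imports Defs
begin

text \<open>
  Every countable union of worlds lies in a world: a real coding the membership relation of the
  union lies in some world, and that world computes the collapse of the coded relation.
  Iterating through the countably many sentences, one reaches above \<open>U\<close> a world \<open>W\<close> such that
  whatever is possibly necessary above \<open>W\<close> is already necessary there; hence S5 is valid at \<open>W\<close>.
  For the converse, a formula outside S5 fails in a finite model with universal accessibility,
  which is simulated by dials: colour the cardinals by the residue modulo \<open>k\<close> of the length of
  the maximal descending chain of immediate predecessors, and let a world show the colour of its
  continuum. Cohen forcing preserves cardinals and can move the continuum to the next cardinals
  in turn, so every colour is reachable from every world.
\<close>

section \<open>Modal logic\<close>

text \<open>Worlds disagree about cardinals, and an arbitrary larger world may collapse those of a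
  smaller one, so no feature of the continuum can be kept stable. A dial asks for less: a world
  shows at most one value and can reach each of them. Hence it suffices to control one kind of
  extension, the Cohen extensions. The size of their continuum is the obstacle, since the starting
  world may violate any form of GCH. The way out is the property \<open>wcl\<close> of a set: to
  have, up to size, no more countable subsets than elements. The reals have it, the Hartogs number
  of an ordinal inherits it from that ordinal, and for a cardinal \<open>\<mu>\<close> with it,
  \<open>\<mu>\<close> many Cohen reals make the continuum exactly \<open>\<mu>\<close>. Cardinals
  with this property follow one another without gaps from above the continuum on, so all colours
  occur among them. Everything constructed in a world must be shown to belong to it. Predicates and
  operations of HOL are therefore certified as definable over the model (\<open>dfn\<close>,
  \<open>dtm\<close>), and formulas are never written down; only the dials, being sentences, need
  definitions uniform in the world (\<open>udf\<close>).\<close>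

primrec imps :: "pfm list \<Rightarrow> pfm \<Rightarrow> pfm" where
  "imps [] q = q"
| "imps (p # ps) q = PImp p (imps ps q)"

lemma peval_imps: "peval v (imps ps q) \<longleftrightarrow> ((\<forall>p\<in>set ps. peval v p) \<longrightarrow> peval v q)"
  by (induction ps) auto

text \<open>Necessitation is confined to theorems: the premises enter only through an implication in
  S5. This is what makes the deduction theorem a matter of propositional logic.\<close>

definition der :: "pfm set \<Rightarrow> pfm \<Rightarrow> bool" where
  "der \<Gamma> q \<longleftrightarrow> (\<exists>ps. set ps \<subseteq> \<Gamma> \<and> imps ps q \<in> S5)"

lemma der_S5: "p \<in> S5 \<Longrightarrow> der \<Gamma> p"
  unfolding der_def by (rule exI[of _ "[]"]) simp

lemma der_mem: "p \<in> \<Gamma> \<Longrightarrow> der \<Gamma> p"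
  unfolding der_def by (rule exI[of _ "[p]"]) (auto intro!: S5.taut simp: tautology_def)

lemma der_MP:
  assumes "der \<Gamma> (PImp p q)" "der \<Gamma> p" shows "der \<Gamma> q"
proof -
  obtain ps where ps: "set ps \<subseteq> \<Gamma>" "imps ps (PImp p q) \<in> S5" using assms(1) unfolding der_def by blast
  obtain qs where qs: "set qs \<subseteq> \<Gamma>" "imps qs p \<in> S5" using assms(2) unfolding der_def by blast
  have "tautology (PImp (imps ps (PImp p q)) (PImp (imps qs p) (imps (ps @ qs) q)))"
    by (auto simp: tautology_def peval_imps)
  then have "imps (ps @ qs) q \<in> S5" using ps(2) qs(2) S5.taut S5.MP by blast
  then show ?thesis using ps(1) qs(1) unfolding der_def by (intro exI[of _ "ps @ qs"]) simp
qed

lemma der_taut1: "der \<Gamma> p \<Longrightarrow> (\<And>v. peval v p \<Longrightarrow> peval v q) \<Longrightarrow> der \<Gamma> q"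
  by (rule der_MP[OF der_S5[OF S5.taut]]) (auto simp: tautology_def)

lemma der_taut2: "der \<Gamma> p \<Longrightarrow> der \<Gamma> p' \<Longrightarrow> (\<And>v. peval v p \<Longrightarrow> peval v p' \<Longrightarrow> peval v q) \<Longrightarrow> der \<Gamma> q"
proof -
  assume d: "der \<Gamma> p" "der \<Gamma> p'" and v: "\<And>v. peval v p \<Longrightarrow> peval v p' \<Longrightarrow> peval v q"
  have "tautology (PImp p (PImp p' q))" using v by (simp add: tautology_def)
  then show ?thesis using der_MP d der_S5 S5.taut by blast
qed

lemma der_deduct: "der (insert p \<Gamma>) q \<Longrightarrow> der \<Gamma> (PImp p q)"
proof -
  assume "der (insert p \<Gamma>) q"
  then obtain ps where ps: "set ps \<subseteq> insert p \<Gamma>" "imps ps q \<in> S5" unfolding der_def by blast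
  let ?qs = "filter (\<lambda>x. x \<noteq> p) ps"
  have "tautology (PImp (imps ps q) (imps ?qs (PImp p q)))" by (auto simp: tautology_def peval_imps)
  then have "imps ?qs (PImp p q) \<in> S5" using ps(2) S5.taut S5.MP by blast
  then show ?thesis using ps(1) unfolding der_def by (intro exI[of _ ?qs]) auto
qed

section \<open>Maximal consistent sets and the canonical model\<close>

definition mcs :: "pfm set \<Rightarrow> bool" where
  "mcs \<Gamma> \<longleftrightarrow> \<not> der \<Gamma> PFls \<and> (\<forall>p. p \<in> \<Gamma> \<or> PNeg p \<in> \<Gamma>)"

lemma mcs_der: "mcs \<Gamma> \<Longrightarrow> der \<Gamma> p \<Longrightarrow> p \<in> \<Gamma>"
  using der_taut2[of \<Gamma> p "PNeg p" PFls] der_mem[of "PNeg p" \<Gamma>] unfolding mcs_def PNeg_def by auto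

lemma mcs_neg: "mcs \<Gamma> \<Longrightarrow> PNeg p \<in> \<Gamma> \<longleftrightarrow> p \<notin> \<Gamma>"
  using der_taut2[of \<Gamma> p "PNeg p" PFls] der_mem[of _ \<Gamma>] unfolding mcs_def PNeg_def by auto

lemma mcs_imp: "mcs \<Gamma> \<Longrightarrow> PImp p q \<in> \<Gamma> \<longleftrightarrow> (p \<in> \<Gamma> \<longrightarrow> q \<in> \<Gamma>)"
proof
  assume m: "mcs \<Gamma>"
  show "PImp p q \<in> \<Gamma> \<Longrightarrow> p \<in> \<Gamma> \<longrightarrow> q \<in> \<Gamma>"
    using mcs_der[OF m der_MP[OF der_mem der_mem]] by blast
  assume "p \<in> \<Gamma> \<longrightarrow> q \<in> \<Gamma>"
  then consider "PNeg p \<in> \<Gamma>" | "q \<in> \<Gamma>" using mcs_neg[OF m] by blast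
  then show "PImp p q \<in> \<Gamma>"
  proof cases
    case 1
    show ?thesis by (rule mcs_der[OF m der_taut1[OF der_mem[OF 1]]]) (simp add: PNeg_def)
  next
    case 2
    show ?thesis by (rule mcs_der[OF m der_taut1[OF der_mem[OF 2]]]) simp
  qed
qed

text \<open>Zorn's lemma applies because a derivation uses finitely many premises, which all lie in
  a single member of a chain.\<close>

lemma lindenbaum:
  assumes c: "\<not> der \<Gamma> PFls" obtains \<Delta> where "\<Gamma> \<subseteq> \<Delta>" "mcs \<Delta>"
proof -
  let ?A = "{\<Delta>. \<Gamma> \<subseteq> \<Delta> \<and> \<not> der \<Delta> PFls}"
  have "\<exists>M\<in>?A. \<forall>X\<in>?A. M \<subseteq> X \<longrightarrow> X = M"
  proof (rule subset_Zorn_nonempty)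
    show "?A \<noteq> {}" using c by blast
    fix C assume C: "C \<noteq> {}" "subset.chain ?A C"
    have "\<not> der (\<Union>C) PFls"
    proof
      assume "der (\<Union>C) PFls"
      then obtain ps where ps: "set ps \<subseteq> \<Union>C" "imps ps PFls \<in> S5" unfolding der_def by blast
      obtain B where "B \<in> C" "set ps \<subseteq> B" by (rule finite_subset_Union_chain[OF finite_set ps(1) C])
      then show False using ps(2) C(2) unfolding der_def subset.chain_def by blast
    qed
    then show "\<Union>C \<in> ?A" using C unfolding subset.chain_def by blast
  qed
  then obtain \<Delta> where D: "\<Gamma> \<subseteq> \<Delta>" "\<not> der \<Delta> PFls" and mx: "\<forall>X\<in>?A. \<Delta> \<subseteq> X \<longrightarrow> X = \<Delta>" by blast
  have "p \<in> \<Delta> \<or> PNeg p \<in> \<Delta>" for p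
  proof (rule ccontr)
    assume *: "\<not> ?thesis"
    have ins: "der (insert q \<Delta>) PFls" if "q \<notin> \<Delta>" for q
    proof (rule ccontr)
      assume "\<not> ?thesis"
      then have "insert q \<Delta> \<in> ?A" using D(1) by blast
      then have "insert q \<Delta> = \<Delta>" using mx by blast
      then show False using that by blast
    qed
    have "der \<Delta> (PImp p PFls)" "der \<Delta> (PImp (PNeg p) PFls)" using der_deduct[OF ins] * by blast+
    then have "der \<Delta> PFls" by (rule der_taut2) (auto simp: PNeg_def)
    then show False using D(2) by blast
  qed
  then show thesis using that D unfolding mcs_def by blast
qed

text \<open>Necessitation followed by repeated use of K. In this form normality enters the canonical
  model: what follows from boxed-away premises follows, boxed, from the boxed premises.\<close>

lemma S5_box_imps:
  assumes "imps ps q \<in> S5" shows "imps (map PBox ps) (PBox q) \<in> S5"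
proof -
  have "PImp (PBox (imps ps q)) (imps (map PBox ps) (PBox q)) \<in> S5"
  proof (induction ps)
    case Nil
    show ?case by (rule S5.taut) (simp add: tautology_def)
  next
    case (Cons p ps)
    let ?a = "PImp (PBox (PImp p (imps ps q))) (PImp (PBox p) (PBox (imps ps q)))"
    let ?b = "PImp (PBox (imps ps q)) (imps (map PBox ps) (PBox q))"
    let ?c = "PImp (PBox (imps (p # ps) q)) (imps (map PBox (p # ps)) (PBox q))"
    have "PImp ?a (PImp ?b ?c) \<in> S5" by (rule S5.taut) (simp add: tautology_def)
    then show ?case by (rule S5.MP[OF S5.MP[OF _ S5.K] Cons])
  qed
  from S5.MP[OF this S5.Nec[OF assms]] show ?thesis .
qed

text \<open>Kripke semantics with universal accessibility. A point is identified with its valuation,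
  so \<open>Vs\<close> is frame and model at once.\<close>

primrec sem :: "(nat \<Rightarrow> bool) set \<Rightarrow> (nat \<Rightarrow> bool) \<Rightarrow> pfm \<Rightarrow> bool" where
  "sem Vs v (PVar n) = v n"
| "sem Vs v PFls = False"
| "sem Vs v (PImp p q) = (sem Vs v p \<longrightarrow> sem Vs v q)"
| "sem Vs v (PBox p) = (\<forall>w\<in>Vs. sem Vs w p)"
| "sem Vs v (PDia p) = (\<exists>w\<in>Vs. sem Vs w p)"

primrec pvars :: "pfm \<Rightarrow> nat set" where
  "pvars (PVar n) = {n}"
| "pvars PFls = {}"
| "pvars (PImp p q) = pvars p \<union> pvars q"
| "pvars (PBox p) = pvars p"
| "pvars (PDia p) = pvars p"

lemma finite_pvars: "finite (pvars p)" by (induction p) auto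

text \<open>On the part of the canonical model seen from one point, boxes have constant truth value,
  which amounts to universal accessibility. Identifying points that agree on the variables of
  \<open>p\<close> leaves finitely many valuations, and the truth lemma survives because the modal
  clauses do not depend on the point.\<close>

theorem S5_complete:
  assumes "p \<notin> S5" shows "\<exists>Vs v. finite Vs \<and> v \<in> Vs \<and> \<not> sem Vs v p"
proof -
  have "\<not> der {PNeg p} PFls"
  proof
    assume "der {PNeg p} PFls"
    then have "der {} (PImp (PNeg p) PFls)" by (rule der_deduct)
    then have "der {} p" by (rule der_taut1) (simp add: PNeg_def)
    then show False using assms by (auto simp: der_def)
  qed
  then obtain \<Gamma> where G: "PNeg p \<in> \<Gamma>" "mcs \<Gamma>" using lindenbaum by blast
  \<comment> \<open>The points seen from \<open>\<Gamma>\<close>. Axiom T puts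
    \<open>\<Gamma>\<close> among them, while Four and Five make boxed formulas agree on all of
    them.\<close>
  define Ws where "Ws = {\<Delta>. mcs \<Delta> \<and> (\<forall>q. PBox q \<in> \<Gamma> \<longrightarrow> q \<in> \<Delta>)}"
  have GW: "\<Gamma> \<in> Ws" unfolding Ws_def using G(2) mcs_imp[OF G(2)] mcs_der[OF G(2) der_S5[OF S5.T]] by blast
  have box: "PBox q \<in> \<Delta> \<longleftrightarrow> PBox q \<in> \<Gamma>" if D: "\<Delta> \<in> Ws" for q \<Delta>
  proof
    have m: "mcs \<Delta>" using D unfolding Ws_def by blast
    show "PBox q \<in> \<Gamma> \<Longrightarrow> PBox q \<in> \<Delta>"
      using D mcs_imp[OF G(2)] mcs_der[OF G(2) der_S5[OF S5.Four]] unfolding Ws_def by blast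
    assume b: "PBox q \<in> \<Delta>"
    show "PBox q \<in> \<Gamma>"
    proof (rule ccontr)
      let ?d = "PDia (PNeg q)"
      assume "PBox q \<notin> \<Gamma>"
      \<comment> \<open>The duality axioms turn a diamond of \<open>PNeg q\<close> into a box of the
        double negation, which has to be exchanged with \<open>q\<close> under the box.\<close>
      have "imps [q] (PNeg (PNeg q)) \<in> S5" "imps [PNeg (PNeg q)] q \<in> S5"
        by (auto intro!: S5.taut simp: tautology_def PNeg_def)
      from this[THEN S5_box_imps]
      have i: "PImp (PBox q) (PBox (PNeg (PNeg q))) \<in> S5" "PImp (PBox (PNeg (PNeg q))) (PBox q) \<in> S5" by simp_all
      have "PBox (PNeg (PNeg q)) \<notin> \<Gamma>" using \<open>PBox q \<notin> \<Gamma>\<close> mcs_imp[OF G(2)] mcs_der[OF G(2) der_S5[OF i(2)]] by blast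
      then have "?d \<in> \<Gamma>" using mcs_neg[OF G(2)] mcs_imp[OF G(2)] mcs_der[OF G(2) der_S5[OF S5.Dual2]] by blast
      then have "PBox ?d \<in> \<Gamma>" using mcs_imp[OF G(2)] mcs_der[OF G(2) der_S5[OF S5.Five]] by blast
      then have "?d \<in> \<Delta>" using D unfolding Ws_def by blast
      then have "PNeg (PBox (PNeg (PNeg q))) \<in> \<Delta>" using mcs_imp[OF m] mcs_der[OF m der_S5[OF S5.Dual1]] by blast
      moreover have "PBox (PNeg (PNeg q)) \<in> \<Delta>" using b mcs_imp[OF m] mcs_der[OF m der_S5[OF i(1)]] by blast
      ultimately show False using mcs_neg[OF m] by blast
    qed
  qed
  have boxW: "PBox q \<in> \<Gamma> \<longleftrightarrow> (\<forall>\<Delta>\<in>Ws. q \<in> \<Delta>)" for q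
  proof
    show "PBox q \<in> \<Gamma> \<Longrightarrow> \<forall>\<Delta>\<in>Ws. q \<in> \<Delta>" unfolding Ws_def by blast
    assume a: "\<forall>\<Delta>\<in>Ws. q \<in> \<Delta>"
    have "der (insert (PNeg q) {r. PBox r \<in> \<Gamma>}) PFls"
    proof (rule ccontr)
      assume "\<not> ?thesis"
      then obtain \<Delta> where D: "insert (PNeg q) {r. PBox r \<in> \<Gamma>} \<subseteq> \<Delta>" "mcs \<Delta>" by (rule lindenbaum)
      then have "\<Delta> \<in> Ws" unfolding Ws_def by blast
      then show False using a mcs_neg[OF D(2)] D(1) by blast
    qed
    then have "der {r. PBox r \<in> \<Gamma>} (PImp (PNeg q) PFls)" by (rule der_deduct)
    then have "der {r. PBox r \<in> \<Gamma>} q" by (rule der_taut1) (simp add: PNeg_def)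
    then obtain rs where rs: "set rs \<subseteq> {r. PBox r \<in> \<Gamma>}" "imps rs q \<in> S5" unfolding der_def by blast
    have "set (map PBox rs) \<subseteq> \<Gamma>" using rs(1) by auto
    then have "der \<Gamma> (PBox q)" using S5_box_imps[OF rs(2)] unfolding der_def by blast
    then show "PBox q \<in> \<Gamma>" by (rule mcs_der[OF G(2)])
  qed
  \<comment> \<open>Variables outside \<open>p\<close> are made false everywhere, so that only
    finitely many valuations arise.\<close>
  define vl where "vl \<Delta> n \<longleftrightarrow> n \<in> pvars p \<and> PVar n \<in> \<Delta>" for \<Delta> n
  have dia: "PDia q \<in> \<Delta> \<longleftrightarrow> (\<exists>\<Delta>'\<in>Ws. q \<in> \<Delta>')" if D: "\<Delta> \<in> Ws" for q \<Delta>
  proof -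
    have m: "mcs \<Delta>" using D unfolding Ws_def by blast
    have "PDia q \<in> \<Delta> \<longleftrightarrow> PNeg (PBox (PNeg q)) \<in> \<Delta>"
      using mcs_imp[OF m] mcs_der[OF m der_S5[OF S5.Dual1]] mcs_der[OF m der_S5[OF S5.Dual2]] by blast
    also have "\<dots> \<longleftrightarrow> \<not> (\<forall>\<Delta>'\<in>Ws. PNeg q \<in> \<Delta>')" unfolding mcs_neg[OF m] box[OF D] boxW ..
    also have "\<dots> \<longleftrightarrow> (\<exists>\<Delta>'\<in>Ws. q \<in> \<Delta>')" using mcs_neg unfolding Ws_def by blast
    finally show ?thesis .
  qed
  have truth: "pvars q \<subseteq> pvars p \<Longrightarrow> \<Delta> \<in> Ws \<Longrightarrow> sem (vl ` Ws) (vl \<Delta>) q \<longleftrightarrow> q \<in> \<Delta>" for q \<Delta>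
  proof (induction q arbitrary: \<Delta>)
    case PFls
    have "mcs \<Delta>" using PFls unfolding Ws_def by blast
    then show ?case using der_mem unfolding mcs_def by auto
  next
    case (PImp q r)
    then have "mcs \<Delta>" unfolding Ws_def by blast
    then show ?case using PImp mcs_imp by simp
  qed (simp_all add: vl_def[abs_def] box boxW dia)
  have "vl ` Ws \<subseteq> (\<lambda>A n. n \<in> A) ` Pow (pvars p)"
  proof (rule image_subsetI)
    fix \<Delta>
    have "vl \<Delta> = (\<lambda>n. n \<in> {n \<in> pvars p. PVar n \<in> \<Delta>})" by (simp add: vl_def fun_eq_iff)
    then show "vl \<Delta> \<in> (\<lambda>A n. n \<in> A) ` Pow (pvars p)" by blast
  qed
  then have "finite (vl ` Ws)" by (rule finite_subset) (simp add: finite_pvars)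
  moreover have "\<not> sem (vl ` Ws) (vl \<Gamma>) p" using truth[OF _ GW, of p] G mcs_neg by blast
  ultimately show ?thesis using GW by blast
qed

section \<open>Sentences of the modal language\<close>

lemma tm_val_cong: "(\<And>n. n \<in> tm_fv t \<Longrightarrow> e n = e' n) \<Longrightarrow> tm_val L W e t = tm_val L W e' t"
proof (induction t)
  case (TFun f ts)
  have "map (tm_val L W e) ts = map (tm_val L W e') ts"
    by (rule map_cong[OF refl]) (use TFun in fastforce)
  then show ?case by (simp only: tm_val.simps)
qed simp

lemma msat_cong: "(\<And>n. n \<in> mfv \<phi> \<Longrightarrow> e n = e' n) \<Longrightarrow> msat L W e \<phi> \<longleftrightarrow> msat L W e' \<phi>"
proof (induction \<phi> arbitrary: W e e')
  case (MMem s t)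
  then show ?case using tm_val_cong[of s e e' L W] tm_val_cong[of t e e' L W] by simp
next
  case (MEq s t)
  then show ?case using tm_val_cong[of s e e' L W] tm_val_cong[of t e e' L W] by simp
next
  case (MRel r ts)
  have "map (tm_val L W e) ts = map (tm_val L W e') ts"
    by (rule map_cong[OF refl], rule tm_val_cong) (use MRel in auto)
  then show ?case by (simp only: msat.simps)
next
  case (MImp \<phi> \<psi>)
  have "msat L W e \<phi> \<longleftrightarrow> msat L W e' \<phi>" "msat L W e \<psi> \<longleftrightarrow> msat L W e' \<psi>"
    by (rule MImp; simp add: MImp.prems)+
  then show ?case by simp
next
  case (MAll n \<phi>)
  have "msat L W (e(n := x)) \<phi> \<longleftrightarrow> msat L W (e'(n := x)) \<phi>" for x by (rule MAll.IH) (simp add: MAll.prems)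
  then show ?case by simp
next
  case (MBox \<phi>)
  have "msat L V e \<phi> \<longleftrightarrow> msat L V e' \<phi>" for V by (rule MBox.IH) (simp add: MBox.prems)
  then show ?case by simp
next
  case (MDia \<phi>)
  have "msat L V e \<phi> \<longleftrightarrow> msat L V e' \<phi>" for V by (rule MDia.IH) (simp add: MDia.prems)
  then show ?case by simp
qed simp

lemma msat_sentence: "\<phi> \<in> sentences L \<Longrightarrow> msat L W e \<phi> \<longleftrightarrow> msat L W e' \<phi>"
  by (rule msat_cong) (simp add: sentences_def)

instance tm :: (countable) countable by countable_datatype
instance mfm :: (countable, countable) countable by countable_datatype

lemma wf_tm_set: "wf_tm L t \<Longrightarrow> set_tm t \<subseteq> funs L"
  by (induction t) (auto simp: list_all_iff)

lemma wf_mfm_set: "wf_mfm L \<phi> \<Longrightarrow> set1_mfm \<phi> \<subseteq> rels L \<and> set2_mfm \<phi> \<subseteq> funs L"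
  by (induction \<phi>) (use wf_tm_set in \<open>fastforce simp: list_all_iff\<close>)+

text \<open>The types of the symbols may be uncountable. Renaming the symbols of \<open>L\<close> to
  natural numbers embeds the sentences into a countable datatype.\<close>

lemma countable_sentences:
  assumes "countable_lang L" shows "countable (sentences L)"
proof -
  obtain f g where f: "inj_on (f :: _ \<Rightarrow> nat) (rels L)" and g: "inj_on (g :: _ \<Rightarrow> nat) (funs L)"
    using assms unfolding countable_lang_def countable_def by blast
  have "inj_on (map_mfm f g) (sentences L)"
  proof (rule inj_onI)
    fix \<phi> \<psi> assume "\<phi> \<in> sentences L" "\<psi> \<in> sentences L" and eq: "map_mfm f g \<phi> = map_mfm f g \<psi>"
    then have w: "set1_mfm \<phi> \<subseteq> rels L" "set2_mfm \<phi> \<subseteq> funs L" "set1_mfm \<psi> \<subseteq> rels L" "set2_mfm \<psi> \<subseteq> funs L"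
      using wf_mfm_set unfolding sentences_def by blast+
    show "\<phi> = \<psi>"
      by (rule mfm.inj_map_strong[OF _ _ eq]) (use w f g in \<open>auto dest!: inj_onD\<close>)
  qed
  then show ?thesis by (rule countable_image_inj_on[rotated]) simp
qed

lemma subst_sentence:
  assumes "\<And>n. \<sigma> n \<in> sentences L" shows "subst_inst \<sigma> p \<in> sentences L"
  using assms by (induction p) (auto simp: sentences_def)

text \<open>The hypothesis serves axiom Five: if a formula possible at \<open>V\<close> were
  impossible from some larger \<open>U\<close>, its negation would be possibly necessary at
  \<open>V\<close>, hence necessary there. The induction speaks of all worlds above
  \<open>W\<close>, as necessitation demands.\<close>

lemma S5_valid:
  assumes W: "\<And>V \<phi> e. V \<in> ctms \<Longrightarrow> W \<subseteq> V \<Longrightarrow> \<phi> \<in> sentences L \<Longrightarrow> msat L V e (MDia (MBox \<phi>)) \<Longrightarrow> msat L V e (MBox \<phi>)"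
    and s: "\<And>n. \<sigma> n \<in> sentences L" and p: "p \<in> S5"
  shows "V \<in> ctms \<Longrightarrow> W \<subseteq> V \<Longrightarrow> msat L V e (subst_inst \<sigma> p)"
  using p
proof (induction arbitrary: V rule: S5.induct)
  case (taut p)
  have "peval (\<lambda>q. msat L V e (subst_inst \<sigma> q)) q \<longleftrightarrow> msat L V e (subst_inst \<sigma> q)" for q by (induction q) auto
  then show ?case using taut by (auto simp: tautology_def)
next
  case (Five p)
  have ns: "MImp (subst_inst \<sigma> p) MFls \<in> sentences L" using subst_sentence[OF s, where p = p] by (simp add: sentences_def)
  show ?case
  proof (simp, intro impI ballI)
    fix U assume *: "\<exists>U\<in>ctms. V \<subseteq> U \<and> msat L U e (subst_inst \<sigma> p)" "U \<in> ctms" "V \<subseteq> U"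
    show "\<exists>U'\<in>ctms. U \<subseteq> U' \<and> msat L U' e (subst_inst \<sigma> p)"
    proof (rule ccontr)
      assume "\<not> ?thesis"
      then have "msat L V e (MDia (MBox (MImp (subst_inst \<sigma> p) MFls)))" using *(2,3) by auto
      then have "msat L V e (MBox (MImp (subst_inst \<sigma> p) MFls))" by (rule W[OF Five ns])
      then show False using *(1) by auto
    qed
  qed
next
  case (Nec p)
  have "msat L U e (subst_inst \<sigma> p)" if "U \<in> ctms" "V \<subseteq> U" for U using Nec that by blast
  then show ?case by simp
next
  case (MP p q)
  have "msat L V e (subst_inst \<sigma> p) \<longrightarrow> msat L V e (subst_inst \<sigma> q)" "msat L V e (subst_inst \<sigma> p)"
    using MP.IH[OF MP.prems] by simp_all
  then show ?case by blast
qed (auto simp: PNeg_def)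

section \<open>Dials and the inclusion of the valid formulas in S5\<close>

fun mdis :: "('r, 'f) mfm list \<Rightarrow> ('r, 'f) mfm" where
  "mdis [] = MFls"
| "mdis (\<phi> # \<phi>s) = MImp (MImp \<phi> MFls) (mdis \<phi>s)"

lemma msat_mdis [simp]: "msat L W e (mdis \<phi>s) \<longleftrightarrow> (\<exists>\<phi>\<in>set \<phi>s. msat L W e \<phi>)"
  by (induction \<phi>s) auto

lemma mdis_sentence: "set \<phi>s \<subseteq> sentences L \<Longrightarrow> mdis \<phi>s \<in> sentences L"
  by (induction \<phi>s) (auto simp: sentences_def)

text \<open>A world may show no value at all. Required is that it shows at most one and that every
  value can be reached from every world.\<close>

definition dial :: "('r, 'f) lang \<Rightarrow> nat \<Rightarrow> (nat \<Rightarrow> ('r, 'f) mfm) \<Rightarrow> bool" where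
  "dial L k s \<longleftrightarrow> (\<forall>r<k. s r \<in> sentences L) \<and>
     (\<forall>V\<in>ctms. \<forall>e. range e \<subseteq> V \<longrightarrow>
        (\<forall>r<k. \<forall>r'<k. msat L V e (s r) \<longrightarrow> msat L V e (s r') \<longrightarrow> r = r') \<and>
        (\<forall>r<k. \<exists>N\<in>ctms. V \<subseteq> N \<and> msat L N e (s r)))"

lemma ctms_nonempty: "W \<in> ctms \<Longrightarrow> W \<noteq> {}" by (simp add: ctms_def models_ZFC_def)

text \<open>Positions of the dial stand for points of a finite countermodel. Since every position is
  reachable from every world, modal operators range over exactly the points of the countermodel, and
  the position of \<open>W\<close> is made to stand for the refuting point.\<close>

lemma valid_S5:
  assumes dial: "\<And>k. k > 0 \<Longrightarrow> \<exists>s :: nat \<Rightarrow> ('r, 'f) mfm. dial L k s" and W: "W \<in> ctms"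
    and p: "p \<in> Val W L"
  shows "p \<in> S5"
proof (rule ccontr)
  assume "p \<notin> S5"
  then obtain Vs v where V: "finite Vs" "v \<in> Vs" "\<not> sem Vs v p" using S5_complete by blast
  obtain b where b: "bij_betw b {..<card Vs} Vs" using ex_bij_betw_nat_finite[OF V(1)] by (auto simp: lessThan_atLeast0)
  \<comment> \<open>One position more than there are valuations: the position of \<open>W\<close>,
    whichever it is, can be given to \<open>v\<close>, while the others still exhaust
    \<open>Vs\<close>.\<close>
  let ?k = "Suc (card Vs)"
  obtain s :: "nat \<Rightarrow> ('r, 'f) mfm" where s: "dial L ?k s" using dial by blast
  obtain x where x: "x \<in> W" using ctms_nonempty[OF W] by blast
  define e where "e = (\<lambda>n::nat. x)"
  have eV: "range e \<subseteq> V" if "W \<subseteq> V" for V using x that by (auto simp: e_def)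
  \<comment> \<open>A world that shows no value is counted as being in position 0.\<close>
  define pos where "pos V = (if \<exists>r<?k. msat L V e (s r) then (SOME r. r < ?k \<and> msat L V e (s r)) else 0)" for V
  have pos_less: "pos V < ?k" for V
    unfolding pos_def using someI_ex[of "\<lambda>r. r < ?k \<and> msat L V e (s r)"] by auto
  have pos_eq: "msat L V e (s r) \<Longrightarrow> r < ?k \<Longrightarrow> V \<in> ctms \<Longrightarrow> W \<subseteq> V \<Longrightarrow> pos V = r" for V r
    unfolding pos_def using someI_ex[of "\<lambda>r. r < ?k \<and> msat L V e (s r)"] s eV[of V] unfolding dial_def by auto
  \<comment> \<open>The position of \<open>W\<close> is assigned \<open>v\<close>; the remaining
    \<open>card Vs\<close> positions enumerate \<open>Vs\<close>, skipping that one.\<close>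
  define w where "w i = (if i = pos W then v else if i < pos W then b i else b (i - 1))" for i
  have wV: "w ` {..<?k} = Vs"
  proof
    have bV: "b j \<in> Vs" if "j < card Vs" for j using b that by (auto simp: bij_betw_def)
    show "w ` {..<?k} \<subseteq> Vs" using V(2) pos_less[of W] by (auto simp: w_def intro!: bV)
    show "Vs \<subseteq> w ` {..<?k}"
    proof
      fix u assume "u \<in> Vs"
      then obtain j where j: "j < card Vs" "u = b j" using b by (auto simp: bij_betw_def)
      show "u \<in> w ` {..<?k}"
      proof (cases "j < pos W")
        case True
        then show ?thesis using j by (intro image_eqI[of _ _ j]) (auto simp: w_def)
      next
        case False
        then show ?thesis using j by (intro image_eqI[of _ _ "Suc j"]) (auto simp: w_def)
      qed
    qed
  qed
  \<comment> \<open>The sentence says that the position shown is one whose valuation makes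
    \<open>n\<close> true. The second part accounts for worlds showing no value, in agreement with
    their position 0.\<close>
  define \<sigma> where "\<sigma> n = mdis (map s (filter (\<lambda>i. w i n) [0..<?k]) @
    (if w 0 n then [MImp (mdis (map s [0..<?k])) MFls] else []))" for n
  have sig: "\<sigma> n \<in> sentences L" for n
  proof -
    have 1: "set (map s [0..<?k]) \<subseteq> sentences L" using s by (auto simp: dial_def simp del: upt_Suc)
    have 2: "MImp (mdis (map s [0..<?k])) MFls \<in> sentences L"
      using mdis_sentence[OF 1] by (simp add: sentences_def del: upt_Suc)
    show ?thesis unfolding \<sigma>_def by (rule mdis_sentence) (use 1 2 in \<open>auto simp del: upt_Suc\<close>)
  qed
  have sat: "msat L V e (\<sigma> n) \<longleftrightarrow> w (pos V) n" if "V \<in> ctms" "W \<subseteq> V" for V n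
  proof (cases "\<exists>r<?k. msat L V e (s r)")
    case True
    then obtain r where r: "r < ?k" "msat L V e (s r)" by blast
    have "pos V = r" by (rule pos_eq[OF r(2,1) that])
    moreover have "msat L V e (\<sigma> n) \<longleftrightarrow> (\<exists>i<?k. w i n \<and> msat L V e (s i))"
      unfolding \<sigma>_def using True by (auto simp del: upt_Suc)
    moreover have "r' = r" if "r' < ?k" "msat L V e (s r')" for r'
      using pos_eq[OF that(2,1) \<open>V \<in> ctms\<close> \<open>W \<subseteq> V\<close>] \<open>pos V = r\<close> by simp
    ultimately show ?thesis using r by blast
  next
    case False
    then have "pos V = 0" unfolding pos_def by (rule if_not_P)
    then show ?thesis unfolding \<sigma>_def using False by (auto simp del: upt_Suc)
  qed
  have reach: "\<exists>U\<in>ctms. V \<subseteq> U \<and> w (pos U) = u" if V: "V \<in> ctms" "W \<subseteq> V" and "u \<in> Vs" for u V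
  proof -
    obtain r where r: "r < ?k" "w r = u" using \<open>u \<in> Vs\<close> wV by (metis imageE lessThan_iff)
    have "\<exists>N\<in>ctms. V \<subseteq> N \<and> msat L N e (s r)" using s V(1) eV[OF V(2)] r(1) unfolding dial_def by simp
    then obtain U where U: "U \<in> ctms" "V \<subseteq> U" "msat L U e (s r)" by blast
    have "pos U = r" by (rule pos_eq[OF U(3) r(1) U(1)]) (use U(2) V(2) in blast)
    then show ?thesis using U r by blast
  qed
  have truth: "V \<in> ctms \<Longrightarrow> W \<subseteq> V \<Longrightarrow> msat L V e (subst_inst \<sigma> q) \<longleftrightarrow> sem Vs (w (pos V)) q" for q V
  proof (induction q arbitrary: V)
    case (PBox q)
    note reach = reach[OF PBox.prems]
    have "msat L U e (subst_inst \<sigma> q) \<longleftrightarrow> sem Vs (w (pos U)) q" if "U \<in> ctms" "V \<subseteq> U" for U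
      using PBox.IH PBox.prems that by blast
    moreover have "w (pos U) \<in> Vs" for U using wV pos_less[of U] by blast
    ultimately show ?case unfolding subst_inst.simps msat.simps sem.simps using reach by metis
  next
    case (PDia q)
    note reach = reach[OF PDia.prems]
    have "msat L U e (subst_inst \<sigma> q) \<longleftrightarrow> sem Vs (w (pos U)) q" if "U \<in> ctms" "V \<subseteq> U" for U
      using PDia.IH PDia.prems that by blast
    moreover have "w (pos U) \<in> Vs" for U using wV pos_less[of U] by blast
    ultimately show ?case unfolding subst_inst.simps msat.simps sem.simps using reach by metis
  qed (simp_all add: sat)
  have "msat L W e (subst_inst \<sigma> p)" using p sig eV[of W] unfolding Val_def true_at_def by blast
  then show False using truth[OF W] V(3) by (simp add: w_def)
qed

text \<open>Each sentence is treated once: its box is made true at stage \<open>Suc n\<close> if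
  some world above stage \<open>n\<close> makes it true. Anything possible above \<open>W\<close> is
  possible above every stage, and a box once true stays true in larger worlds, so nothing has to be
  revisited.\<close>

theorem S5_from_dials:
  assumes L: "countable_lang L" and U: "U \<in> ctms"
    and union: "\<And>A :: nat \<Rightarrow> hcset set. (\<And>n. A n \<in> ctms) \<Longrightarrow> \<exists>W\<in>ctms. (\<Union>n. A n) \<subseteq> W"
    and dial: "\<And>k. k > 0 \<Longrightarrow> \<exists>s :: nat \<Rightarrow> ('r, 'f) mfm. dial L k s"
  shows "\<exists>W\<in>ctms. U \<subseteq> W \<and> Val W L = S5"
proof -
  have "MFls \<in> sentences L" by (simp add: sentences_def)
  then obtain \<phi> :: "nat \<Rightarrow> ('r, 'f) mfm" where \<phi>: "range \<phi> = sentences L"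
    using range_from_nat_into[OF _ countable_sentences[OF L]] by (metis empty_iff)
  define ext where "ext n X = (SOME Y. Y \<in> ctms \<and> X \<subseteq> Y \<and>
    ((\<exists>Z\<in>ctms. X \<subseteq> Z \<and> (\<forall>e. msat L Z e (MBox (\<phi> n)))) \<longrightarrow> (\<forall>e. msat L Y e (MBox (\<phi> n)))))" for n X
  have ext: "ext n X \<in> ctms \<and> X \<subseteq> ext n X \<and>
    ((\<exists>Z\<in>ctms. X \<subseteq> Z \<and> (\<forall>e. msat L Z e (MBox (\<phi> n)))) \<longrightarrow> (\<forall>e. msat L (ext n X) e (MBox (\<phi> n))))" if "X \<in> ctms" for n X
    unfolding ext_def by (rule someI_ex) (use that in blast)
  define A where "A = rec_nat U ext"
  have A0: "A 0 = U" and AS: "A (Suc n) = ext n (A n)" for n by (simp_all add: A_def)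
  have Actm: "A n \<in> ctms" for n by (induction n) (use A0 AS U ext in auto)
  obtain W where W: "W \<in> ctms" "(\<Union>n. A n) \<subseteq> W" using union[of A] Actm by blast
  have stable: "msat L V e (MBox \<psi>)" if V: "V \<in> ctms" "W \<subseteq> V" and \<psi>: "\<psi> \<in> sentences L" and d: "msat L V e (MDia (MBox \<psi>))" for V \<psi> e
  proof -
    obtain n where n: "\<psi> = \<phi> n" using \<psi> \<phi> by auto
    have bs: "MBox \<psi> \<in> sentences L" using \<psi> by (simp add: sentences_def)
    obtain X where X: "X \<in> ctms" "V \<subseteq> X" "msat L X e (MBox \<psi>)" using d by auto
    have "A n \<subseteq> X" using W V X by blast
    moreover have "\<forall>e. msat L X e (MBox (\<phi> n))" using X(3) msat_sentence[OF bs] n by blast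
    ultimately have "msat L (A (Suc n)) e (MBox (\<phi> n))" using ext[OF Actm] X(1) AS by metis
    moreover have "A (Suc n) \<subseteq> V" using W V by blast
    ultimately show ?thesis unfolding n by auto
  qed
  have "S5 \<subseteq> Val W L"
  proof
    fix p assume p: "p \<in> S5"
    show "p \<in> Val W L" unfolding Val_def true_at_def
      using S5_valid[OF stable _ p W(1) subset_refl] by blast
  qed
  moreover have "Val W L \<subseteq> S5" using valid_S5[OF dial W(1)] by blast
  moreover have "U \<subseteq> W" using W(2) A0 by blast
  ultimately show ?thesis using W(1) by blast
qed

section \<open>Definability in transitive models\<close>

definition mems :: "hcset \<Rightarrow> hcset set" where
  "mems x = {y. y \<epsilon> x}"

definition hset :: "hcset set \<Rightarrow> hcset" where
  "hset A = HCSet (acset A)"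

lemma in_mems [simp]: "y \<in> mems x \<longleftrightarrow> y \<epsilon> x"
  by (simp add: mems_def)

lemma mems_hset [simp]: "countable A \<Longrightarrow> mems (hset A) = A"
  by (auto simp: mems_def hset_def hmem_def cin.rep_eq acset_inverse)

lemma hmem_hset [simp]: "countable A \<Longrightarrow> x \<epsilon> hset A \<longleftrightarrow> x \<in> A"
  by (metis in_mems mems_hset)

lemma countable_mems [simp, intro]: "countable (mems x)"
proof -
  have "mems x = rcset (elts x)"
    by (auto simp: mems_def hmem_def cin.rep_eq)
  then show ?thesis
    using rcset[of "elts x"] by simp
qed

lemma mems_inject: "mems x = mems y \<longleftrightarrow> x = y"
  using hmem_extensional[of x y] by (auto simp: set_eq_iff)

lemma hset_mems [simp]: "hset (mems x) = x"
  using mems_inject by force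

lemma wf_hmem: "wf {(x, y). x \<epsilon> y}"
proof (rule wfUNIVI)
  fix P and z :: hcset
  assume *: "\<forall>x. (\<forall>y. (y, x) \<in> {(x, y). x \<epsilon> y} \<longrightarrow> P y) \<longrightarrow> P x"
  show "P z"
    by (rule hmem_induct) (use * in auto)
qed

lemma hmem_irrefl [simp]: "\<not> x \<epsilon> x"
  using wf_hmem by (auto dest: wf_not_refl)

subsection \<open>Definability with parameters\<close>

text \<open>Assignments interleave the parameters \<open>a\<close> (even variables) with the arguments \<open>e\<close>.\<close>

definition merge :: "(nat \<Rightarrow> hcset) \<Rightarrow> (nat \<Rightarrow> hcset) \<Rightarrow> nat \<Rightarrow> hcset" where
  "merge a e n = (if even n then a (n div 2) else e (n div 2))"

text \<open>Definability with parameters as a property of HOL predicates on assignments. Closure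
  rules then certify a predicate by its shape, with argument \<open>i\<close> in the role of the
  \<open>i\<close>-th free variable.\<close>

definition dfn :: "hcset set \<Rightarrow> ((nat \<Rightarrow> hcset) \<Rightarrow> bool) \<Rightarrow> bool" where
  "dfn M P \<longleftrightarrow> (\<exists>\<phi> a. range a \<subseteq> M \<and> (\<forall>e. range e \<subseteq> M \<longrightarrow> (P e \<longleftrightarrow> ssat M (merge a e) \<phi>)))"

primrec ren :: "(nat \<Rightarrow> nat) \<Rightarrow> sfm \<Rightarrow> sfm" where
  "ren f (FMem i j) = FMem (f i) (f j)"
| "ren f (FEq i j) = FEq (f i) (f j)"
| "ren f FFls = FFls"
| "ren f (FImp \<phi> \<psi>) = FImp (ren f \<phi>) (ren f \<psi>)"
| "ren f (FAll n \<phi>) = FAll (f n) (ren f \<phi>)"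

text \<open>Bound variables are included, because \<open>ren\<close> renames them as well;
  injectivity on all of them is what excludes capture.\<close>

primrec fvars :: "sfm \<Rightarrow> nat set" where
  "fvars (FMem i j) = {i, j}"
| "fvars (FEq i j) = {i, j}"
| "fvars FFls = {}"
| "fvars (FImp \<phi> \<psi>) = fvars \<phi> \<union> fvars \<psi>"
| "fvars (FAll n \<phi>) = insert n (fvars \<phi>)"

lemma finite_fvars [simp]: "finite (fvars \<phi>)"
  by (induction \<phi>) auto

lemma fv_subset_fvars: "fv \<phi> \<subseteq> fvars \<phi>"
  by (induction \<phi>) auto

lemma fv_ren_subset: "fv (ren f \<phi>) \<subseteq> range f"
  by (induction \<phi>) auto

lemma ssat_cong_fv: "(\<And>n. n \<in> fv \<phi> \<Longrightarrow> e n = e' n) \<Longrightarrow> ssat M e \<phi> \<longleftrightarrow> ssat M e' \<phi>"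
proof (induction \<phi> arbitrary: e e')
  case (FImp \<phi> \<psi>)
  from FImp.IH(1)[of e e'] FImp.IH(2)[of e e'] FImp.prems show ?case by simp
next
  case (FAll n \<phi>)
  have "ssat M (e(n := x)) \<phi> \<longleftrightarrow> ssat M (e'(n := x)) \<phi>" for x
    by (rule FAll.IH) (use FAll.prems in auto)
  then show ?case by simp
qed auto

lemma ssat_ren: "inj_on f (fvars \<phi>) \<Longrightarrow> ssat M e (ren f \<phi>) \<longleftrightarrow> ssat M (e \<circ> f) \<phi>"
proof (induction \<phi> arbitrary: e)
  case (FAll n \<phi>)
  have "ssat M (e(f n := x) \<circ> f) \<phi> \<longleftrightarrow> ssat M ((e \<circ> f)(n := x)) \<phi>" for x
  proof (rule ssat_cong_fv)
    fix k assume "k \<in> fv \<phi>"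
    then have "k \<in> fvars \<phi>" using fv_subset_fvars by auto
    then show "(e(f n := x) \<circ> f) k = ((e \<circ> f)(n := x)) k"
      using FAll.prems by (auto simp: inj_on_def)
  qed
  moreover have "inj_on f (fvars \<phi>)" using FAll.prems by (simp add: inj_on_def)
  ultimately show ?case
    by (simp only: ren.simps ssat.simps FAll.IH)
next
  case (FImp \<phi> \<psi>)
  then show ?case by (simp add: inj_on_Un)
qed (auto)

named_theorems dfnI

lemma dfn_cong:
  "(\<And>e. range e \<subseteq> M \<Longrightarrow> P e \<longleftrightarrow> Q e) \<Longrightarrow> dfn M P \<longleftrightarrow> dfn M Q"
  unfolding dfn_def by auto

lemma dfn_mem_var:
  assumes "M \<noteq> {}" shows "dfn M (\<lambda>e. e i \<epsilon> e j)"
proof -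
  obtain m where "m \<in> M" using assms by auto
  then show ?thesis unfolding dfn_def
    by (intro exI[of _ "FMem (Suc (2*i)) (Suc (2*j))"] exI[of _ "\<lambda>_. m"]) (simp add: merge_def)
qed

lemma dfn_eq_var:
  assumes "M \<noteq> {}" shows "dfn M (\<lambda>e. e i = e j)"
proof -
  obtain m where "m \<in> M" using assms by auto
  then show ?thesis unfolding dfn_def
    by (intro exI[of _ "FEq (Suc (2*i)) (Suc (2*j))"] exI[of _ "\<lambda>_. m"]) (simp add: merge_def)
qed

lemma dfn_False:
  assumes "M \<noteq> {}" shows "dfn M (\<lambda>e. False)"
proof -
  obtain m where "m \<in> M" using assms by auto
  then show ?thesis unfolding dfn_def
    by (intro exI[of _ FFls] exI[of _ "\<lambda>_. m"]) simp
qed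

lemma dfn_imp [dfnI]:
  assumes "dfn M P" "dfn M Q"
  shows "dfn M (\<lambda>e. P e \<longrightarrow> Q e)"
proof -
  obtain \<phi> a where 1: "range a \<subseteq> M" "\<And>e. range e \<subseteq> M \<Longrightarrow> P e \<longleftrightarrow> ssat M (merge a e) \<phi>"
    using assms(1) unfolding dfn_def by auto
  obtain \<psi> b where 2: "range b \<subseteq> M" "\<And>e. range e \<subseteq> M \<Longrightarrow> Q e \<longleftrightarrow> ssat M (merge b e) \<psi>"
    using assms(2) unfolding dfn_def by auto
  \<comment> \<open>Parameter \<open>i\<close> of \<open>\<phi>\<close> becomes parameter
    \<open>2 * i\<close> and parameter \<open>i\<close> of \<open>\<psi>\<close> becomes
    \<open>2 * i + 1\<close>; the arguments, on odd variables, stay where they are.\<close>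
  define f where "f n = (if even n then 2 * n else n)" for n :: nat
  define g where "g n = (if even n then 2 * n + 2 else n)" for n :: nat
  define c where "c n = (if even n then a (n div 2) else b (n div 2))" for n
  have inj: "inj f" "inj g" unfolding inj_def f_def g_def by presburger+
  have f: "merge c e \<circ> f = merge a e" for e
  proof
    fix n show "(merge c e \<circ> f) n = merge a e n"
      by (cases "even n") (auto simp: merge_def f_def c_def elim!: evenE)
  qed
  have g: "merge c e \<circ> g = merge b e" for e
  proof
    fix n show "(merge c e \<circ> g) n = merge b e n"
      by (cases "even n") (auto simp: merge_def g_def c_def elim!: evenE)
  qed
  have "range c \<subseteq> M" using 1(1) 2(1) by (auto simp: c_def)
  moreover have "(P e \<longrightarrow> Q e) \<longleftrightarrow> ssat M (merge c e) (FImp (ren f \<phi>) (ren g \<psi>))" if "range e \<subseteq> M" for e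
    using inj 1(2)[OF that] 2(2)[OF that] by (simp add: ssat_ren f g inj_on_subset[OF _ subset_UNIV])
  ultimately show ?thesis unfolding dfn_def by blast
qed

lemma dfn_ren:
  assumes "dfn M P" "inj f"
  shows "dfn M (\<lambda>e. P (\<lambda>i. e (f i)))"
proof -
  obtain \<phi> a where 1: "range a \<subseteq> M" "\<And>e. range e \<subseteq> M \<Longrightarrow> P e \<longleftrightarrow> ssat M (merge a e) \<phi>"
    using assms(1) unfolding dfn_def by auto
  define g where "g n = (if even n then n else Suc (2 * f (n div 2)))" for n
  have "inj g"
  proof (rule injI)
    fix x y assume *: "g x = g y"
    then have 1: "even x \<longleftrightarrow> even y" unfolding g_def by presburger
    show "x = y"
    proof (cases "even x")
      case False
      then have "f (x div 2) = f (y div 2)" using * 1 by (simp add: g_def)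
      then have "x div 2 = y div 2" using \<open>inj f\<close> by (simp add: inj_eq)
      then show ?thesis using False 1 by presburger
    qed (use * 1 in \<open>simp add: g_def\<close>)
  qed
  have g: "merge a e \<circ> g = merge a (\<lambda>i. e (f i))" for e
    by (rule ext) (auto simp: merge_def g_def)
  have "P (\<lambda>i. e (f i)) \<longleftrightarrow> ssat M (merge a e) (ren g \<phi>)" if "range e \<subseteq> M" for e
  proof -
    have "range (\<lambda>i. e (f i)) \<subseteq> M" using that by auto
    from 1(2)[OF this] show ?thesis
      using \<open>inj g\<close> by (simp add: ssat_ren g inj_on_subset[OF _ subset_UNIV])
  qed
  then show ?thesis using 1(1) unfolding dfn_def by blast
qed

text \<open>De Bruijn style: under a quantifier, the bound variable is argument 0.\<close>

lemma dfn_all [dfnI]: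
  assumes "dfn M (\<lambda>e. Q (e 0) (\<lambda>i. e (Suc i)))"
  shows "dfn M (\<lambda>e. \<forall>x\<in>M. Q x e)"
proof -
  obtain \<phi> a where 1: "range a \<subseteq> M"
    "\<And>e. range e \<subseteq> M \<Longrightarrow> Q (e 0) (\<lambda>i. e (Suc i)) \<longleftrightarrow> ssat M (merge a e) \<phi>"
    using assms unfolding dfn_def by auto
  \<comment> \<open>Variable \<open>2 * N + 1\<close> lies beyond all variables of
    \<open>\<phi>\<close> and can be quantified. Argument 0 is moved there and every other argument
    moves down by one.\<close>
  obtain N where N: "\<And>n. n \<in> fvars \<phi> \<Longrightarrow> n < N"
    using finite_nat_set_iff_bounded[of "fvars \<phi>"] by auto
  define g where "g n = (if even n then n else if n = 1 then Suc (2 * N) else n - 2)" for n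
  define h where "h m = (if even m then m else if m = Suc (2 * N) then 1 else m + 2)" for m
  have "h (g n) = n" if n: "n \<in> fvars \<phi>" for n
  proof (cases "even n")
    case False
    then obtain k where k: "n = Suc (2 * k)" by (auto elim: oddE)
    then show ?thesis using N[OF n] by (cases k) (auto simp: g_def h_def)
  qed (auto simp: g_def h_def)
  then have inj: "inj_on g (fvars \<phi>)"
    by (metis inj_onI)
  have "(\<forall>x\<in>M. Q x e) \<longleftrightarrow> ssat M (merge a e) (FAll (Suc (2 * N)) (ren g \<phi>))" if e: "range e \<subseteq> M" for e
  proof -
    have "Q x e \<longleftrightarrow> ssat M ((merge a e)(Suc (2 * N) := x)) (ren g \<phi>)" if x: "x \<in> M" for x
    proof -
      have "e n \<in> M" for n using e by auto
      then have "range (case_nat x e) \<subseteq> M" using x by (auto split: nat.splits)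
      from 1(2)[OF this] have "Q x e \<longleftrightarrow> ssat M (merge a (case_nat x e)) \<phi>" by simp
      also have "\<dots> \<longleftrightarrow> ssat M ((merge a e)(Suc (2 * N) := x) \<circ> g) \<phi>"
      proof (rule ssat_cong_fv)
        fix n assume "n \<in> fv \<phi>"
        then have "n < N" using N fv_subset_fvars by blast
        show "merge a (case_nat x e) n = ((merge a e)(Suc (2 * N) := x) \<circ> g) n"
        proof (cases "even n")
          case True
          then show ?thesis using \<open>n < N\<close> by (auto simp: merge_def g_def)
        next
          case False
          then obtain k where k: "n = Suc (2 * k)" by (auto elim: oddE)
          then show ?thesis using \<open>n < N\<close>
            by (cases k) (auto simp: merge_def g_def)
        qed
      qed
      finally show ?thesis using inj by (simp add: ssat_ren)
    qed
    then show ?thesis by simp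
  qed
  then show ?thesis using 1(1) unfolding dfn_def by blast
qed

text \<open>Argument 0 becomes a new parameter 0; the old parameters move up by one to make
  room.\<close>

lemma dfn_par:
  assumes "dfn M (\<lambda>e. Q (e 0) (\<lambda>i. e (Suc i)))" "c \<in> M"
  shows "dfn M (\<lambda>e. Q c e)"
proof -
  obtain \<phi> a where 1: "range a \<subseteq> M"
    "\<And>e. range e \<subseteq> M \<Longrightarrow> Q (e 0) (\<lambda>i. e (Suc i)) \<longleftrightarrow> ssat M (merge a e) \<phi>"
    using assms unfolding dfn_def by auto
  define g where "g n = (if even n then n + 2 else if n = 1 then 0 else n - 2)" for n :: nat
  have inj: "inj g"
    unfolding inj_def g_def by presburger
  have "a n \<in> M" for n using 1(1) by auto
  then have "range (case_nat c a) \<subseteq> M" using assms(2) by (auto split: nat.splits)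
  moreover have "Q c e \<longleftrightarrow> ssat M (merge (case_nat c a) e) (ren g \<phi>)" if e: "range e \<subseteq> M" for e
  proof -
    have "e n \<in> M" for n using e by auto
    then have "range (case_nat c e) \<subseteq> M" using assms(2) by (auto split: nat.splits)
    from 1(2)[OF this] have "Q c e \<longleftrightarrow> ssat M (merge a (case_nat c e)) \<phi>" by simp
    also have "merge a (case_nat c e) = merge (case_nat c a) e \<circ> g"
    proof
      fix n show "merge a (case_nat c e) n = (merge (case_nat c a) e \<circ> g) n"
      proof (cases "even n")
        case False
        then obtain k where k: "n = Suc (2 * k)" by (auto elim: oddE)
        show ?thesis by (cases k) (auto simp: k merge_def g_def)
      qed (auto simp: merge_def g_def)
    qed
    finally show ?thesis using inj by (simp add: ssat_ren inj_on_subset[OF _ subset_UNIV] comp_def)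
  qed
  ultimately show ?thesis unfolding dfn_def by blast
qed

text \<open>All arguments but the first become parameters, all at once. Separation and genericity
  ask for predicates of one variable, and this is how they are obtained.\<close>

lemma dfn_fix:
  assumes "dfn M (\<lambda>e. Q (e 0) (\<lambda>i. e (Suc i)))" "range b \<subseteq> M"
  shows "dfn M (\<lambda>e. Q (e 0) b)"
proof -
  obtain \<phi> a where 1: "range a \<subseteq> M"
    "\<And>e. range e \<subseteq> M \<Longrightarrow> Q (e 0) (\<lambda>i. e (Suc i)) \<longleftrightarrow> ssat M (merge a e) \<phi>"
    using assms unfolding dfn_def by auto
  \<comment> \<open>Argument 0 stays, the old parameter \<open>i\<close> becomes parameter
    \<open>2 * i\<close>, and argument \<open>i + 1\<close> becomes parameter
    \<open>2 * i + 1\<close>, which holds \<open>b i\<close>.\<close>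
  define g where "g n = (if n = 1 then 1 else if even n then 2 * n else 2 * n - 4)" for n :: nat
  define h where "h m = (if m = 1 then 1 else if m mod 4 = 0 then m div 2 else (m + 4) div 2)" for m :: nat
  have "h (g n) = n" for n
  proof (cases "even n")
    case True
    then show ?thesis by (auto simp: g_def h_def elim!: evenE)
  next
    case False
    then obtain k where k: "n = Suc (2 * k)" by (auto elim: oddE)
    show ?thesis
    proof (cases k)
      case (Suc j)
      then have "g n = 4 * j + 2" using k by (simp add: g_def)
      then show ?thesis using k Suc by (simp add: h_def) presburger
    qed (use k in \<open>simp add: g_def h_def\<close>)
  qed
  then have inj: "inj g"
    by (metis injI)
  have bM: "b n \<in> M" "a n \<in> M" for n using assms(2) 1(1) by auto
  then have "range (merge a b) \<subseteq> M" by (auto simp: merge_def)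
  moreover have "Q (e 0) b \<longleftrightarrow> ssat M (merge (merge a b) e) (ren g \<phi>)" if e: "range e \<subseteq> M" for e
  proof -
    have "e n \<in> M" for n using e by auto
    then have "range (case_nat (e 0) b) \<subseteq> M" using bM by (auto split: nat.splits)
    from 1(2)[OF this] have "Q (e 0) b \<longleftrightarrow> ssat M (merge a (case_nat (e 0) b)) \<phi>" by simp
    also have "merge a (case_nat (e 0) b) = merge (merge a b) e \<circ> g"
    proof
      fix n show "merge a (case_nat (e 0) b) n = (merge (merge a b) e \<circ> g) n"
      proof (cases "even n")
        case False
        then obtain k where k: "n = Suc (2 * k)" by (auto elim: oddE)
        show ?thesis
        proof (cases k)
          case (Suc j)
          then have "g n = 2 * (2 * j + 1)" using k by (simp add: g_def)
          then show ?thesis using k Suc by (simp add: merge_def)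
        qed (use k in \<open>simp add: merge_def g_def\<close>)
      qed (auto simp: merge_def g_def)
    qed
    finally show ?thesis using inj by (simp add: ssat_ren inj_on_subset[OF _ subset_UNIV] comp_def)
  qed
  ultimately show ?thesis unfolding dfn_def by blast
qed

text \<open>An operation with definable graph that maps \<open>M\<close> into itself. Argument 0
  holds the value, so the arguments of \<open>t\<close> are shifted by one.\<close>

definition dtm :: "hcset set \<Rightarrow> ((nat \<Rightarrow> hcset) \<Rightarrow> hcset) \<Rightarrow> bool" where
  "dtm M t \<longleftrightarrow> (\<forall>e. range e \<subseteq> M \<longrightarrow> t e \<in> M) \<and> dfn M (\<lambda>e. e 0 = t (\<lambda>i. e (Suc i)))"

lemma dtm_in: "dtm M t \<Longrightarrow> range e \<subseteq> M \<Longrightarrow> t e \<in> M"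
  by (simp add: dtm_def)

lemma dtm_eq: "dtm M t \<Longrightarrow> dfn M (\<lambda>e. e 0 = t (\<lambda>i. e (Suc i)))"
  by (simp add: dtm_def)

lemma dtm_ren:
  assumes "dtm M t" "inj f" shows "dtm M (\<lambda>e. t (\<lambda>i. e (f i)))"
proof -
  have "x = y" if "case_nat 0 (\<lambda>i. Suc (f i)) x = case_nat 0 (\<lambda>i. Suc (f i)) y" for x y
    using that assms(2) by (cases x; cases y) (auto simp: inj_eq)
  then have "inj (case_nat 0 (\<lambda>i. Suc (f i)))"
    by (rule injI)
  from dfn_ren[OF dtm_eq[OF assms(1)] this]
  have "dfn M (\<lambda>e. e 0 = t (\<lambda>i. e (Suc (f i))))" by simp
  moreover have "t (\<lambda>i. e (f i)) \<in> M" if "range e \<subseteq> M" for e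
    by (rule dtm_in[OF assms(1)]) (use that in auto)
  ultimately show ?thesis unfolding dtm_def by simp
qed

lemma dtm_Suc: "dtm M t \<Longrightarrow> dtm M (\<lambda>e. t (\<lambda>i. e (Suc i)))"
  using dtm_ren[of M t Suc] by simp

text \<open>Kept free of axioms of set theory, so that the calculus is available in a generic
  extension while the axioms are still being verified there.\<close>

locale tmodel =
  fixes M :: "hcset set"
  assumes transM: "x \<in> M \<Longrightarrow> y \<epsilon> x \<Longrightarrow> y \<in> M"
    and countableM: "countable M"
    and nonemptyM: "M \<noteq> {}"
begin

lemma mems_subset: "x \<in> M \<Longrightarrow> mems x \<subseteq> M"
  using transM by auto

lemma extM: "x \<in> M \<Longrightarrow> y \<in> M \<Longrightarrow> x = y \<longleftrightarrow> (\<forall>z\<in>M. z \<epsilon> x \<longleftrightarrow> z \<epsilon> y)"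
  using hmem_extensional transM by blast

lemma dfn_congI:
  assumes "dfn M Q" "\<And>e. (\<And>i. e i \<in> M) \<Longrightarrow> P e \<longleftrightarrow> Q e" shows "dfn M P"
proof -
  have "P e \<longleftrightarrow> Q e" if "range e \<subseteq> M" for e
    by (rule assms(2)) (use that in auto)
  then show ?thesis using assms(1) dfn_cong[of M P Q] by simp
qed

lemma dtm_closed: "dtm M t \<Longrightarrow> (\<And>i. e i \<in> M) \<Longrightarrow> t e \<in> M"
  by (rule dtm_in) auto

lemma dtmI:
  assumes "\<And>e. (\<And>i. e i \<in> M) \<Longrightarrow> t e \<in> M" "dfn M (\<lambda>e. e 0 = t (\<lambda>i. e (Suc i)))"
  shows "dtm M t"
proof -
  have "t e \<in> M" if "range e \<subseteq> M" for e
    by (rule assms(1)) (use that in auto)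
  then show ?thesis using assms(2) by (simp add: dtm_def)
qed

lemma dfn_not [dfnI]: "dfn M P \<Longrightarrow> dfn M (\<lambda>e. \<not> P e)"
  using dfn_imp[of M P "\<lambda>e. False"] dfn_False[OF nonemptyM] by simp

lemma dfn_const [dfnI]: "dfn M (\<lambda>e. c)"
  using dfn_False[OF nonemptyM] dfn_not[OF dfn_False[OF nonemptyM]] by (cases c) auto

lemma dfn_or [dfnI]: "dfn M P \<Longrightarrow> dfn M Q \<Longrightarrow> dfn M (\<lambda>e. P e \<or> Q e)"
  using dfn_imp[of M "\<lambda>e. \<not> P e" Q] dfn_not[of P] by (simp add: disj_imp)

lemma dfn_and [dfnI]: "dfn M P \<Longrightarrow> dfn M Q \<Longrightarrow> dfn M (\<lambda>e. P e \<and> Q e)"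
  using dfn_not[OF dfn_imp[of M P "\<lambda>e. \<not> Q e"]] dfn_not[of Q] by simp

lemma dfn_iff [dfnI]: "dfn M P \<Longrightarrow> dfn M Q \<Longrightarrow> dfn M (\<lambda>e. P e \<longleftrightarrow> Q e)"
  using dfn_and[OF dfn_imp[of M P Q] dfn_imp[of M Q P]] by (simp add: iff_conv_conj_imp)

lemma dfn_ex [dfnI]:
  "dfn M (\<lambda>e. Q (e 0) (\<lambda>i. e (Suc i))) \<Longrightarrow> dfn M (\<lambda>e. \<exists>x\<in>M. Q x e)"
  using dfn_not[OF dfn_all[of M "\<lambda>x e. \<not> Q x e"]] dfn_not[of "\<lambda>e. Q (e 0) (\<lambda>i. e (Suc i))"] by simp

lemma dtm_var [dfnI]: "dtm M (\<lambda>e. e i)"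
  unfolding dtm_def using dfn_eq_var[OF nonemptyM] by auto

lemma dtm_const [dfnI]: "c \<in> M \<Longrightarrow> dtm M (\<lambda>e. c)"
  unfolding dtm_def using dfn_par[of M "\<lambda>x e. e 0 = x" c] dfn_eq_var[OF nonemptyM, of "Suc 0" 0]
  by auto

text \<open>The term is introduced by an existential quantifier over \<open>M\<close> and its graph;
  its value lies in \<open>M\<close>.\<close>

lemma dfn_subst:
  assumes "dfn M (\<lambda>e. Q (e 0) (\<lambda>i. e (Suc i)))" "dtm M t"
  shows "dfn M (\<lambda>e. Q (t e) e)"
proof -
  have "dfn M (\<lambda>e. \<exists>x\<in>M. x = t e \<and> Q x e)"
    by (intro dfn_ex dfn_and dtm_eq assms)
  then show ?thesis
    by (rule dfn_congI) (simp add: dtm_closed[OF assms(2)])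
qed

lemma dfn_subst1: "dfn M (\<lambda>e. P (e 0)) \<Longrightarrow> dtm M t \<Longrightarrow> dfn M (\<lambda>e. P (t e))"
  by (rule dfn_subst)

lemma dfn_subst2:
  assumes "dfn M (\<lambda>e. R (e 0) (e 1))" "dtm M t" "dtm M s"
  shows "dfn M (\<lambda>e. R (t e) (s e))"
proof -
  have "inj (\<lambda>i::nat. if i = 0 then 1 else if i = 1 then 0 else i)"
    by (auto simp: inj_def)
  from dfn_ren[OF assms(1) this] have "dfn M (\<lambda>e. R (e 1) (e 0))" by simp
  then have "dfn M (\<lambda>e. R (e 0) (s (\<lambda>i. e (Suc i))))"
    by (intro dfn_subst[of "\<lambda>y e. R (e 0) y"] dtm_Suc assms) simp
  from dfn_subst[OF this assms(2)] show ?thesis .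
qed

lemma dfn_subst3:
  assumes "dfn M (\<lambda>e. R (e 0) (e 1) (e 2))" "dtm M t" "dtm M s" "dtm M u"
  shows "dfn M (\<lambda>e. R (t e) (s e) (u e))"
proof -
  have "inj (\<lambda>i::nat. if i = 0 then 2 else if i = 2 then 0 else i)"
    by (auto simp: inj_def)
  from dfn_ren[OF assms(1) this] have "dfn M (\<lambda>e. R (e 2) (e 1) (e 0))" by (simp add: numeral_2_eq_2)
  then have "dfn M (\<lambda>e. R (e 1) (e 0) (u (\<lambda>i. e (Suc (Suc i)))))"
    by (intro dfn_subst[of "\<lambda>y e. R (e 1) (e 0) y"] dtm_Suc[of M "\<lambda>e. u (\<lambda>i. e (Suc i))"] dtm_Suc assms)
      (simp add: numeral_2_eq_2)
  then have "dfn M (\<lambda>e. R (e 0) (s (\<lambda>i. e (Suc i))) (u (\<lambda>i. e (Suc i))))"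
    by (intro dfn_subst[of "\<lambda>y e. R (e 0) y (u (\<lambda>i. e (Suc i)))"] dtm_Suc assms) simp
  from dfn_subst[OF this assms(2)] show ?thesis .
qed

lemma dfn_mem [dfnI]: "dtm M t \<Longrightarrow> dtm M s \<Longrightarrow> dfn M (\<lambda>e. t e \<epsilon> s e)"
  using dfn_subst2 dfn_mem_var[OF nonemptyM] by blast

lemma dfn_eq [dfnI]: "dtm M t \<Longrightarrow> dtm M s \<Longrightarrow> dfn M (\<lambda>e. t e = s e)"
  using dfn_subst2[of "(=)"] dfn_eq_var[OF nonemptyM] by blast

lemma dfn_ball [dfnI]:
  assumes "dtm M t" "dfn M (\<lambda>e. Q (e 0) (\<lambda>i. e (Suc i)))"
  shows "dfn M (\<lambda>e. \<forall>x\<in>mems (t e). Q x e)"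
proof -
  have "dfn M (\<lambda>e. \<forall>x\<in>M. x \<epsilon> t e \<longrightarrow> Q x e)"
    by (intro dfnI dtm_Suc assms)
  then show ?thesis
  proof (rule dfn_congI)
    fix e :: "nat \<Rightarrow> hcset" assume "\<And>i. e i \<in> M"
    then have "t e \<in> M" by (rule dtm_closed[OF assms(1)])
    then show "(\<forall>x\<in>mems (t e). Q x e) \<longleftrightarrow> (\<forall>x\<in>M. x \<epsilon> t e \<longrightarrow> Q x e)"
      using transM by auto
  qed
qed

lemma dfn_bex [dfnI]:
  assumes "dtm M t" "dfn M (\<lambda>e. Q (e 0) (\<lambda>i. e (Suc i)))"
  shows "dfn M (\<lambda>e. \<exists>x\<in>mems (t e). Q x e)"
  using dfn_not[OF dfn_ball[OF assms(1) dfn_not[OF assms(2)]]] by simp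

lemma dfn1I:
  assumes "dfn M (\<lambda>e. P' (e 0))" "\<And>x. x \<in> M \<Longrightarrow> P x \<longleftrightarrow> P' x" "dtm M t"
  shows "dfn M (\<lambda>e. P (t e))"
  by (rule dfn_subst1[OF _ assms(3)], rule dfn_congI[OF assms(1)]) (simp add: assms(2))

lemma dtm1I:
  assumes "\<And>x. x \<in> M \<Longrightarrow> F x \<in> M"
    "dfn M (\<lambda>e. R (e 0) (e 1))" "\<And>z x. z \<in> M \<Longrightarrow> x \<in> M \<Longrightarrow> z = F x \<longleftrightarrow> R z x" "dtm M t"
  shows "dtm M (\<lambda>e. F (t e))"
proof -
  have "dfn M (\<lambda>e. e 0 = F (e 1))"
    by (rule dfn_congI[OF assms(2)]) (simp add: assms(3))
  from dfn_subst2[of "\<lambda>a b. a = F b", OF this dtm_var[of 0] dtm_Suc[OF assms(4)]] show ?thesis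
    by (intro dtmI assms(1) dtm_closed[OF assms(4)])
qed

lemma dtm2I:
  assumes "\<And>x y. x \<in> M \<Longrightarrow> y \<in> M \<Longrightarrow> F x y \<in> M"
    "dfn M (\<lambda>e. R (e 0) (e 1) (e 2))"
    "\<And>z x y. z \<in> M \<Longrightarrow> x \<in> M \<Longrightarrow> y \<in> M \<Longrightarrow> z = F x y \<longleftrightarrow> R z x y" "dtm M t" "dtm M s"
  shows "dtm M (\<lambda>e. F (t e) (s e))"
proof -
  have "dfn M (\<lambda>e. e 0 = F (e 1) (e 2))"
    by (rule dfn_congI[OF assms(2)]) (simp add: assms(3))
  from dfn_subst3[of "\<lambda>a b c. a = F b c", OF this dtm_var[of 0] dtm_Suc[OF assms(4)] dtm_Suc[OF assms(5)]]
  show ?thesis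
    by (intro dtmI assms(1) dtm_closed[OF assms(4)] dtm_closed[OF assms(5)])
qed

lemma dtm_if [dfnI]:
  assumes "dfn M P" "dtm M t" "dtm M s"
  shows "dtm M (\<lambda>e. if P e then t e else s e)"
proof -
  have P: "dfn M (\<lambda>e. P (\<lambda>i. e (Suc i)))"
    by (rule dfn_ren[OF assms(1)]) auto
  have "dfn M (\<lambda>e. (P (\<lambda>i. e (Suc i)) \<longrightarrow> e 0 = t (\<lambda>i. e (Suc i))) \<and>
      (\<not> P (\<lambda>i. e (Suc i)) \<longrightarrow> e 0 = s (\<lambda>i. e (Suc i))))"
    by (intro dfn_and dfn_imp dfn_not P dtm_eq assms)
  then have "dfn M (\<lambda>e. e 0 = (if P (\<lambda>i. e (Suc i)) then t (\<lambda>i. e (Suc i)) else s (\<lambda>i. e (Suc i))))"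
    by (rule dfn_congI) auto
  then show ?thesis
    by (intro dtmI) (auto intro: dtm_closed[OF assms(2)] dtm_closed[OF assms(3)])
qed

text \<open>By extensionality in a transitive set, the graph of an operation is definable as soon as
  membership in its value is.\<close>

lemma dtm_elemsI:
  assumes "\<And>e. (\<And>i. e i \<in> M) \<Longrightarrow> t e \<in> M"
    "\<And>e z. (\<And>i. e i \<in> M) \<Longrightarrow> z \<in> M \<Longrightarrow> z \<epsilon> t e \<longleftrightarrow> Q z e"
    "dfn M (\<lambda>e. Q (e 0) (\<lambda>i. e (Suc i)))"
  shows "dtm M t"
proof -
  have "x = y" if "case_nat 0 (\<lambda>i. Suc (Suc i)) x = case_nat 0 (\<lambda>i. Suc (Suc i)) y" for x y
    using that by (cases x; cases y) auto
  then have "inj (case_nat 0 (\<lambda>i. Suc (Suc i)))"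
    by (rule injI)
  from dfn_ren[OF assms(3) this]
  have Q: "dfn M (\<lambda>e. Q (e 0) (\<lambda>i. e (Suc (Suc i))))" by simp
  have "dfn M (\<lambda>e. \<forall>z\<in>M. z \<epsilon> e 0 \<longleftrightarrow> Q z (\<lambda>i. e (Suc i)))"
    by (intro dfnI Q)
  then have "dfn M (\<lambda>e. e 0 = t (\<lambda>i. e (Suc i)))"
  proof (rule dfn_congI)
    fix e :: "nat \<Rightarrow> hcset" assume e: "\<And>i. e i \<in> M"
    show "e 0 = t (\<lambda>i. e (Suc i)) \<longleftrightarrow> (\<forall>z\<in>M. z \<epsilon> e 0 \<longleftrightarrow> Q z (\<lambda>i. e (Suc i)))"
      using extM[OF e assms(1)[OF e]] assms(2)[OF e] by simp
  qed
  then show ?thesis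
  proof (rule dtmI[rotated])
    fix e :: "nat \<Rightarrow> hcset" assume "\<And>i. e i \<in> M"
    then show "t e \<in> M" by (rule assms(1))
  qed
qed

end

section \<open>Basic set operations in a model\<close>

definition hempty :: hcset where "hempty = hset {}"
definition upair :: "hcset \<Rightarrow> hcset \<Rightarrow> hcset" where "upair x y = hset {x, y}"
definition hpair :: "hcset \<Rightarrow> hcset \<Rightarrow> hcset" where "hpair x y = upair (upair x x) (upair x y)"
definition hUn :: "hcset \<Rightarrow> hcset" where "hUn x = hset (\<Union> (mems ` mems x))"
definition hun :: "hcset \<Rightarrow> hcset \<Rightarrow> hcset" where "hun x y = hset (mems x \<union> mems y)"
definition hsucc :: "hcset \<Rightarrow> hcset" where "hsucc x = hset (insert x (mems x))"
definition hprod :: "hcset \<Rightarrow> hcset \<Rightarrow> hcset" where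
  "hprod x y = hset (\<Union>a\<in>mems x. (\<lambda>b. hpair a b) ` mems y)"
definition hom :: hcset where "hom = hset (range omega_nat)"
definition hfst :: "hcset \<Rightarrow> hcset" where
  "hfst z = (if \<exists>a b. z = hpair a b then THE a. \<exists>b. z = hpair a b else hempty)"
definition hsnd :: "hcset \<Rightarrow> hcset" where
  "hsnd z = (if \<exists>a b. z = hpair a b then THE b. \<exists>a. z = hpair a b else hempty)"
text \<open>Total application: where \<open>f\<close> fails to be single-valued or defined, the
  value is \<open>hempty\<close>. Any set can thus serve as the code of a function.\<close>

definition happ :: "hcset \<Rightarrow> hcset \<Rightarrow> hcset" where
  "happ f x = (if \<exists>!y. hpair x y \<epsilon> f then THE y. hpair x y \<epsilon> f else hempty)"

lemma mem_hempty [simp]: "\<not> x \<epsilon> hempty" by (simp add: hempty_def)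
lemma mem_upair [simp]: "z \<epsilon> upair x y \<longleftrightarrow> z = x \<or> z = y" by (simp add: upair_def)
lemma mem_hUn [simp]: "z \<epsilon> hUn x \<longleftrightarrow> (\<exists>y. y \<epsilon> x \<and> z \<epsilon> y)" by (auto simp: hUn_def)
lemma mem_hun [simp]: "z \<epsilon> hun x y \<longleftrightarrow> z \<epsilon> x \<or> z \<epsilon> y" by (simp add: hun_def)
lemma mem_hsucc [simp]: "z \<epsilon> hsucc x \<longleftrightarrow> z = x \<or> z \<epsilon> x" by (simp add: hsucc_def)
lemma mem_hom [simp]: "x \<epsilon> hom \<longleftrightarrow> x \<in> range omega_nat" by (simp add: hom_def)

lemma hcset_eqI: "(\<And>z. z \<epsilon> x \<longleftrightarrow> z \<epsilon> y) \<Longrightarrow> x = y"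
  by (rule hmem_extensional)

lemma upair_eq_iff: "upair a b = upair c d \<longleftrightarrow> a = c \<and> b = d \<or> a = d \<and> b = c"
proof
  assume *: "upair a b = upair c d"
  have "z = a \<or> z = b \<longleftrightarrow> z = c \<or> z = d" for z
    using mem_upair[of z a b] mem_upair[of z c d] * by simp
  then show "a = c \<and> b = d \<or> a = d \<and> b = c" by metis
next
  assume "a = c \<and> b = d \<or> a = d \<and> b = c"
  then show "upair a b = upair c d" by (auto intro: hcset_eqI)
qed

lemma hpair_inject [simp]: "hpair a b = hpair c d \<longleftrightarrow> a = c \<and> b = d"
  unfolding hpair_def upair_eq_iff by metis

lemma mem_hprod [simp]: "z \<epsilon> hprod x y \<longleftrightarrow> (\<exists>a b. a \<epsilon> x \<and> b \<epsilon> y \<and> z = hpair a b)"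
proof -
  have "countable (\<Union>a\<in>mems x. (\<lambda>b. hpair a b) ` mems y)" by auto
  moreover have "(\<Union>a\<in>mems x. (\<lambda>b. hpair a b) ` mems y) = {hpair a b |a b. a \<epsilon> x \<and> b \<epsilon> y}"
    by auto
  ultimately show ?thesis by (auto simp: hprod_def)
qed

lemma hfst_hpair [simp]: "hfst (hpair a b) = a"
proof -
  have "(THE a'. \<exists>b'. hpair a b = hpair a' b') = a"
    by (rule the_equality) auto
  then show ?thesis by (simp only: hfst_def) auto
qed

lemma hsnd_hpair [simp]: "hsnd (hpair a b) = b"
proof -
  have "(THE b'. \<exists>a'. hpair a b = hpair a' b') = b"
    by (rule the_equality) auto
  then show ?thesis by (simp only: hsnd_def) auto
qed

lemma happ_eq: "hpair x y \<epsilon> f \<Longrightarrow> (\<And>y'. hpair x y' \<epsilon> f \<Longrightarrow> y' = y) \<Longrightarrow> happ f x = y"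
proof -
  assume *: "hpair x y \<epsilon> f" "\<And>y'. hpair x y' \<epsilon> f \<Longrightarrow> y' = y"
  then have "\<exists>!y. hpair x y \<epsilon> f" by auto
  moreover have "(THE y. hpair x y \<epsilon> f) = y" using * by (rule the_equality)
  ultimately show ?thesis by (simp add: happ_def)
qed

lemma omega_nat_0: "omega_nat 0 = hempty"
  by (rule hcset_eqI) (simp add: hmem_def cin.rep_eq hempty_def hset_def acset_inverse bot_cset.rep_eq)

lemma omega_nat_Suc: "omega_nat (Suc n) = hsucc (omega_nat n)"
  by (rule hcset_eqI) (auto simp: hmem_def cin.rep_eq hsucc_def mems_def hset_def
      acset_inverse cinsert.rep_eq)

lemmas omega_nat_simps = omega_nat_0 omega_nat_Suc
declare omega_nat.simps [simp del]

lemma mem_omega_nat: "x \<epsilon> omega_nat n \<longleftrightarrow> (\<exists>m<n. x = omega_nat m)"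
  by (induction n) (auto simp: omega_nat_simps less_Suc_eq)

lemma omega_nat_inject [simp]: "omega_nat m = omega_nat n \<longleftrightarrow> m = n"
proof -
  have "omega_nat m \<noteq> omega_nat n" if "m < n" for m n
    using mem_omega_nat[of "omega_nat m" n] that by force
  then show ?thesis by (metis nat_neq_iff)
qed

lemma ssat_derived [simp]:
  "ssat M e (FNeg \<phi>) \<longleftrightarrow> \<not> ssat M e \<phi>"
  "ssat M e (FOr \<phi> \<psi>) \<longleftrightarrow> ssat M e \<phi> \<or> ssat M e \<psi>"
  "ssat M e (FAnd \<phi> \<psi>) \<longleftrightarrow> ssat M e \<phi> \<and> ssat M e \<psi>"
  "ssat M e (FIff \<phi> \<psi>) \<longleftrightarrow> (ssat M e \<phi> \<longleftrightarrow> ssat M e \<psi>)"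
  "ssat M e (FEx n \<phi>) \<longleftrightarrow> (\<exists>x\<in>M. ssat M (e(n := x)) \<phi>)"
  by (auto simp: FNeg_def FOr_def FAnd_def FIff_def FEx_def)

locale ctm =
  fixes M :: "hcset set"
  assumes ctm: "M \<in> ctms"

sublocale ctm \<subseteq> tmodel
  by unfold_locales (use ctm in \<open>auto simp: ctms_def transitive_set_def models_ZFC_def\<close>)

context ctm
begin

lemma axiom: "\<phi> \<in> ZFC \<Longrightarrow> (\<And>i. e i \<in> M) \<Longrightarrow> ssat M e \<phi>"
proof -
  assume *: "\<phi> \<in> ZFC" "\<And>i. e i \<in> M"
  then have "range e \<subseteq> M" by auto
  moreover have "\<forall>\<phi>\<in>ZFC. \<forall>e. range e \<subseteq> M \<longrightarrow> ssat M e \<phi>"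
    using ctm by (auto simp: ctms_def models_ZFC_def)
  ultimately show ?thesis using *(1) by blast
qed

text \<open>The bridge from axioms to actual sets: by transitivity, a witness found in
  \<open>M\<close> has no elements other than those that \<open>M\<close> sees.\<close>

lemma hset_in:
  assumes "z \<in> M" "\<And>w. w \<in> M \<Longrightarrow> w \<epsilon> z \<longleftrightarrow> w \<in> A" "A \<subseteq> M"
  shows "hset A \<in> M"
proof -
  have "mems z = A" using assms(2,3) transM[OF assms(1)] unfolding mems_def by blast
  then have "hset A = z" by auto
  then show ?thesis using assms(1) by simp
qed

lemma upair_in [simp]: "x \<in> M \<Longrightarrow> y \<in> M \<Longrightarrow> upair x y \<in> M"
proof -
  assume xy: "x \<in> M" "y \<in> M"
  have "ssat M (\<lambda>_. x) pairing_ax"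
    by (rule axiom) (auto simp: ZFC_def xy)
  then have "\<forall>x\<in>M. \<forall>y\<in>M. \<exists>z\<in>M. \<forall>w\<in>M. w \<epsilon> z \<longleftrightarrow> w = x \<or> w = y"
    by (simp add: pairing_ax_def)
  then obtain z where "z \<in> M" "\<forall>w\<in>M. w \<epsilon> z \<longleftrightarrow> w = x \<or> w = y"
    using xy by blast
  then show ?thesis unfolding upair_def by (intro hset_in[of z]) (auto simp: xy)
qed

lemma hpair_in [simp]: "hpair x y \<in> M \<longleftrightarrow> x \<in> M \<and> y \<in> M"
proof
  assume "hpair x y \<in> M"
  then have "upair x y \<in> M" by (rule transM) (simp add: hpair_def)
  then show "x \<in> M \<and> y \<in> M" by (meson transM mem_upair)
qed (simp add: hpair_def)

lemma hUn_in [simp]: "x \<in> M \<Longrightarrow> hUn x \<in> M"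
proof -
  assume x: "x \<in> M"
  have "ssat M (\<lambda>_. x) union_ax"
    by (rule axiom) (auto simp: ZFC_def x)
  then have "\<forall>x\<in>M. \<exists>z\<in>M. \<forall>w\<in>M. w \<epsilon> z \<longleftrightarrow> (\<exists>y\<in>M. y \<epsilon> x \<and> w \<epsilon> y)"
    by (simp add: union_ax_def)
  then obtain z where z: "z \<in> M" "\<forall>w\<in>M. w \<epsilon> z \<longleftrightarrow> (\<exists>y\<in>M. y \<epsilon> x \<and> w \<epsilon> y)"
    using x by blast
  show ?thesis unfolding hUn_def
  proof (rule hset_in[OF z(1)])
    show "w \<epsilon> z \<longleftrightarrow> w \<in> \<Union> (mems ` mems x)" if "w \<in> M" for w
      using z(2) that x transM by auto
    show "\<Union> (mems ` mems x) \<subseteq> M"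
      using x transM by (meson UN_least in_mems mems_subset)
  qed
qed

text \<open>Power sets are not absolute: this one depends on the world, and a generic extension has
  its own.\<close>

definition hpow :: "hcset \<Rightarrow> hcset" where
  "hpow x = hset {y \<in> M. mems y \<subseteq> mems x}"

lemma mem_hpow [simp]: "z \<epsilon> hpow x \<longleftrightarrow> z \<in> M \<and> mems z \<subseteq> mems x"
proof -
  have "countable {y \<in> M. mems y \<subseteq> mems x}"
    by (rule countable_subset[OF _ countableM]) auto
  then show ?thesis by (simp add: hpow_def)
qed

lemma hpow_in [simp]: "x \<in> M \<Longrightarrow> hpow x \<in> M"
proof -
  assume x: "x \<in> M"
  have "ssat M (\<lambda>_. x) powerset_ax"
    by (rule axiom) (auto simp: ZFC_def x)
  then have "\<forall>x\<in>M. \<exists>z\<in>M. \<forall>w\<in>M. w \<epsilon> z \<longleftrightarrow> (\<forall>y\<in>M. y \<epsilon> w \<longrightarrow> y \<epsilon> x)"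
    by (simp add: powerset_ax_def)
  then obtain z where z: "z \<in> M" "\<forall>w\<in>M. w \<epsilon> z \<longleftrightarrow> (\<forall>y\<in>M. y \<epsilon> w \<longrightarrow> y \<epsilon> x)"
    using x by blast
  show ?thesis unfolding hpow_def
    by (rule hset_in[OF z(1)]) (use z(2) x transM in \<open>auto simp: subset_iff\<close>)
qed

lemma sep:
  assumes "dfn M (\<lambda>e. P (e 0))" "a \<in> M"
  shows "hset {x \<in> mems a. P x} \<in> M"
proof -
  obtain \<phi> p where p: "range p \<subseteq> M"
    "\<And>e. range e \<subseteq> M \<Longrightarrow> P (e 0) \<longleftrightarrow> ssat M (merge p e) \<phi>"
    using assms(1) unfolding dfn_def by auto
  have pM: "p i \<in> M" for i using p(1) by auto
  \<comment> \<open>The axiom reserves the variables 0, 1 and 2. The tested argument, variable 1 of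
    \<open>\<phi>\<close>, is sent to 2, and all other variables move above the reserved
    ones.\<close>
  define f where "f n = (if n = 1 then 2 else n + 3)" for n :: nat
  have "inj f" unfolding f_def inj_def by auto
  define e where "e n = (if n < 3 then a else merge p (\<lambda>_. a) (n - 3))" for n
  have eM: "e n \<in> M" for n using pM assms(2) by (auto simp: e_def merge_def)
  have "1 \<notin> fv (ren f \<phi>)" using fv_ren_subset[of f \<phi>] by (auto simp: f_def)
  then have ax: "ssat M e (separation_ax (ren f \<phi>))"
    by (intro axiom eM) (auto simp: ZFC_def)
  obtain z where z: "z \<in> M"
    "\<forall>x\<in>M. x \<epsilon> z \<longleftrightarrow> x \<epsilon> a \<and> ssat M (e(0 := a, 1 := z, 2 := x)) (ren f \<phi>)"
    using bspec[OF ax[unfolded separation_ax_def ssat.simps ssat_derived] assms(2)] by auto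
  have key: "ssat M (e(0 := a, 1 := z, 2 := x)) (ren f \<phi>) \<longleftrightarrow> P x" if x: "x \<in> M" for x
  proof -
    have "e(0 := a, 1 := z, 2 := x) \<circ> f = merge p (\<lambda>i. if i = 0 then x else a)"
      by (rule ext) (auto simp: f_def e_def merge_def elim!: oddE)
    moreover have "range (\<lambda>i. if i = 0 then x else a) \<subseteq> M" using x assms(2) by auto
    from p(2)[OF this] have "P x \<longleftrightarrow> ssat M (merge p (\<lambda>i. if i = 0 then x else a)) \<phi>" by simp
    ultimately show ?thesis using \<open>inj f\<close> by (simp add: ssat_ren inj_on_subset[OF _ subset_UNIV])
  qed
  show ?thesis
    by (rule hset_in[OF z(1)]) (use z(2) key transM[OF assms(2)] in auto)
qed

lemma repl:
  assumes "dfn M (\<lambda>e. R (e 0) (e 1))" "a \<in> M"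
    "\<And>x. x \<epsilon> a \<Longrightarrow> \<exists>y\<in>M. \<forall>y'\<in>M. R y' x \<longleftrightarrow> y' = y"
  shows "hset {y \<in> M. \<exists>x\<in>mems a. R y x} \<in> M"
proof -
  obtain \<phi> p where p: "range p \<subseteq> M"
    "\<And>e. range e \<subseteq> M \<Longrightarrow> R (e 0) (e 1) \<longleftrightarrow> ssat M (merge p e) \<phi>"
    using assms(1) unfolding dfn_def by auto
  have pM: "p i \<in> M" for i using p(1) by auto
  \<comment> \<open>In the axiom, 2 is the element and 3 its image, while 1 and 4 must not occur. So
    the arguments 0 and 1, on the variables 1 and 3, go to 3 and 2; the rest moves above 4.\<close>
  define f where "f n = (if n = 1 then 3 else if n = 3 then 2 else n + 5)" for n :: nat
  have "inj f" unfolding f_def inj_def by auto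
  define e where "e n = (if n < 5 then a else merge p (\<lambda>_. a) (n - 5))" for n
  have eM: "e n \<in> M" for n using pM assms(2) by (auto simp: e_def merge_def)
  have "1 \<notin> fv (ren f \<phi>)" "4 \<notin> fv (ren f \<phi>)" using fv_ren_subset[of f \<phi>] by (auto simp: f_def)
  then have ax: "ssat M e (replacement_ax (ren f \<phi>))"
    by (intro axiom eM) (auto simp: ZFC_def)
  have key: "ssat M e' (ren f \<phi>) \<longleftrightarrow> R y x"
    if "e' 2 = x" "e' 3 = y" "\<And>n. n \<ge> 5 \<Longrightarrow> e' n = e n" "x \<in> M" "y \<in> M" for e' x y
  proof -
    have "e' \<circ> f = merge p (\<lambda>i. if i = 0 then y else if i = 1 then x else a)"
      using that by (intro ext) (auto simp: f_def e_def merge_def elim!: oddE)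
    moreover have "range (\<lambda>i. if i = 0 then y else if i = 1 then x else a) \<subseteq> M" using that assms(2) by auto
    from p(2)[OF this] have "R y x \<longleftrightarrow> ssat M (merge p (\<lambda>i. if i = 0 then y else if i = 1 then x else a)) \<phi>" by simp
    ultimately show ?thesis using \<open>inj f\<close> by (simp add: ssat_ren inj_on_subset[OF _ subset_UNIV])
  qed
  have "\<forall>x\<in>M. x \<epsilon> a \<longrightarrow> (\<exists>w\<in>M. \<forall>y\<in>M. ssat M (e(0 := a, 2 := x, 4 := w, 3 := y)) (ren f \<phi>) \<longleftrightarrow> y = w)"
  proof (intro ballI impI)
    fix x assume x: "x \<in> M" "x \<epsilon> a"
    then obtain w where w: "w \<in> M" "\<forall>y'\<in>M. R y' x \<longleftrightarrow> y' = w" using assms(3) by blast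
    have "ssat M (e(0 := a, 2 := x, 4 := w, 3 := y)) (ren f \<phi>) \<longleftrightarrow> R y x" if "y \<in> M" for y
      by (rule key) (use x that in auto)
    then show "\<exists>w\<in>M. \<forall>y\<in>M. ssat M (e(0 := a, 2 := x, 4 := w, 3 := y)) (ren f \<phi>) \<longleftrightarrow> y = w"
      using w by blast
  qed
  moreover have "(\<forall>x\<in>M. x \<epsilon> a \<longrightarrow> (\<exists>w\<in>M. \<forall>y\<in>M. ssat M (e(0 := a, 2 := x, 4 := w, 3 := y)) (ren f \<phi>) \<longleftrightarrow> y = w)) \<longrightarrow>
      (\<exists>z\<in>M. \<forall>y\<in>M. y \<epsilon> z \<longleftrightarrow> (\<exists>x\<in>M. x \<epsilon> a \<and> ssat M (e(0 := a, 1 := z, 3 := y, 2 := x)) (ren f \<phi>)))"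
    using bspec[OF ax[unfolded replacement_ax_def ssat.simps ssat_derived] assms(2)] by simp
  ultimately obtain z where z: "z \<in> M"
    "\<forall>y\<in>M. y \<epsilon> z \<longleftrightarrow> (\<exists>x\<in>M. x \<epsilon> a \<and> ssat M (e(0 := a, 1 := z, 3 := y, 2 := x)) (ren f \<phi>))"
    by blast
  have "ssat M (e(0 := a, 1 := z, 3 := y, 2 := x)) (ren f \<phi>) \<longleftrightarrow> R y x" if "x \<in> M" "y \<in> M" for x y
    by (rule key) (use that in auto)
  then show ?thesis
    by (intro hset_in[OF z(1)]) (use z(2) transM[OF assms(2)] in auto)
qed

lemma image_in:
  assumes "dfn M (\<lambda>e. e 0 = F (e 1))" "a \<in> M" "\<And>x. x \<epsilon> a \<Longrightarrow> F x \<in> M"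
  shows "hset (F ` mems a) \<in> M"
proof -
  have "hset {y \<in> M. \<exists>x\<in>mems a. y = F x} \<in> M"
    by (rule repl) (use assms in auto)
  also have "{y \<in> M. \<exists>x\<in>mems a. y = F x} = F ` mems a"
    using assms(3) by auto
  finally show ?thesis .
qed

end

text \<open>Every even-numbered argument becomes a parameter, and the odd-numbered ones are
  renumbered. This fixes infinitely many arguments while infinitely many remain.\<close>

lemma dfn_merge:
  assumes "dfn M P" "range b \<subseteq> M"
  shows "dfn M (\<lambda>e. P (merge b e))"
proof -
  obtain \<phi> a where 1: "range a \<subseteq> M" "\<And>e. range e \<subseteq> M \<Longrightarrow> P e \<longleftrightarrow> ssat M (merge a e) \<phi>"
    using assms unfolding dfn_def by auto
  define g where "g n = (if even n then 2 * n else if even (n div 2) then n + 1 else n div 2)" for n :: nat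
  define h where "h m = (if odd m then 2 * m + 1 else if m mod 4 = 0 then m div 2 else m - 1)" for m :: nat
  have cases4: "(\<exists>j. n = 4 * j) \<or> (\<exists>j. n = 4 * j + 1) \<or> (\<exists>j. n = 4 * j + 2) \<or> (\<exists>j. n = 4 * j + 3)" for n :: nat
    by presburger
  have "h (g n) = n" for n
  proof -
    consider j where "n = 2 * j" | j where "n = 4 * j + 1" | j where "n = 4 * j + 3"
      using cases4[of n] by (metis dvd_def even_add even_mult_iff even_numeral)
    then show ?thesis
    proof cases
      case (2 j)
      then have "g n = 4 * j + 2" by (simp add: g_def)
      moreover have "(4 * j + 2) mod 4 = 2" by presburger
      ultimately show ?thesis using 2 by (simp add: h_def)
    next
      case (3 j)
      then have "n div 2 = 2 * j + 1" by presburger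
      then have "g n = 2 * j + 1" using 3 by (simp add: g_def)
      then show ?thesis using 3 by (simp add: h_def)
    qed (simp add: g_def h_def)
  qed
  then have inj: "inj g" by (metis injI)
  have bM: "b n \<in> M" "a n \<in> M" for n using assms(2) 1(1) by auto
  then have "range (merge a b) \<subseteq> M" by (auto simp: merge_def)
  moreover have "P (merge b e) \<longleftrightarrow> ssat M (merge (merge a b) e) (ren g \<phi>)" if e: "range e \<subseteq> M" for e
  proof -
    have "e n \<in> M" for n using e by auto
    then have "range (merge b e) \<subseteq> M" using bM by (auto simp: merge_def)
    from 1(2)[OF this] have "P (merge b e) \<longleftrightarrow> ssat M (merge a (merge b e)) \<phi>" .
    also have "merge a (merge b e) = merge (merge a b) e \<circ> g"
    proof
      fix n :: nat
      consider j where "n = 2 * j" | j where "n = 4 * j + 1" | j where "n = 4 * j + 3"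
        using cases4[of n] by (metis dvd_def even_add even_mult_iff even_numeral)
      then show "merge a (merge b e) n = (merge (merge a b) e \<circ> g) n"
      proof cases
        case (2 j)
        then have "g n = 2 * (2 * j + 1)" by (simp add: g_def)
        then show ?thesis using 2 by (simp add: merge_def)
      next
        case (3 j)
        then have *: "n div 2 = 2 * j + 1" "odd n" by presburger+
        then have "g n = 2 * j + 1" by (simp add: g_def)
        then show ?thesis using * by (simp add: merge_def)
      qed (simp add: g_def merge_def)
    qed
    finally show ?thesis using inj by (simp add: ssat_ren inj_on_subset[OF _ subset_UNIV] comp_def)
  qed
  ultimately show ?thesis unfolding dfn_def by blast
qed

lemma dfn_fix2:
  assumes "dfn M (\<lambda>e. Q (e 0) (e 1) (\<lambda>i. e (Suc (Suc i))))" "range b \<subseteq> M"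
  shows "dfn M (\<lambda>e. Q (e 0) (e 1) b)"
proof -
  define f where "f i = (if i = 0 then 1 else if i = 1 then 3 else 2 * (i - 2))" for i :: nat
  have "inj f"
  proof (rule injI)
    fix x y assume "f x = f y"
    then show "x = y"
      by (auto simp: f_def split: if_splits) presburger+
  qed
  from dfn_ren[OF assms(1) this] have "dfn M (\<lambda>e. Q (e 1) (e 3) (\<lambda>i. e (2 * i)))"
    by (simp add: f_def)
  from dfn_merge[OF this assms(2)] show ?thesis by (simp add: merge_def)
qed

context tmodel
begin

lemma dtm1_elems:
  assumes "\<And>x. x \<in> M \<Longrightarrow> F x \<in> M"
    "\<And>z x. z \<in> M \<Longrightarrow> x \<in> M \<Longrightarrow> z \<epsilon> F x \<longleftrightarrow> Q z x"
    "dfn M (\<lambda>e. Q (e 0) (e 1))" "dtm M t"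
  shows "dtm M (\<lambda>e. F (t e))"
proof (rule dtm_elemsI)
  show "dfn M (\<lambda>e. Q (e 0) (t (\<lambda>i. e (Suc i))))"
    by (rule dfn_subst2[OF assms(3)]) (intro dfnI dtm_Suc[OF assms(4)])+
next
  fix e :: "nat \<Rightarrow> hcset" assume "\<And>i. e i \<in> M"
  then have "t e \<in> M" by (rule dtm_closed[OF assms(4)])
  then show "F (t e) \<in> M" "z \<in> M \<Longrightarrow> z \<epsilon> F (t e) \<longleftrightarrow> Q z (t e)" for z
    using assms(1,2) by blast+
qed

lemma dtm2_elems:
  assumes "\<And>x y. x \<in> M \<Longrightarrow> y \<in> M \<Longrightarrow> F x y \<in> M"
    "\<And>z x y. z \<in> M \<Longrightarrow> x \<in> M \<Longrightarrow> y \<in> M \<Longrightarrow> z \<epsilon> F x y \<longleftrightarrow> Q z x y"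
    "dfn M (\<lambda>e. Q (e 0) (e 1) (e 2))" "dtm M t" "dtm M s"
  shows "dtm M (\<lambda>e. F (t e) (s e))"
proof (rule dtm_elemsI)
  show "dfn M (\<lambda>e. Q (e 0) (t (\<lambda>i. e (Suc i))) (s (\<lambda>i. e (Suc i))))"
    by (rule dfn_subst3[OF assms(3)]) (intro dfnI assms(4,5)[THEN dtm_Suc])+
next
  fix e :: "nat \<Rightarrow> hcset" assume e: "\<And>i. e i \<in> M"
  then have "t e \<in> M" by (rule dtm_closed[OF assms(4)])
  moreover have "s e \<in> M" using e by (rule dtm_closed[OF assms(5)])
  ultimately show "F (t e) (s e) \<in> M" "z \<in> M \<Longrightarrow> z \<epsilon> F (t e) (s e) \<longleftrightarrow> Q z (t e) (s e)" for z
    using assms(1,2) by blast+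
qed

lemma dfn_subset [dfnI]:
  assumes "dtm M t" "dtm M s" shows "dfn M (\<lambda>e. mems (t e) \<subseteq> mems (s e))"
proof -
  have "dfn M (\<lambda>e. \<forall>z\<in>mems (t e). z \<epsilon> s e)"
    by (intro dfnI assms dtm_Suc[OF assms(2)])
  then show ?thesis by (simp add: subset_iff Ball_def)
qed

end

context ctm
begin

lemma upair_in_iff [simp]: "upair x y \<in> M \<longleftrightarrow> x \<in> M \<and> y \<in> M"
  by (metis mem_upair transM upair_in)

lemma dtm_upair [dfnI]: "dtm M t \<Longrightarrow> dtm M s \<Longrightarrow> dtm M (\<lambda>e. upair (t e) (s e))"
  by (rule dtm2_elems[of upair "\<lambda>z x y. z = x \<or> z = y"]) (auto intro!: dfnI)

lemma dtm_hpair [dfnI]: "dtm M t \<Longrightarrow> dtm M s \<Longrightarrow> dtm M (\<lambda>e. hpair (t e) (s e))"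
  unfolding hpair_def by (intro dfnI)

lemma dtm_hUn [dfnI]: "dtm M t \<Longrightarrow> dtm M (\<lambda>e. hUn (t e))"
  by (rule dtm1_elems[of hUn "\<lambda>z x. \<exists>y\<in>mems x. z \<epsilon> y"]) (auto intro!: dfnI)

lemma hun_eq: "hun x y = hUn (upair x y)"
  by (rule hcset_eqI) auto

lemma hun_in [simp]: "x \<in> M \<Longrightarrow> y \<in> M \<Longrightarrow> hun x y \<in> M"
  by (simp add: hun_eq)

lemma dtm_hun [dfnI]: "dtm M t \<Longrightarrow> dtm M s \<Longrightarrow> dtm M (\<lambda>e. hun (t e) (s e))"
  unfolding hun_eq by (intro dfnI)

lemma hsucc_eq: "hsucc x = hun x (upair x x)"
  by (rule hcset_eqI) auto

lemma hsucc_in [simp]: "x \<in> M \<Longrightarrow> hsucc x \<in> M"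
  by (simp add: hsucc_eq)

lemma dtm_hsucc [dfnI]: "dtm M t \<Longrightarrow> dtm M (\<lambda>e. hsucc (t e))"
  unfolding hsucc_eq by (intro dfnI)

lemma dtm_hpow [dfnI]: "dtm M t \<Longrightarrow> dtm M (\<lambda>e. hpow (t e))"
  by (rule dtm1_elems[of hpow "\<lambda>z x. mems z \<subseteq> mems x"]) (auto intro!: dfnI)

lemma sep_fix:
  assumes "dfn M (\<lambda>e. Q (e 0) (\<lambda>i. e (Suc i)))" "\<And>i. e i \<in> M" "a \<in> M"
  shows "hset {x \<in> mems a. Q x e} \<in> M"
proof -
  have "range e \<subseteq> M" using assms(2) by auto
  from dfn_fix[OF assms(1) this] show ?thesis by (rule sep) (rule assms(3))
qed

lemma countable_sep [simp]: "countable {x. x \<epsilon> a \<and> P x}"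
  by (rule countable_subset[OF _ countable_mems[of a]]) auto

lemma hempty_in [simp]: "hempty \<in> M"
proof -
  obtain a where "a \<in> M" using nonemptyM by auto
  from sep[of "\<lambda>_. False", OF dfn_const this] show ?thesis by (simp add: hempty_def)
qed

lemma dtm_sep [dfnI]:
  assumes "dtm M t" "dfn M (\<lambda>e. Q (e 0) (\<lambda>i. e (Suc i)))"
  shows "dtm M (\<lambda>e. hset {x \<in> mems (t e). Q x e})"
proof (rule dtm_elemsI)
  fix e :: "nat \<Rightarrow> hcset" assume e: "\<And>i. e i \<in> M"
  then have "t e \<in> M" by (rule dtm_closed[OF assms(1)])
  then show "hset {x \<in> mems (t e). Q x e} \<in> M"
    using assms(2) e by (intro sep_fix)
  show "z \<epsilon> hset {x \<in> mems (t e). Q x e} \<longleftrightarrow> z \<epsilon> t e \<and> Q z e" for z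
    by simp
next
  show "dfn M (\<lambda>e. e 0 \<epsilon> t (\<lambda>i. e (Suc i)) \<and> Q (e 0) (\<lambda>i. e (Suc i)))"
    by (intro dfnI assms dtm_Suc[OF assms(1)])
qed

lemma dtm_image [dfnI]:
  assumes "dtm M t" "dtm M (\<lambda>e. s (e 0) (\<lambda>i. e (Suc i)))"
  shows "dtm M (\<lambda>e. hset ((\<lambda>x. s x e) ` mems (t e)))"
proof (rule dtm_elemsI)
  have 1: "dfn M (\<lambda>e. e 0 = s (e 1) (\<lambda>i. e (Suc (Suc i))))"
    using dtm_eq[OF assms(2)] by simp
  fix e :: "nat \<Rightarrow> hcset" assume e: "\<And>i. e i \<in> M"
  then have tM: "t e \<in> M" by (rule dtm_closed[OF assms(1)])
  have "range e \<subseteq> M" using e by auto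
  from dfn_fix2[OF 1 this] have 2: "dfn M (\<lambda>e'. e' 0 = s (e' 1) e)" .
  have "s x e \<in> M" if "x \<in> M" for x
  proof -
    have "case_nat x e i \<in> M" for i using e that by (cases i) auto
    from dtm_closed[OF assms(2), of "case_nat x e"] this show ?thesis by simp
  qed
  then show "hset ((\<lambda>x. s x e) ` mems (t e)) \<in> M"
    by (intro image_in[OF 2 tM]) (use transM[OF tM] in blast)
  show "z \<epsilon> hset ((\<lambda>x. s x e) ` mems (t e)) \<longleftrightarrow> (\<exists>x\<in>mems (t e). z = s x e)" for z
    by (simp add: image_iff)
next
  have "inj (\<lambda>i. if i = 0 then 0 else Suc i)" by (auto simp: inj_def)
  from dtm_ren[OF assms(2) this] have "dtm M (\<lambda>e. s (e 0) (\<lambda>i. e (Suc (Suc i))))" by simp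
  then show "dfn M (\<lambda>e. \<exists>x\<in>mems (t (\<lambda>i. e (Suc i))). e 0 = s x (\<lambda>i. e (Suc i)))"
    by (intro dfnI dtm_Suc[OF assms(1)])
qed

lemma hprod_eq: "hprod x y = hUn (hset ((\<lambda>a. hset ((\<lambda>b. hpair a b) ` mems y)) ` mems x))"
proof (rule hcset_eqI)
  fix z
  have "(\<exists>u. (\<exists>a\<in>mems x. u = F a) \<and> z \<epsilon> u) \<longleftrightarrow> (\<exists>a\<in>mems x. z \<epsilon> F a)" for F by blast
  then show "z \<epsilon> hprod x y \<longleftrightarrow> z \<epsilon> hUn (hset ((\<lambda>a. hset ((\<lambda>b. hpair a b) ` mems y)) ` mems x))"
    by (auto simp: image_iff)
qed

lemma dtm_hprod [dfnI]:
  assumes "dtm M t" "dtm M s" shows "dtm M (\<lambda>e. hprod (t e) (s e))"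
  unfolding hprod_eq by (intro dfnI assms dtm_Suc[OF assms(2)])

lemma hprod_in [simp]: "x \<in> M \<Longrightarrow> y \<in> M \<Longrightarrow> hprod x y \<in> M"
  using dtm_closed[OF dtm_hprod[OF dtm_const dtm_const], of x y "\<lambda>_. x"] by simp

lemma hfst_in [simp]: "x \<in> M \<Longrightarrow> hfst x \<in> M"
  by (cases "\<exists>a b. x = hpair a b") (auto simp: hfst_def[of x])

lemma hsnd_in [simp]: "x \<in> M \<Longrightarrow> hsnd x \<in> M"
  by (cases "\<exists>a b. x = hpair a b") (auto simp: hsnd_def[of x])

lemma dfn_is_pair [dfnI]: "dtm M t \<Longrightarrow> dfn M (\<lambda>e. \<exists>a b. t e = hpair a b)"
proof (rule dfn1I[where P = "\<lambda>x. \<exists>a b. x = hpair a b" and P' = "\<lambda>x. \<exists>a\<in>M. \<exists>b\<in>M. x = hpair a b"])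
  show "dfn M (\<lambda>e. \<exists>a\<in>M. \<exists>b\<in>M. e 0 = hpair a b)" by (intro dfnI)
qed (metis hpair_in)+

lemma dtm_hfst [dfnI]: "dtm M t \<Longrightarrow> dtm M (\<lambda>e. hfst (t e))"
proof (rule dtm1I[where F = hfst and R = "\<lambda>z x. (\<exists>b\<in>M. x = hpair z b) \<or> \<not> (\<exists>a b. x = hpair a b) \<and> z = hempty"])
  show "dfn M (\<lambda>e. (\<exists>b\<in>M. e 1 = hpair (e 0) b) \<or> \<not> (\<exists>a b. e 1 = hpair a b) \<and> e 0 = hempty)"
    by (intro dfnI) simp
  show "z = hfst x \<longleftrightarrow> (\<exists>b\<in>M. x = hpair z b) \<or> \<not> (\<exists>a b. x = hpair a b) \<and> z = hempty"
    if "z \<in> M" "x \<in> M" for z x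
    using that by (cases "\<exists>a b. x = hpair a b") (auto simp: hfst_def[of x])
qed auto

lemma dtm_hsnd [dfnI]: "dtm M t \<Longrightarrow> dtm M (\<lambda>e. hsnd (t e))"
proof (rule dtm1I[where F = hsnd and R = "\<lambda>z x. (\<exists>b\<in>M. x = hpair b z) \<or> \<not> (\<exists>a b. x = hpair a b) \<and> z = hempty"])
  show "dfn M (\<lambda>e. (\<exists>b\<in>M. e 1 = hpair b (e 0)) \<or> \<not> (\<exists>a b. e 1 = hpair a b) \<and> e 0 = hempty)"
    by (intro dfnI) simp
  show "z = hsnd x \<longleftrightarrow> (\<exists>b\<in>M. x = hpair b z) \<or> \<not> (\<exists>a b. x = hpair a b) \<and> z = hempty"
    if "z \<in> M" "x \<in> M" for z x
    using that by (cases "\<exists>a b. x = hpair a b") (auto simp: hsnd_def[of x])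
qed auto

lemma pair_mem_in: "f \<in> M \<Longrightarrow> hpair x y \<epsilon> f \<Longrightarrow> x \<in> M \<and> y \<in> M"
  using transM hpair_in by blast

lemma happ_cases: "(\<exists>!y. hpair x y \<epsilon> f) \<and> hpair x (happ f x) \<epsilon> f \<or> \<not> (\<exists>!y. hpair x y \<epsilon> f) \<and> happ f x = hempty"
proof (cases "\<exists>!y. hpair x y \<epsilon> f")
  case True
  then show ?thesis using theI'[OF True] by (simp add: happ_def)
next
  case False
  then show ?thesis unfolding happ_def by (simp only: if_False) simp
qed

lemma happ_in [simp]: "f \<in> M \<Longrightarrow> happ f x \<in> M"
proof -
  assume f: "f \<in> M"
  have "hpair x (happ f x) \<epsilon> f \<or> happ f x = hempty" using happ_cases[of x f] by metis
  then show ?thesis using pair_mem_in[OF f] hempty_in by metis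
qed

lemma dtm_happ [dfnI]: "dtm M t \<Longrightarrow> dtm M s \<Longrightarrow> dtm M (\<lambda>e. happ (t e) (s e))"
proof (rule dtm2I[where F = happ and R = "\<lambda>z f x. (hpair x z \<epsilon> f \<and> (\<forall>y\<in>M. hpair x y \<epsilon> f \<longrightarrow> y = z))
    \<or> \<not> (\<exists>y\<in>M. hpair x y \<epsilon> f \<and> (\<forall>y'\<in>M. hpair x y' \<epsilon> f \<longrightarrow> y' = y)) \<and> z = hempty"])
  show "dfn M (\<lambda>e. (hpair (e 2) (e 0) \<epsilon> e 1 \<and> (\<forall>y\<in>M. hpair (e 2) y \<epsilon> e 1 \<longrightarrow> y = e 0))
    \<or> \<not> (\<exists>y\<in>M. hpair (e 2) y \<epsilon> e 1 \<and> (\<forall>y'\<in>M. hpair (e 2) y' \<epsilon> e 1 \<longrightarrow> y' = y)) \<and> e 0 = hempty)"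
    by (intro dfnI) simp
  show "z = happ f x \<longleftrightarrow> (hpair x z \<epsilon> f \<and> (\<forall>y\<in>M. hpair x y \<epsilon> f \<longrightarrow> y = z))
    \<or> \<not> (\<exists>y\<in>M. hpair x y \<epsilon> f \<and> (\<forall>y'\<in>M. hpair x y' \<epsilon> f \<longrightarrow> y' = y)) \<and> z = hempty"
    if "z \<in> M" "f \<in> M" "x \<in> M" for z f x
  proof -
    let ?U = "\<exists>y\<in>M. hpair x y \<epsilon> f \<and> (\<forall>y'\<in>M. hpair x y' \<epsilon> f \<longrightarrow> y' = y)"
    have yM: "y \<in> M" if "hpair x y \<epsilon> f" for y using pair_mem_in[OF \<open>f \<in> M\<close> that] by simp
    show ?thesis
    proof (cases "\<exists>!y. hpair x y \<epsilon> f")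
      case True
      then obtain y where y: "hpair x y \<epsilon> f" "\<And>y'. hpair x y' \<epsilon> f \<Longrightarrow> y' = y" by blast
      then have "happ f x = y" by (rule happ_eq)
      moreover have ?U using y yM by blast
      ultimately show ?thesis using y \<open>z \<in> M\<close> by blast
    next
      case False
      then have 1: "\<not> ?U" using yM by blast
      have 2: "happ f x = hempty" using False happ_cases[of x f] by blast
      have 3: "\<not> (hpair x z \<epsilon> f \<and> (\<forall>y\<in>M. hpair x y \<epsilon> f \<longrightarrow> y = z))" using False yM by blast
      show ?thesis unfolding 2 using 1 3 by argo
    qed
  qed
qed auto

lemma infinity:
  obtains I where "I \<in> M" "hempty \<epsilon> I" "\<And>x. x \<epsilon> I \<Longrightarrow> hsucc x \<epsilon> I"
proof -
  obtain a where a: "a \<in> M" using nonemptyM by auto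
  have "ssat M (\<lambda>_. a) infinity_ax"
    by (rule axiom) (auto simp: ZFC_def a)
  then obtain I where I: "I \<in> M" "\<exists>x\<in>M. x \<epsilon> I \<and> (\<forall>z\<in>M. \<not> z \<epsilon> x)"
    "\<forall>x\<in>M. x \<epsilon> I \<longrightarrow> (\<exists>y\<in>M. y \<epsilon> I \<and> (\<forall>z\<in>M. z \<epsilon> y \<longleftrightarrow> z \<epsilon> x \<or> z = x))"
    by (simp add: infinity_ax_def) blast
  show thesis
  proof (rule that[OF I(1)])
    obtain x where "x \<in> M" "x \<epsilon> I" "\<forall>z\<in>M. \<not> z \<epsilon> x" using I(2) by auto
    moreover from this have "x = hempty" using extM[of x hempty] by simp
    ultimately show "hempty \<epsilon> I" by simp
  next
    fix x assume x: "x \<epsilon> I"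
    then have "x \<in> M" using transM[OF I(1)] by blast
    then obtain y where y: "y \<in> M" "y \<epsilon> I" "\<forall>z\<in>M. z \<epsilon> y \<longleftrightarrow> z \<epsilon> x \<or> z = x" using I(3) x by blast
    have "y = hsucc x"
      using extM[OF y(1) hsucc_in[OF \<open>x \<in> M\<close>]] y(3) by auto
    then show "hsucc x \<epsilon> I" using y(2) by simp
  qed
qed

text \<open>Every element of \<open>hsucc x\<close> is zero or the successor of one of its own
  elements; well-foundedness turns this bounded condition into being a natural number. It cuts the
  true \<open>\<omega>\<close> out of the inductive set given by the axiom of infinity.\<close>

lemma omega_nat_charact:
  "(\<forall>y\<in>mems (hsucc x). y = hempty \<or> (\<exists>z\<in>mems y. y = hsucc z)) \<longleftrightarrow> x \<in> range omega_nat"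
proof
  show "x \<in> range omega_nat \<Longrightarrow> \<forall>y\<in>mems (hsucc x). y = hempty \<or> (\<exists>z\<in>mems y. y = hsucc z)"
  proof (clarify)
    fix n y assume "y \<in> mems (hsucc (omega_nat n))" and n: "\<not> (\<exists>z\<in>mems y. y = hsucc z)"
    then obtain m where "y = omega_nat m" by (auto simp: mem_omega_nat)
    then show "y = hempty" using n by (cases m) (auto simp: omega_nat_simps)
  qed
next
  show "\<forall>y\<in>mems (hsucc x). y = hempty \<or> (\<exists>z\<in>mems y. y = hsucc z) \<Longrightarrow> x \<in> range omega_nat"
  proof (induction x rule: hmem_induct)
    case (1 x)
    have "x \<in> mems (hsucc x)" by simp
    with 1(2) have "x = hempty \<or> (\<exists>z\<in>mems x. x = hsucc z)" by blast
    then consider "x = hempty" | z where "z \<epsilon> x" "x = hsucc z" by auto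
    then show ?case
    proof cases
      case 1
      then show ?thesis by (metis omega_nat_0 rangeI)
    next
      case (2 z)
      then have "z \<in> range omega_nat" using 1 by auto
      then show ?thesis using 2(2) by (metis imageE omega_nat_Suc rangeI)
    qed
  qed
qed

lemma hom_in [simp]: "hom \<in> M"
proof -
  obtain I where I: "I \<in> M" "hempty \<epsilon> I" "\<And>x. x \<epsilon> I \<Longrightarrow> hsucc x \<epsilon> I"
    using infinity by blast
  have "dfn M (\<lambda>e. \<forall>y\<in>mems (hsucc (e 0)). y = hempty \<or> (\<exists>z\<in>mems y. y = hsucc z))"
    by (intro dfnI) simp
  from sep[of "\<lambda>x. \<forall>y\<in>mems (hsucc x). y = hempty \<or> (\<exists>z\<in>mems y. y = hsucc z)", OF this I(1)]
  have "hset {x \<in> mems I. x \<in> range omega_nat} \<in> M"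
    unfolding omega_nat_charact .
  moreover have "omega_nat n \<epsilon> I" for n
    by (induction n) (use I(2,3) in \<open>auto simp: omega_nat_simps\<close>)
  then have "{x \<in> mems I. x \<in> range omega_nat} = range omega_nat" by auto
  ultimately show ?thesis by (simp add: hom_def)
qed

lemma omega_nat_in [simp]: "omega_nat n \<in> M"
  using transM[OF hom_in, of "omega_nat n"] by simp

end

section \<open>Recursion and choice in a model\<close>

definition hgraph :: "(hcset \<Rightarrow> hcset) \<Rightarrow> hcset set \<Rightarrow> hcset" where
  "hgraph F A = hset ((\<lambda>y. hpair y (F y)) ` A)"

lemma mem_hgraph [simp]: "countable A \<Longrightarrow> z \<epsilon> hgraph F A \<longleftrightarrow> (\<exists>y\<in>A. z = hpair y (F y))"
  by (auto simp: hgraph_def)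

lemma happ_hgraph: "countable A \<Longrightarrow> x \<in> A \<Longrightarrow> happ (hgraph F A) x = F x"
  by (rule happ_eq) auto

context ctm
begin

text \<open>A set-sized piece of the recursion: a domain closed under \<open>R\<close>-predecessors,
  and a relation on it obeying the recursion clause. The function itself is recovered as the union
  of such pieces.\<close>

definition appr :: "(hcset \<Rightarrow> hcset \<Rightarrow> bool) \<Rightarrow> (hcset \<Rightarrow> hcset \<Rightarrow> hcset) \<Rightarrow> hcset \<Rightarrow> hcset \<Rightarrow> bool" where
  "appr R G d f \<longleftrightarrow> (\<forall>x\<in>mems d. \<forall>y\<in>M. R y x \<longrightarrow> y \<epsilon> d)
     \<and> (\<forall>u\<in>mems f. \<exists>x\<in>mems d. u = hpair x (hsnd u))
     \<and> (\<forall>x\<in>mems d. \<forall>z\<in>M. hpair x z \<epsilon> f \<longleftrightarrow> z = G x (hset {u \<in> mems f. R (hfst u) x}))"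

text \<open>The function \<open>F\<close> is given outside the model; the point is that
  \<open>M\<close> is closed under it and can define it. Approximations in \<open>M\<close> are
  restrictions of \<open>F\<close>, and by induction along \<open>R\<close> every element of
  \<open>M\<close> lies in the domain of one. The hypothesis \<open>cover\<close> plays the role of
  set-likeness inside \<open>M\<close>.\<close>

lemma wf_recursion:
  assumes wf: "wf {(y, x). R y x}"
    and RM: "\<And>x y. R y x \<Longrightarrow> x \<in> M \<Longrightarrow> y \<in> M"
    and R: "dfn M (\<lambda>e. R (e 0) (e 1))"
    and cover: "\<And>x. x \<in> M \<Longrightarrow> \<exists>t\<in>M. x \<epsilon> t \<and> (\<forall>z\<in>mems t. \<forall>y. R y z \<longrightarrow> y \<epsilon> t)"
    and GM: "\<And>x f. x \<in> M \<Longrightarrow> f \<in> M \<Longrightarrow> G x f \<in> M"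
    and G: "dfn M (\<lambda>e. e 0 = G (e 1) (e 2))"
    and F: "\<And>x. x \<in> M \<Longrightarrow> F x = G x (hgraph F {y. R y x})"
  shows "x \<in> M \<Longrightarrow> F x \<in> M" "dtm M t \<Longrightarrow> dtm M (\<lambda>e. F (t e))"
proof -
  have dG: "dtm M (\<lambda>e. G (t e) (s e))" if "dtm M t" "dtm M s" for t s
    by (rule dtm2I[where F = G and R = "\<lambda>z x y. z = G x y"]) (use GM G that in auto)
  have dR: "dfn M (\<lambda>e. R (t e) (s e))" if "dtm M t" "dtm M s" for t s
    by (rule dfn_subst2[OF R that])
  have dA: "dfn M (\<lambda>e. appr R G (t e) (s e))" if "dtm M t" "dtm M s" for t s
  proof (rule dfn_subst2[OF _ that])
    show "dfn M (\<lambda>e. appr R G (e 0) (e 1))"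
      unfolding appr_def by (intro dfnI dR dG)
  qed
  have cR: "countable {y. R y x}" if "x \<in> M" for x
    by (rule countable_subset[OF _ countableM]) (use RM[OF _ that] in blast)
  \<comment> \<open>Approximations cannot disagree with \<open>F\<close>, hence not with each
    other.\<close>
  have graph_eq: "mems f = (\<lambda>x. hpair x (F x)) ` mems d" if A: "appr R G d f" and M: "d \<in> M" "f \<in> M" for d f
  proof -
    have val: "x \<epsilon> d \<longrightarrow> (\<forall>z\<in>M. hpair x z \<epsilon> f \<longleftrightarrow> z = F x) \<and> F x \<in> M" for x
    proof (induction x rule: wf_induct_rule[OF wf])
      case (1 x)
      show ?case
      proof
        assume xd: "x \<epsilon> d"
        then have xM: "x \<in> M" using transM[OF M(1)] by blast
        have "u \<epsilon> f \<and> R (hfst u) x \<longleftrightarrow> (\<exists>y. R y x \<and> u = hpair y (F y))" for u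
        proof
          assume u: "u \<epsilon> f \<and> R (hfst u) x"
          then obtain y v where y: "y \<epsilon> d" "u = hpair y v"
            using A unfolding appr_def Ball_def Bex_def in_mems by blast
          then have Ry: "R y x" using u by simp
          have "v \<in> M" using transM[OF M(2) conjunct1[OF u]] y(2) by simp
          then have "v = F y" using 1[of y] Ry y(1) u unfolding y(2) by auto
          then show "\<exists>y. R y x \<and> u = hpair y (F y)" using y(2) Ry by auto
        next
          assume "\<exists>y. R y x \<and> u = hpair y (F y)"
          then obtain y where y: "R y x" "u = hpair y (F y)" by blast
          then have "y \<epsilon> d" using A xd RM[OF y(1) xM] unfolding appr_def by auto
          then show "u \<epsilon> f \<and> R (hfst u) x" using 1[of y] y by auto
        qed
        then have "{u \<in> mems f. R (hfst u) x} = (\<lambda>y. hpair y (F y)) ` {y. R y x}" by auto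
        then have "hset {u \<in> mems f. R (hfst u) x} = hgraph F {y. R y x}" by (simp add: hgraph_def)
        then have "\<forall>z\<in>M. hpair x z \<epsilon> f \<longleftrightarrow> z = F x"
          using A xd F[OF xM] unfolding appr_def by simp
        moreover have "F x \<in> M"
        proof -
          have "G x (hset {u \<in> mems f. R (hfst u) x}) \<in> M"
          proof (rule GM[OF xM sep[OF _ M(2)]])
            show "dfn M (\<lambda>e. R (hfst (e 0)) x)" using xM by (intro dfnI dR)
          qed
          then show ?thesis
            using \<open>hset {u \<in> mems f. R (hfst u) x} = hgraph F {y. R y x}\<close> F[OF xM] by simp
        qed
        ultimately show "(\<forall>z\<in>M. hpair x z \<epsilon> f \<longleftrightarrow> z = F x) \<and> F x \<in> M" by simp
      qed
    qed
    show ?thesis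
    proof (intro equalityI subsetI)
      fix u assume "u \<in> mems f"
      then have u: "u \<epsilon> f" by simp
      then obtain x v where x: "x \<epsilon> d" "u = hpair x v"
        using A unfolding appr_def Ball_def Bex_def in_mems by blast
      then have "v \<in> M" using transM[OF M(2) u] by simp
      then have "v = F x" using val[of x] x(1) u unfolding x(2) by auto
      then show "u \<in> (\<lambda>x. hpair x (F x)) ` mems d" using x by auto
    qed (use val in auto)
  qed
  define good where "good x \<longleftrightarrow> (\<exists>d\<in>M. \<exists>f\<in>M. appr R G d f \<and> x \<epsilon> d)" for x
  have dgood: "dfn M (\<lambda>e. good (t e))" if "dtm M t" for t
  proof (rule dfn_subst1[OF _ that])
    show "dfn M (\<lambda>e. good (e 0))" unfolding good_def by (intro dfnI dA)
  qed
  have good_val: "F x \<in> M \<and> (\<forall>z\<in>M. z = F x \<longleftrightarrow> (\<exists>d\<in>M. \<exists>f\<in>M. appr R G d f \<and> hpair x z \<epsilon> f))"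
    if gx: "good x" and xM: "x \<in> M" for x
  proof -
    obtain d f where df: "d \<in> M" "f \<in> M" "appr R G d f" "x \<epsilon> d" using gx unfolding good_def by blast
    have "hpair x (F x) \<epsilon> f" using graph_eq[OF df(3,1,2)] df(4) in_mems by blast
    moreover from this have "F x \<in> M" using pair_mem_in[OF df(2)] by blast
    moreover have "z = F x" if "d' \<in> M" "f' \<in> M" "appr R G d' f'" "hpair x z \<epsilon> f'" for d' f' z
    proof -
      have "hpair x z \<in> mems f'" using that by simp
      then show ?thesis using graph_eq[OF that(3,1,2)] by auto
    qed
    ultimately show ?thesis using df by blast
  qed
  have all_good: "x \<in> M \<longrightarrow> good x" for x
  proof (induction x rule: wf_induct_rule[OF wf])
    case (1 x)
    show ?case
    proof
      assume xM: "x \<in> M"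
      obtain t where t: "t \<in> M" "x \<epsilon> t" "\<And>z y. z \<epsilon> t \<Longrightarrow> R y z \<Longrightarrow> y \<epsilon> t"
        using cover[OF xM] by auto
      \<comment> \<open>The part of \<open>t\<close> that approximations already cover. It is closed
        under predecessors and contains those of \<open>x\<close>; replacement yields the graph of
        \<open>F\<close> on it, to which \<open>x\<close> is then added.\<close>
      define S where "S = hset {y \<in> mems t. good y}"
      have SM: "S \<in> M" unfolding S_def by (rule sep[OF _ t(1)]) (intro dfnI dgood)
      have memS: "y \<epsilon> S \<longleftrightarrow> y \<epsilon> t \<and> good y" for y by (simp add: S_def)
      have Sclosed: "y' \<epsilon> S" if y: "y \<epsilon> S" "R y' y" for y y'
      proof -
        obtain d f where df: "d \<in> M" "f \<in> M" "appr R G d f" "y \<epsilon> d"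
          using y(1) memS[of y] unfolding good_def by blast
        have "y' \<in> M" using y t(3) memS transM[OF t(1)] by blast
        then have "y' \<epsilon> d" using df y(2) unfolding appr_def by auto
        then have "good y'" using df unfolding good_def by blast
        then show ?thesis using memS y t(3) by blast
      qed
      have Rx: "y \<epsilon> S" if "R y x" for y
        using 1[of y] that t(3)[OF t(2) that] memS RM[OF that xM] by auto
      have SM': "y \<in> M" if "y \<epsilon> S" for y using transM[OF SM that] .
      have dF: "dfn M (\<lambda>e. e 0 = hpair (e 1) (hsnd (e 0)) \<and> (\<exists>d\<in>M. \<exists>f\<in>M. appr R G d f \<and> e 0 \<epsilon> f))"
        by (intro dfnI dA)
      have fS: "hgraph F (mems S) \<in> M"
      proof -
        have "hset {u \<in> M. \<exists>y\<in>mems S. u = hpair y (hsnd u) \<and> (\<exists>d\<in>M. \<exists>f\<in>M. appr R G d f \<and> u \<epsilon> f)} \<in> M"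
        proof (rule repl[OF dF SM])
          fix y assume y: "y \<epsilon> S"
          have gv: "F y \<in> M \<and> (\<forall>z\<in>M. z = F y \<longleftrightarrow> (\<exists>d\<in>M. \<exists>f\<in>M. appr R G d f \<and> hpair y z \<epsilon> f))"
            by (rule good_val) (use y memS SM' in auto)
          show "\<exists>u\<in>M. \<forall>y'\<in>M. (y' = hpair y (hsnd y') \<and> (\<exists>d\<in>M. \<exists>f\<in>M. appr R G d f \<and> y' \<epsilon> f)) \<longleftrightarrow> y' = u"
          proof (intro bexI[of _ "hpair y (F y)"] ballI iffI)
            fix u assume uM: "u \<in> M" and *: "u = hpair y (hsnd u) \<and> (\<exists>d\<in>M. \<exists>f\<in>M. appr R G d f \<and> u \<epsilon> f)"
            obtain v where v: "u = hpair y v" using conjunct1[OF *] by (rule that)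
            then have "v \<in> M" using uM by simp
            moreover have "\<exists>d\<in>M. \<exists>f\<in>M. appr R G d f \<and> hpair y v \<epsilon> f" using * unfolding v by blast
            ultimately have "v = F y" using gv by blast
            then show "u = hpair y (F y)" using v by simp
          next
            fix u assume u: "u = hpair y (F y)"
            have "\<exists>d\<in>M. \<exists>f\<in>M. appr R G d f \<and> hpair y (F y) \<epsilon> f" using gv by blast
            then show "u = hpair y (hsnd u) \<and> (\<exists>d\<in>M. \<exists>f\<in>M. appr R G d f \<and> u \<epsilon> f)" using u by simp
          qed (use gv SM'[OF y] in simp)
        qed
        moreover have "{u \<in> M. \<exists>y\<in>mems S. u = hpair y (hsnd u) \<and> (\<exists>d\<in>M. \<exists>f\<in>M. appr R G d f \<and> u \<epsilon> f)}
            = (\<lambda>y. hpair y (F y)) ` mems S"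
        proof (intro equalityI subsetI)
          fix u assume "u \<in> {u \<in> M. \<exists>y\<in>mems S. u = hpair y (hsnd u) \<and> (\<exists>d\<in>M. \<exists>f\<in>M. appr R G d f \<and> u \<epsilon> f)}"
          then obtain y v where y: "y \<epsilon> S" "u \<in> M" "u = hpair y v" "\<exists>d\<in>M. \<exists>f\<in>M. appr R G d f \<and> u \<epsilon> f"
            unfolding in_mems Bex_def mem_Collect_eq by blast
          have "good y" "y \<in> M" using y(1) memS SM' by auto
          from good_val[OF this] have "v = F y" using y(2,4) unfolding y(3) by auto
          then show "u \<in> (\<lambda>y. hpair y (F y)) ` mems S" using y(1,3) by auto
        next
          fix u assume "u \<in> (\<lambda>y. hpair y (F y)) ` mems S"
          then obtain y where y: "y \<epsilon> S" "u = hpair y (F y)" by auto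
          have "good y" "y \<in> M" using y(1) memS SM' by auto
          from good_val[OF this] have "F y \<in> M" "\<exists>d\<in>M. \<exists>f\<in>M. appr R G d f \<and> u \<epsilon> f" using y(2) by blast+
          then show "u \<in> {u \<in> M. \<exists>y\<in>mems S. u = hpair y (hsnd u) \<and> (\<exists>d\<in>M. \<exists>f\<in>M. appr R G d f \<and> u \<epsilon> f)}"
            using y \<open>y \<in> M\<close> by (auto intro!: bexI[of _ y])
        qed
        ultimately show ?thesis by (simp add: hgraph_def)
      qed
      have restr: "hset {u \<in> mems g. R (hfst u) y} = hgraph F {z. R z y}"
        if g: "mems g = (\<lambda>y. hpair y (F y)) ` A" and A: "\<And>z. R z y \<Longrightarrow> z \<in> A" for g A y
      proof -
        have "{u \<in> mems g. R (hfst u) y} = (\<lambda>y. hpair y (F y)) ` {z. R z y}"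
          unfolding g using A by auto
        then show ?thesis by (simp add: hgraph_def)
      qed
      have mS: "mems (hgraph F (mems S)) = (\<lambda>y. hpair y (F y)) ` mems S" by (simp add: hgraph_def)
      have FxM: "F x \<in> M"
      proof -
        have "hset {u \<in> mems (hgraph F (mems S)). R (hfst u) x} \<in> M"
          by (rule sep[OF _ fS]) (use xM in \<open>intro dfnI dR\<close>)
        moreover have "hset {u \<in> mems (hgraph F (mems S)). R (hfst u) x} = hgraph F {z. R z x}"
          by (rule restr[OF mS]) (use Rx in simp)
        ultimately have "G x (hgraph F {z. R z x}) \<in> M"
          using GM[OF xM] by simp
        then show ?thesis using F[OF xM] by simp
      qed
      define d where "d = hun S (upair x x)"
      define f where "f = hun (hgraph F (mems S)) (upair (hpair x (F x)) (hpair x (F x)))"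
      have M: "d \<in> M" "f \<in> M" unfolding d_def f_def using SM fS xM FxM by auto
      have md: "mems d = insert x (mems S)" by (auto simp: d_def)
      have mf: "mems f = (\<lambda>y. hpair y (F y)) ` mems d" unfolding md f_def by auto
      have dclosed: "z \<epsilon> d" if "y \<epsilon> d" "R z y" for y z
        using that Rx Sclosed by (auto simp: d_def)
      have "appr R G d f"
        unfolding appr_def
      proof (intro conjI ballI impI)
        fix u assume "u \<in> mems f"
        then show "\<exists>x\<in>mems d. u = hpair x (hsnd u)" unfolding mf by auto
      next
        fix y z assume y: "y \<in> mems d"
        then have yM: "y \<in> M" using transM[OF M(1)] unfolding in_mems by blast
        have "hset {u \<in> mems f. R (hfst u) y} = hgraph F {z. R z y}"
          by (rule restr[OF mf]) (use dclosed y in auto)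
        then have "G y (hset {u \<in> mems f. R (hfst u) y}) = F y" using F[OF yM] by simp
        moreover have "hpair y z \<epsilon> f \<longleftrightarrow> z = F y"
          unfolding in_mems[symmetric] mf using y by auto
        ultimately show "hpair y z \<epsilon> f \<longleftrightarrow> z = G y (hset {u \<in> mems f. R (hfst u) y})" by simp
      qed (use dclosed in auto)
      moreover have "x \<epsilon> d" by (simp add: d_def)
      ultimately show "good x" unfolding good_def using M by blast
    qed
  qed
  show FM: "x \<in> M \<Longrightarrow> F x \<in> M" for x using good_val all_good by blast
  show "dtm M (\<lambda>e. F (t e))" if "dtm M t"
  proof (rule dtm1I[where F = F and R = "\<lambda>z x. \<exists>d\<in>M. \<exists>f\<in>M. appr R G d f \<and> hpair x z \<epsilon> f"])
    show "dfn M (\<lambda>e. \<exists>d\<in>M. \<exists>f\<in>M. appr R G d f \<and> hpair (e 1) (e 0) \<epsilon> f)"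
      by (intro dfnI dA)
    show "z = F x \<longleftrightarrow> (\<exists>d\<in>M. \<exists>f\<in>M. appr R G d f \<and> hpair x z \<epsilon> f)" if "z \<in> M" "x \<in> M" for z x
      using good_val[OF all_good[THEN mp, OF that(2)] that(2)] that(1) by blast
  qed (use FM that in auto)
qed

end

section \<open>Ordinals and transitive closures\<close>

definition Tr :: "hcset \<Rightarrow> bool" where "Tr t \<longleftrightarrow> (\<forall>y\<in>mems t. mems y \<subseteq> mems t)"
definition Ord :: "hcset \<Rightarrow> bool" where "Ord x \<longleftrightarrow> Tr x \<and> (\<forall>y\<in>mems x. Tr y)"

lemma Tr_iff: "Tr t \<longleftrightarrow> (\<forall>y z. y \<epsilon> t \<longrightarrow> z \<epsilon> y \<longrightarrow> z \<epsilon> t)"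
  unfolding Tr_def Ball_def subset_iff in_mems by blast

lemma TrD: "Tr t \<Longrightarrow> y \<epsilon> t \<Longrightarrow> z \<epsilon> y \<Longrightarrow> z \<epsilon> t"
  unfolding Tr_iff by blast

lemma Ord_iff: "Ord x \<longleftrightarrow> Tr x \<and> (\<forall>y. y \<epsilon> x \<longrightarrow> Tr y)"
  unfolding Ord_def Ball_def in_mems by blast

lemma Ord_mem: "Ord x \<Longrightarrow> y \<epsilon> x \<Longrightarrow> Ord y"
  unfolding Ord_iff by (blast dest: TrD)

lemma mems_nonempty: "mems b \<noteq> {} \<longleftrightarrow> (\<exists>y. y \<epsilon> b)"
  by (auto simp: mems_def)

lemma Ord_trans: "Ord x \<Longrightarrow> y \<epsilon> x \<Longrightarrow> z \<epsilon> y \<Longrightarrow> z \<epsilon> x"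
  unfolding Ord_iff by (blast dest: TrD)

lemma Ord_linear: "Ord x \<Longrightarrow> Ord y \<Longrightarrow> x \<epsilon> y \<or> x = y \<or> y \<epsilon> x"
proof (induction x arbitrary: y rule: hmem_induct)
  case (1 x)
  note IHx = 1
  show ?case
    using IHx(3)
  proof (induction y rule: hmem_induct)
    case (1 y)
    show ?case
    proof (rule ccontr)
      assume *: "\<not> (x \<epsilon> y \<or> x = y \<or> y \<epsilon> x)"
      have "z \<epsilon> y" if "z \<epsilon> x" for z
        using IHx(1)[OF that Ord_mem[OF IHx(2) that] 1(2)] * that Ord_trans[OF IHx(2) that] by blast
      moreover have "z \<epsilon> x" if "z \<epsilon> y" for z
        using 1(1)[OF that Ord_mem[OF 1(2) that]] * that Ord_trans[OF 1(2) that] by blast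
      ultimately have "x = y" by (intro hcset_eqI) blast
      then show False using * by blast
    qed
  qed
qed

lemma Ord_subset_iff:
  assumes "Ord x" "Ord y" shows "mems x \<subseteq> mems y \<longleftrightarrow> x \<epsilon> y \<or> x = y"
proof
  assume "mems x \<subseteq> mems y"
  then have "\<not> y \<epsilon> x" by (metis hmem_irrefl in_mems subsetD)
  then show "x \<epsilon> y \<or> x = y" using Ord_linear[OF assms] by blast
next
  assume "x \<epsilon> y \<or> x = y"
  then show "mems x \<subseteq> mems y" using Ord_trans[OF assms(2)] by auto
qed

lemma Ord_least:
  assumes "P x" "Ord x"
  obtains y where "P y" "Ord y" "\<And>z. z \<epsilon> y \<Longrightarrow> \<not> P z"
proof -
  have "x \<in> {x. P x \<and> Ord x}" using assms by simp
  from wfE_min[OF wf_hmem this] obtain y where y: "y \<in> {x. P x \<and> Ord x}"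
    "\<And>z. (z, y) \<in> {(x, y). x \<epsilon> y} \<Longrightarrow> z \<notin> {x. P x \<and> Ord x}" by blast
  have *: "P y" "Ord y" using y(1) by auto
  have "\<not> P z" if "z \<epsilon> y" for z using y(2)[of z] Ord_mem[OF *(2) that] that by simp
  then show thesis by (rule that[OF *])
qed

lemma Ord_transitive_set: "(\<And>y. y \<epsilon> x \<Longrightarrow> Ord y) \<Longrightarrow> Tr x \<Longrightarrow> Ord x"
  unfolding Ord_iff by blast

lemma Ord_hsucc: "Ord x \<Longrightarrow> Ord (hsucc x)"
  unfolding Ord_iff Tr_iff mem_hsucc by blast

lemma Ord_hempty [simp]: "Ord hempty" by (simp add: Ord_iff Tr_iff)

lemma Ord_omega_nat [simp]: "Ord (omega_nat n)"
  by (induction n) (auto simp: omega_nat_simps intro: Ord_hsucc)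

lemma Ord_hom [simp]: "Ord hom"
proof (rule Ord_transitive_set)
  show "Tr hom" unfolding Tr_iff mem_hom using mem_omega_nat by blast
qed auto

lemma Ord_mem_hsucc: "Ord x \<Longrightarrow> Ord y \<Longrightarrow> \<not> x \<epsilon> y \<Longrightarrow> y \<epsilon> hsucc x"
  using Ord_linear by auto

definition tcset :: "hcset \<Rightarrow> hcset set" where "tcset x = {z. (z, x) \<in> {(a, b). a \<epsilon> b}\<^sup>*}"

lemma tcset_eq: "tcset x = insert x (\<Union>y\<in>mems x. tcset y)"
proof (intro equalityI subsetI)
  fix z assume "z \<in> tcset x"
  then have "(z, x) \<in> {(a, b). a \<epsilon> b}\<^sup>*" by (simp add: tcset_def)
  then show "z \<in> insert x (\<Union>y\<in>mems x. tcset y)"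
    by (cases rule: rtranclE) (auto simp: tcset_def)
next
  fix z assume "z \<in> insert x (\<Union>y\<in>mems x. tcset y)"
  then show "z \<in> tcset x"
    unfolding tcset_def by (auto intro: rtrancl_into_rtrancl)
qed

lemma tcset_refl [simp]: "x \<in> tcset x" by (simp add: tcset_def)

lemma tcset_closed: "z \<in> tcset x \<Longrightarrow> w \<epsilon> z \<Longrightarrow> w \<in> tcset x"
  unfolding tcset_def by (auto intro: converse_rtrancl_into_rtrancl)

lemma tcset_least:
  assumes "x \<in> A" "\<And>y z. y \<in> A \<Longrightarrow> z \<epsilon> y \<Longrightarrow> z \<in> A"
  shows "tcset x \<subseteq> A"
proof
  fix z assume "z \<in> tcset x"
  then have "(z, x) \<in> {(a, b). a \<epsilon> b}\<^sup>*" by (simp add: tcset_def)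
  then show "z \<in> A" by (induction rule: converse_rtrancl_induct) (use assms in auto)
qed

context ctm
begin

lemma tcset_subset: "x \<in> M \<Longrightarrow> tcset x \<subseteq> M"
  by (rule tcset_least) (use transM in blast)+

lemma countable_tcset [simp]: "x \<in> M \<Longrightarrow> countable (tcset x)"
  using tcset_subset countable_subset[OF _ countableM] by blast

lemma dfn_Tr [dfnI]: "dtm M t \<Longrightarrow> dfn M (\<lambda>e. Tr (t e))"
  by (rule dfn_subst1[of Tr]) (auto simp only: Tr_def intro!: dfnI)

lemma dfn_Ord [dfnI]: "dtm M t \<Longrightarrow> dfn M (\<lambda>e. Ord (t e))"
  by (rule dfn_subst1[of Ord]) (auto simp only: Ord_def intro!: dfnI)

text \<open>This comes before recursion over membership, because it supplies the covering sets.
  Replacement collects the closures of the elements, each described in \<open>M\<close> as the least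
  transitive set containing the given element.\<close>

lemma tc_in: "x \<in> M \<Longrightarrow> hset (tcset x) \<in> M"
proof (induction x rule: hmem_induct)
  case (1 x)
  have c: "countable (tcset y)" "hset (tcset y) \<in> M" if "y \<epsilon> x" for y
    using 1(1)[OF that] transM[OF 1(2) that] by auto
  define R where "R z y \<longleftrightarrow> Tr z \<and> y \<epsilon> z \<and> (\<forall>t\<in>M. Tr t \<and> y \<epsilon> t \<longrightarrow> mems z \<subseteq> mems t)" for z y
  have R: "R z y \<longleftrightarrow> z = hset (tcset y)" if "y \<epsilon> x" "z \<in> M" for y z
  proof -
    have 1: "Tr (hset (tcset y))" "y \<epsilon> hset (tcset y)"
      using c(1)[OF that(1)] tcset_closed[of _ y] unfolding Tr_iff by auto
    have 2: "tcset y \<subseteq> mems t" if "Tr t" "y \<epsilon> t" for t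
      by (rule tcset_least) (use that in \<open>auto dest: TrD\<close>)
    show ?thesis
    proof
      assume "R z y"
      then have "mems z \<subseteq> mems (hset (tcset y))" "Tr z" "y \<epsilon> z"
        using 1 c(2)[OF that(1)] unfolding R_def by blast+
      then have "mems z = tcset y" using 2[of z] c(1)[OF that(1)] by simp
      then show "z = hset (tcset y)" by (metis hset_mems)
    next
      assume "z = hset (tcset y)"
      then show "R z y" using 1 2 c[OF that(1)] unfolding R_def by simp
    qed
  qed
  have "hset {z \<in> M. \<exists>y\<in>mems x. R z y} \<in> M"
  proof (rule repl[OF _ 1(2)])
    show "dfn M (\<lambda>e. R (e 0) (e 1))" unfolding R_def by (intro dfnI)
    show "\<exists>z\<in>M. \<forall>z'\<in>M. R z' y \<longleftrightarrow> z' = z" if "y \<epsilon> x" for y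
      using R[OF that] c[OF that] by blast
  qed
  moreover have "{z \<in> M. \<exists>y\<in>mems x. R z y} = (\<lambda>y. hset (tcset y)) ` mems x"
  proof (intro equalityI subsetI)
    fix z assume "z \<in> (\<lambda>y. hset (tcset y)) ` mems x"
    then obtain y where "y \<epsilon> x" "z = hset (tcset y)" by auto
    then show "z \<in> {z \<in> M. \<exists>y\<in>mems x. R z y}" using R c(2) by (auto intro!: bexI[of _ y])
  qed (use R in auto)
  ultimately have "hun (upair x x) (hUn (hset ((\<lambda>y. hset (tcset y)) ` mems x))) \<in> M"
    using 1(2) by simp
  also have "hun (upair x x) (hUn (hset ((\<lambda>y. hset (tcset y)) ` mems x))) = hset (tcset x)"
  proof (rule hcset_eqI)
    fix z
    have "(\<exists>u. u \<in> (\<lambda>y. hset (tcset y)) ` mems x \<and> z \<epsilon> u) \<longleftrightarrow> (\<exists>y\<in>mems x. z \<epsilon> hset (tcset y))" by blast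
    also have "\<dots> \<longleftrightarrow> (\<exists>y\<in>mems x. z \<in> tcset y)" using c by (intro bex_cong) auto
    finally have *: "(\<exists>u. u \<in> (\<lambda>y. hset (tcset y)) ` mems x \<and> z \<epsilon> u) \<longleftrightarrow> (\<exists>y\<in>mems x. z \<in> tcset y)" .
    have "z \<epsilon> hset (tcset x) \<longleftrightarrow> z \<in> tcset x" using 1(2) by simp
    also have "\<dots> \<longleftrightarrow> z = x \<or> (\<exists>y\<in>mems x. z \<in> tcset y)" using tcset_eq[of x] by blast
    finally show "z \<epsilon> hun (upair x x) (hUn (hset ((\<lambda>y. hset (tcset y)) ` mems x))) \<longleftrightarrow> z \<epsilon> hset (tcset x)"
      using * by simp
  qed
  finally show ?case .
qed

lemma cover_eps: "x \<in> M \<Longrightarrow> \<exists>t\<in>M. x \<epsilon> t \<and> (\<forall>z\<in>mems t. \<forall>y. y \<epsilon> z \<longrightarrow> y \<epsilon> t)"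
  using tc_in[of x] tcset_closed[of _ x] by (intro bexI[of _ "hset (tcset x)"]) auto

lemma eps_recursion:
  assumes "\<And>x f. x \<in> M \<Longrightarrow> f \<in> M \<Longrightarrow> G x f \<in> M" "dfn M (\<lambda>e. e 0 = G (e 1) (e 2))"
    "\<And>x. x \<in> M \<Longrightarrow> F x = G x (hgraph F (mems x))"
  shows "x \<in> M \<Longrightarrow> F x \<in> M" "dtm M t \<Longrightarrow> dtm M (\<lambda>e. F (t e))"
proof -
  have eq: "{y. y \<epsilon> x} = mems x" for x by (auto simp: mems_def)
  have RM: "y \<in> M" if "y \<epsilon> x" "x \<in> M" for x y using transM[OF that(2,1)] .
  have d: "dfn M (\<lambda>e. e 0 \<epsilon> e 1)" by (intro dfnI)
  have F: "F x = G x (hgraph F {y. y \<epsilon> x})" if "x \<in> M" for x using assms(3)[OF that] eq by simp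
  show "F x \<in> M" if x: "x \<in> M" for x
    by (rule wf_recursion(1)[of "(\<epsilon>)" G F]) (fact wf_hmem RM d cover_eps assms F x)+
  show "dtm M (\<lambda>e. F (t e))" if t: "dtm M t" for t
    by (rule wf_recursion(2)[of "(\<epsilon>)" G F]) (fact wf_hmem RM d cover_eps assms F t)+
qed

lemma dtm_graph:
  assumes "dtm M (\<lambda>e. F (e 0))" "a \<in> M" shows "hgraph F (mems a) \<in> M"
proof -
  have "dtm M (\<lambda>e. hset ((\<lambda>x. hpair x (F x)) ` mems a))"
    by (intro dfnI assms)
  then show ?thesis unfolding hgraph_def using dtm_closed[of _ "\<lambda>_. a"] assms(2) by blast
qed

definition Rng :: "hcset \<Rightarrow> hcset" where "Rng f = hset (hsnd ` mems f)"

lemma Rng_hgraph: "countable A \<Longrightarrow> Rng (hgraph F A) = hset (F ` A)"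
  unfolding Rng_def hgraph_def by (simp add: image_image)

lemma dtm_Rng [dfnI]: "dtm M t \<Longrightarrow> dtm M (\<lambda>e. Rng (t e))"
  unfolding Rng_def by (intro dfnI)

lemma choice:
  assumes a: "a \<in> M" and ne: "\<And>b. b \<epsilon> a \<Longrightarrow> \<exists>y. y \<epsilon> b"
    and disj: "\<And>b c z. b \<epsilon> a \<Longrightarrow> c \<epsilon> a \<Longrightarrow> z \<epsilon> b \<Longrightarrow> z \<epsilon> c \<Longrightarrow> b = c"
  obtains t where "t \<in> M" "\<And>b. b \<epsilon> a \<Longrightarrow> \<exists>y. \<forall>z. z \<epsilon> b \<and> z \<epsilon> t \<longleftrightarrow> z = y"
proof -
  have "ssat M (\<lambda>_. a) choice_ax"
    by (rule axiom) (auto simp: ZFC_def a)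
  then have "(\<forall>b\<in>M. b \<epsilon> a \<longrightarrow> (\<exists>y\<in>M. y \<epsilon> b)) \<and>
      (\<forall>b\<in>M. \<forall>c\<in>M. b \<epsilon> a \<and> c \<epsilon> a \<longrightarrow> (\<exists>z\<in>M. z \<epsilon> b \<and> z \<epsilon> c) \<longrightarrow> b = c) \<longrightarrow>
      (\<exists>t\<in>M. \<forall>b\<in>M. b \<epsilon> a \<longrightarrow> (\<exists>y\<in>M. \<forall>z\<in>M. z \<epsilon> b \<and> z \<epsilon> t \<longleftrightarrow> z = y))"
    unfolding choice_ax_def ssat.simps(5) using a by (auto dest!: bspec[of M _ a])
  moreover have "\<forall>b\<in>M. b \<epsilon> a \<longrightarrow> (\<exists>y\<in>M. y \<epsilon> b)" using ne transM by blast
  moreover have "\<forall>b\<in>M. \<forall>c\<in>M. b \<epsilon> a \<and> c \<epsilon> a \<longrightarrow> (\<exists>z\<in>M. z \<epsilon> b \<and> z \<epsilon> c) \<longrightarrow> b = c" using disj by blast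
  ultimately obtain t where t: "t \<in> M" "\<forall>b\<in>M. b \<epsilon> a \<longrightarrow> (\<exists>y\<in>M. \<forall>z\<in>M. z \<epsilon> b \<and> z \<epsilon> t \<longleftrightarrow> z = y)"
    by blast
  show thesis
  proof (rule that[OF t(1)])
    fix b assume b: "b \<epsilon> a"
    then have bM: "b \<in> M" using transM[OF a] by blast
    then obtain y where "y \<in> M" "\<forall>z\<in>M. z \<epsilon> b \<and> z \<epsilon> t \<longleftrightarrow> z = y" using t(2) b by blast
    then show "\<exists>y. \<forall>z. z \<epsilon> b \<and> z \<epsilon> t \<longleftrightarrow> z = y" using transM[OF bM] by blast
  qed
qed

text \<open>The axiom provides transversals of disjoint families. Replacing each nonempty
  \<open>b\<close> by the product of its singleton with \<open>b\<close> makes the family disjoint,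
  and a transversal becomes a choice function.\<close>

lemma choice_function:
  assumes x: "x \<in> M"
  obtains g where "g \<in> M" "\<And>b. b \<epsilon> x \<Longrightarrow> mems b \<noteq> {} \<Longrightarrow> happ g b \<epsilon> b"
proof -
  define a where "a = hset ((\<lambda>b. hprod (upair b b) b) ` mems (hset {b \<in> mems x. \<exists>y\<in>mems b. y = y}))"
  have "dtm M (\<lambda>e. hset ((\<lambda>b. hprod (upair b b) b) ` mems (hset {b \<in> mems (e 0). \<exists>y\<in>mems b. y = y})))"
    by (intro dfnI)
  from dtm_closed[OF this, of "\<lambda>_. x"] have aM: "a \<in> M" using x by (simp add: a_def)
  have mem_a: "u \<epsilon> a \<longleftrightarrow> (\<exists>b. b \<epsilon> x \<and> mems b \<noteq> {} \<and> u = hprod (upair b b) b)" for u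
    unfolding a_def mems_nonempty by (simp add: image_iff Bex_def)
  obtain t where t: "t \<in> M" "\<And>u. u \<epsilon> a \<Longrightarrow> \<exists>y. \<forall>z. z \<epsilon> u \<and> z \<epsilon> t \<longleftrightarrow> z = y"
  proof (rule choice[OF aM])
    show "\<exists>y. y \<epsilon> u" if "u \<epsilon> a" for u using that unfolding mem_a by auto
    show "u = v" if "u \<epsilon> a" "v \<epsilon> a" "z \<epsilon> u" "z \<epsilon> v" for u v z
      using that unfolding mem_a by auto
  qed blast
  \<comment> \<open>A transversal may contain elements outside the family; cutting these off makes
    it single-valued as a set of pairs.\<close>
  define g where "g = hset {z \<in> mems t. z \<epsilon> hUn a}"
  have gM: "g \<in> M" unfolding g_def by (rule sep[OF _ t(1)]) (use aM in \<open>intro dfnI; simp\<close>)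
  show thesis
  proof (rule that[OF gM])
    fix b assume b: "b \<epsilon> x" "mems b \<noteq> {}"
    then have "hprod (upair b b) b \<epsilon> a" unfolding mem_a by blast
    from t(2)[OF this] obtain y where y: "\<And>z. z \<epsilon> hprod (upair b b) b \<and> z \<epsilon> t \<longleftrightarrow> z = y" by blast
    then obtain v where v: "y = hpair b v" "v \<epsilon> b" using mem_hprod mem_upair by metis
    have "hpair b w \<epsilon> hUn a \<longleftrightarrow> w \<epsilon> b" for w
    proof
      assume "hpair b w \<epsilon> hUn a"
      then show "w \<epsilon> b" by (auto simp: mem_a)
    next
      assume "w \<epsilon> b"
      then have "hpair b w \<epsilon> hprod (upair b b) b" by simp
      then show "hpair b w \<epsilon> hUn a" using \<open>hprod (upair b b) b \<epsilon> a\<close> unfolding mem_hUn by blast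
    qed
    then have g: "hpair b w \<epsilon> g \<longleftrightarrow> w \<epsilon> b \<and> hpair b w \<epsilon> t" for w
      unfolding g_def by auto
    have "happ g b = v"
    proof (rule happ_eq)
      show "hpair b v \<epsilon> g" using g y v by auto
      show "w = v" if "hpair b w \<epsilon> g" for w using that g y[of "hpair b w"] v by auto
    qed
    then show "happ g b \<epsilon> b" using v by simp
  qed
qed

end

text \<open>Supplies the external functions to which the recursion theorem of the model is
  applied.\<close>

lemma wfrec_exists:
  assumes "wf {(y, x). R y x}" "\<And>x. countable {y. R y x}"
  shows "\<exists>F. \<forall>x. F x = G x (hgraph F {y. R y x})"
proof -
  define F where "F = wfrec {(y, x). R y x} (\<lambda>F x. G x (hgraph F {y. R y x}))"
  have "F x = G x (hgraph F {y. R y x})" for x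
  proof -
    have "F x = G x (hgraph (cut F {(y, x). R y x} x) {y. R y x})"
      unfolding F_def by (subst wfrec[OF assms(1)]) simp
    also have "hgraph (cut F {(y, x). R y x} x) {y. R y x} = hgraph F {y. R y x}"
      unfolding hgraph_def by (rule arg_cong[where f = hset], rule image_cong) (auto simp: cut_def)
    finally show ?thesis .
  qed
  then show ?thesis by blast
qed

lemma eps_rec_exists: "\<exists>F. \<forall>x. F x = G x (hgraph F (mems x))"
  using wfrec_exists[of "(\<epsilon>)" G] wf_hmem by (simp add: mems_def[symmetric])

lemma mem_hUn_image: "z \<epsilon> hUn (hset (F ` mems x)) \<longleftrightarrow> (\<exists>y. y \<epsilon> x \<and> z \<epsilon> F y)"
proof -
  have *: "y \<epsilon> hset (F ` mems x) \<longleftrightarrow> (\<exists>v. v \<epsilon> x \<and> y = F v)" for y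
    by (subst hmem_hset) auto
  show ?thesis by (simp only: mem_hUn *) blast
qed

context ctm
begin

text \<open>The Burali-Forti argument carried out in \<open>M\<close>.\<close>

lemma no_set_of_ordinals: "z \<in> M \<Longrightarrow> \<exists>\<alpha>\<in>M. Ord \<alpha> \<and> \<not> \<alpha> \<epsilon> z"
proof (rule ccontr)
  assume z: "z \<in> M" and *: "\<not> (\<exists>\<alpha>\<in>M. Ord \<alpha> \<and> \<not> \<alpha> \<epsilon> z)"
  define Os where "Os = hset {\<alpha> \<in> mems z. Ord \<alpha>}"
  have OM: "Os \<in> M" unfolding Os_def by (rule sep[OF _ z]) (intro dfnI)
  have mem: "\<alpha> \<epsilon> Os \<longleftrightarrow> \<alpha> \<in> M \<and> Ord \<alpha>" for \<alpha>
    using * transM[OF z] unfolding Os_def by (simp, blast)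
  have "Ord Os"
  proof (rule Ord_transitive_set)
    show "Tr Os" unfolding Tr_iff using mem Ord_mem transM by blast
  qed (use mem in blast)
  then have "Os \<epsilon> Os" using mem OM by blast
  then show False by simp
qed

text \<open>Zermelo's enumeration: choose elements not yet listed, with the value \<open>x\<close>,
  which is not an element of \<open>x\<close>, as stop signal. If it never stopped, replacement
  applied to the inverse of the enumeration would yield a set containing all ordinals.\<close>

lemma wellorder:
  assumes x: "x \<in> M"
  shows "\<exists>\<alpha>\<in>M. Ord \<alpha> \<and> (\<exists>f\<in>M. bij_betw (happ f) (mems \<alpha>) (mems x))"
proof -
  obtain g where g: "g \<in> M" "\<And>b. b \<epsilon> hpow x \<Longrightarrow> mems b \<noteq> {} \<Longrightarrow> happ g b \<epsilon> b"
    using choice_function[OF hpow_in[OF x]] by blast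
  define r where "r f = hset {y \<in> mems x. \<not> y \<epsilon> Rng f}" for f
  define G where "G \<alpha> f = (if r f = hempty then x else happ g (r f))" for \<alpha> f :: hcset
  have dr: "dtm M (\<lambda>e. r (t e))" if "dtm M t" for t
    unfolding r_def using dtm_Suc[OF that] x by (intro dfnI) auto
  have dG: "dtm M (\<lambda>e. G (e 1) (e 2))"
    unfolding G_def by (intro dfnI dr g x hempty_in)
  obtain F where F: "\<And>\<alpha>. F \<alpha> = G \<alpha> (hgraph F (mems \<alpha>))"
    using eps_rec_exists[of G] by blast
  have GM: "G a f \<in> M" if "a \<in> M" "f \<in> M" for a f
    using dtm_closed[OF dG, of "\<lambda>i. if i = 1 then a else f"] that by simp
  have dG': "dfn M (\<lambda>e. e 0 = G (e 1) (e 2))"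
    unfolding G_def by (intro dfnI dr g x hempty_in)
  have dF: "dtm M (\<lambda>e. F (t e))" if t: "dtm M t" for t
    by (rule eps_recursion(2)[of G F]) (fact GM dG' t | rule F)+
  have FM: "F a \<in> M" if a: "a \<in> M" for a
    by (rule eps_recursion(1)[of G F]) (fact GM dG' a | rule F)+
  have rng: "mems (r (hgraph F (mems \<alpha>))) = mems x - F ` mems \<alpha>" for \<alpha>
    by (auto simp: r_def Rng_hgraph)
  have r_in: "r (hgraph F (mems \<alpha>)) \<epsilon> hpow x" if "\<alpha> \<in> M" for \<alpha>
  proof -
    have "hgraph F (mems \<alpha>) \<in> M" by (rule dtm_graph[OF dF that]) (intro dfnI)
    then have "r (hgraph F (mems \<alpha>)) \<in> M" using dtm_closed[OF dr[OF dtm_var[of 0]], of "\<lambda>_. hgraph F (mems \<alpha>)"] by simp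
    then show ?thesis using rng by auto
  qed
  have Fcases: "(F \<alpha> = x \<and> mems x \<subseteq> F ` mems \<alpha>) \<or> F \<alpha> \<in> mems x - F ` mems \<alpha>" if "\<alpha> \<in> M" for \<alpha>
  proof (cases "mems (r (hgraph F (mems \<alpha>))) = {}")
    case True
    then have "r (hgraph F (mems \<alpha>)) = hempty" by (metis hempty_def hset_mems)
    then have "F \<alpha> = x" using F[of \<alpha>] by (simp add: G_def)
    moreover have "mems x - F ` mems \<alpha> = {}" using True unfolding rng .
    ultimately show ?thesis by blast
  next
    case False
    then have "r (hgraph F (mems \<alpha>)) \<noteq> hempty" by (auto simp: mems_def)
    then have "F \<alpha> = happ g (r (hgraph F (mems \<alpha>)))" using F[of \<alpha>] by (simp add: G_def)
    then have "F \<alpha> \<in> mems (r (hgraph F (mems \<alpha>)))" using g(2)[OF r_in[OF that] False] by simp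
    then show ?thesis unfolding rng by simp
  qed
  have img: "F a \<in> F ` mems b" if "a \<epsilon> b" for a b using that by simp
  have "\<exists>\<alpha>. \<alpha> \<in> M \<and> Ord \<alpha> \<and> F \<alpha> = x"
  proof (rule ccontr)
    assume *: "\<nexists>\<alpha>. \<alpha> \<in> M \<and> Ord \<alpha> \<and> F \<alpha> = x"
    have Fx: "F \<alpha> \<in> mems x - F ` mems \<alpha>" if "\<alpha> \<in> M" "Ord \<alpha>" for \<alpha>
      using Fcases[OF that(1)] * that by blast
    have inj: "\<alpha> = \<beta>" if "\<alpha> \<in> M" "Ord \<alpha>" "\<beta> \<in> M" "Ord \<beta>" "F \<alpha> = F \<beta>" for \<alpha> \<beta>
      using Ord_linear[OF that(2,4)] Fx[OF that(1,2)] Fx[OF that(3,4)] that(5) img[of \<alpha> \<beta>] img[of \<beta> \<alpha>]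
      by (metis DiffD2)
    define A where "A = hset {y \<in> mems x. \<exists>\<alpha>\<in>M. Ord \<alpha> \<and> y = F \<alpha>}"
    have AM: "A \<in> M" unfolding A_def by (rule sep[OF _ x]) (intro dfnI dF)
    have "hset {\<alpha> \<in> M. \<exists>y\<in>mems A. Ord \<alpha> \<and> y = F \<alpha>} \<in> M"
    proof (rule repl[OF _ AM])
      show "dfn M (\<lambda>e. Ord (e 0) \<and> e 1 = F (e 0))" by (intro dfnI dF)
      show "\<exists>\<alpha>\<in>M. \<forall>\<beta>\<in>M. (Ord \<beta> \<and> y = F \<beta>) \<longleftrightarrow> \<beta> = \<alpha>" if y: "y \<epsilon> A" for y
      proof -
        obtain \<alpha> where \<alpha>: "\<alpha> \<in> M" "Ord \<alpha>" "y = F \<alpha>" using y by (auto simp: A_def)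
        then show ?thesis using inj by (intro bexI[of _ \<alpha>]) blast+
      qed
    qed
    from no_set_of_ordinals[OF this] obtain \<alpha> where \<alpha>: "\<alpha> \<in> M" "Ord \<alpha>"
      "\<not> \<alpha> \<epsilon> hset {\<alpha> \<in> M. \<exists>y\<in>mems A. Ord \<alpha> \<and> y = F \<alpha>}" by blast
    have "countable {\<alpha> \<in> M. \<exists>y\<in>mems A. Ord \<alpha> \<and> y = F \<alpha>}"
      by (rule countable_subset[OF _ countableM]) blast
    moreover have "F \<alpha> \<in> mems A" using Fx[OF \<alpha>(1,2)] \<alpha> by (auto simp: A_def)
    ultimately show False using \<alpha> by auto
  qed
  then obtain \<alpha>0 where "\<alpha>0 \<in> M \<and> F \<alpha>0 = x" "Ord \<alpha>0" by blast
  then obtain \<alpha> where \<alpha>: "\<alpha> \<in> M \<and> F \<alpha> = x" "Ord \<alpha>" "\<And>\<beta>. \<beta> \<epsilon> \<alpha> \<Longrightarrow> \<not> (\<beta> \<in> M \<and> F \<beta> = x)"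
    using Ord_least[of "\<lambda>\<alpha>. \<alpha> \<in> M \<and> F \<alpha> = x" \<alpha>0] by blast
  have F\<beta>: "F \<beta> \<in> mems x - F ` mems \<beta>" if "\<beta> \<epsilon> \<alpha>" for \<beta>
  proof -
    have "\<beta> \<in> M" using transM \<alpha>(1) that by blast
    then show ?thesis using Fcases[of \<beta>] \<alpha>(3)[OF that] by blast
  qed
  have "inj_on F (mems \<alpha>)"
  proof (rule inj_onI)
    fix \<beta> \<gamma> assume *: "\<beta> \<in> mems \<alpha>" "\<gamma> \<in> mems \<alpha>" "F \<beta> = F \<gamma>"
    then have "Ord \<beta>" "Ord \<gamma>" using Ord_mem[OF \<alpha>(2)] by auto
    then show "\<beta> = \<gamma>"
      using Ord_linear[of \<beta> \<gamma>] F\<beta>[of \<beta>] F\<beta>[of \<gamma>] * img[of \<beta> \<gamma>] img[of \<gamma> \<beta>] by (metis DiffD2 in_mems)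
  qed
  moreover have "F ` mems \<alpha> = mems x"
  proof -
    have "x \<notin> mems x" by simp
    then have "mems x \<subseteq> F ` mems \<alpha>" using Fcases[of \<alpha>] \<alpha>(1) by auto
    then show ?thesis using F\<beta> by auto
  qed
  ultimately have "bij_betw F (mems \<alpha>) (mems x)" by (simp add: bij_betw_def)
  then have "bij_betw (happ (hgraph F (mems \<alpha>))) (mems \<alpha>) (mems x)"
    by (rule iffD1[OF bij_betw_cong, rotated]) (simp add: happ_hgraph)
  moreover have "hgraph F (mems \<alpha>) \<in> M" by (rule dtm_graph[OF dF]) (use \<alpha> in \<open>auto intro: dfnI\<close>)
  ultimately show ?thesis using \<alpha> by blast
qed

text \<open>Collection from replacement by Scott's trick. \<open>rk\<close> is the rank and
  \<open>V\<close> the cumulative hierarchy as computed in \<open>M\<close>; for each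
  \<open>x\<close> only witnesses of least rank are gathered.\<close>

lemma collection:
  assumes R: "dfn M (\<lambda>e. R (e 0) (e 1))" and a: "a \<in> M"
  obtains b where "b \<in> M" "\<And>x y. x \<epsilon> a \<Longrightarrow> y \<in> M \<Longrightarrow> R y x \<Longrightarrow> \<exists>y. y \<epsilon> b \<and> R y x"
proof -
  define GV where "GV x f = hUn (hset ((\<lambda>v. hpow v) ` mems (Rng f)))" for x f :: hcset
  define GR where "GR x f = hUn (hset ((\<lambda>v. hsucc v) ` mems (Rng f)))" for x f :: hcset
  have dGV: "dtm M (\<lambda>e. GV (e 1) (e 2))" and dGV': "dfn M (\<lambda>e. e 0 = GV (e 1) (e 2))"
    unfolding GV_def by (intro dfnI)+
  have dGR: "dtm M (\<lambda>e. GR (e 1) (e 2))" and dGR': "dfn M (\<lambda>e. e 0 = GR (e 1) (e 2))"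
    unfolding GR_def by (intro dfnI)+
  have GVM: "GV a f \<in> M" if "a \<in> M" "f \<in> M" for a f
    using dtm_closed[OF dGV, of "\<lambda>i. if i = 1 then a else f"] that by simp
  have GRM: "GR a f \<in> M" if "a \<in> M" "f \<in> M" for a f
    using dtm_closed[OF dGR, of "\<lambda>i. if i = 1 then a else f"] that by simp
  obtain V where V: "\<And>x. V x = GV x (hgraph V (mems x))" using eps_rec_exists[of GV] by blast
  obtain rk where rk: "\<And>x. rk x = GR x (hgraph rk (mems x))" using eps_rec_exists[of GR] by blast
  have dV: "dtm M (\<lambda>e. V (t e))" if t: "dtm M t" for t
    by (rule eps_recursion(2)[of GV V]) (fact GVM dGV' t | rule V)+
  have VM: "V a \<in> M" if t: "a \<in> M" for a
    by (rule eps_recursion(1)[of GV V]) (fact GVM dGV' t | rule V)+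
  have drk: "dtm M (\<lambda>e. rk (t e))" if t: "dtm M t" for t
    by (rule eps_recursion(2)[of GR rk]) (fact GRM dGR' t | rule rk)+
  have rkM: "rk a \<in> M" if t: "a \<in> M" for a
    by (rule eps_recursion(1)[of GR rk]) (fact GRM dGR' t | rule rk)+
  have memV: "z \<epsilon> V x \<longleftrightarrow> (\<exists>y. y \<epsilon> x \<and> z \<epsilon> hpow (V y))" for x z
  proof -
    have "V x = hUn (hset ((\<lambda>y. hpow (V y)) ` mems x))"
      by (subst V) (simp add: GV_def Rng_hgraph image_image)
    then show ?thesis by (simp only: mem_hUn_image)
  qed
  have memrk: "z \<epsilon> rk x \<longleftrightarrow> (\<exists>y. y \<epsilon> x \<and> (z = rk y \<or> z \<epsilon> rk y))" for x z
  proof -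
    have "rk x = hUn (hset ((\<lambda>y. hsucc (rk y)) ` mems x))"
      by (subst rk) (simp add: GR_def Rng_hgraph image_image)
    then show ?thesis by (simp only: mem_hUn_image mem_hsucc)
  qed
  have Ordrk: "Ord (rk x)" for x
  proof (induction x rule: hmem_induct)
    case (1 x)
    show ?case
    proof (rule Ord_transitive_set)
      show "Ord z" if z: "z \<epsilon> rk x" for z
      proof -
        obtain y where "y \<epsilon> x" "z = rk y \<or> z \<epsilon> rk y" using iffD1[OF memrk z] by blast
        then show ?thesis using 1[of y] Ord_mem[of "rk y" z] by blast
      qed
      have "w \<epsilon> rk x" if z: "z \<epsilon> rk x" and w: "w \<epsilon> z" for z w
      proof -
        obtain y where y: "y \<epsilon> x" "z = rk y \<or> z \<epsilon> rk y" using iffD1[OF memrk z] by blast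
        then have "w \<epsilon> rk y" using 1[of y] Ord_trans[of "rk y" z w] w by blast
        then show ?thesis using y(1) by (intro iffD2[OF memrk]) blast
      qed
      then show "Tr (rk x)" unfolding Tr_iff by blast
    qed
  qed
  have inV: "y \<in> M \<longrightarrow> (\<forall>\<alpha>\<in>M. rk y \<epsilon> \<alpha> \<longrightarrow> y \<epsilon> V \<alpha>)" for y
  proof (induction y rule: hmem_induct)
    case (1 y)
    show ?case
    proof (intro impI ballI)
      fix \<alpha> assume *: "y \<in> M" "\<alpha> \<in> M" "rk y \<epsilon> \<alpha>"
      have "z \<epsilon> V (rk y)" if "z \<epsilon> y" for z
      proof -
        have "rk z \<epsilon> rk y" by (rule iffD2[OF memrk]) (use that in blast)
        then show ?thesis using 1[OF that] transM[OF *(1) that] rkM[OF *(1)] by blast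
      qed
      then have "y \<epsilon> hpow (V (rk y))" using *(1) by auto
      then show "y \<epsilon> V \<alpha>" using *(3) by (intro iffD2[OF memV]) blast
    qed
  qed
  \<comment> \<open>\<open>z\<close> is the least rank of a witness for \<open>x\<close>. It is
    unique, so replacement applies to it although it would not apply to the witnesses
    themselves.\<close>
  define S where "S z x \<longleftrightarrow> Ord z \<and> (\<exists>y\<in>M. R y x \<and> rk y = z) \<and> (\<forall>w\<in>mems z. \<not> (\<exists>y\<in>M. R y x \<and> rk y = w))" for z x
  define a' where "a' = hset {x \<in> mems a. \<exists>y\<in>M. R y x}"
  have dR: "dfn M (\<lambda>e. R (t e) (s e))" if "dtm M t" "dtm M s" for t s
    by (rule dfn_subst2[OF R that])
  have a'M: "a' \<in> M" unfolding a'_def by (rule sep[OF _ a]) (intro dfnI dR)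
  have "hset {z \<in> M. \<exists>x\<in>mems a'. S z x} \<in> M"
  proof (rule repl[OF _ a'M])
    show "dfn M (\<lambda>e. S (e 0) (e 1))" unfolding S_def by (intro dfnI dR drk)
    fix x assume "x \<epsilon> a'"
    then obtain y where "y \<in> M" "R y x" by (auto simp: a'_def)
    then have "(\<exists>y\<in>M. R y x \<and> rk y = rk y)" "\<exists>y'\<in>M. R y' x \<and> rk y' = rk y" by blast+
    then obtain z where z: "\<exists>y\<in>M. R y x \<and> rk y = z" "Ord z" "\<And>w. w \<epsilon> z \<Longrightarrow> \<not> (\<exists>y\<in>M. R y x \<and> rk y = w)"
      using Ord_least[of "\<lambda>z. \<exists>y\<in>M. R y x \<and> rk y = z" "rk y"] Ordrk by blast
    have Sz: "S z x" unfolding S_def using z by auto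
    have uniq: "z' = z" if "S z' x" for z'
      using Ord_linear[of z' z] Sz that unfolding S_def by auto
    show "\<exists>z\<in>M. \<forall>z'\<in>M. S z' x \<longleftrightarrow> z' = z"
      using Sz uniq z(1) rkM by (intro bexI[of _ z]) blast+
  qed
  then have ZM: "hset {z \<in> M. \<exists>x\<in>mems a'. S z x} \<in> M" (is "?Z \<in> M") .
  have cZ: "countable {z \<in> M. \<exists>x\<in>mems a'. S z x}" by (rule countable_subset[OF _ countableM]) blast
  define b where "b = hUn (hset ((\<lambda>z. V (hsucc z)) ` mems ?Z))"
  have "dtm M (\<lambda>e. hUn (hset ((\<lambda>z. V (hsucc z)) ` mems (e 0))))" by (intro dfnI dV)
  from dtm_closed[OF this, of "\<lambda>_. ?Z"] have bM: "b \<in> M" using ZM by (simp add: b_def)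
  show thesis
  proof (rule that[OF bM])
    fix x y assume x: "x \<epsilon> a" and y: "y \<in> M" "R y x"
    then obtain z where z: "\<exists>y\<in>M. R y x \<and> rk y = z" "Ord z" "\<And>w. w \<epsilon> z \<Longrightarrow> \<not> (\<exists>y\<in>M. R y x \<and> rk y = w)"
      using Ord_least[of "\<lambda>z. \<exists>y\<in>M. R y x \<and> rk y = z" "rk y"] Ordrk by blast
    then have "S z x" unfolding S_def by auto
    obtain y' where y': "y' \<in> M" "R y' x" "rk y' = z" using z(1) by blast
    have "x \<epsilon> a'" using x y by (auto simp: a'_def)
    then have "z \<in> mems ?Z" using \<open>S z x\<close> rkM[OF y'(1)] y'(3) cZ by auto
    moreover have "y' \<epsilon> V (hsucc z)" using inV y' rkM[OF y'(1)] by (metis hsucc_in mem_hsucc)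
    ultimately have "y' \<epsilon> b" unfolding b_def by auto
    then show "\<exists>y. y \<epsilon> b \<and> R y x" using y'(2) by blast
  qed
qed

end

section \<open>Forcing\<close>

text \<open>Conditions are ordered by reverse inclusion, with \<open>hempty\<close> as the weakest.
  The order is thereby absolute and determined by the set of conditions.\<close>

definition le :: "hcset \<Rightarrow> hcset \<Rightarrow> bool" where "le p q \<longleftrightarrow> mems q \<subseteq> mems p"

lemma le_refl [simp]: "le p p" by (simp add: le_def)
lemma le_trans: "le p q \<Longrightarrow> le q r \<Longrightarrow> le p r" by (auto simp: le_def)

lemma mem_tc_fst: "(x, hpair x y) \<in> {(a, b). a \<epsilon> b}\<^sup>+" "(y, hpair x y) \<in> {(a, b). a \<epsilon> b}\<^sup>+"
proof -
  have "(x, upair x x) \<in> {(a, b). a \<epsilon> b}" "(upair x x, hpair x y) \<in> {(a, b). a \<epsilon> b}"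
    "(y, upair x y) \<in> {(a, b). a \<epsilon> b}" "(upair x y, hpair x y) \<in> {(a, b). a \<epsilon> b}"
    by (auto simp: hpair_def)
  then show "(x, hpair x y) \<in> {(a, b). a \<epsilon> b}\<^sup>+" "(y, hpair x y) \<in> {(a, b). a \<epsilon> b}\<^sup>+"
    by (meson trancl.intros)+
qed

lemma mem_dom_tc: "hpair y p \<epsilon> x \<Longrightarrow> (y, x) \<in> {(a, b). a \<epsilon> b}\<^sup>+"
  using mem_tc_fst(1)[of y p] by (auto intro: trancl_into_trancl)

lemma wf_dom: "wf {(y, x). \<exists>p. hpair y p \<epsilon> x}"
  by (rule wf_subset[OF wf_trancl[OF wf_hmem]]) (auto intro: mem_dom_tc)

lemma dom_in_tcset: "hpair y p \<epsilon> x \<Longrightarrow> x \<in> tcset t \<Longrightarrow> y \<in> tcset t"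
proof -
  assume "hpair y p \<epsilon> x" "x \<in> tcset t"
  then have "hpair y p \<in> tcset t" using tcset_closed by blast
  then have "upair y y \<in> tcset t" using tcset_closed[of "hpair y p" t "upair y y"] by (simp add: hpair_def)
  then show ?thesis using tcset_closed[of "upair y y" t y] by simp
qed

locale forcing = ctm +
  fixes P :: hcset
  assumes PM [simp]: "P \<in> M" and one: "hempty \<epsilon> P"
begin

lemma P_M: "p \<epsilon> P \<Longrightarrow> p \<in> M" by (rule transM[OF PM])

lemma dfn_le [dfnI]: "dtm M t \<Longrightarrow> dtm M s \<Longrightarrow> dfn M (\<lambda>e. le (t e) (s e))"
  unfolding le_def by (intro dfnI)

text \<open>Every set of \<open>M\<close> serves as a name; this singles out the elements that
  matter, namely pairs whose second component is a condition.\<close>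

definition nm :: "hcset \<Rightarrow> bool" where "nm w \<longleftrightarrow> (\<exists>a b. w = hpair a b) \<and> hsnd w \<epsilon> P"

lemma nm_hpair [simp]: "nm (hpair a b) \<longleftrightarrow> b \<epsilon> P" by (auto simp: nm_def)

lemma dfn_nm [dfnI]: "dtm M t \<Longrightarrow> dfn M (\<lambda>e. nm (t e))"
  unfolding nm_def by (intro dfnI PM)

text \<open>Forced equality is defined by recursion on two names at once: both components pass to
  members of the domains. The first component alone guarantees well-foundedness.\<close>

definition RR :: "hcset \<Rightarrow> hcset \<Rightarrow> bool" where
  "RR v u \<longleftrightarrow> (\<exists>a b. v = hpair a b) \<and> (\<exists>a b. u = hpair a b)
     \<and> (\<exists>w\<in>mems (hfst u). nm w \<and> hfst v = hfst w) \<and> (\<exists>w\<in>mems (hsnd u). nm w \<and> hsnd v = hfst w)"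

lemma RR_iff: "RR v u \<longleftrightarrow> (\<exists>z z' x y r s. v = hpair z z' \<and> u = hpair x y \<and> hpair z r \<epsilon> x \<and> r \<epsilon> P
    \<and> hpair z' s \<epsilon> y \<and> s \<epsilon> P)"
proof
  assume "RR v u"
  then obtain z z' x y w w' where *: "v = hpair z z'" "u = hpair x y" "w \<epsilon> x" "nm w" "z = hfst w" "w' \<epsilon> y"
    "nm w'" "z' = hfst w'" unfolding RR_def by auto
  from *(4,7) obtain a b c d where "w = hpair a b" "w' = hpair c d" unfolding nm_def by blast
  then show "\<exists>z z' x y r s. v = hpair z z' \<and> u = hpair x y \<and> hpair z r \<epsilon> x \<and> r \<epsilon> P \<and> hpair z' s \<epsilon> y \<and> s \<epsilon> P"
    using * by auto
next
  assume "\<exists>z z' x y r s. v = hpair z z' \<and> u = hpair x y \<and> hpair z r \<epsilon> x \<and> r \<epsilon> P \<and> hpair z' s \<epsilon> y \<and> s \<epsilon> P"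
  then show "RR v u" unfolding RR_def
    by clarsimp (metis hfst_hpair in_mems nm_hpair)
qed

lemma wf_RR: "wf {(v, u). RR v u}"
proof (rule wf_subset)
  show "wf (inv_image {(y, x). \<exists>p. hpair y p \<epsilon> x} hfst)" by (rule wf_inv_image[OF wf_dom])
  show "{(v, u). RR v u} \<subseteq> inv_image {(y, x). \<exists>p. hpair y p \<epsilon> x} hfst"
    unfolding RR_iff inv_image_def by auto
qed

text \<open>The recursion clause for forced equality: whatever enters one name is, densely often,
  equal to something entering the other. The value at a pair of names is the set of conditions
  forcing equality, so that the recursion has sets as values.\<close>

definition FG :: "hcset \<Rightarrow> hcset \<Rightarrow> hcset" where
  "FG u f = hset {p \<in> mems P.
     (\<forall>w\<in>mems (hfst u). nm w \<longrightarrow> (\<forall>q\<in>mems P. le q p \<and> le q (hsnd w) \<longrightarrow> (\<exists>q'\<in>mems P. le q' q \<and>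
        (\<exists>v\<in>mems (hsnd u). nm v \<and> le q' (hsnd v) \<and> q' \<epsilon> happ f (hpair (hfst w) (hfst v))))))
   \<and> (\<forall>w\<in>mems (hsnd u). nm w \<longrightarrow> (\<forall>q\<in>mems P. le q p \<and> le q (hsnd w) \<longrightarrow> (\<exists>q'\<in>mems P. le q' q \<and>
        (\<exists>v\<in>mems (hfst u). nm v \<and> le q' (hsnd v) \<and> q' \<epsilon> happ f (hpair (hfst v) (hfst w))))))}"

definition FE :: "hcset \<Rightarrow> hcset" where
  "FE = (SOME F. \<forall>u. F u = FG u (hgraph F {v. RR v u}))"

lemma countable_RR: "countable {v. RR v u}"
proof (rule countable_subset)
  show "{v. RR v u} \<subseteq> (\<lambda>(w, w'). hpair (hfst w) (hfst w')) ` (mems (hfst u) \<times> mems (hsnd u))"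
    unfolding RR_iff by (force simp: image_iff)
qed auto

lemma FE_eq: "FE u = FG u (hgraph FE {v. RR v u})"
proof -
  have "\<exists>F. \<forall>u. F u = FG u (hgraph F {v. RR v u})"
    by (rule wfrec_exists[OF wf_RR countable_RR])
  from someI_ex[OF this] show ?thesis unfolding FE_def by blast
qed

lemma dtm_FG: "dtm M (\<lambda>e. FG (e 1) (e 2))"
  unfolding FG_def by (intro dfnI PM)

lemma FG_in: "u \<in> M \<Longrightarrow> f \<in> M \<Longrightarrow> FG u f \<in> M"
  using dtm_closed[OF dtm_FG, of "\<lambda>i. if i = 1 then u else f"] by simp

lemma dtm_FE: assumes t: "dtm M t" shows "dtm M (\<lambda>e. FE (t e))"
proof (rule wf_recursion(2)[of RR FG FE])
  show "wf {(y, x). RR y x}" by (rule wf_RR)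
  show "y \<in> M" if yx: "RR y x" and xM: "x \<in> M" for x y
  proof -
    obtain z z' a b r s where *: "y = hpair z z'" "x = hpair a b" "hpair z r \<epsilon> a" "hpair z' s \<epsilon> b"
      using yx[unfolded RR_iff] by blast
    have "a \<in> M" "b \<in> M" using xM *(2) by auto
    then show ?thesis using *(1) pair_mem_in[OF _ *(3)] pair_mem_in[OF _ *(4)] by simp
  qed
  show "dfn M (\<lambda>e. RR (e 0) (e 1))" unfolding RR_def by (intro dfnI)
  show "\<exists>t\<in>M. x \<epsilon> t \<and> (\<forall>z\<in>mems t. \<forall>y. RR y z \<longrightarrow> y \<epsilon> t)" if xM: "x \<in> M" for x
  proof (intro bexI[of _ "hun (upair x x) (hprod (hset (tcset x)) (hset (tcset x)))"] conjI ballI allI impI)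
    fix z y assume z: "z \<in> mems (hun (upair x x) (hprod (hset (tcset x)) (hset (tcset x))))" and "RR y z"
    then obtain a a' b b' r s where *: "y = hpair a a'" "z = hpair b b'" "hpair a r \<epsilon> b" "hpair a' s \<epsilon> b'"
      unfolding RR_iff by blast
    have "b \<in> tcset x \<and> b' \<in> tcset x"
    proof (cases "z = x")
      case True
      have "upair b b \<in> tcset x" "upair b b' \<in> tcset x"
        using tcset_closed[OF tcset_refl, of _ x] unfolding True[symmetric] *(2) hpair_def by simp_all
      then show ?thesis using tcset_closed[of "upair b b" x b] tcset_closed[of "upair b b'" x b'] by simp
    next
      case False
      then show ?thesis using z *(2) xM by auto
    qed
    then have "a \<in> tcset x" "a' \<in> tcset x" using dom_in_tcset *(3,4) by blast+
    then show "y \<epsilon> hun (upair x x) (hprod (hset (tcset x)) (hset (tcset x)))"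
      using *(1) xM by simp
  qed (use xM tc_in[OF xM] in auto)
  show "dfn M (\<lambda>e. e 0 = FG (e 1) (e 2))" unfolding FG_def by (intro dfnI PM)
qed (use FG_in FE_eq t in auto)

definition feq :: "hcset \<Rightarrow> hcset \<Rightarrow> hcset \<Rightarrow> bool" where "feq p x y \<longleftrightarrow> p \<epsilon> FE (hpair x y)"

text \<open>\<open>q\<close> makes \<open>x\<close> equal to one particular element entering
  \<open>y\<close>. The mirrored \<open>fex'\<close> keeps the two names in the order in which the
  recursion for equality meets them.\<close>

definition fex :: "hcset \<Rightarrow> hcset \<Rightarrow> hcset \<Rightarrow> bool" where
  "fex q x y \<longleftrightarrow> (\<exists>v\<in>mems y. nm v \<and> le q (hsnd v) \<and> feq q x (hfst v))"
definition fex' :: "hcset \<Rightarrow> hcset \<Rightarrow> hcset \<Rightarrow> bool" where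
  "fex' q x y \<longleftrightarrow> (\<exists>v\<in>mems x. nm v \<and> le q (hsnd v) \<and> feq q (hfst v) y)"
definition fmem :: "hcset \<Rightarrow> hcset \<Rightarrow> hcset \<Rightarrow> bool" where
  "fmem p x y \<longleftrightarrow> (\<forall>q\<in>mems P. le q p \<longrightarrow> (\<exists>q'\<in>mems P. le q' q \<and> fex q' x y))"

lemma dfn_feq [dfnI]: "dtm M t \<Longrightarrow> dtm M s \<Longrightarrow> dtm M u \<Longrightarrow> dfn M (\<lambda>e. feq (t e) (s e) (u e))"
  unfolding feq_def by (intro dfnI dtm_FE)
lemma dfn_fex [dfnI]: "dtm M t \<Longrightarrow> dtm M s \<Longrightarrow> dtm M u \<Longrightarrow> dfn M (\<lambda>e. fex (t e) (s e) (u e))"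
  by (rule dfn_subst3[of fex]) (auto simp only: fex_def intro!: dfnI)
lemma dfn_fex' [dfnI]: "dtm M t \<Longrightarrow> dtm M s \<Longrightarrow> dtm M u \<Longrightarrow> dfn M (\<lambda>e. fex' (t e) (s e) (u e))"
  by (rule dfn_subst3[of fex']) (auto simp only: fex'_def intro!: dfnI)
lemma dfn_fmem [dfnI]: "dtm M t \<Longrightarrow> dtm M s \<Longrightarrow> dtm M u \<Longrightarrow> dfn M (\<lambda>e. fmem (t e) (s e) (u e))"
  by (rule dfn_subst3[of fmem]) (auto simp only: fmem_def intro!: dfnI PM)

lemma fex_iff: "fex q x y \<longleftrightarrow> (\<exists>z s. hpair z s \<epsilon> y \<and> s \<epsilon> P \<and> le q s \<and> feq q x z)"
proof
  assume "fex q x y"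
  then obtain v where v: "v \<epsilon> y" "nm v" "le q (hsnd v)" "feq q x (hfst v)" unfolding fex_def by auto
  from v(2) obtain a b where "v = hpair a b" unfolding nm_def by blast
  then show "\<exists>z s. hpair z s \<epsilon> y \<and> s \<epsilon> P \<and> le q s \<and> feq q x z" using v by auto
next
  assume "\<exists>z s. hpair z s \<epsilon> y \<and> s \<epsilon> P \<and> le q s \<and> feq q x z"
  then obtain z s where "hpair z s \<epsilon> y" "s \<epsilon> P" "le q s" "feq q x z" by blast
  then show "fex q x y" unfolding fex_def by (intro bexI[of _ "hpair z s"]) auto
qed

lemma fex'_iff: "fex' q x y \<longleftrightarrow> (\<exists>z s. hpair z s \<epsilon> x \<and> s \<epsilon> P \<and> le q s \<and> feq q z y)"
proof
  assume "fex' q x y"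
  then obtain v where v: "v \<epsilon> x" "nm v" "le q (hsnd v)" "feq q (hfst v) y" unfolding fex'_def by auto
  from v(2) obtain a b where "v = hpair a b" unfolding nm_def by blast
  then show "\<exists>z s. hpair z s \<epsilon> x \<and> s \<epsilon> P \<and> le q s \<and> feq q z y" using v by auto
next
  assume "\<exists>z s. hpair z s \<epsilon> x \<and> s \<epsilon> P \<and> le q s \<and> feq q z y"
  then obtain z s where "hpair z s \<epsilon> x" "s \<epsilon> P" "le q s" "feq q z y" by blast
  then show "fex' q x y" unfolding fex'_def by (intro bexI[of _ "hpair z s"]) auto
qed

lemma feq_iff: "feq p x y \<longleftrightarrow> p \<epsilon> P
   \<and> (\<forall>z r. hpair z r \<epsilon> x \<and> r \<epsilon> P \<longrightarrow> (\<forall>q. q \<epsilon> P \<and> le q p \<and> le q r \<longrightarrow> (\<exists>q'. q' \<epsilon> P \<and> le q' q \<and> fex q' z y)))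
   \<and> (\<forall>z r. hpair z r \<epsilon> y \<and> r \<epsilon> P \<longrightarrow> (\<forall>q. q \<epsilon> P \<and> le q p \<and> le q r \<longrightarrow> (\<exists>q'. q' \<epsilon> P \<and> le q' q \<and> fex' q' x z)))"
proof -
  let ?f = "hgraph FE {v. RR v (hpair x y)}"
  have val: "happ ?f (hpair z z') = FE (hpair z z')"
    if "hpair z r \<epsilon> x" "r \<epsilon> P" "hpair z' s \<epsilon> y" "s \<epsilon> P" for z z' r s
    by (rule happ_hgraph[OF countable_RR]) (use that in \<open>simp add: RR_iff; blast\<close>)
  have nmE: "(\<forall>w\<in>mems x. nm w \<longrightarrow> Q (hfst w) (hsnd w)) \<longleftrightarrow> (\<forall>z r. hpair z r \<epsilon> x \<and> r \<epsilon> P \<longrightarrow> Q z r)" for Q x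
  proof (intro iffI allI impI ballI)
    fix z r assume *: "\<forall>w\<in>mems x. nm w \<longrightarrow> Q (hfst w) (hsnd w)" "hpair z r \<epsilon> x \<and> r \<epsilon> P"
    then have "hpair z r \<in> mems x" by simp
    from bspec[OF *(1) this] show "Q z r" using *(2) by simp
  next
    fix w assume "\<forall>z r. hpair z r \<epsilon> x \<and> r \<epsilon> P \<longrightarrow> Q z r" "w \<in> mems x" "nm w"
    then show "Q (hfst w) (hsnd w)" by (auto simp: nm_def)
  qed
  have 1: "(\<exists>v\<in>mems y. nm v \<and> le q' (hsnd v) \<and> q' \<epsilon> happ ?f (hpair z (hfst v))) \<longleftrightarrow> fex q' z y"
    if "hpair z r \<epsilon> x" "r \<epsilon> P" for z r q'
  proof -
    have "q' \<epsilon> happ ?f (hpair z (hfst v)) \<longleftrightarrow> feq q' z (hfst v)" if "v \<in> mems y" "nm v" for v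
    proof -
      from that obtain a b where "v = hpair a b" "b \<epsilon> P" by (auto simp: nm_def)
      then show ?thesis using val[OF \<open>hpair z r \<epsilon> x\<close> \<open>r \<epsilon> P\<close>, of a b] that by (simp add: feq_def)
    qed
    then show ?thesis unfolding fex_def by blast
  qed
  have 2: "(\<exists>v\<in>mems x. nm v \<and> le q' (hsnd v) \<and> q' \<epsilon> happ ?f (hpair (hfst v) z)) \<longleftrightarrow> fex' q' x z"
    if "hpair z r \<epsilon> y" "r \<epsilon> P" for z r q'
  proof -
    have "q' \<epsilon> happ ?f (hpair (hfst v) z) \<longleftrightarrow> feq q' (hfst v) z" if "v \<in> mems x" "nm v" for v
    proof -
      from that obtain a b where "v = hpair a b" "b \<epsilon> P" by (auto simp: nm_def)
      then show ?thesis using val[OF _ _ \<open>hpair z r \<epsilon> y\<close> \<open>r \<epsilon> P\<close>, of a b] that by (simp add: feq_def)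
    qed
    then show ?thesis unfolding fex'_def by blast
  qed
  have "feq p x y \<longleftrightarrow> p \<epsilon> P
   \<and> (\<forall>w\<in>mems x. nm w \<longrightarrow> (\<forall>q\<in>mems P. le q p \<and> le q (hsnd w) \<longrightarrow> (\<exists>q'\<in>mems P. le q' q \<and>
        (\<exists>v\<in>mems y. nm v \<and> le q' (hsnd v) \<and> q' \<epsilon> happ ?f (hpair (hfst w) (hfst v))))))
   \<and> (\<forall>w\<in>mems y. nm w \<longrightarrow> (\<forall>q\<in>mems P. le q p \<and> le q (hsnd w) \<longrightarrow> (\<exists>q'\<in>mems P. le q' q \<and>
        (\<exists>v\<in>mems x. nm v \<and> le q' (hsnd v) \<and> q' \<epsilon> happ ?f (hpair (hfst v) (hfst w))))))"
    unfolding feq_def by (subst FE_eq) (simp add: FG_def)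
  also have "\<dots> \<longleftrightarrow> p \<epsilon> P
   \<and> (\<forall>z r. hpair z r \<epsilon> x \<and> r \<epsilon> P \<longrightarrow> (\<forall>q\<in>mems P. le q p \<and> le q r \<longrightarrow> (\<exists>q'\<in>mems P. le q' q \<and>
        (\<exists>v\<in>mems y. nm v \<and> le q' (hsnd v) \<and> q' \<epsilon> happ ?f (hpair z (hfst v))))))
   \<and> (\<forall>z r. hpair z r \<epsilon> y \<and> r \<epsilon> P \<longrightarrow> (\<forall>q\<in>mems P. le q p \<and> le q r \<longrightarrow> (\<exists>q'\<in>mems P. le q' q \<and>
        (\<exists>v\<in>mems x. nm v \<and> le q' (hsnd v) \<and> q' \<epsilon> happ ?f (hpair (hfst v) z)))))"
    unfolding nmE[of x "\<lambda>a b. \<forall>q\<in>mems P. le q p \<and> le q b \<longrightarrow> (\<exists>q'\<in>mems P. le q' q \<and>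
        (\<exists>v\<in>mems y. nm v \<and> le q' (hsnd v) \<and> q' \<epsilon> happ ?f (hpair a (hfst v))))"]
      nmE[of y "\<lambda>a b. \<forall>q\<in>mems P. le q p \<and> le q b \<longrightarrow> (\<exists>q'\<in>mems P. le q' q \<and>
        (\<exists>v\<in>mems x. nm v \<and> le q' (hsnd v) \<and> q' \<epsilon> happ ?f (hpair (hfst v) a)))"] ..
  also have "\<dots> \<longleftrightarrow> p \<epsilon> P
   \<and> (\<forall>z r. hpair z r \<epsilon> x \<and> r \<epsilon> P \<longrightarrow> (\<forall>q\<in>mems P. le q p \<and> le q r \<longrightarrow> (\<exists>q'\<in>mems P. le q' q \<and> fex q' z y)))
   \<and> (\<forall>z r. hpair z r \<epsilon> y \<and> r \<epsilon> P \<longrightarrow> (\<forall>q\<in>mems P. le q p \<and> le q r \<longrightarrow> (\<exists>q'\<in>mems P. le q' q \<and> fex' q' x z)))"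
    by (intro arg_cong2[where f = "(\<and>)"] all_cong1 imp_cong ball_cong bex_cong refl; (rule 1 | rule 2); blast)
  finally show ?thesis unfolding Ball_def Bex_def in_mems by blast
qed

lemma feq_mono: "feq p x y \<Longrightarrow> q \<epsilon> P \<Longrightarrow> le q p \<Longrightarrow> feq q x y"
  unfolding feq_iff[of p x y] feq_iff[of q x y] using le_trans by blast

lemma fex_mono: "fex p x y \<Longrightarrow> q \<epsilon> P \<Longrightarrow> le q p \<Longrightarrow> fex q x y"
  unfolding fex_iff using feq_mono le_trans by blast

text \<open>Both halves of the clause for equality already ask for something densely below
  \<open>p\<close>, so forcing densely below implies forcing.\<close>

lemma feq_dense:
  assumes "p \<epsilon> P" "\<And>q. q \<epsilon> P \<Longrightarrow> le q p \<Longrightarrow> \<exists>r. r \<epsilon> P \<and> le r q \<and> feq r x y"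
  shows "feq p x y"
  unfolding feq_iff[of p]
proof (intro conjI allI impI assms(1))
  fix z r q assume *: "hpair z r \<epsilon> x \<and> r \<epsilon> P" "q \<epsilon> P \<and> le q p \<and> le q r"
  then obtain s where s: "s \<epsilon> P" "le s q" "feq s x y" using assms(2) by blast
  have "le s r" using s(2) * le_trans by blast
  then have "\<exists>q'. q' \<epsilon> P \<and> le q' s \<and> fex q' z y" using s *(1) unfolding feq_iff[of s] using le_refl by blast
  then show "\<exists>q'. q' \<epsilon> P \<and> le q' q \<and> fex q' z y" using s(2) le_trans by blast
next
  fix z r q assume *: "hpair z r \<epsilon> y \<and> r \<epsilon> P" "q \<epsilon> P \<and> le q p \<and> le q r"
  then obtain s where s: "s \<epsilon> P" "le s q" "feq s x y" using assms(2) by blast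
  have "le s r" using s(2) * le_trans by blast
  then have "\<exists>q'. q' \<epsilon> P \<and> le q' s \<and> fex' q' x z" using s *(1) unfolding feq_iff[of s] using le_refl by blast
  then show "\<exists>q'. q' \<epsilon> P \<and> le q' q \<and> fex' q' x z" using s(2) le_trans by blast
qed

text \<open>Kripke-style forcing for the connectives; no negative translation is needed because every
  clause is closed under density.\<close>

primrec forces :: "sfm \<Rightarrow> hcset \<Rightarrow> (nat \<Rightarrow> hcset) \<Rightarrow> bool" where
  "forces (FMem i j) p e \<longleftrightarrow> fmem p (e i) (e j)"
| "forces (FEq i j) p e \<longleftrightarrow> feq p (e i) (e j)"
| "forces FFls p e \<longleftrightarrow> False"
| "forces (FImp \<phi> \<psi>) p e \<longleftrightarrow> (\<forall>q\<in>mems P. le q p \<longrightarrow> forces \<phi> q e \<longrightarrow> forces \<psi> q e)"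
| "forces (FAll n \<phi>) p e \<longleftrightarrow> (\<forall>x\<in>M. forces \<phi> p (e(n := x)))"

lemma forces_mono: "forces \<phi> p e \<Longrightarrow> q \<epsilon> P \<Longrightarrow> le q p \<Longrightarrow> forces \<phi> q e"
proof (induction \<phi> arbitrary: e)
  case (FMem i j)
  then show ?case using le_trans[of _ q p] by (auto simp: fmem_def)
next
  case (FEq i j)
  then show ?case using feq_mono by simp
next
  case (FImp \<phi> \<psi>)
  then show ?case using le_trans[of _ q p] by simp
qed auto

lemma forces_dense:
  "p \<epsilon> P \<Longrightarrow> (\<And>q. q \<epsilon> P \<Longrightarrow> le q p \<Longrightarrow> \<exists>r. r \<epsilon> P \<and> le r q \<and> forces \<phi> r e) \<Longrightarrow> forces \<phi> p e"
proof (induction \<phi> arbitrary: p e)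
  case (FMem i j)
  show ?case unfolding forces.simps fmem_def
  proof (intro ballI impI)
    fix q assume q: "q \<in> mems P" "le q p"
    then obtain r where r: "r \<epsilon> P" "le r q" "fmem r (e i) (e j)" using FMem(2)[of q] by auto
    then obtain q' where "q' \<epsilon> P" "le q' r" "fex q' (e i) (e j)"
      unfolding fmem_def Ball_def Bex_def in_mems using le_refl[of r] by blast
    then show "\<exists>q'\<in>mems P. le q' q \<and> fex q' (e i) (e j)" using r(2) le_trans[of q' r q] by auto
  qed
next
  case (FEq i j)
  then show ?case using feq_dense by simp
next
  case FFls
  then show ?case using le_refl by (metis forces.simps(3))
next
  case (FImp \<phi> \<psi>)
  show ?case unfolding forces.simps
  proof (intro ballI impI)
    fix q assume q: "q \<in> mems P" "le q p" "forces \<phi> q e"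
    show "forces \<psi> q e"
    proof (rule FImp.IH(2))
      fix q' assume q': "q' \<epsilon> P" "le q' q"
      then obtain r where r: "r \<epsilon> P" "le r q'" "forces (FImp \<phi> \<psi>) r e"
        using FImp.prems(2)[of q'] le_trans[of q' q p] q by auto
      have "forces \<phi> r e" using forces_mono[OF q(3) r(1)] le_trans[OF r(2) q'(2)] by blast
      then have "forces \<psi> r e" using r(1,3) by auto
      then show "\<exists>r. r \<epsilon> P \<and> le r q' \<and> forces \<psi> r e" using r by blast
    qed (use q in simp)
  qed
next
  case (FAll n \<phi>)
  show ?case unfolding forces.simps
  proof
    fix x assume x: "x \<in> M"
    show "forces \<phi> p (e(n := x))"
    proof (rule FAll.IH[OF FAll.prems(1)])
      fix q assume "q \<epsilon> P" "le q p"
      from FAll.prems(2)[OF this] obtain r where "r \<epsilon> P" "le r q" "forces (FAll n \<phi>) r e" by blast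
      then show "\<exists>r. r \<epsilon> P \<and> le r q \<and> forces \<phi> r (e(n := x))" using x by (intro exI[of _ r]) simp
    qed
  qed
qed

text \<open>Definability of forcing, for one formula at a time: argument 0 is the condition and the
  later ones are the names.\<close>

lemma dfn_forces: "dfn M (\<lambda>e. forces \<phi> (e 0) (\<lambda>i. e (Suc i)))"
proof (induction \<phi>)
  case (FImp \<phi> \<psi>)
  have inj: "inj (\<lambda>i. if i = 0 then 0 else Suc i)" by (auto simp: inj_def)
  from dfn_ren[OF FImp.IH(1) inj] dfn_ren[OF FImp.IH(2) inj]
  have "dfn M (\<lambda>e. forces \<phi> (e 0) (\<lambda>i. e (Suc (Suc i))))" "dfn M (\<lambda>e. forces \<psi> (e 0) (\<lambda>i. e (Suc (Suc i))))"
    by simp_all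
  then have "dfn M (\<lambda>e. \<forall>q\<in>mems P. le q (e 0) \<longrightarrow> forces \<phi> q (\<lambda>i. e (Suc i)) \<longrightarrow> forces \<psi> q (\<lambda>i. e (Suc i)))"
    by (intro dfnI PM)
  then show ?case by simp
next
  case (FAll n \<phi>)
  define f where "f k = (case k of 0 \<Rightarrow> 1 | Suc i \<Rightarrow> if i = n then 0 else Suc (Suc i))" for k
  have "inj f"
  proof (rule injI)
    fix x y assume "f x = f y"
    then show "x = y" by (cases x; cases y) (auto simp: f_def split: if_splits)
  qed
  from dfn_ren[OF FAll.IH this]
  have 1: "dfn M (\<lambda>e. forces \<phi> (e 1) (\<lambda>i. e (if i = n then 0 else Suc (Suc i))))" by (simp add: f_def)
  have 2: "(\<lambda>i. e (if i = n then 0 else Suc (Suc i))) = (\<lambda>i. e (Suc (Suc i)))(n := e 0)" for e :: "nat \<Rightarrow> hcset"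
    by auto
  from 1 have "dfn M (\<lambda>e. forces \<phi> (e 1) ((\<lambda>i. e (Suc (Suc i)))(n := e 0)))" unfolding 2 .
  then have "dfn M (\<lambda>e. \<forall>x\<in>M. forces \<phi> (e 0) ((\<lambda>i. e (Suc i))(n := x)))"
    by (intro dfn_all) simp
  then show ?case by simp
qed (simp_all, (intro dfnI)+)

lemma dfn_forces_fix: "(\<And>i. e i \<in> M) \<Longrightarrow> dtm M t \<Longrightarrow> dfn M (\<lambda>e'. forces \<phi> (t e') e)"
proof -
  assume e: "\<And>i. e i \<in> M" and t: "dtm M t"
  have "range e \<subseteq> M" using e by auto
  from dfn_subst1[OF dfn_fix[OF dfn_forces this] t] show ?thesis .
qed

end

locale generic = forcing +
  fixes G :: "hcset set"
  assumes G_P: "p \<in> G \<Longrightarrow> p \<epsilon> P"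
    and G_one: "hempty \<in> G"
    and G_up: "p \<in> G \<Longrightarrow> q \<epsilon> P \<Longrightarrow> le p q \<Longrightarrow> q \<in> G"
    and G_dir: "p \<in> G \<Longrightarrow> q \<in> G \<Longrightarrow> \<exists>r\<in>G. le r p \<and> le r q"
    and G_meet: "D \<in> M \<Longrightarrow> (\<And>q. q \<epsilon> D \<Longrightarrow> q \<epsilon> P) \<Longrightarrow>
      (\<And>p. p \<epsilon> P \<Longrightarrow> \<exists>q. q \<epsilon> D \<and> le q p) \<Longrightarrow> \<exists>p\<in>G. p \<epsilon> D"

text \<open>Rasiowa-Sikorski: \<open>M\<close> is countable, so its dense sets can be met one after
  the other by a descending sequence, whose upward closure is generic.\<close>

lemma (in forcing) generic_exists:
  assumes p: "p \<epsilon> P"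
  shows "\<exists>G. generic M P G \<and> p \<in> G"
proof -
  define DD where "DD = {D \<in> M. (\<forall>q. q \<epsilon> D \<longrightarrow> q \<epsilon> P) \<and> (\<forall>p. p \<epsilon> P \<longrightarrow> (\<exists>q. q \<epsilon> D \<and> le q p))}"
  have "P \<in> DD" unfolding DD_def using le_refl by auto
  moreover have "countable DD" unfolding DD_def by (rule countable_subset[OF _ countableM]) blast
  ultimately obtain d :: "nat \<Rightarrow> hcset" where d: "range d = DD"
    using range_from_nat_into[of DD] by (metis empty_iff)
  define s where "s = rec_nat p (\<lambda>n r. SOME q. q \<epsilon> d n \<and> le q r)"
  have s0: "s 0 = p" and sS: "s (Suc n) = (SOME q. q \<epsilon> d n \<and> le q (s n))" for n
    by (simp_all add: s_def)
  have dDD: "d n \<in> DD" for n using d by blast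
  have step: "s n \<epsilon> P \<Longrightarrow> s (Suc n) \<epsilon> d n \<and> le (s (Suc n)) (s n)" for n
  proof -
    assume "s n \<epsilon> P"
    then have "\<exists>q. q \<epsilon> d n \<and> le q (s n)" using dDD[of n] unfolding DD_def by blast
    from someI_ex[OF this] show ?thesis unfolding sS .
  qed
  have sP: "s n \<epsilon> P" for n
  proof (induction n)
    case (Suc n)
    then show ?case using step[of n] dDD[of n] unfolding DD_def by blast
  qed (simp add: s0 p)
  have dec: "le (s (n + k)) (s n)" for n k
  proof (induction k)
    case (Suc k)
    then show ?case using step[OF sP, of "n + k"] le_trans by (metis add_Suc_right)
  qed simp
  have dec': "le (s (max m n)) (s n)" "le (s (max m n)) (s m)" for m n
    using dec[of n "max m n - n"] dec[of m "max m n - m"] by simp_all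
  define G where "G = {q. q \<epsilon> P \<and> (\<exists>n. le (s n) q)}"
  have "generic M P G"
  proof (unfold_locales)
    show "hempty \<in> G" unfolding G_def using one by (auto simp: le_def mems_def)
    show "\<exists>r\<in>G. le r p \<and> le r q" if pq: "p \<in> G" "q \<in> G" for p q
    proof -
      obtain m n where "le (s m) p" "le (s n) q" using pq unfolding G_def by blast
      then have "le (s (max m n)) p" "le (s (max m n)) q" using dec' le_trans by blast+
      moreover have "s (max m n) \<in> G" unfolding G_def using sP le_refl by blast
      ultimately show ?thesis by blast
    qed
    show "\<exists>p\<in>G. p \<epsilon> D" if D: "D \<in> M" "\<And>q. q \<epsilon> D \<Longrightarrow> q \<epsilon> P" "\<And>p. p \<epsilon> P \<Longrightarrow> \<exists>q. q \<epsilon> D \<and> le q p" for D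
    proof -
      have "D \<in> DD" unfolding DD_def using D by blast
      then obtain n where n: "D = d n" using d by blast
      have "s (Suc n) \<in> G" unfolding G_def using sP le_refl by blast
      then show ?thesis using step[OF sP, of n] n by blast
    qed
  qed (auto simp: G_def intro: le_trans)
  moreover have "p \<in> G" unfolding G_def using p s0 le_refl by (metis (mono_tags) mem_Collect_eq)
  ultimately show ?thesis by blast
qed

context generic
begin

lemma G_M: "p \<in> G \<Longrightarrow> p \<in> M" using G_P P_M by blast

lemma countable_G: "countable G"
  by (rule countable_subset[OF _ countableM]) (use G_M in blast)

lemma meet:
  assumes d: "dfn M (\<lambda>e. \<phi> (e 0))" and dense: "\<And>p. p \<epsilon> P \<Longrightarrow> \<exists>q. q \<epsilon> P \<and> le q p \<and> \<phi> q"
  shows "\<exists>p\<in>G. \<phi> p"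
proof -
  have "hset {q \<in> mems P. \<phi> q} \<in> M" by (rule sep[OF d PM])
  from G_meet[OF this] have "\<exists>p\<in>G. p \<epsilon> hset {q \<in> mems P. \<phi> q}"
    using dense by auto
  then show ?thesis by auto
qed

text \<open>Density below \<open>p\<close> becomes plain density once the conditions incompatible
  with \<open>p\<close> are added; a filter containing \<open>p\<close> cannot contain any of
  these.\<close>

lemma meet_below:
  assumes d: "dfn M (\<lambda>e. \<phi> (e 0))" and p: "p \<in> G"
    and dense: "\<And>q. q \<epsilon> P \<Longrightarrow> le q p \<Longrightarrow> \<exists>r. r \<epsilon> P \<and> le r q \<and> \<phi> r"
  shows "\<exists>r\<in>G. le r p \<and> \<phi> r"
proof -
  have "\<exists>q\<in>G. le q p \<and> \<phi> q \<or> \<not> (\<exists>r\<in>mems P. le r q \<and> le r p)"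
  proof (rule meet)
    show "dfn M (\<lambda>e. le (e 0) p \<and> \<phi> (e 0) \<or> \<not> (\<exists>r\<in>mems P. le r (e 0) \<and> le r p))"
      by (intro dfnI d PM G_M[OF p])
    fix q assume q: "q \<epsilon> P"
    show "\<exists>q'. q' \<epsilon> P \<and> le q' q \<and> (le q' p \<and> \<phi> q' \<or> \<not> (\<exists>r\<in>mems P. le r q' \<and> le r p))"
    proof (cases "\<exists>r\<in>mems P. le r q \<and> le r p")
      case True
      then obtain r where r: "r \<epsilon> P" "le r q" "le r p" by auto
      then obtain r' where "r' \<epsilon> P" "le r' r" "\<phi> r'" using dense by blast
      then show ?thesis using r le_trans by blast
    qed (use q le_refl in blast)
  qed
  then obtain q where q: "q \<in> G" "le q p \<and> \<phi> q \<or> \<not> (\<exists>r\<in>mems P. le r q \<and> le r p)" by blast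
  obtain r where "r \<in> G" "le r q" "le r p" using G_dir[OF q(1) p] by blast
  then have "r \<in> mems P" "le r q" "le r p" using G_P by auto
  then show ?thesis using q by blast
qed

section \<open>Values of names and the truth lemma\<close>

definition val :: "hcset \<Rightarrow> hcset" where
  "val = (SOME F. \<forall>x. F x = hset (F ` {y. \<exists>p\<in>G. hpair y p \<epsilon> x}))"

lemma countable_dom: "countable {y. \<exists>p\<in>G. hpair y p \<epsilon> x}"
proof (rule countable_subset)
  show "{y. \<exists>p\<in>G. hpair y p \<epsilon> x} \<subseteq> hfst ` mems x"
    by (force simp: image_iff)
qed auto

lemma val_eq: "val x = hset (val ` {y. \<exists>p\<in>G. hpair y p \<epsilon> x})"
proof -
  have "wf {(y, x). \<exists>p\<in>G. hpair y p \<epsilon> x}" by (rule wf_subset[OF wf_dom]) blast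
  from wfrec_exists[OF this countable_dom, of "\<lambda>x f. Rng f"]
  have "\<exists>F. \<forall>x. F x = hset (F ` {y. \<exists>p\<in>G. hpair y p \<epsilon> x})"
    by (simp add: Rng_hgraph[OF countable_dom])
  from someI_ex[OF this] show ?thesis unfolding val_def by blast
qed

lemma mem_val: "u \<epsilon> val x \<longleftrightarrow> (\<exists>y p. hpair y p \<epsilon> x \<and> p \<in> G \<and> u = val y)"
proof -
  have "u \<epsilon> val x \<longleftrightarrow> u \<in> val ` {y. \<exists>p\<in>G. hpair y p \<epsilon> x}"
    by (subst val_eq) (simp add: countable_dom)
  then show ?thesis by blast
qed

lemma mem_valI: "hpair y p \<epsilon> x \<Longrightarrow> p \<in> G \<Longrightarrow> val y \<epsilon> val x"
  unfolding mem_val by blast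

text \<open>Induction on the pair of names. If equality is forced, genericity provides a partner for
  every element. Conversely, the conditions that force equality or exhibit an element without
  partner are dense, and one of the second kind in \<open>G\<close> would contradict the equality of
  the values.\<close>

lemma truth_eq_pair: "\<forall>x y. u = hpair x y \<longrightarrow> x \<in> M \<longrightarrow> y \<in> M \<longrightarrow> ((\<exists>p\<in>G. feq p x y) \<longleftrightarrow> val x = val y)"
proof (induction u rule: wf_induct_rule[OF wf_RR])
  case (1 u)
  show ?case
  proof (intro allI impI)
    fix x y assume u: "u = hpair x y" and xM: "x \<in> M" and yM: "y \<in> M"
    have IH: "(\<exists>p\<in>G. feq p z z') \<longleftrightarrow> val z = val z'"
      if "hpair z r \<epsilon> x" "r \<epsilon> P" "hpair z' s \<epsilon> y" "s \<epsilon> P" for z r z' s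
    proof -
      have "RR (hpair z z') u" unfolding RR_iff u using that by blast
      moreover have "z \<in> M" "z' \<in> M" using pair_mem_in[OF xM that(1)] pair_mem_in[OF yM that(3)] by auto
      ultimately show ?thesis using 1[of "hpair z z'"] by blast
    qed
    show "(\<exists>p\<in>G. feq p x y) \<longleftrightarrow> val x = val y"
    proof
      assume "\<exists>p\<in>G. feq p x y"
      then obtain p where p: "p \<in> G" "feq p x y" by blast
      note pf = p(2)[unfolded feq_iff[of p]]
      show "val x = val y"
      proof (rule hcset_eqI, rule iffI)
        fix v assume "v \<epsilon> val x"
        then obtain z r where z: "hpair z r \<epsilon> x" "r \<in> G" "v = val z" unfolding mem_val by blast
        obtain q where q: "q \<in> G" "le q p" "le q r" using G_dir[OF p(1) z(2)] by blast
        have zM: "z \<in> M" using pair_mem_in[OF xM z(1)] by simp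
        have "\<exists>q'\<in>G. le q' q \<and> fex q' z y"
        proof (rule meet_below[OF _ q(1)])
          show "dfn M (\<lambda>e. fex (e 0) z y)" by (intro dfnI zM yM)
          show "\<exists>r. r \<epsilon> P \<and> le r q' \<and> fex r z y" if "q' \<epsilon> P" "le q' q" for q'
            using pf z(1) G_P[OF z(2)] that le_trans[OF that(2)] q(2,3) by blast
        qed
        then obtain q' z' s where q': "q' \<in> G" "hpair z' s \<epsilon> y" "s \<epsilon> P" "le q' s" "feq q' z z'"
          unfolding fex_iff by blast
        then have "val z = val z'" using IH[OF z(1) G_P[OF z(2)] q'(2,3)] by blast
        then show "v \<epsilon> val y" using mem_valI[OF q'(2) G_up[OF q'(1,3,4)]] z(3) by simp
      next
        fix v assume "v \<epsilon> val y"
        then obtain z r where z: "hpair z r \<epsilon> y" "r \<in> G" "v = val z" unfolding mem_val by blast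
        obtain q where q: "q \<in> G" "le q p" "le q r" using G_dir[OF p(1) z(2)] by blast
        have zM: "z \<in> M" using pair_mem_in[OF yM z(1)] by simp
        have "\<exists>q'\<in>G. le q' q \<and> fex' q' x z"
        proof (rule meet_below[OF _ q(1)])
          show "dfn M (\<lambda>e. fex' (e 0) x z)" by (intro dfnI zM xM)
          show "\<exists>r. r \<epsilon> P \<and> le r q' \<and> fex' r x z" if "q' \<epsilon> P" "le q' q" for q'
            using pf z(1) G_P[OF z(2)] that le_trans[OF that(2)] q(2,3) by blast
        qed
        then obtain q' z' s where q': "q' \<in> G" "hpair z' s \<epsilon> x" "s \<epsilon> P" "le q' s" "feq q' z' z"
          unfolding fex'_iff by blast
        then have "val z' = val z" using IH[OF q'(2,3) z(1) G_P[OF z(2)]] by blast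
        then show "v \<epsilon> val x" using mem_valI[OF q'(2) G_up[OF q'(1,3,4)]] z(3) by simp
      qed
    next
      assume eq: "val x = val y"
      \<comment> \<open>\<open>B1 p\<close> says that \<open>p\<close> puts an element into
        \<open>x\<close> which no stronger condition makes equal to an element of \<open>y\<close>;
        \<open>B2\<close> is its mirror image.\<close>
      define B1 where "B1 p \<longleftrightarrow> (\<exists>w\<in>mems x. nm w \<and> le p (hsnd w) \<and> \<not> (\<exists>q\<in>mems P. le q p \<and> fex q (hfst w) y))" for p
      define B2 where "B2 p \<longleftrightarrow> (\<exists>w\<in>mems y. nm w \<and> le p (hsnd w) \<and> \<not> (\<exists>q\<in>mems P. le q p \<and> fex' q x (hfst w)))" for p
      have B1I: "B1 q" if "hpair z r \<epsilon> x" "r \<epsilon> P" "le q r" "\<And>q'. q' \<epsilon> P \<Longrightarrow> le q' q \<Longrightarrow> \<not> fex q' z y" for q z r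
        unfolding B1_def by (rule bexI[of _ "hpair z r"]) (use that in auto)
      have B2I: "B2 q" if "hpair z r \<epsilon> y" "r \<epsilon> P" "le q r" "\<And>q'. q' \<epsilon> P \<Longrightarrow> le q' q \<Longrightarrow> \<not> fex' q' x z" for q z r
        unfolding B2_def by (rule bexI[of _ "hpair z r"]) (use that in auto)
      have "\<exists>p\<in>G. feq p x y \<or> B1 p \<or> B2 p"
      proof (rule meet)
        show "dfn M (\<lambda>e. feq (e 0) x y \<or> B1 (e 0) \<or> B2 (e 0))"
          unfolding B1_def B2_def by (intro dfnI xM yM PM)
        fix p assume pP: "p \<epsilon> P"
        show "\<exists>q. q \<epsilon> P \<and> le q p \<and> (feq q x y \<or> B1 q \<or> B2 q)"
        proof (cases "feq p x y")
          case True
          then show ?thesis using pP le_refl by blast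
        next
          case False
          then have "(\<exists>z r q. hpair z r \<epsilon> x \<and> r \<epsilon> P \<and> q \<epsilon> P \<and> le q p \<and> le q r \<and> (\<forall>q'. q' \<epsilon> P \<and> le q' q \<longrightarrow> \<not> fex q' z y)) \<or>
            (\<exists>z r q. hpair z r \<epsilon> y \<and> r \<epsilon> P \<and> q \<epsilon> P \<and> le q p \<and> le q r \<and> (\<forall>q'. q' \<epsilon> P \<and> le q' q \<longrightarrow> \<not> fex' q' x z))"
            unfolding feq_iff[of p] using pP by blast
          then show ?thesis using B1I B2I by blast
        qed
      qed
      then obtain p where p: "p \<in> G" "feq p x y \<or> B1 p \<or> B2 p" by blast
      have "\<not> B1 p"
      proof
        assume "B1 p"
        then obtain w where w: "w \<epsilon> x" "nm w" "le p (hsnd w)" "\<And>q. q \<epsilon> P \<Longrightarrow> le q p \<Longrightarrow> \<not> fex q (hfst w) y"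
          unfolding B1_def by auto
        obtain z r where zr: "w = hpair z r" "r \<epsilon> P" using w(2) by (auto simp: nm_def)
        have r: "r \<in> G" using G_up[OF p(1) zr(2)] w(3) zr(1) by simp
        have "val z \<epsilon> val y" using mem_valI[of z r x] w(1) zr(1) r eq by simp
        then obtain z' s where s: "hpair z' s \<epsilon> y" "s \<in> G" "val z = val z'" unfolding mem_val by blast
        have "hpair z r \<epsilon> x" using w(1) zr(1) by simp
        from IH[OF this zr(2) s(1) G_P[OF s(2)]] s(3) obtain q where q: "q \<in> G" "feq q z z'" by blast
        obtain q1 where q1: "q1 \<in> G" "le q1 p" "le q1 q" using G_dir[OF p(1) q(1)] by blast
        obtain q2 where q2: "q2 \<in> G" "le q2 q1" "le q2 s" using G_dir[OF q1(1) s(2)] by blast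
        have "feq q2 z z'" using feq_mono[OF q(2) G_P[OF q2(1)]] le_trans[OF q2(2) q1(3)] by blast
        then have "fex q2 z y" unfolding fex_iff using s G_P q2 by blast
        then show False using w(4)[OF G_P[OF q2(1)] le_trans[OF q2(2) q1(2)]] zr(1) by simp
      qed
      moreover have "\<not> B2 p"
      proof
        assume "B2 p"
        then obtain w where w: "w \<epsilon> y" "nm w" "le p (hsnd w)" "\<And>q. q \<epsilon> P \<Longrightarrow> le q p \<Longrightarrow> \<not> fex' q x (hfst w)"
          unfolding B2_def by auto
        obtain z r where zr: "w = hpair z r" "r \<epsilon> P" using w(2) by (auto simp: nm_def)
        have r: "r \<in> G" using G_up[OF p(1) zr(2)] w(3) zr(1) by simp
        have "val z \<epsilon> val x" using mem_valI[of z r y] w(1) zr(1) r eq by simp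
        then obtain z' s where s: "hpair z' s \<epsilon> x" "s \<in> G" "val z = val z'" unfolding mem_val by blast
        have "hpair z r \<epsilon> y" using w(1) zr(1) by simp
        from IH[OF s(1) G_P[OF s(2)] this zr(2)] s(3) obtain q where q: "q \<in> G" "feq q z' z" by auto
        obtain q1 where q1: "q1 \<in> G" "le q1 p" "le q1 q" using G_dir[OF p(1) q(1)] by blast
        obtain q2 where q2: "q2 \<in> G" "le q2 q1" "le q2 s" using G_dir[OF q1(1) s(2)] by blast
        have "feq q2 z' z" using feq_mono[OF q(2) G_P[OF q2(1)]] le_trans[OF q2(2) q1(3)] by blast
        then have "fex' q2 x z" unfolding fex'_iff using s G_P q2 by blast
        then show False using w(4)[OF G_P[OF q2(1)] le_trans[OF q2(2) q1(2)]] zr(1) by simp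
      qed
      ultimately show "\<exists>p\<in>G. feq p x y" using p by blast
    qed
  qed
qed

lemma truth_eq: "x \<in> M \<Longrightarrow> y \<in> M \<Longrightarrow> (\<exists>p\<in>G. feq p x y) \<longleftrightarrow> val x = val y"
  using truth_eq_pair by blast

lemma truth_mem:
  assumes xM: "x \<in> M" and yM: "y \<in> M"
  shows "(\<exists>p\<in>G. fmem p x y) \<longleftrightarrow> val x \<epsilon> val y"
proof
  assume "\<exists>p\<in>G. fmem p x y"
  then obtain p where p: "p \<in> G" "fmem p x y" by blast
  have "\<exists>q'\<in>G. le q' p \<and> fex q' x y"
  proof (rule meet_below[OF _ p(1)])
    show "dfn M (\<lambda>e. fex (e 0) x y)" by (intro dfnI xM yM)
    show "\<exists>r. r \<epsilon> P \<and> le r q \<and> fex r x y" if "q \<epsilon> P" "le q p" for q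
      using p(2) that unfolding fmem_def Ball_def Bex_def in_mems by blast
  qed
  then obtain q z s where q: "q \<in> G" "hpair z s \<epsilon> y" "s \<epsilon> P" "le q s" "feq q x z" unfolding fex_iff by blast
  have "z \<in> M" using pair_mem_in[OF yM q(2)] by simp
  then have "val x = val z" using truth_eq[OF xM] q by blast
  then show "val x \<epsilon> val y" using mem_valI[OF q(2) G_up[OF q(1,3,4)]] by simp
next
  assume "val x \<epsilon> val y"
  then obtain z s where s: "hpair z s \<epsilon> y" "s \<in> G" "val x = val z" unfolding mem_val by blast
  have "z \<in> M" using pair_mem_in[OF yM s(1)] by simp
  then obtain q where q: "q \<in> G" "feq q x z" using truth_eq[OF xM] s(3) by blast
  obtain q1 where q1: "q1 \<in> G" "le q1 q" "le q1 s" using G_dir[OF q(1) s(2)] by blast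
  have "fex q1 x y" unfolding fex_iff using s G_P q1 feq_mono[OF q(2)] by blast
  then have "fmem q1 x y" unfolding fmem_def Ball_def Bex_def in_mems using fex_mono le_refl by blast
  then show "\<exists>p\<in>G. fmem p x y" using q1 by blast
qed

definition MG :: "hcset set" where "MG = val ` M"

text \<open>For implications and universal statements, the conditions that force the statement or
  settle on a counterexample are dense. A counterexample settled in \<open>G\<close> is a real one
  by the induction hypothesis and directedness.\<close>

theorem truth: "(\<And>i. e i \<in> M) \<Longrightarrow> ssat MG (\<lambda>i. val (e i)) \<phi> \<longleftrightarrow> (\<exists>p\<in>G. forces \<phi> p e)"
proof (induction \<phi> arbitrary: e)
  case (FMem i j)
  then show ?case using truth_mem by simp
next
  case (FEq i j)
  then show ?case using truth_eq by simp
next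
  case (FImp \<phi> \<psi>)
  note IH1 = FImp.IH(1)[of e, OF FImp.prems] and IH2 = FImp.IH(2)[of e, OF FImp.prems]
  have d1: "dfn M (\<lambda>e'. forces \<phi> (t e') e)" and d2: "dfn M (\<lambda>e'. forces \<psi> (t e') e)" if "dtm M t" for t
    by (rule dfn_forces_fix[of e, OF FImp.prems that])+
  have *: "\<exists>p\<in>G. forces (FImp \<phi> \<psi>) p e \<or> forces \<phi> p e \<and> \<not> (\<exists>q\<in>mems P. le q p \<and> forces \<psi> q e)"
  proof (rule meet)
    show "dfn M (\<lambda>e'. forces (FImp \<phi> \<psi>) (e' 0) e \<or> forces \<phi> (e' 0) e \<and> \<not> (\<exists>q\<in>mems P. le q (e' 0) \<and> forces \<psi> q e))"
      unfolding forces.simps by (intro dfnI PM d1 d2)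
    fix p assume p: "p \<epsilon> P"
    show "\<exists>q. q \<epsilon> P \<and> le q p \<and> (forces (FImp \<phi> \<psi>) q e \<or> forces \<phi> q e \<and> \<not> (\<exists>q'\<in>mems P. le q' q \<and> forces \<psi> q' e))"
    proof (cases "forces (FImp \<phi> \<psi>) p e")
      case True
      then show ?thesis using p le_refl by blast
    next
      case False
      then obtain q where q: "q \<epsilon> P" "le q p" "forces \<phi> q e" "\<not> forces \<psi> q e" by auto
      then obtain r where r: "r \<epsilon> P" "le r q" "\<And>s. s \<epsilon> P \<Longrightarrow> le s r \<Longrightarrow> \<not> forces \<psi> s e"
        using forces_dense[OF q(1)] by blast
      have "forces \<phi> r e" by (rule forces_mono[OF q(3) r(1,2)])
      moreover have "\<not> (\<exists>q'\<in>mems P. le q' r \<and> forces \<psi> q' e)" using r(3) by auto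
      ultimately show ?thesis using r(1) le_trans[OF r(2) q(2)] by blast
    qed
  qed
  show ?case
  proof
    assume L: "ssat MG (\<lambda>i. val (e i)) (FImp \<phi> \<psi>)"
    from * obtain p where p: "p \<in> G" "forces (FImp \<phi> \<psi>) p e \<or> forces \<phi> p e \<and> \<not> (\<exists>q\<in>mems P. le q p \<and> forces \<psi> q e)" by blast
    have False if f: "forces \<phi> p e" "\<not> (\<exists>q\<in>mems P. le q p \<and> forces \<psi> q e)"
    proof -
      have "ssat MG (\<lambda>i. val (e i)) \<psi>" using L IH1 f(1) p(1) unfolding ssat.simps by blast
      then obtain s where s: "s \<in> G" "forces \<psi> s e" using IH2 by blast
      obtain r where r: "r \<in> G" "le r p" "le r s" using G_dir[OF p(1) s(1)] by blast
      have "forces \<psi> r e" by (rule forces_mono[OF s(2) G_P[OF r(1)] r(3)])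
      moreover have "r \<in> mems P" using G_P[OF r(1)] by simp
      ultimately show False using f(2) r(2) by blast
    qed
    then show "\<exists>p\<in>G. forces (FImp \<phi> \<psi>) p e" using p by blast
  next
    assume "\<exists>p\<in>G. forces (FImp \<phi> \<psi>) p e"
    then obtain p where p: "p \<in> G" "forces (FImp \<phi> \<psi>) p e" by blast
    show "ssat MG (\<lambda>i. val (e i)) (FImp \<phi> \<psi>)" unfolding ssat.simps
    proof
      assume "ssat MG (\<lambda>i. val (e i)) \<phi>"
      then obtain q where q: "q \<in> G" "forces \<phi> q e" using IH1 by blast
      obtain r where r: "r \<in> G" "le r p" "le r q" using G_dir[OF p(1) q(1)] by blast
      have "forces \<phi> r e" by (rule forces_mono[OF q(2) G_P[OF r(1)] r(3)])
      moreover have "r \<in> mems P" using G_P[OF r(1)] by simp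
      ultimately have "forces \<psi> r e" using p(2) r(2) unfolding forces.simps by blast
      then show "ssat MG (\<lambda>i. val (e i)) \<psi>" using IH2 r(1) by blast
    qed
  qed
next
  case (FAll n \<phi>)
  have upd: "(\<lambda>i. val (e i))(n := val x) = (\<lambda>i. val ((e(n := x)) i))" for x by auto
  have IH: "ssat MG ((\<lambda>i. val (e i))(n := val x)) \<phi> \<longleftrightarrow> (\<exists>p\<in>G. forces \<phi> p (e(n := x)))" if x: "x \<in> M" for x
    unfolding upd by (rule FAll.IH) (use FAll.prems x in auto)
  have dA: "dfn M (\<lambda>e'. forces (FAll n \<phi>) (t e') e)" if "dtm M t" for t
    by (rule dfn_forces_fix[of e, OF FAll.prems that])
  have d1: "dfn M (\<lambda>e'. \<exists>x\<in>M. \<not> (\<exists>q\<in>mems P. le q (e' 0) \<and> forces \<phi> q (e(n := x))))"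
  proof -
    define f where "f k = (case k of 0 \<Rightarrow> 0 | Suc i \<Rightarrow> if i = n then 1 else Suc (Suc (Suc i)))" for k
    have "inj f"
    proof (rule injI)
      fix x y assume "f x = f y"
      then show "x = y" by (cases x; cases y) (auto simp: f_def split: if_splits)
    qed
    from dfn_ren[OF dfn_forces this, of \<phi>]
    have 1: "dfn M (\<lambda>e. forces \<phi> (e 0) (\<lambda>i. e (if i = n then 1 else Suc (Suc (Suc i)))))" by (simp add: f_def)
    have 2: "(\<lambda>i. e (if i = n then 1 else Suc (Suc (Suc i)))) = (\<lambda>i. e (Suc (Suc (Suc i))))(n := e 1)" for e :: "nat \<Rightarrow> hcset"
      by auto
    from 1 have "dfn M (\<lambda>e. forces \<phi> (e 0) ((\<lambda>i. e (Suc (Suc (Suc i))))(n := e 1)))" unfolding 2 .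
    then have "dfn M (\<lambda>e. \<not> (\<exists>q\<in>mems P. le q (e 1) \<and> forces \<phi> q ((\<lambda>i. e (Suc (Suc i)))(n := e 0))))"
      by (intro dfnI PM) simp
    then have "dfn M (\<lambda>e. \<exists>x\<in>M. \<not> (\<exists>q\<in>mems P. le q (e 0) \<and> forces \<phi> q ((\<lambda>i. e (Suc i))(n := x))))"
      by (intro dfn_ex) simp
    moreover have "range e \<subseteq> M" using FAll.prems by auto
    ultimately show ?thesis by (rule dfn_fix)
  qed
  have *: "\<exists>p\<in>G. forces (FAll n \<phi>) p e \<or> (\<exists>x\<in>M. \<not> (\<exists>q\<in>mems P. le q p \<and> forces \<phi> q (e(n := x))))"
  proof (rule meet)
    show "dfn M (\<lambda>e'. forces (FAll n \<phi>) (e' 0) e \<or> (\<exists>x\<in>M. \<not> (\<exists>q\<in>mems P. le q (e' 0) \<and> forces \<phi> q (e(n := x)))))"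
      by (intro dfn_or dA d1 dtm_var)
    fix p assume p: "p \<epsilon> P"
    show "\<exists>q. q \<epsilon> P \<and> le q p \<and> (forces (FAll n \<phi>) q e \<or> (\<exists>x\<in>M. \<not> (\<exists>q'\<in>mems P. le q' q \<and> forces \<phi> q' (e(n := x)))))"
    proof (cases "forces (FAll n \<phi>) p e")
      case True
      then show ?thesis using p le_refl by blast
    next
      case False
      then obtain x where x: "x \<in> M" "\<not> forces \<phi> p (e(n := x))" by auto
      then obtain r where r: "r \<epsilon> P" "le r p" "\<And>s. s \<epsilon> P \<Longrightarrow> le s r \<Longrightarrow> \<not> forces \<phi> s (e(n := x))"
        using forces_dense[OF p] by blast
      then have "\<not> (\<exists>q'\<in>mems P. le q' r \<and> forces \<phi> q' (e(n := x)))" by auto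
      then show ?thesis using r(1,2) x(1) by blast
    qed
  qed
  show ?case
  proof
    assume L: "ssat MG (\<lambda>i. val (e i)) (FAll n \<phi>)"
    from * obtain p where p: "p \<in> G" "forces (FAll n \<phi>) p e \<or> (\<exists>x\<in>M. \<not> (\<exists>q\<in>mems P. le q p \<and> forces \<phi> q (e(n := x))))" by blast
    have False if x: "x \<in> M" "\<not> (\<exists>q\<in>mems P. le q p \<and> forces \<phi> q (e(n := x)))" for x
    proof -
      have "val x \<in> MG" using x(1) by (simp add: MG_def)
      then have "ssat MG ((\<lambda>i. val (e i))(n := val x)) \<phi>" using L unfolding ssat.simps by blast
      then obtain s where s: "s \<in> G" "forces \<phi> s (e(n := x))" using IH[OF x(1)] by blast
      obtain r where r: "r \<in> G" "le r p" "le r s" using G_dir[OF p(1) s(1)] by blast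
      have "forces \<phi> r (e(n := x))" by (rule forces_mono[OF s(2) G_P[OF r(1)] r(3)])
      moreover have "r \<in> mems P" using G_P[OF r(1)] by simp
      ultimately show False using x(2) r(2) by blast
    qed
    then show "\<exists>p\<in>G. forces (FAll n \<phi>) p e" using p by blast
  next
    assume "\<exists>p\<in>G. forces (FAll n \<phi>) p e"
    then obtain p where p: "p \<in> G" "\<And>x. x \<in> M \<Longrightarrow> forces \<phi> p (e(n := x))" by auto
    show "ssat MG (\<lambda>i. val (e i)) (FAll n \<phi>)" unfolding ssat.simps
    proof
      fix u assume "u \<in> MG"
      then obtain x where x: "x \<in> M" "u = val x" by (auto simp: MG_def)
      then show "ssat MG ((\<lambda>i. val (e i))(n := u)) \<phi>" using IH[OF x(1)] p by blast
    qed
  qed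
qed simp

end

section \<open>The axioms of ZFC in the extension\<close>

lemma eps_minimal:
  assumes "y \<epsilon> x"
  obtains z where "z \<epsilon> x" "\<And>w. w \<epsilon> z \<Longrightarrow> \<not> w \<epsilon> x"
proof -
  have "y \<in> mems x" using assms by simp
  from wfE_min[OF wf_hmem this] obtain z where z: "z \<in> mems x"
    "\<And>w. (w, z) \<in> {(x, y). x \<epsilon> y} \<Longrightarrow> w \<notin> mems x" by blast
  show thesis by (rule that[of z]) (use z in auto)
qed

lemma mem_hpair: "w \<epsilon> hpair x y \<longleftrightarrow> w = upair x x \<or> w = upair x y" by (simp add: hpair_def)

text \<open>All quantifiers are bounded, so membership of a pair is definable in any transitive set,
  even before pairing is known to hold in it.\<close>

lemma hpair_mem_iff: "hpair x y \<epsilon> u \<longleftrightarrow> (\<exists>w\<in>mems u. \<exists>a\<in>mems w. \<exists>b\<in>mems w. (\<forall>z\<in>mems w. z = a \<or> z = b)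
    \<and> (x \<epsilon> a \<and> (\<forall>z\<in>mems a. z = x)) \<and> (x \<epsilon> b \<and> y \<epsilon> b \<and> (\<forall>z\<in>mems b. z = x \<or> z = y)))"
proof
  assume "hpair x y \<epsilon> u"
  then show "\<exists>w\<in>mems u. \<exists>a\<in>mems w. \<exists>b\<in>mems w. (\<forall>z\<in>mems w. z = a \<or> z = b)
    \<and> (x \<epsilon> a \<and> (\<forall>z\<in>mems a. z = x)) \<and> (x \<epsilon> b \<and> y \<epsilon> b \<and> (\<forall>z\<in>mems b. z = x \<or> z = y))"
    by (intro bexI[of _ "hpair x y"] bexI[of _ "upair x x"] bexI[of _ "upair x y"]) (auto simp: mem_hpair)
next
  assume "\<exists>w\<in>mems u. \<exists>a\<in>mems w. \<exists>b\<in>mems w. (\<forall>z\<in>mems w. z = a \<or> z = b)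
    \<and> (x \<epsilon> a \<and> (\<forall>z\<in>mems a. z = x)) \<and> (x \<epsilon> b \<and> y \<epsilon> b \<and> (\<forall>z\<in>mems b. z = x \<or> z = y))"
  then obtain w a b where w: "w \<epsilon> u" "a \<epsilon> w" "b \<epsilon> w" "\<And>z. z \<epsilon> w \<Longrightarrow> z = a \<or> z = b"
    "x \<epsilon> a" "\<And>z. z \<epsilon> a \<Longrightarrow> z = x" "x \<epsilon> b" "y \<epsilon> b" "\<And>z. z \<epsilon> b \<Longrightarrow> z = x \<or> z = y"
    unfolding Ball_def Bex_def in_mems by blast
  have "a = upair x x" by (rule hcset_eqI, unfold mem_upair) (use w(5,6) in blast)
  moreover have "b = upair x y" by (rule hcset_eqI, unfold mem_upair) (use w(7-9) in blast)
  moreover have "w = upair a b" by (rule hcset_eqI, unfold mem_upair) (use w(2-4) in blast)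
  ultimately show "hpair x y \<epsilon> u" using w(1) by (simp add: hpair_def)
qed

context tmodel
begin

lemma dfn_hpair_mem:
  assumes "dtm M t" "dtm M s" "dtm M u" shows "dfn M (\<lambda>e. hpair (t e) (s e) \<epsilon> u e)"
proof (rule dfn_subst3[OF _ assms])
  show "dfn M (\<lambda>e. hpair (e 0) (e 1) \<epsilon> e 2)" unfolding hpair_mem_iff by (intro dfnI)
qed

text \<open>Satisfaction of a formula is a definable predicate: \<open>h\<close> says which
  variables are arguments, and \<open>b\<close> supplies the parameters for the others. The axiom
  schemes thereby reduce to statements about \<open>dfn\<close>.\<close>

lemma dfn_ssat:
  assumes b: "\<And>i. b i \<in> M" and h: "\<And>m n k. h m = Some k \<Longrightarrow> h n = Some k \<Longrightarrow> m = n"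
  shows "dfn M (\<lambda>e. ssat M (\<lambda>n. case h n of None \<Rightarrow> b n | Some k \<Rightarrow> e k) \<phi>)"
proof -
  define f where "f n = (case h n of None \<Rightarrow> 2 * n | Some k \<Rightarrow> Suc (2 * k))" for n
  have "inj f"
  proof (rule injI)
    fix m n assume *: "f m = f n"
    show "m = n"
    proof (cases "h m"; cases "h n")
      fix a assume "h m = None" "h n = Some a"
      then have "2 * m = Suc (2 * a)" using * by (simp add: f_def)
      then show ?thesis by presburger
    next
      fix a assume "h m = Some a" "h n = None"
      then have "Suc (2 * a) = 2 * n" using * by (simp add: f_def)
      then show ?thesis by presburger
    next
      fix a c assume "h m = Some a" "h n = Some c"
      then show ?thesis using * h by (simp add: f_def)
    qed (use * in \<open>simp add: f_def\<close>)
  qed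
  have "merge b e \<circ> f = (\<lambda>n. case h n of None \<Rightarrow> b n | Some k \<Rightarrow> e k)" for e
    by (rule ext) (simp add: f_def merge_def split: option.split)
  then have "ssat M (\<lambda>n. case h n of None \<Rightarrow> b n | Some k \<Rightarrow> e k) \<phi> \<longleftrightarrow> ssat M (merge b e) (ren f \<phi>)" for e
    using \<open>inj f\<close> by (simp add: ssat_ren inj_on_subset[OF _ subset_UNIV] del: comp_apply)
  moreover have "range b \<subseteq> M" using b by auto
  ultimately show ?thesis unfolding dfn_def by blast
qed

text \<open>Sets that are large enough suffice for pairing, union and power set, since separation
  cuts them down to size. In the same way collection with separation gives replacement.\<close>

lemma ctmsI:
  assumes pair: "\<And>x y. x \<in> M \<Longrightarrow> y \<in> M \<Longrightarrow> \<exists>z\<in>M. x \<epsilon> z \<and> y \<epsilon> z"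
    and union: "\<And>x. x \<in> M \<Longrightarrow> \<exists>z\<in>M. \<forall>y u. y \<epsilon> x \<longrightarrow> u \<epsilon> y \<longrightarrow> u \<epsilon> z"
    and pow: "\<And>x. x \<in> M \<Longrightarrow> \<exists>z\<in>M. \<forall>y\<in>M. mems y \<subseteq> mems x \<longrightarrow> y \<epsilon> z"
    and inf: "hom \<in> M"
    and sepM: "\<And>P a. dfn M (\<lambda>e. P (e 0)) \<Longrightarrow> a \<in> M \<Longrightarrow> hset {x \<in> mems a. P x} \<in> M"
    and coll: "\<And>R a. dfn M (\<lambda>e. R (e 0) (e 1)) \<Longrightarrow> a \<in> M \<Longrightarrow>
      \<exists>b\<in>M. \<forall>x y. x \<epsilon> a \<longrightarrow> y \<in> M \<longrightarrow> R y x \<longrightarrow> (\<exists>y. y \<epsilon> b \<and> R y x)"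
    and ch: "\<And>a. a \<in> M \<Longrightarrow> (\<And>b. b \<epsilon> a \<Longrightarrow> \<exists>y. y \<epsilon> b) \<Longrightarrow>
      (\<And>b c z. b \<epsilon> a \<Longrightarrow> c \<epsilon> a \<Longrightarrow> z \<epsilon> b \<Longrightarrow> z \<epsilon> c \<Longrightarrow> b = c) \<Longrightarrow>
      \<exists>t\<in>M. \<forall>b. b \<epsilon> a \<longrightarrow> (\<exists>y. \<forall>z. z \<epsilon> b \<and> z \<epsilon> t \<longleftrightarrow> z = y)"
  shows "M \<in> ctms"
proof -
  have sepE: "\<exists>z\<in>M. \<forall>x. x \<epsilon> z \<longleftrightarrow> x \<epsilon> a \<and> P x" if "dfn M (\<lambda>e. P (e 0))" "a \<in> M" for P a
  proof -
    have "countable {x \<in> mems a. P x}" by (rule countable_subset[OF _ countable_mems[of a]]) blast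
    then show ?thesis using sepM[OF that] by (intro bexI[of _ "hset {x \<in> mems a. P x}"]) simp_all
  qed
  have sat: "ssat M e \<phi>" if \<phi>: "\<phi> \<in> ZFC" and e: "\<And>i. e i \<in> M" for \<phi> e
  proof -
    consider "\<phi> = extensionality_ax" | "\<phi> = foundation_ax" | "\<phi> = pairing_ax" | "\<phi> = union_ax"
      | "\<phi> = powerset_ax" | "\<phi> = infinity_ax" | "\<phi> = choice_ax"
      | \<psi> where "\<phi> = separation_ax \<psi>" "1 \<notin> fv \<psi>"
      | \<psi> where "\<phi> = replacement_ax \<psi>" "1 \<notin> fv \<psi>" "4 \<notin> fv \<psi>"
      using \<phi> unfolding ZFC_def by blast
    then show ?thesis
    proof cases
      case 1
      have "x = y" if "x \<in> M" "y \<in> M" "\<forall>z\<in>M. z \<epsilon> x \<longleftrightarrow> z \<epsilon> y" for x y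
        using extM that by blast
      then show ?thesis unfolding 1 extensionality_ax_def by simp
    next
      case 2
      have "\<exists>y\<in>M. y \<epsilon> x \<and> (\<forall>z\<in>M. z \<epsilon> y \<longrightarrow> \<not> z \<epsilon> x)" if x: "x \<in> M" and y: "y \<epsilon> x" for x y
      proof -
        obtain z where "z \<epsilon> x" "\<And>w. w \<epsilon> z \<Longrightarrow> \<not> w \<epsilon> x" using eps_minimal[OF y] by blast
        then show ?thesis using transM[OF x] by blast
      qed
      then show ?thesis unfolding 2 foundation_ax_def by auto
    next
      case 3
      have "\<exists>z\<in>M. \<forall>w\<in>M. w \<epsilon> z \<longleftrightarrow> w = x \<or> w = y" if xy: "x \<in> M" "y \<in> M" for x y
      proof -
        obtain z where z: "z \<in> M" "x \<epsilon> z" "y \<epsilon> z" using pair[OF xy] by blast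
        have "dfn M (\<lambda>e. e 0 = x \<or> e 0 = y)" by (intro dfnI xy)
        from sepE[of "\<lambda>w. w = x \<or> w = y", OF this z(1)] show ?thesis using z by blast
      qed
      then show ?thesis unfolding 3 pairing_ax_def by simp
    next
      case 4
      have "\<exists>z\<in>M. \<forall>w\<in>M. w \<epsilon> z \<longleftrightarrow> (\<exists>y\<in>M. y \<epsilon> x \<and> w \<epsilon> y)" if x: "x \<in> M" for x
      proof -
        obtain z where z: "z \<in> M" "\<And>y u. y \<epsilon> x \<Longrightarrow> u \<epsilon> y \<Longrightarrow> u \<epsilon> z" using union[OF x] by blast
        have "dfn M (\<lambda>e. \<exists>y\<in>M. y \<epsilon> x \<and> e 0 \<epsilon> y)" by (intro dfnI x)
        from sepE[of "\<lambda>w. \<exists>y\<in>M. y \<epsilon> x \<and> w \<epsilon> y", OF this z(1)] show ?thesis using z(2) by blast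
      qed
      then show ?thesis unfolding 4 union_ax_def by simp
    next
      case 5
      have "\<exists>z\<in>M. \<forall>w\<in>M. w \<epsilon> z \<longleftrightarrow> (\<forall>y\<in>M. y \<epsilon> w \<longrightarrow> y \<epsilon> x)" if x: "x \<in> M" for x
      proof -
        obtain z where z: "z \<in> M" "\<forall>y\<in>M. mems y \<subseteq> mems x \<longrightarrow> y \<epsilon> z" using pow[OF x] by blast
        have "dfn M (\<lambda>e. \<forall>y\<in>M. y \<epsilon> e 0 \<longrightarrow> y \<epsilon> x)" by (intro dfnI x)
        from sepE[of "\<lambda>w. \<forall>y\<in>M. y \<epsilon> w \<longrightarrow> y \<epsilon> x", OF this z(1)]
        obtain z' where z': "z' \<in> M" "\<And>w. w \<epsilon> z' \<longleftrightarrow> w \<epsilon> z \<and> (\<forall>y\<in>M. y \<epsilon> w \<longrightarrow> y \<epsilon> x)" by blast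
        have "w \<epsilon> z" if w: "w \<in> M" "\<forall>y\<in>M. y \<epsilon> w \<longrightarrow> y \<epsilon> x" for w
        proof -
          have "mems w \<subseteq> mems x" using w(2) transM[OF w(1)] unfolding subset_iff in_mems by blast
          then show ?thesis using z(2) w(1) by blast
        qed
        then show ?thesis using z' by blast
      qed
      then show ?thesis unfolding 5 powerset_ax_def by simp
    next
      case 6
      have om: "omega_nat n \<in> M" "omega_nat n \<epsilon> hom" for n using transM[OF inf] by simp_all
      have suc: "\<exists>y\<in>M. y \<epsilon> hom \<and> (\<forall>z\<in>M. z \<epsilon> y \<longleftrightarrow> z \<epsilon> x \<or> z = x)" if x: "x \<epsilon> hom" for x
      proof -
        obtain n where n: "x = omega_nat n" using x unfolding mem_hom by blast
        have "z \<epsilon> omega_nat (Suc n) \<longleftrightarrow> z \<epsilon> x \<or> z = x" for z unfolding n omega_nat_Suc mem_hsucc by blast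
        then show ?thesis using om[of "Suc n"] by blast
      qed
      have "\<not> z \<epsilon> omega_nat 0" for z by (simp add: omega_nat_0)
      then have "\<exists>I\<in>M. (\<exists>y\<in>M. y \<epsilon> I \<and> (\<forall>z\<in>M. \<not> z \<epsilon> y)) \<and>
          (\<forall>x\<in>M. x \<epsilon> I \<longrightarrow> (\<exists>y\<in>M. y \<epsilon> I \<and> (\<forall>z\<in>M. z \<epsilon> y \<longleftrightarrow> z \<epsilon> x \<or> z = x)))"
        using om suc inf by blast
      then show ?thesis unfolding 6 infinity_ax_def by simp
    next
      case 7
      have "\<exists>t\<in>M. \<forall>b\<in>M. b \<epsilon> a \<longrightarrow> (\<exists>y\<in>M. \<forall>z\<in>M. z \<epsilon> b \<and> z \<epsilon> t \<longleftrightarrow> z = y)"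
        if a: "a \<in> M" and ne: "\<forall>b\<in>M. b \<epsilon> a \<longrightarrow> (\<exists>y\<in>M. y \<epsilon> b)"
          and disj: "\<forall>b\<in>M. \<forall>c\<in>M. b \<epsilon> a \<and> c \<epsilon> a \<longrightarrow> (\<exists>z\<in>M. z \<epsilon> b \<and> z \<epsilon> c) \<longrightarrow> b = c" for a
      proof -
        have 1: "\<exists>y. y \<epsilon> b" if "b \<epsilon> a" for b using ne transM[OF a that] that by blast
        have 2: "b = c" if "b \<epsilon> a" "c \<epsilon> a" "z \<epsilon> b" "z \<epsilon> c" for b c z
          using disj transM[OF a that(1)] transM[OF a that(2)] transM[OF transM[OF a that(1)] that(3)] that by blast
        have "\<exists>t\<in>M. \<forall>b. b \<epsilon> a \<longrightarrow> (\<exists>y. \<forall>z. z \<epsilon> b \<and> z \<epsilon> t \<longleftrightarrow> z = y)"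
        proof (rule ch[OF a])
          show "\<exists>y. y \<epsilon> b" if "b \<epsilon> a" for b using 1 that .
          show "b = c" if "b \<epsilon> a" "c \<epsilon> a" "z \<epsilon> b" "z \<epsilon> c" for b c z using 2 that by blast
        qed
        then obtain t where t: "t \<in> M" "\<And>b. b \<epsilon> a \<Longrightarrow> \<exists>y. \<forall>z. z \<epsilon> b \<and> z \<epsilon> t \<longleftrightarrow> z = y"
          by blast
        show ?thesis
        proof (rule bexI[OF _ t(1)], intro ballI impI)
          fix b assume b: "b \<in> M" "b \<epsilon> a"
          obtain y where y: "\<And>z. z \<epsilon> b \<and> z \<epsilon> t \<longleftrightarrow> z = y" using t(2)[OF b(2)] by blast
          then have "y \<epsilon> b" by blast
          then show "\<exists>y\<in>M. \<forall>z\<in>M. z \<epsilon> b \<and> z \<epsilon> t \<longleftrightarrow> z = y" using y transM[OF b(1)] by blast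
        qed
      qed
      then show ?thesis unfolding 7 choice_ax_def by simp
    next
      case (8 \<psi>)
      define h :: "nat \<Rightarrow> nat option" where "h n = (if n = 2 then Some 0 else None)" for n
      have "\<exists>z\<in>M. \<forall>x\<in>M. x \<epsilon> z \<longleftrightarrow> x \<epsilon> a \<and> ssat M (e(0 := a, 1 := z, 2 := x)) \<psi>" if a: "a \<in> M" for a
      proof -
        have "dfn M (\<lambda>e'. ssat M (\<lambda>n. case h n of None \<Rightarrow> (e(0 := a)) n | Some k \<Rightarrow> e' k) \<psi>)"
          by (rule dfn_ssat) (use a e in \<open>auto simp: h_def split: if_splits\<close>)
        moreover have "ssat M (\<lambda>n. case h n of None \<Rightarrow> (e(0 := a)) n | Some k \<Rightarrow> e' k) \<psi> \<longleftrightarrow> ssat M (e(0 := a, 1 := z, 2 := e' 0)) \<psi>" for e' z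
          by (rule ssat_cong_fv) (use 8(2) in \<open>auto simp: h_def\<close>)
        ultimately have "dfn M (\<lambda>e'. ssat M (e(0 := a, 1 := a, 2 := e' 0)) \<psi>)" by simp
        from sepE[of "\<lambda>x. ssat M (e(0 := a, 1 := a, 2 := x)) \<psi>", OF this a]
        obtain z where z: "z \<in> M" "\<And>x. x \<epsilon> z \<longleftrightarrow> x \<epsilon> a \<and> ssat M (e(0 := a, 1 := a, 2 := x)) \<psi>" by blast
        have "ssat M (e(0 := a, 1 := a, 2 := x)) \<psi> \<longleftrightarrow> ssat M (e(0 := a, 1 := z, 2 := x)) \<psi>" for x
          by (rule ssat_cong_fv) (use 8(2) in auto)
        then show ?thesis using z by blast
      qed
      then show ?thesis unfolding 8(1) separation_ax_def by simp
    next
      case (9 \<psi>)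
      define h :: "nat \<Rightarrow> nat option" where "h n = (if n = 2 then Some 1 else if n = 3 then Some 0 else None)" for n
      have "\<exists>z\<in>M. \<forall>y\<in>M. y \<epsilon> z \<longleftrightarrow> (\<exists>x\<in>M. x \<epsilon> a \<and> ssat M (e(0 := a, 1 := z, 3 := y, 2 := x)) \<psi>)"
        if a: "a \<in> M" and fn: "\<forall>x\<in>M. x \<epsilon> a \<longrightarrow> (\<exists>w\<in>M. \<forall>y\<in>M. ssat M (e(0 := a, 2 := x, 4 := w, 3 := y)) \<psi> \<longleftrightarrow> y = w)" for a
      proof -
        define R where "R y x \<longleftrightarrow> ssat M (\<lambda>n. case h n of None \<Rightarrow> (e(0 := a)) n | Some k \<Rightarrow> (if k = 0 then y else x)) \<psi>" for y x
        have R1: "R y x \<longleftrightarrow> ssat M (e(0 := a, 2 := x, 4 := w, 3 := y)) \<psi>" for y x w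
          unfolding R_def by (rule ssat_cong_fv) (use 9(3) in \<open>auto simp: h_def\<close>)
        have R2: "R y x \<longleftrightarrow> ssat M (e(0 := a, 1 := z, 3 := y, 2 := x)) \<psi>" for y x z
          unfolding R_def by (rule ssat_cong_fv) (use 9(2) in \<open>auto simp: h_def\<close>)
        have dR0: "dfn M (\<lambda>e'. ssat M (\<lambda>n. case h n of None \<Rightarrow> (e(0 := a)) n | Some k \<Rightarrow> e' k) \<psi>)"
          by (rule dfn_ssat) (use a e in \<open>auto simp: h_def split: if_splits\<close>)
        have "ssat M (\<lambda>n. case h n of None \<Rightarrow> (e(0 := a)) n | Some k \<Rightarrow> e' k) \<psi> \<longleftrightarrow> R (e' 0) (e' 1)" for e'
          unfolding R_def by (rule ssat_cong_fv) (auto simp: h_def)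
        then have dR: "dfn M (\<lambda>e'. R (e' 0) (e' 1))" using dR0 by simp
        obtain b where b: "b \<in> M" "\<And>x y. x \<epsilon> a \<Longrightarrow> y \<in> M \<Longrightarrow> R y x \<Longrightarrow> \<exists>y. y \<epsilon> b \<and> R y x"
          using coll[OF dR a] by blast
        have "dfn M (\<lambda>e'. \<exists>x\<in>mems a. R (e' 0) x)"
          by (intro dfnI a dfn_subst2[OF dR])
        from sepE[of "\<lambda>y. \<exists>x\<in>mems a. R y x", OF this b(1)]
        obtain z where z: "z \<in> M" "\<And>y. y \<epsilon> z \<longleftrightarrow> y \<epsilon> b \<and> (\<exists>x. x \<epsilon> a \<and> R y x)" unfolding Bex_def in_mems by blast
        have "y \<epsilon> z \<longleftrightarrow> (\<exists>x\<in>M. x \<epsilon> a \<and> R y x)" if yM: "y \<in> M" for y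
        proof
          assume "y \<epsilon> z"
          then show "\<exists>x\<in>M. x \<epsilon> a \<and> R y x" using z(2) transM[OF a] by blast
        next
          assume "\<exists>x\<in>M. x \<epsilon> a \<and> R y x"
          then obtain x where x: "x \<in> M" "x \<epsilon> a" "R y x" by blast
          obtain w where w: "\<And>y. y \<in> M \<Longrightarrow> R y x \<longleftrightarrow> y = w" using fn[unfolded R1[symmetric]] x by blast
          obtain y' where y': "y' \<epsilon> b" "R y' x" using b(2)[OF x(2) yM x(3)] by blast
          have "y' = y" using w[OF transM[OF b(1) y'(1)]] w[OF yM] y'(2) x(3) by simp
          then show "y \<epsilon> z" using z(2) y' x by blast
        qed
        then show ?thesis using z(1) R2 by blast
      qed
      then show ?thesis unfolding 9(1) replacement_ax_def by simp
    qed
  qed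
  have "ssat M e \<phi>" if "\<phi> \<in> ZFC" "range e \<subseteq> M" for \<phi> e
    by (rule sat[OF that(1)]) (use that(2) in auto)
  then have "models_ZFC M" unfolding models_ZFC_def using nonemptyM by blast
  moreover have "transitive_set M" unfolding transitive_set_def using transM by blast
  ultimately show ?thesis unfolding ctms_def using countableM by blast
qed

end

context generic
begin

lemma val_in [simp]: "x \<in> M \<Longrightarrow> val x \<in> MG" by (simp add: MG_def)

lemma MG_tmodel: "tmodel MG"
proof
  show "y \<in> MG" if x: "x \<in> MG" and y: "y \<epsilon> x" for x y
  proof -
    obtain n where n: "n \<in> M" "x = val n" using x by (auto simp: MG_def)
    then obtain m p where "hpair m p \<epsilon> n" "y = val m" using y unfolding n(2) mem_val by blast
    then show ?thesis using pair_mem_in[OF n(1)] by simp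
  qed
  show "countable MG" unfolding MG_def using countableM by simp
  show "MG \<noteq> {}" unfolding MG_def using nonemptyM by simp
qed

lemma dfn_forces3:
  assumes K: "\<And>i. K i \<in> M" and t: "dtm M t" "dtm M s" "dtm M u"
  shows "dfn M (\<lambda>e. forces \<phi> (u e) (K(3 := s e, 1 := t e)))"
proof (rule dfn_subst3[OF _ t])
  define f where "f k = (case k of 0 \<Rightarrow> 5 | Suc i \<Rightarrow> if i = 3 then 3 else if i = 1 then 1 else 2 * i)" for k :: nat
  define h where "h m = (if m = 5 then 0 else if m = 3 then 4 else if m = 1 then 2 else Suc (m div 2))" for m :: nat
  have odd: "2 * i \<noteq> 5" "2 * i \<noteq> 3" "2 * i \<noteq> Suc 0" for i :: nat by presburger+
  have "h (f k) = k" for k by (cases k) (auto simp: f_def h_def odd)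
  then have "inj f" by (metis injI)
  from dfn_ren[OF dfn_forces this, of \<phi>]
  have 1: "dfn M (\<lambda>e. forces \<phi> (e 5) (\<lambda>i. e (if i = 3 then 3 else if i = 1 then 1 else 2 * i)))" by (simp add: f_def)
  have "range K \<subseteq> M" using K by auto
  from dfn_merge[OF 1 this]
  have "dfn M (\<lambda>e. forces \<phi> (merge K e 5) (\<lambda>i. merge K e (if i = 3 then 3 else if i = 1 then 1 else 2 * i)))" .
  moreover have "(\<lambda>i. merge K e (if i = 3 then 3 else if i = 1 then 1 else 2 * i)) = K(3 := e 1, 1 := e 0)"
    "merge K e 5 = e 2" for e
    by (auto simp: merge_def)
  ultimately show "dfn M (\<lambda>e. forces \<phi> (e 2) (K(3 := e 1, 1 := e 0)))" by (simp only:)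
qed

text \<open>Truth lemma and definability of forcing packed together: a relation definable in the
  extension is governed by a relation \<open>F\<close> between names and conditions that is
  definable in \<open>M\<close> and persists to stronger conditions. The two arguments occupy
  variables 1 and 3, as \<open>merge\<close> prescribes, and names of the parameters the even
  ones.\<close>

lemma dfn_MG:
  assumes "dfn MG (\<lambda>e. R (e 0) (e 1))"
  obtains F where "\<And>t s u. dtm M t \<Longrightarrow> dtm M s \<Longrightarrow> dtm M u \<Longrightarrow> dfn M (\<lambda>e. F (t e) (s e) (u e))"
    "\<And>y x. y \<in> M \<Longrightarrow> x \<in> M \<Longrightarrow> R (val y) (val x) \<longleftrightarrow> (\<exists>p\<in>G. F y x p)"
    "\<And>y x p q. F y x p \<Longrightarrow> q \<epsilon> P \<Longrightarrow> le q p \<Longrightarrow> F y x q"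
proof -
  obtain \<phi> a where a: "range a \<subseteq> MG" "\<And>e. range e \<subseteq> MG \<Longrightarrow> R (e 0) (e 1) \<longleftrightarrow> ssat MG (merge a e) \<phi>"
    using assms unfolding dfn_def by blast
  have "\<forall>i. \<exists>n. n \<in> M \<and> a i = val n" using a(1) unfolding MG_def by blast
  then obtain an where an: "\<And>i. an i \<in> M" "\<And>i. a i = val (an i)" by metis
  define K where "K = merge an (\<lambda>_. hempty)"
  have KM: "K i \<in> M" for i unfolding K_def merge_def using an by simp
  show thesis
  proof (rule that[of "\<lambda>y x p. forces \<phi> p (K(3 := x, 1 := y))"])
    show "dfn M (\<lambda>e. forces \<phi> (u e) (K(3 := s e, 1 := t e)))" if "dtm M t" "dtm M s" "dtm M u" for t s u
      by (rule dfn_forces3[OF KM that])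
    show "forces \<phi> q (K(3 := x, 1 := y))"
      if "forces \<phi> p (K(3 := x, 1 := y))" "q \<epsilon> P" "le q p" for y x p q
      by (rule forces_mono[OF that])
    fix y x assume yx: "y \<in> M" "x \<in> M"
    define e where "e i = (if i = 0 then val y else if i = 1 then val x else val hempty)" for i :: nat
    have "range e \<subseteq> MG" using yx by (auto simp: e_def)
    from a(2)[OF this] have "R (val y) (val x) \<longleftrightarrow> ssat MG (merge a e) \<phi>" by (simp add: e_def)
    also have "merge a e = (\<lambda>i. val ((K(3 := x, 1 := y)) i))"
    proof
      fix i show "merge a e i = val ((K(3 := x, 1 := y)) i)"
        by (cases "even i") (auto simp: merge_def e_def K_def an(2) elim!: oddE)
    qed
    also have "ssat MG (\<lambda>i. val ((K(3 := x, 1 := y)) i)) \<phi> \<longleftrightarrow> (\<exists>p\<in>G. forces \<phi> p (K(3 := x, 1 := y)))"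
      by (rule truth) (use KM yx in auto)
    finally show "R (val y) (val x) \<longleftrightarrow> (\<exists>p\<in>G. forces \<phi> p (K(3 := x, 1 := y)))" .
  qed
qed

end

lemma hmem_sep: "x \<epsilon> hset {z \<in> mems a. Q z} \<longleftrightarrow> x \<epsilon> a \<and> Q x"
proof -
  have "countable {z \<in> mems a. Q z}" by (rule countable_subset[OF _ countable_mems[of a]]) blast
  then show ?thesis by simp
qed

lemma hpair_in_dom: "hpair n p \<epsilon> hprod (hset (hfst ` mems A)) P \<longleftrightarrow> n \<in> hfst ` mems A \<and> p \<epsilon> P"
  by auto

context generic
begin

interpretation N: tmodel MG by (rule MG_tmodel)

lemma MG_E: "x \<in> MG \<Longrightarrow> \<exists>n\<in>M. x = val n" by (auto simp: MG_def)

text \<open>A name for the subset consists of the pairs of a name \<open>n\<close> from the domain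
  of \<open>A\<close> and a condition that forces \<open>n\<close> into \<open>A\<close> and extends
  one forcing \<open>Q\<close>.\<close>

lemma sepG:
  assumes d: "dfn MG (\<lambda>e. Q (e 0))" and a: "a \<in> MG"
  shows "hset {x \<in> mems a. Q x} \<in> MG"
proof -
  obtain A where A: "A \<in> M" "a = val A" using MG_E[OF a] by blast
  obtain F where F: "\<And>t s u. dtm M t \<Longrightarrow> dtm M s \<Longrightarrow> dtm M u \<Longrightarrow> dfn M (\<lambda>e. F (t e) (s e) (u e))"
    "\<And>y x. y \<in> M \<Longrightarrow> x \<in> M \<Longrightarrow> Q (val y) \<longleftrightarrow> (\<exists>p\<in>G. F y x p)"
    by (rule dfn_MG[of "\<lambda>y x. Q y"]) (use d in blast)+
  define dm where "dm = hprod (hset (hfst ` mems A)) P"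
  have "dtm M (\<lambda>e. hprod (hset ((\<lambda>w. hfst w) ` mems (e 0))) P)" by (intro dfnI PM)
  from dtm_closed[OF this, of "\<lambda>_. A"] A(1) have dmM: "dm \<in> M" by (simp add: dm_def)
  define B where "B = hset {w \<in> mems dm. fmem (hsnd w) (hfst w) A
    \<and> (\<exists>q\<in>mems P. le (hsnd w) q \<and> F (hfst w) hempty q)}"
  have BM: "B \<in> M" unfolding B_def
    by (rule sep[OF _ dmM]) (intro dfnI F PM A(1) hempty_in)
  have memB: "hpair n p \<epsilon> B \<longleftrightarrow> n \<in> hfst ` mems A \<and> p \<epsilon> P \<and> fmem p n A \<and> (\<exists>q\<in>mems P. le p q \<and> F n hempty q)" for n p
    unfolding B_def hmem_sep dm_def hpair_in_dom hfst_hpair hsnd_hpair by blast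
  have "val B = hset {x \<in> mems a. Q x}"
  proof (rule hcset_eqI, rule iffI)
    fix u assume "u \<epsilon> val B"
    then obtain n p where n: "hpair n p \<epsilon> B" "p \<in> G" "u = val n" unfolding mem_val by blast
    have nM: "n \<in> M" using pair_mem_in[OF BM n(1)] by simp
    have "fmem p n A" using n(1) memB by blast
    then have "u \<epsilon> a" using truth_mem[OF nM A(1)] n(2,3) A(2) by blast
    moreover have "Q u"
    proof -
      obtain q where "q \<epsilon> P" "le p q" "F n hempty q" using n(1) memB by auto
      then show ?thesis using F(2)[OF nM hempty_in] G_up[OF n(2)] n(3) by blast
    qed
    ultimately show "u \<epsilon> hset {x \<in> mems a. Q x}" by simp
  next
    fix u assume "u \<epsilon> hset {x \<in> mems a. Q x}"
    then have u: "u \<epsilon> val A" "Q u" using A(2) by simp_all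
    then obtain n p where n: "hpair n p \<epsilon> A" "p \<in> G" "u = val n" unfolding mem_val by blast
    have nM: "n \<in> M" using pair_mem_in[OF A(1) n(1)] by simp
    obtain q where q: "q \<in> G" "F n hempty q" using F(2)[OF nM hempty_in] u(2) n(3) by blast
    obtain r where r: "r \<in> G" "fmem r n A" using truth_mem[OF nM A(1)] u(1) n(3) by blast
    obtain s where s: "s \<in> G" "le s q" "le s r" using G_dir[OF q(1) r(1)] by blast
    have "fmem s n A" using r(2) s le_trans[OF _ s(3)] unfolding fmem_def by blast
    moreover have "n \<in> hfst ` mems A" using n(1) by (intro image_eqI[of _ _ "hpair n p"]) simp_all
    moreover have "q \<in> mems P" using G_P[OF q(1)] by simp
    ultimately have "hpair n s \<epsilon> B" using memB G_P[OF s(1)] s(2) q(2) by blast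
    then show "u \<epsilon> val B" using mem_valI s(1) n(3) by blast
  qed
  then show ?thesis using BM val_in by metis
qed

text \<open>A name for the set of all values of names in \<open>b\<close>: whenever a family of sets
  has its names in one set of \<open>M\<close>, this bounds the family in the extension.\<close>

definition allnames :: "hcset \<Rightarrow> hcset" where "allnames b = hprod b (upair hempty hempty)"

lemma allnames_in: "b \<in> M \<Longrightarrow> allnames b \<in> M" by (simp add: allnames_def)

lemma mem_val_allnames: "u \<epsilon> val (allnames b) \<longleftrightarrow> (\<exists>n. n \<epsilon> b \<and> u = val n)"
  unfolding mem_val by (auto simp: allnames_def G_one)

text \<open>Collection in \<open>M\<close>, applied to pairs of a name and a condition, finds a set
  of names among which every required witness has a representative.\<close>

lemma collG:
  assumes d: "dfn MG (\<lambda>e. R (e 0) (e 1))" and a: "a \<in> MG"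
  shows "\<exists>b\<in>MG. \<forall>x y. x \<epsilon> a \<longrightarrow> y \<in> MG \<longrightarrow> R y x \<longrightarrow> (\<exists>y. y \<epsilon> b \<and> R y x)"
proof -
  obtain A where A: "A \<in> M" "a = val A" using MG_E[OF a] by blast
  obtain F where F: "\<And>t s u. dtm M t \<Longrightarrow> dtm M s \<Longrightarrow> dtm M u \<Longrightarrow> dfn M (\<lambda>e. F (t e) (s e) (u e))"
    "\<And>y x. y \<in> M \<Longrightarrow> x \<in> M \<Longrightarrow> R (val y) (val x) \<longleftrightarrow> (\<exists>p\<in>G. F y x p)"
    by (rule dfn_MG[OF d]) blast
  define dm where "dm = hprod (hset (hfst ` mems A)) P"
  have "dtm M (\<lambda>e. hprod (hset ((\<lambda>w. hfst w) ` mems (e 0))) P)" by (intro dfnI PM)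
  from dtm_closed[OF this, of "\<lambda>_. A"] A(1) have dmM: "dm \<in> M" by (simp add: dm_def)
  have "dfn M (\<lambda>e. F (e 0) (hfst (e 1)) (hsnd (e 1)))" by (intro F dfnI)
  from collection[of "\<lambda>y w. F y (hfst w) (hsnd w)", OF this dmM]
  obtain b where b: "b \<in> M" "\<And>w y. w \<epsilon> dm \<Longrightarrow> y \<in> M \<Longrightarrow> F y (hfst w) (hsnd w) \<Longrightarrow> \<exists>y. y \<epsilon> b \<and> F y (hfst w) (hsnd w)"
    by blast
  show ?thesis
  proof (rule bexI[OF _ val_in[OF allnames_in[OF b(1)]]], intro allI impI)
    fix x y assume *: "x \<epsilon> a" "y \<in> MG" "R y x"
    obtain n p where n: "hpair n p \<epsilon> A" "x = val n" using *(1) unfolding A(2) mem_val by blast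
    have nM: "n \<in> M" using pair_mem_in[OF A(1) n(1)] by simp
    obtain m where m: "m \<in> M" "y = val m" using MG_E[OF *(2)] by blast
    obtain q where q: "q \<in> G" "F m n q" using F(2)[OF m(1) nM] *(3) m(2) n(2) by blast
    have "n \<in> hfst ` mems A" using n(1) by (intro image_eqI[of _ _ "hpair n p"]) simp_all
    then have "hpair n q \<epsilon> dm" using G_P[OF q(1)] unfolding dm_def hpair_in_dom by blast
    from b(2)[OF this m(1)] q(2) obtain m' where m': "m' \<epsilon> b" "F m' n q" by auto
    then have "R (val m') x" using F(2)[OF transM[OF b(1) m'(1)] nM] q(1) n(2) by blast
    moreover have "val m' \<epsilon> val (allnames b)" using m'(1) mem_val_allnames by blast
    ultimately show "\<exists>y. y \<epsilon> val (allnames b) \<and> R y x" by blast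
  qed
qed

lemma val_upair: "val (upair (hpair x hempty) (hpair y hempty)) = upair (val x) (val y)"
  by (rule hcset_eqI) (simp add: mem_val, use G_one in blast)

definition opn :: "hcset \<Rightarrow> hcset \<Rightarrow> hcset" where
  "opn x y = (let u = (\<lambda>x y. upair (hpair x hempty) (hpair y hempty)) in u (u x x) (u x y))"

lemma val_opn [simp]: "val (opn x y) = hpair (val x) (val y)"
  by (simp add: opn_def val_upair hpair_def[of "val x"])

lemma opn_in [simp]: "x \<in> M \<Longrightarrow> y \<in> M \<Longrightarrow> opn x y \<in> M" by (simp add: opn_def)

lemma dtm_opn: "dtm M t \<Longrightarrow> dtm M s \<Longrightarrow> dtm M (\<lambda>e. opn (t e) (s e))"
  unfolding opn_def Let_def by (intro dfnI hempty_in)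

text \<open>The check names, the canonical names of sets of the ground model.\<close>

definition chk :: "hcset \<Rightarrow> hcset" where
  "chk = (SOME F. \<forall>x. F x = hset ((\<lambda>v. hpair v hempty) ` mems (Rng (hgraph F (mems x)))))"

lemma chk_eq': "chk x = hset ((\<lambda>v. hpair v hempty) ` mems (Rng (hgraph chk (mems x))))"
proof -
  have "\<exists>F. \<forall>x. F x = hset ((\<lambda>v. hpair v hempty) ` mems (Rng (hgraph F (mems x))))"
    by (rule eps_rec_exists[of "\<lambda>x f. hset ((\<lambda>v. hpair v hempty) ` mems (Rng f))"])
  from someI_ex[OF this] show ?thesis unfolding chk_def by blast
qed

lemma chk_eq: "chk x = hset ((\<lambda>y. hpair (chk y) hempty) ` mems x)"
  by (subst chk_eq') (simp add: Rng_hgraph image_image)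

lemma chk_rec:
  shows "x \<in> M \<Longrightarrow> chk x \<in> M" "dtm M t \<Longrightarrow> dtm M (\<lambda>e. chk (t e))"
proof -
  define H where "H x f = hset ((\<lambda>v. hpair v hempty) ` mems (Rng f))" for x f :: hcset
  have 1: "dtm M (\<lambda>e. H (e 1) (e 2))" unfolding H_def by (intro dfnI hempty_in)
  have 2: "H x f \<in> M" if "x \<in> M" "f \<in> M" for x f
    using dtm_closed[OF 1, of "\<lambda>i. if i = 1 then x else f"] that by simp
  have 3: "dfn M (\<lambda>e. e 0 = H (e 1) (e 2))" unfolding H_def by (intro dfnI hempty_in)
  have 4: "chk x = H x (hgraph chk (mems x))" for x unfolding H_def by (rule chk_eq')
  show "chk x \<in> M" if x: "x \<in> M" for x
    by (rule eps_recursion(1)[of H chk]) (fact 2 3 x | rule 4)+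
  show "dtm M (\<lambda>e. chk (t e))" if t: "dtm M t" for t
    by (rule eps_recursion(2)[of H chk]) (fact 2 3 t | rule 4)+
qed

lemma val_chk [simp]: "val (chk x) = x"
proof (induction x rule: hmem_induct)
  case (1 x)
  have "hpair n p \<epsilon> chk x \<longleftrightarrow> p = hempty \<and> (\<exists>y. y \<epsilon> x \<and> n = chk y)" for n p
    by (subst chk_eq) auto
  then have "u \<epsilon> val (chk x) \<longleftrightarrow> (\<exists>y. y \<epsilon> x \<and> u = val (chk y))" for u
    unfolding mem_val using G_one by auto
  then show ?case using 1 by (intro hcset_eqI) auto
qed

lemma M_subset_MG: "M \<subseteq> MG"
proof
  fix x assume "x \<in> M"
  from val_in[OF chk_rec(1)[OF this]] show "x \<in> MG" by simp
qed

lemma G_in_MG: "hset G \<in> MG"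
proof -
  have "dtm M (\<lambda>e. hset ((\<lambda>p. hpair (chk p) p) ` mems P))" by (intro dfnI chk_rec PM)
  from dtm_closed[OF this, of "\<lambda>_. P"] have 1: "hset ((\<lambda>p. hpair (chk p) p) ` mems P) \<in> M" by simp
  have "val (hset ((\<lambda>p. hpair (chk p) p) ` mems P)) = hset G"
    by (rule hcset_eqI) (use G_P in \<open>force simp: mem_val countable_G\<close>)
  then show ?thesis using val_in[OF 1] by simp
qed

text \<open>Every element of a member of \<open>a\<close> has a name in the transitive closure
  \<open>T\<close> of the name \<open>A\<close>. A well-ordering of \<open>T\<close> in
  \<open>M\<close> becomes an enumeration \<open>k\<close> of values in the extension, and from each
  member the element with the least index is selected.\<close>

lemma choiceG:
  assumes a: "a \<in> MG" and ne: "\<And>b. b \<epsilon> a \<Longrightarrow> \<exists>y. y \<epsilon> b"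
    and disj: "\<And>b c z. b \<epsilon> a \<Longrightarrow> c \<epsilon> a \<Longrightarrow> z \<epsilon> b \<Longrightarrow> z \<epsilon> c \<Longrightarrow> b = c"
  shows "\<exists>t\<in>MG. \<forall>b. b \<epsilon> a \<longrightarrow> (\<exists>y. \<forall>z. z \<epsilon> b \<and> z \<epsilon> t \<longleftrightarrow> z = y)"
proof -
  obtain A where A: "A \<in> M" "a = val A" using MG_E[OF a] by blast
  define T where "T = hset (tcset A)"
  have TM: "T \<in> M" unfolding T_def by (rule tc_in[OF A(1)])
  have inT: "\<exists>n. n \<epsilon> T \<and> u = val n" if b: "b \<epsilon> a" and u: "u \<epsilon> b" for b u
  proof -
    obtain n p where n: "hpair n p \<epsilon> A" "b = val n" using b unfolding A(2) mem_val by blast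
    obtain m q where m: "hpair m q \<epsilon> n" "u = val m" using u unfolding n(2) mem_val by blast
    have "m \<in> tcset A" using dom_in_tcset[OF m(1) dom_in_tcset[OF n(1) tcset_refl]] .
    then show ?thesis using m(2) A(1) by (auto simp: T_def)
  qed
  obtain \<alpha> f where \<alpha>: "\<alpha> \<in> M" "Ord \<alpha>" "f \<in> M" "bij_betw (happ f) (mems \<alpha>) (mems T)"
    using wellorder[OF TM] by blast
  define kn where "kn = hset ((\<lambda>\<beta>. hpair (opn (chk \<beta>) (happ f \<beta>)) hempty) ` mems \<alpha>)"
  have "dtm M (\<lambda>e. hset ((\<lambda>\<beta>. hpair (opn (chk \<beta>) (happ f \<beta>)) hempty) ` mems \<alpha>))"
    by (intro dfnI dtm_opn chk_rec \<alpha> hempty_in)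
  from dtm_closed[OF this, of "\<lambda>_. \<alpha>"] \<alpha>(1) have knM: "kn \<in> M" by (simp add: kn_def)
  define k where "k = val kn"
  have kG: "k \<in> MG" unfolding k_def by (rule val_in[OF knM])
  have memk: "w \<epsilon> k \<longleftrightarrow> (\<exists>\<beta>. \<beta> \<epsilon> \<alpha> \<and> w = hpair \<beta> (val (happ f \<beta>)))" for w
  proof -
    have "hpair n p \<epsilon> kn \<longleftrightarrow> p = hempty \<and> (\<exists>\<beta>. \<beta> \<epsilon> \<alpha> \<and> n = opn (chk \<beta>) (happ f \<beta>))" for n p
      by (auto simp: kn_def)
    then show ?thesis unfolding k_def mem_val using G_one by auto
  qed
  define V where "V = val (allnames T)"
  have VG: "V \<in> MG" unfolding V_def by (rule val_in[OF allnames_in[OF TM]])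
  have \<alpha>G: "\<alpha> \<in> MG" using \<alpha>(1) M_subset_MG by blast
  define Q where "Q u \<longleftrightarrow> (\<exists>b\<in>mems a. u \<epsilon> b \<and> (\<exists>\<beta>\<in>mems \<alpha>. hpair \<beta> u \<epsilon> k \<and>
      (\<forall>\<gamma>\<in>mems \<beta>. \<forall>v\<in>mems V. hpair \<gamma> v \<epsilon> k \<longrightarrow> \<not> v \<epsilon> b)))" for u
  have "dfn MG (\<lambda>e. Q (e 0))" unfolding Q_def by (intro dfnI N.dfn_hpair_mem a \<alpha>G VG kG)
  then have tG: "hset {u \<in> mems V. Q u} \<in> MG" by (rule sepG[OF _ VG])
  show ?thesis
  proof (rule bexI[OF _ tG], intro allI impI)
    fix b assume b: "b \<epsilon> a"
    have idx: "\<exists>\<beta>. \<beta> \<epsilon> \<alpha> \<and> u = val (happ f \<beta>)" if u: "u \<epsilon> b" for u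
    proof -
      obtain n where n: "n \<in> mems T" "u = val n" using inT[OF b u] by auto
      then obtain \<beta> where "\<beta> \<in> mems \<alpha>" "n = happ f \<beta>" using \<alpha>(4) unfolding bij_betw_def by blast
      then show ?thesis using n(2) by auto
    qed
    obtain u0 where "u0 \<epsilon> b" using ne[OF b] by blast
    then obtain \<beta>0 where \<beta>0: "\<beta>0 \<epsilon> \<alpha>" "val (happ f \<beta>0) \<epsilon> b" using idx by blast
    have "Ord \<beta>0" using Ord_mem[OF \<alpha>(2) \<beta>0(1)] .
    then obtain \<beta> where \<beta>: "\<beta> \<epsilon> \<alpha> \<and> val (happ f \<beta>) \<epsilon> b" "\<And>\<gamma>. \<gamma> \<epsilon> \<beta> \<Longrightarrow> \<not> (\<gamma> \<epsilon> \<alpha> \<and> val (happ f \<gamma>) \<epsilon> b)"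
      using Ord_least[of "\<lambda>\<beta>. \<beta> \<epsilon> \<alpha> \<and> val (happ f \<beta>) \<epsilon> b" \<beta>0] \<beta>0 by blast
    have Vmem: "val (happ f \<gamma>) \<epsilon> V" if "\<gamma> \<epsilon> \<alpha>" for \<gamma>
    proof -
      have "happ f \<gamma> \<epsilon> T" using \<alpha>(4) that unfolding bij_betw_def by auto
      then show ?thesis unfolding V_def mem_val_allnames by blast
    qed
    have k_iff: "hpair \<gamma> v \<epsilon> k \<longleftrightarrow> \<gamma> \<epsilon> \<alpha> \<and> v = val (happ f \<gamma>)" for \<gamma> v unfolding memk by auto
    have sub: "\<gamma> \<epsilon> \<alpha>" if "\<gamma> \<epsilon> \<delta>" "\<delta> \<epsilon> \<alpha>" for \<gamma> \<delta> using Ord_trans[OF \<alpha>(2) that(2,1)] .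
    have "z \<epsilon> b \<and> Q z \<and> z \<epsilon> V \<longleftrightarrow> z = val (happ f \<beta>)" for z
    proof
      assume z: "z \<epsilon> b \<and> Q z \<and> z \<epsilon> V"
      then obtain b' \<delta> where b': "b' \<epsilon> a" "z \<epsilon> b'" "\<delta> \<epsilon> \<alpha>" "z = val (happ f \<delta>)"
        "\<And>\<gamma> v. \<gamma> \<epsilon> \<delta> \<Longrightarrow> v \<epsilon> V \<Longrightarrow> hpair \<gamma> v \<epsilon> k \<Longrightarrow> \<not> v \<epsilon> b'"
        unfolding Q_def k_iff Bex_def Ball_def in_mems by blast
      have eq: "b' = b" using disj[OF b'(1) b b'(2)] z by blast
      have "\<not> \<beta> \<epsilon> \<delta>" using b'(5)[of \<beta>] \<beta>(1) Vmem k_iff eq by blast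
      moreover have "\<not> \<delta> \<epsilon> \<beta>" using \<beta>(2) b'(3,4) z by blast
      ultimately have "\<delta> = \<beta>" using Ord_linear[OF Ord_mem[OF \<alpha>(2) b'(3)] Ord_mem[OF \<alpha>(2) conjunct1[OF \<beta>(1)]]] by blast
      then show "z = val (happ f \<beta>)" using b'(4) by simp
    next
      assume z: "z = val (happ f \<beta>)"
      have "Q z" unfolding Q_def k_iff Bex_def Ball_def in_mems
        using b \<beta> z sub by blast
      then show "z \<epsilon> b \<and> Q z \<and> z \<epsilon> V" using \<beta>(1) Vmem z by blast
    qed
    moreover have "countable {u \<in> mems V. Q u}" by (rule countable_subset[OF _ countable_mems[of V]]) blast
    ultimately have "z \<epsilon> b \<and> z \<epsilon> hset {u \<in> mems V. Q u} \<longleftrightarrow> z = val (happ f \<beta>)" for z by (simp add: conj_commute)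
    then show "\<exists>y. \<forall>z. z \<epsilon> b \<and> z \<epsilon> hset {u \<in> mems V. Q u} \<longleftrightarrow> z = y" by blast
  qed
qed

theorem MG_ctm: "MG \<in> ctms"
proof (rule N.ctmsI)
  show "\<exists>z\<in>MG. x \<epsilon> z \<and> y \<epsilon> z" if xy: "x \<in> MG" "y \<in> MG" for x y
  proof -
    obtain n m where n: "n \<in> M" "x = val n" "m \<in> M" "y = val m" using MG_E xy by blast
    then have "upair n m \<in> M" by simp
    from val_in[OF allnames_in[OF this]] show ?thesis
      by (rule bexI[rotated]) (use n in \<open>auto simp: mem_val_allnames\<close>)
  qed
  show "\<exists>z\<in>MG. \<forall>y u. y \<epsilon> x \<longrightarrow> u \<epsilon> y \<longrightarrow> u \<epsilon> z" if x: "x \<in> MG" for x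
  proof -
    obtain n where n: "n \<in> M" "x = val n" using MG_E x by blast
    show ?thesis
    proof (rule bexI[OF _ val_in[OF allnames_in[OF tc_in[OF n(1)]]]], intro allI impI)
      fix y u assume y: "y \<epsilon> x" and u: "u \<epsilon> y"
      obtain m p where m: "hpair m p \<epsilon> n" "y = val m" using y unfolding n(2) mem_val by blast
      obtain l q where l: "hpair l q \<epsilon> m" "u = val l" using u unfolding m(2) mem_val by blast
      have "l \<in> tcset n" using dom_in_tcset[OF l(1) dom_in_tcset[OF m(1) tcset_refl]] .
      then show "u \<epsilon> val (allnames (hset (tcset n)))" unfolding mem_val_allnames using l(2) n(1) by auto
    qed
  qed
  show "\<exists>z\<in>MG. \<forall>y\<in>MG. mems y \<subseteq> mems x \<longrightarrow> y \<epsilon> z" if x: "x \<in> MG" for x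
  proof -
    obtain A where A: "A \<in> M" "x = val A" using MG_E x by blast
    define dm where "dm = hprod (hset (hfst ` mems A)) P"
    have "dtm M (\<lambda>e. hprod (hset ((\<lambda>w. hfst w) ` mems (e 0))) P)" by (intro dfnI PM)
    from dtm_closed[OF this, of "\<lambda>_. A"] A(1) have dmM: "dm \<in> M" by (simp add: dm_def)
    show ?thesis
    proof (rule bexI[OF _ val_in[OF allnames_in[OF hpow_in[OF dmM]]]], intro ballI impI)
      fix y assume y: "y \<in> MG" "mems y \<subseteq> mems x"
      obtain B where B: "B \<in> M" "y = val B" using MG_E y(1) by blast
      \<comment> \<open>Every subset of \<open>val A\<close> is the value of such a subset of
        \<open>dm\<close>, so the power set of \<open>dm\<close> in \<open>M\<close> supplies enough
        names for the power set in the extension.\<close>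
      define C where "C = hset {w \<in> mems dm. fmem (hsnd w) (hfst w) B}"
      have CM: "C \<in> M" unfolding C_def by (rule sep[OF _ dmM]) (intro dfnI B(1))
      have memC: "hpair n p \<epsilon> C \<longleftrightarrow> n \<in> hfst ` mems A \<and> p \<epsilon> P \<and> fmem p n B" for n p
        unfolding C_def hmem_sep dm_def hpair_in_dom hfst_hpair hsnd_hpair by blast
      have "val C = y"
      proof (rule hcset_eqI, rule iffI)
        fix u assume "u \<epsilon> val C"
        then obtain n p where n: "hpair n p \<epsilon> C" "p \<in> G" "u = val n" unfolding mem_val by blast
        have nM: "n \<in> M" using pair_mem_in[OF CM n(1)] by simp
        show "u \<epsilon> y" using truth_mem[OF nM B(1)] n memC B(2) by blast
      next
        fix u assume u: "u \<epsilon> y"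
        then have "u \<epsilon> val A" using y(2) A(2) by auto
        then obtain n p where n: "hpair n p \<epsilon> A" "u = val n" unfolding mem_val by blast
        have nM: "n \<in> M" using pair_mem_in[OF A(1) n(1)] by simp
        have nA: "n \<in> hfst ` mems A" using n(1) by (intro image_eqI[of _ _ "hpair n p"]) simp_all
        obtain q where "q \<in> G" "fmem q n B" using truth_mem[OF nM B(1)] u B(2) n(2) by blast
        then have "hpair n q \<epsilon> C" "q \<in> G" using memC nA G_P by blast+
        then show "u \<epsilon> val C" using mem_valI n(2) by blast
      qed
      moreover have "C \<epsilon> hpow dm"
        unfolding mem_hpow subset_iff in_mems using CM by (simp add: C_def hmem_sep)
      ultimately show "y \<epsilon> val (allnames (hpow dm))" unfolding mem_val_allnames by blast
    qed
  qed
  show "hom \<in> MG" using hom_in M_subset_MG by blast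
  show "hset {x \<in> mems a. Q x} \<in> MG" if "dfn MG (\<lambda>e. Q (e 0))" "a \<in> MG" for Q a
    by (rule sepG[OF that])
  show "\<exists>b\<in>MG. \<forall>x y. x \<epsilon> a \<longrightarrow> y \<in> MG \<longrightarrow> R y x \<longrightarrow> (\<exists>y. y \<epsilon> b \<and> R y x)"
    if "dfn MG (\<lambda>e. R (e 0) (e 1))" "a \<in> MG" for R a
    by (rule collG[OF that])
  show "\<exists>t\<in>MG. \<forall>b. b \<epsilon> a \<longrightarrow> (\<exists>y. \<forall>z. z \<epsilon> b \<and> z \<epsilon> t \<longleftrightarrow> z = y)"
    if "a \<in> MG" "\<And>b. b \<epsilon> a \<Longrightarrow> \<exists>y. y \<epsilon> b" "\<And>b c z. b \<epsilon> a \<Longrightarrow> c \<epsilon> a \<Longrightarrow> z \<epsilon> b \<Longrightarrow> z \<epsilon> c \<Longrightarrow> b = c" for a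
    by (rule choiceG) (use that in blast)+
qed

end

section \<open>Cardinality in a model\<close>

definition lepo :: "hcset set \<Rightarrow> hcset \<Rightarrow> hcset \<Rightarrow> bool" where
  "lepo M x y \<longleftrightarrow> (\<exists>f\<in>M. (\<forall>a\<in>mems x. happ f a \<epsilon> y) \<and> (\<forall>a\<in>mems x. \<forall>b\<in>mems x. happ f a = happ f b \<longrightarrow> a = b))"

context ctm
begin

lemma dfn_lepo [dfnI]: "dtm M t \<Longrightarrow> dtm M s \<Longrightarrow> dfn M (\<lambda>e. lepo M (t e) (s e))"
  by (rule dfn_subst2[of "lepo M"]) (auto simp only: lepo_def intro!: dfnI)

lemma lepoI:
  assumes "dtm M (\<lambda>e. F (e 0))" "x \<in> M" "\<And>a. a \<epsilon> x \<Longrightarrow> F a \<epsilon> y"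
    "\<And>a b. a \<epsilon> x \<Longrightarrow> b \<epsilon> x \<Longrightarrow> F a = F b \<Longrightarrow> a = b"
  shows "lepo M x y"
  unfolding lepo_def
proof (intro bexI[of _ "hgraph F (mems x)"] conjI ballI impI)
  show "hgraph F (mems x) \<in> M" by (rule dtm_graph[OF assms(1,2)])
  have h: "happ (hgraph F (mems x)) a = F a" if "a \<in> mems x" for a by (rule happ_hgraph) (use that in auto)
  show "happ (hgraph F (mems x)) a \<epsilon> y" if "a \<in> mems x" for a using h[OF that] assms(3) that by simp
  show "a = b" if "a \<in> mems x" "b \<in> mems x" "happ (hgraph F (mems x)) a = happ (hgraph F (mems x)) b" for a b
    using that(3) assms(4)[of a b] that(1,2) unfolding h[OF that(1)] h[OF that(2)] by simp
qed

lemma lepoE: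
  assumes "lepo M x y"
  obtains f where "f \<in> M" "\<And>a. a \<epsilon> x \<Longrightarrow> happ f a \<epsilon> y" "\<And>a b. a \<epsilon> x \<Longrightarrow> b \<epsilon> x \<Longrightarrow> happ f a = happ f b \<Longrightarrow> a = b"
  using assms unfolding lepo_def by auto

lemma lepo_subset: "x \<in> M \<Longrightarrow> mems x \<subseteq> mems y \<Longrightarrow> lepo M x y"
  by (rule lepoI[of "\<lambda>a. a"]) (auto intro: dfnI)

lemma lepo_refl: "x \<in> M \<Longrightarrow> lepo M x x" by (rule lepo_subset) auto

lemma lepo_trans:
  assumes x: "x \<in> M" and xy: "lepo M x y" and yz: "lepo M y z"
  shows "lepo M x z"
proof -
  obtain f where f: "f \<in> M" "\<And>a. a \<epsilon> x \<Longrightarrow> happ f a \<epsilon> y" "\<And>a b. a \<epsilon> x \<Longrightarrow> b \<epsilon> x \<Longrightarrow> happ f a = happ f b \<Longrightarrow> a = b"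
    using lepoE[OF xy] by blast
  obtain g where g: "g \<in> M" "\<And>a. a \<epsilon> y \<Longrightarrow> happ g a \<epsilon> z" "\<And>a b. a \<epsilon> y \<Longrightarrow> b \<epsilon> y \<Longrightarrow> happ g a = happ g b \<Longrightarrow> a = b"
    using lepoE[OF yz] by blast
  show ?thesis
  proof (rule lepoI[OF _ x])
    show "dtm M (\<lambda>e. happ g (happ f (e 0)))" by (intro dfnI f(1) g(1))
  qed (use f g in blast)+
qed

text \<open>A choice function on the fibres inverts the surjection.\<close>

lemma lepo_surj:
  assumes F: "dtm M (\<lambda>e. F (e 0))" and x: "x \<in> M" and y: "y \<in> M"
    and surj: "\<And>v. v \<epsilon> y \<Longrightarrow> \<exists>u. u \<epsilon> x \<and> F u = v"
  shows "lepo M y x"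
proof -
  obtain g where g: "g \<in> M" "\<And>b. b \<epsilon> hpow x \<Longrightarrow> mems b \<noteq> {} \<Longrightarrow> happ g b \<epsilon> b"
    using choice_function[OF hpow_in[OF x]] by blast
  define S where "S v = hset {u \<in> mems x. F u = v}" for v
  have dF: "dtm M (\<lambda>e. F (t e))" if "dtm M t" for t
  proof (rule dtm1I[where F = F and R = "\<lambda>z x. z = F x"])
    show "dfn M (\<lambda>e. e 0 = F (e 1))" using dtm_eq[OF F] by simp
    show "F a \<in> M" if "a \<in> M" for a using dtm_closed[OF F, of "\<lambda>_. a"] that by simp
  qed (use that in auto)
  have dS: "dtm M (\<lambda>e. S (e 0))" unfolding S_def by (intro dfnI dF x)
  have SM: "S v \<in> M" if "v \<in> M" for v using dtm_closed[OF dS, of "\<lambda>_. v"] that by simp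
  have pick: "happ g (S v) \<epsilon> x \<and> F (happ g (S v)) = v" if v: "v \<epsilon> y" for v
  proof -
    have "v \<in> M" using transM[OF y v] .
    then have "S v \<epsilon> hpow x" unfolding mem_hpow subset_iff in_mems using SM by (simp add: S_def hmem_sep)
    moreover have "mems (S v) \<noteq> {}" using surj[OF v] unfolding mems_nonempty by (auto simp: S_def hmem_sep)
    ultimately have "happ g (S v) \<epsilon> S v" by (rule g(2))
    then show ?thesis by (simp add: S_def hmem_sep)
  qed
  show ?thesis
  proof (rule lepoI[OF _ y])
    show "dtm M (\<lambda>e. happ g (S (e 0)))" by (intro dfnI g(1) dS)
    show "happ g (S a) \<epsilon> x" if "a \<epsilon> y" for a using pick[OF that] by blast
    show "a = b" if "a \<epsilon> y" "b \<epsilon> y" "happ g (S a) = happ g (S b)" for a b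
      using pick[OF that(1)] pick[OF that(2)] that(3) by metis
  qed
qed

lemma lepo_prod:
  assumes x: "x \<in> M" "y \<in> M" and "lepo M x x'" "lepo M y y'"
  shows "lepo M (hprod x y) (hprod x' y')"
proof -
  obtain f where f: "f \<in> M" "\<And>a. a \<epsilon> x \<Longrightarrow> happ f a \<epsilon> x'" "\<And>a b. a \<epsilon> x \<Longrightarrow> b \<epsilon> x \<Longrightarrow> happ f a = happ f b \<Longrightarrow> a = b"
    using lepoE[OF assms(3)] by blast
  obtain g where g: "g \<in> M" "\<And>a. a \<epsilon> y \<Longrightarrow> happ g a \<epsilon> y'" "\<And>a b. a \<epsilon> y \<Longrightarrow> b \<epsilon> y \<Longrightarrow> happ g a = happ g b \<Longrightarrow> a = b"
    using lepoE[OF assms(4)] by blast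
  show ?thesis
  proof (rule lepoI)
    show "dtm M (\<lambda>e. hpair (happ f (hfst (e 0))) (happ g (hsnd (e 0))))" by (intro dfnI f(1) g(1))
  qed (use x f(2,3) g(2,3) in auto)
qed

text \<open>An element is sent to the index of a member containing it and to its place in that
  member. The choices are uniform: \<open>g\<close> selects the member and \<open>c\<close> an
  injection of this member into \<open>\<kappa>'\<close>.\<close>

lemma lepo_Union:
  assumes Z: "Z \<in> M" and k: "\<kappa> \<in> M" "\<kappa>' \<in> M" and Zk: "lepo M Z \<kappa>" and zk: "\<And>z. z \<epsilon> Z \<Longrightarrow> lepo M z \<kappa>'"
  shows "lepo M (hUn Z) (hprod \<kappa> \<kappa>')"
proof -
  obtain f where f: "f \<in> M" "\<And>a. a \<epsilon> Z \<Longrightarrow> happ f a \<epsilon> \<kappa>" "\<And>a b. a \<epsilon> Z \<Longrightarrow> b \<epsilon> Z \<Longrightarrow> happ f a = happ f b \<Longrightarrow> a = b"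
    using lepoE[OF Zk] by blast
  obtain g where g: "g \<in> M" "\<And>b. b \<epsilon> hpow Z \<Longrightarrow> mems b \<noteq> {} \<Longrightarrow> happ g b \<epsilon> b"
    using choice_function[OF hpow_in[OF Z]] by blast
  \<comment> \<open>The injections of members into \<open>\<kappa>'\<close> can be taken as subsets
    of this product, so they form a set on which a choice function exists.\<close>
  define A where "A = hpow (hprod (hUn Z) \<kappa>')"
  have AM: "A \<in> M" unfolding A_def using Z k by simp
  obtain c where c: "c \<in> M" "\<And>b. b \<epsilon> hpow A \<Longrightarrow> mems b \<noteq> {} \<Longrightarrow> happ c b \<epsilon> b"
    using choice_function[OF hpow_in[OF AM]] by blast
  define I where "I z = hset {h \<in> mems A. (\<forall>a\<in>mems z. happ h a \<epsilon> \<kappa>') \<and> (\<forall>a\<in>mems z. \<forall>b\<in>mems z. happ h a = happ h b \<longrightarrow> a = b)}" for z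
  have dI: "dtm M (\<lambda>e. I (t e))" if t: "dtm M t" for t
  proof (rule dtm1_elems[of I "\<lambda>h z. h \<epsilon> A \<and> (\<forall>a\<in>mems z. happ h a \<epsilon> \<kappa>') \<and> (\<forall>a\<in>mems z. \<forall>b\<in>mems z. happ h a = happ h b \<longrightarrow> a = b)"])
    show "I z \<in> M" if "z \<in> M" for z unfolding I_def by (rule sep[OF _ AM]) (intro dfnI that k)
    show "dfn M (\<lambda>e. e 0 \<epsilon> A \<and> (\<forall>a\<in>mems (e 1). happ (e 0) a \<epsilon> \<kappa>') \<and> (\<forall>a\<in>mems (e 1). \<forall>b\<in>mems (e 1). happ (e 0) a = happ (e 0) b \<longrightarrow> a = b))"
      by (intro dfnI AM k)
  qed (auto simp only: I_def hmem_sep t)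
  have IM: "I z \<in> M" if "z \<in> M" for z using dtm_closed[OF dI[OF dtm_var[of 0]], of "\<lambda>_. z"] that by simp
  have Ipick: "happ c (I z) \<epsilon> I z" if z: "z \<epsilon> Z" for z
  proof (rule c(2))
    have zM: "z \<in> M" using transM[OF Z z] .
    show "I z \<epsilon> hpow A" unfolding mem_hpow subset_iff in_mems using IM[OF zM] by (simp add: I_def hmem_sep)
    obtain h where h: "h \<in> M" "\<And>a. a \<epsilon> z \<Longrightarrow> happ h a \<epsilon> \<kappa>'" "\<And>a b. a \<epsilon> z \<Longrightarrow> b \<epsilon> z \<Longrightarrow> happ h a = happ h b \<Longrightarrow> a = b"
      using lepoE[OF zk[OF z]] by blast
    let ?h = "hgraph (happ h) (mems z)"
    have hM: "?h \<in> M" by (rule dtm_graph[OF _ zM]) (intro dfnI h(1))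
    have happ: "happ ?h a = happ h a" if "a \<epsilon> z" for a by (rule happ_hgraph) (use that in auto)
    have "w \<epsilon> hprod (hUn Z) \<kappa>'" if "w \<epsilon> ?h" for w using that h(2) z by auto
    then have "?h \<epsilon> A" unfolding A_def mem_hpow subset_iff in_mems using hM by blast
    then have "?h \<epsilon> I z" unfolding I_def hmem_sep using h(2,3) happ by simp
    then show "mems (I z) \<noteq> {}" unfolding mems_nonempty by blast
  qed
  define p where "p u = happ g (hset {z \<in> mems Z. u \<epsilon> z})" for u
  have dp: "dtm M (\<lambda>e. p (e 0))" unfolding p_def by (intro dfnI Z g(1))
  have pick: "p u \<epsilon> Z \<and> u \<epsilon> p u" if u: "u \<epsilon> hUn Z" for u
  proof -
    have uM: "u \<in> M" using transM[OF hUn_in[OF Z] u] .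
    let ?S = "hset {z \<in> mems Z. u \<epsilon> z}"
    have "?S \<in> M" by (rule sep[OF _ Z]) (intro dfnI uM)
    then have "?S \<epsilon> hpow Z" unfolding mem_hpow subset_iff in_mems by (simp add: hmem_sep)
    moreover have "mems ?S \<noteq> {}" unfolding mems_nonempty hmem_sep using u by auto
    ultimately have "happ g ?S \<epsilon> ?S" by (rule g(2))
    then show ?thesis unfolding hmem_sep p_def by blast
  qed
  show ?thesis
  proof (rule lepoI)
    show "dtm M (\<lambda>e. hpair (happ f (p (e 0))) (happ (happ c (I (p (e 0)))) (e 0)))"
      by (intro dfnI dI dp f(1) c(1))
    show "hUn Z \<in> M" using Z by simp
    have J: "happ (happ c (I (p u))) u \<epsilon> \<kappa>'"
      "\<And>v. v \<epsilon> p u \<Longrightarrow> happ (happ c (I (p u))) u = happ (happ c (I (p u))) v \<Longrightarrow> u = v" if "u \<epsilon> hUn Z" for u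
    proof -
      have "happ c (I (p u)) \<epsilon> I (p u)" using Ipick pick[OF that] by blast
      then have "(\<forall>a\<in>mems (p u). happ (happ c (I (p u))) a \<epsilon> \<kappa>') \<and> (\<forall>a\<in>mems (p u). \<forall>b\<in>mems (p u).
          happ (happ c (I (p u))) a = happ (happ c (I (p u))) b \<longrightarrow> a = b)"
        by (subst (asm) (2) I_def) (simp only: hmem_sep, blast)
      then show "happ (happ c (I (p u))) u \<epsilon> \<kappa>'"
        "\<And>v. v \<epsilon> p u \<Longrightarrow> happ (happ c (I (p u))) u = happ (happ c (I (p u))) v \<Longrightarrow> u = v"
        using pick[OF that] by auto
    qed
    show "hpair (happ f (p u)) (happ (happ c (I (p u))) u) \<epsilon> hprod \<kappa> \<kappa>'" if "u \<epsilon> hUn Z" for u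
      using f(2) pick[OF that] J(1)[OF that] by simp
    show "u = v" if uv: "u \<epsilon> hUn Z" "v \<epsilon> hUn Z"
      and eq: "hpair (happ f (p u)) (happ (happ c (I (p u))) u) = hpair (happ f (p v)) (happ (happ c (I (p v))) v)" for u v
    proof -
      have e: "p u = p v" using f(3) pick[OF uv(1)] pick[OF uv(2)] eq by simp
      have "v \<epsilon> p u" using pick[OF uv(2)] e by simp
      then show ?thesis using J(2)[OF uv(1), of v] eq e by simp
    qed
  qed
qed

definition ctb :: "hcset \<Rightarrow> hcset" where "ctb X = hset {y \<in> mems (hpow X). lepo M y hom}"

lemma mem_ctb: "y \<epsilon> ctb X \<longleftrightarrow> y \<in> M \<and> mems y \<subseteq> mems X \<and> lepo M y hom"
  unfolding ctb_def hmem_sep by simp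

lemma dtm_ctb [dfnI]: "dtm M t \<Longrightarrow> dtm M (\<lambda>e. ctb (t e))"
  unfolding ctb_def by (intro dfnI hom_in)

lemma ctb_in [simp]: "X \<in> M \<Longrightarrow> ctb X \<in> M"
  using dtm_closed[OF dtm_ctb[OF dtm_var[of 0]], of "\<lambda>_. X"] by simp

lemma hset_image_in: "dtm M (\<lambda>e. F (e 0)) \<Longrightarrow> y \<in> M \<Longrightarrow> hset (F ` mems y) \<in> M"
proof -
  assume F: "dtm M (\<lambda>e. F (e 0))" and y: "y \<in> M"
  have "dtm M (\<lambda>e. hset ((\<lambda>x. F x) ` mems y))" by (intro dfnI F y)
  from dtm_closed[OF this, of "\<lambda>_. y"] y show ?thesis by simp
qed

lemma lepo_image: "dtm M (\<lambda>e. F (e 0)) \<Longrightarrow> y \<in> M \<Longrightarrow> lepo M (hset (F ` mems y)) y"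
  by (rule lepo_surj[of F]) (auto intro: hset_image_in)

lemma ctb_mono:
  assumes x: "x \<in> M" and "lepo M x y" shows "lepo M (ctb x) (ctb y)"
proof -
  obtain f where f: "f \<in> M" "\<And>a. a \<epsilon> x \<Longrightarrow> happ f a \<epsilon> y" "\<And>a b. a \<epsilon> x \<Longrightarrow> b \<epsilon> x \<Longrightarrow> happ f a = happ f b \<Longrightarrow> a = b"
    using lepoE[OF assms(2)] by blast
  have df: "dtm M (\<lambda>e. happ f (e 0))" by (intro dfnI f(1))
  show ?thesis
  proof (rule lepoI)
    show "dtm M (\<lambda>e. hset ((\<lambda>u. happ f u) ` mems (e 0)))" by (intro dfnI f(1))
    show "ctb x \<in> M" using x by simp
    show "hset ((\<lambda>u. happ f u) ` mems a) \<epsilon> ctb y" if a: "a \<epsilon> ctb x" for a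
    proof -
      have a': "a \<in> M" "mems a \<subseteq> mems x" "lepo M a hom" using a unfolding mem_ctb by auto
      have 1: "hset ((\<lambda>u. happ f u) ` mems a) \<in> M" by (rule hset_image_in[OF df a'(1)])
      moreover have "lepo M (hset ((\<lambda>u. happ f u) ` mems a)) hom"
        by (rule lepo_trans[OF 1 lepo_image[OF df a'(1)] a'(3)])
      moreover have "mems (hset ((\<lambda>u. happ f u) ` mems a)) \<subseteq> mems y" using a'(2) f(2) by auto
      ultimately show ?thesis unfolding mem_ctb by blast
    qed
    show "a = b" if "a \<epsilon> ctb x" "b \<epsilon> ctb x" "hset ((\<lambda>u. happ f u) ` mems a) = hset ((\<lambda>u. happ f u) ` mems b)" for a b
    proof -
      have sub: "mems a \<subseteq> mems x" "mems b \<subseteq> mems x" using that unfolding mem_ctb by auto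
      have "happ f ` mems a = happ f ` mems b" using arg_cong[OF that(3), of mems] by simp
      moreover have "inj_on (happ f) (mems x)" using f(3) by (auto intro: inj_onI)
      ultimately have "mems a = mems b" using sub inj_on_image_eq_iff by metis
      then show ?thesis using mems_inject by blast
    qed
  qed
qed

lemma Cantor: "x \<in> M \<Longrightarrow> \<not> lepo M (hpow x) x"
proof
  assume x: "x \<in> M" and "lepo M (hpow x) x"
  then obtain f where f: "f \<in> M" "\<And>a. a \<epsilon> hpow x \<Longrightarrow> happ f a \<epsilon> x"
    "\<And>a b. a \<epsilon> hpow x \<Longrightarrow> b \<epsilon> hpow x \<Longrightarrow> happ f a = happ f b \<Longrightarrow> a = b" using lepoE by blast
  define D where "D = hset {u \<in> mems x. \<exists>y\<in>mems (hpow x). u = happ f y \<and> \<not> u \<epsilon> y}"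
  have "D \<in> M" unfolding D_def by (rule sep[OF _ x]) (intro dfnI x f(1))
  then have D: "D \<epsilon> hpow x" unfolding mem_hpow subset_iff in_mems by (simp add: D_def hmem_sep)
  have memD: "u \<epsilon> D \<longleftrightarrow> u \<epsilon> x \<and> (\<exists>y. y \<epsilon> hpow x \<and> u = happ f y \<and> \<not> u \<epsilon> y)" for u
    by (simp only: D_def hmem_sep) (simp only: Bex_def in_mems)
  have "happ f D \<epsilon> D \<longleftrightarrow> (\<exists>y. y \<epsilon> hpow x \<and> happ f D = happ f y \<and> \<not> happ f D \<epsilon> y)"
    using f(2)[OF D] by (subst memD) blast
  also have "\<dots> \<longleftrightarrow> \<not> happ f D \<epsilon> D" using f(3)[OF D] D by blast
  finally show False by blast
qed

lemma ordinal_lepo: "x \<in> M \<Longrightarrow> \<exists>\<alpha>\<in>M. Ord \<alpha> \<and> lepo M x \<alpha> \<and> lepo M \<alpha> x"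
proof -
  assume x: "x \<in> M"
  obtain \<alpha> f where \<alpha>: "\<alpha> \<in> M" "Ord \<alpha>" "f \<in> M" "bij_betw (happ f) (mems \<alpha>) (mems x)"
    using wellorder[OF x] by blast
  have b: "inj_on (happ f) (mems \<alpha>)" "happ f ` mems \<alpha> = mems x" using \<alpha>(4) unfolding bij_betw_def by auto
  have "lepo M \<alpha> x" unfolding lepo_def
    by (rule bexI[OF _ \<alpha>(3)]) (use b in \<open>auto simp: inj_on_def\<close>)
  moreover have "lepo M x \<alpha>"
  proof (rule lepo_surj[OF _ \<alpha>(1) x])
    show "dtm M (\<lambda>e. happ f (e 0))" by (intro dfnI \<alpha>(3))
    show "\<exists>u. u \<epsilon> \<alpha> \<and> happ f u = v" if "v \<epsilon> x" for v
    proof -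
      have "v \<in> happ f ` mems \<alpha>" using that b(2) by simp
      then show ?thesis by auto
    qed
  qed
  ultimately show ?thesis using \<alpha>(1,2) by blast
qed

end

text \<open>A walk along the antidiagonals. It uses only successor, predecessor and a test for zero,
  so it can be repeated inside a model by recursion, without arithmetic.\<close>

fun nx :: "nat \<times> nat \<Rightarrow> nat \<times> nat" where
  "nx (m, 0) = (0, Suc m)"
| "nx (m, Suc k) = (Suc m, k)"

definition pr :: "nat \<Rightarrow> nat \<times> nat" where "pr k = (nx ^^ k) (0, 0)"

lemma pr_Suc: "pr (Suc k) = nx (pr k)" by (simp add: pr_def)

lemma pr_surj: "\<exists>k. pr k = (m, n)"
proof -
  have "\<forall>m n. m + n = s \<longrightarrow> (\<exists>k. pr k = (m, n))" for s
  proof (induction s)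
    case 0
    have "pr 0 = (0, 0)" by (simp add: pr_def)
    then show ?case by auto
  next
    case (Suc s)
    have "m \<le> Suc s \<longrightarrow> (\<exists>k. pr k = (m, Suc s - m))" for m
    proof (induction m)
      case 0
      have "\<exists>k. pr k = (s, 0)" using spec[OF spec[OF Suc, of s], of 0] by simp
      then obtain k where "pr k = (s, 0)" by blast
      then have "pr (Suc k) = (0, Suc s)" by (simp add: pr_Suc)
      then show ?case by auto
    next
      case (Suc m)
      show ?case
      proof
        assume m: "Suc m \<le> Suc s"
        then obtain k where k: "pr k = (m, Suc s - m)" using Suc by auto
        obtain j where j: "Suc s - m = Suc j" using m by (metis Suc_diff_le Suc_le_mono)
        then have "pr (Suc k) = (Suc m, j)" using k by (simp add: pr_Suc)
        moreover have "j = Suc s - Suc m" using j by simp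
        ultimately show "\<exists>k. pr k = (Suc m, Suc s - Suc m)" by blast
      qed
    qed
    then show ?case by (metis diff_add_inverse le_add1)
  qed
  then show ?thesis by blast
qed

lemma hUn_omega_nat: "hUn (omega_nat (Suc k)) = omega_nat k"
  by (rule hcset_eqI) (auto simp: mem_omega_nat; metis less_trans_Suc lessI less_antisym Suc_less_eq)

lemma hsucc_neq_hempty [simp]: "hsucc x \<noteq> hempty" "hempty \<noteq> hsucc x"
  by (metis mem_hempty mem_hsucc)+

lemma omega_nat_eq_hempty: "omega_nat k = hempty \<longleftrightarrow> k = 0"
  using omega_nat_inject[of k 0] by (simp add: omega_nat_0)

text \<open>The step \<open>nx\<close> on codes of pairs, with \<open>hUn\<close> acting as the
  predecessor of a natural number.\<close>

definition HG :: "hcset \<Rightarrow> hcset \<Rightarrow> hcset" where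
  "HG x f = (if x = hempty then hpair hempty hempty
     else if hsnd (happ f (hUn x)) = hempty then hpair hempty (hsucc (hfst (happ f (hUn x))))
     else hpair (hsucc (hfst (happ f (hUn x)))) (hUn (hsnd (happ f (hUn x)))))"

definition Hh :: "hcset \<Rightarrow> hcset" where "Hh = (SOME F. \<forall>x. F x = HG x (hgraph F (mems x)))"

lemma Hh_eq: "Hh x = HG x (hgraph Hh (mems x))"
  unfolding Hh_def using someI_ex[OF eps_rec_exists[of HG]] by blast

lemma Hh_omega_nat: "Hh (omega_nat k) = hpair (omega_nat (fst (pr k))) (omega_nat (snd (pr k)))"
proof (induction k)
  case 0
  show ?case by (subst Hh_eq) (simp add: HG_def pr_def omega_nat_0)
next
  case (Suc k)
  have "happ (hgraph Hh (mems (omega_nat (Suc k)))) (omega_nat k) = Hh (omega_nat k)"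
    by (rule happ_hgraph) (auto simp: omega_nat_Suc)
  then have h: "happ (hgraph Hh (mems (omega_nat (Suc k)))) (hUn (omega_nat (Suc k)))
      = hpair (omega_nat (fst (pr k))) (omega_nat (snd (pr k)))"
    by (simp add: hUn_omega_nat Suc)
  obtain m n where mn: "pr k = (m, n)" by (cases "pr k")
  show ?case
  proof (cases n)
    case 0
    then show ?thesis using h mn
      by (subst Hh_eq) (simp add: HG_def omega_nat_eq_hempty pr_Suc omega_nat_simps(2) omega_nat_0)
  next
    case (Suc j)
    then have "Hh (omega_nat (Suc k)) = hpair (hsucc (omega_nat m)) (hUn (omega_nat (Suc j)))"
      using h mn by (subst Hh_eq) (simp add: HG_def omega_nat_eq_hempty)
    then show ?thesis using Suc mn by (simp add: pr_Suc hUn_omega_nat omega_nat_Suc[of m])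
  qed
qed

context ctm
begin

lemma mem_hpowI: "z \<in> M \<Longrightarrow> (\<And>u. u \<epsilon> z \<Longrightarrow> u \<epsilon> x) \<Longrightarrow> z \<epsilon> hpow x"
  by auto

lemma Hh_rec: shows "x \<in> M \<Longrightarrow> Hh x \<in> M" "dtm M t \<Longrightarrow> dtm M (\<lambda>e. Hh (t e))"
proof -
  have 1: "dtm M (\<lambda>e. HG (e 1) (e 2))" unfolding HG_def by (intro dfnI hpair_in[THEN iffD2] conjI hempty_in)
  have 2: "HG x f \<in> M" if "x \<in> M" "f \<in> M" for x f
    using dtm_closed[OF 1, of "\<lambda>i. if i = 1 then x else f"] that by simp
  have 3: "dfn M (\<lambda>e. e 0 = HG (e 1) (e 2))" unfolding HG_def
    by (intro dfnI hpair_in[THEN iffD2] conjI hempty_in)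
  show "Hh x \<in> M" if x: "x \<in> M" for x
    by (rule eps_recursion(1)[of HG Hh]) (fact 2 3 x | rule Hh_eq)+
  show "dtm M (\<lambda>e. Hh (t e))" if t: "dtm M t" for t
    by (rule eps_recursion(2)[of HG Hh]) (fact 2 3 t | rule Hh_eq)+
qed

lemma lepo_omega_square: "lepo M (hprod hom hom) hom"
proof (rule lepo_surj[of Hh])
  show "dtm M (\<lambda>e. Hh (e 0))" by (intro Hh_rec dfnI)
  fix v assume "v \<epsilon> hprod hom hom"
  then obtain m n where v: "v = hpair (omega_nat m) (omega_nat n)" by auto
  obtain k where "pr k = (m, n)" using pr_surj by blast
  then have "Hh (omega_nat k) = v" using v by (simp add: Hh_omega_nat)
  moreover have "omega_nat k \<epsilon> hom" by simp
  ultimately show "\<exists>u. u \<epsilon> hom \<and> Hh u = v" by blast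
qed simp_all

lemma hpow_mono:
  assumes x: "x \<in> M" and xy: "lepo M x y" shows "lepo M (hpow x) (hpow y)"
proof -
  obtain f where f: "f \<in> M" "\<And>a. a \<epsilon> x \<Longrightarrow> happ f a \<epsilon> y" "\<And>a b. a \<epsilon> x \<Longrightarrow> b \<epsilon> x \<Longrightarrow> happ f a = happ f b \<Longrightarrow> a = b"
    using lepoE[OF xy] by blast
  have df: "dtm M (\<lambda>e. happ f (e 0))" by (intro dfnI f(1))
  show ?thesis
  proof (rule lepoI)
    show "dtm M (\<lambda>e. hset ((\<lambda>u. happ f u) ` mems (e 0)))" by (intro dfnI f(1))
    show "hpow x \<in> M" using x by simp
    show "hset ((\<lambda>u. happ f u) ` mems a) \<epsilon> hpow y" if a: "a \<epsilon> hpow x" for a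
    proof -
      have a': "a \<in> M" "mems a \<subseteq> mems x" using a unfolding mem_hpow by auto
      have "mems (hset ((\<lambda>u. happ f u) ` mems a)) \<subseteq> mems y" using a'(2) f(2) by auto
      then show ?thesis unfolding mem_hpow using hset_image_in[OF df a'(1)] by blast
    qed
    show "a = b" if "a \<epsilon> hpow x" "b \<epsilon> hpow x" "hset ((\<lambda>u. happ f u) ` mems a) = hset ((\<lambda>u. happ f u) ` mems b)" for a b
    proof -
      have sub: "mems a \<subseteq> mems x" "mems b \<subseteq> mems x" using that unfolding mem_hpow by auto
      have "happ f ` mems a = happ f ` mems b" using arg_cong[OF that(3), of mems] by simp
      moreover have "inj_on (happ f) (mems x)" using f(3) by (auto intro: inj_onI)
      ultimately have "mems a = mems b" using sub inj_on_image_eq_iff by metis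
      then show ?thesis using mems_inject by blast
    qed
  qed
qed

text \<open>In cardinal notation, \<open>X\<close> to the power \<open>\<omega>\<close> is at most
  \<open>X\<close>. The factor \<open>hom\<close> provides tags, by which products too are coded as
  countable subsets.\<close>

definition wcl :: "hcset \<Rightarrow> bool" where "wcl X \<longleftrightarrow> X \<in> M \<and> mems X \<noteq> {} \<and> lepo M (ctb (hprod hom X)) X"

lemma wcl_M: "wcl X \<Longrightarrow> X \<in> M" by (simp add: wcl_def)

lemma omega01: "omega_nat 0 \<noteq> omega_nat 1" "omega_nat 1 \<noteq> omega_nat 0" by simp_all

text \<open>An element of \<open>hprod hom X\<close> is coded by its singleton, and a pair from
  \<open>X\<close> by the two-element set of its components tagged 0 and 1.\<close>

lemma wcl_mult:
  assumes "wcl X" shows "lepo M (hprod hom X) X" "lepo M (hprod X X) X" "lepo M (ctb X) X"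
proof -
  have X: "X \<in> M" "lepo M (ctb (hprod hom X)) X" using assms by (auto simp: wcl_def)
  \<comment> \<open>A set whose elements are determined by their tags is countable, the tag being
    the injection.\<close>
  have s: "lepo M y hom" if "y \<in> M" "\<And>u v. u \<epsilon> y \<Longrightarrow> v \<epsilon> y \<Longrightarrow> hfst u = hfst v \<Longrightarrow> u = v" "\<And>u. u \<epsilon> y \<Longrightarrow> hfst u \<epsilon> hom" for y
    by (rule lepoI[of hfst]) (use that in \<open>auto intro: dfnI\<close>)
  have "lepo M (hprod hom X) (ctb (hprod hom X))"
  proof (rule lepoI)
    show "dtm M (\<lambda>e. upair (e 0) (e 0))" by (intro dfnI)
    show "upair a a \<epsilon> ctb (hprod hom X)" if a: "a \<epsilon> hprod hom X" for a
    proof -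
      have aM: "a \<in> M" by (rule transM[OF _ a]) (use X in simp)
      have "lepo M (upair a a) hom" by (rule s) (use aM a in auto)
      then show ?thesis unfolding mem_ctb using aM a by auto
    qed
  qed (use X in \<open>auto simp: upair_eq_iff\<close>)
  then show 1: "lepo M (hprod hom X) X" by (rule lepo_trans[rotated, OF _ X(2)]) (use X in simp)
  have "lepo M (hprod X X) (ctb (hprod hom X))"
  proof (rule lepoI)
    show "dtm M (\<lambda>e. upair (hpair (omega_nat 0) (hfst (e 0))) (hpair (omega_nat 1) (hsnd (e 0))))" by (intro dfnI) simp_all
    show "upair (hpair (omega_nat 0) (hfst a)) (hpair (omega_nat 1) (hsnd a)) \<epsilon> ctb (hprod hom X)" (is "?p \<epsilon> _") if a: "a \<epsilon> hprod X X" for a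
    proof -
      obtain b c where bc: "a = hpair b c" "b \<epsilon> X" "c \<epsilon> X" using a by auto
      then have bcM: "b \<in> M" "c \<in> M" using transM[OF X(1)] by blast+
      have "lepo M ?p hom" by (rule s) (use bc bcM in auto)
      then show ?thesis unfolding mem_ctb using bcM bc by auto
    qed
    show "a = b" if ab: "a \<epsilon> hprod X X" "b \<epsilon> hprod X X"
      and "upair (hpair (omega_nat 0) (hfst a)) (hpair (omega_nat 1) (hsnd a)) =
        upair (hpair (omega_nat 0) (hfst b)) (hpair (omega_nat 1) (hsnd b))" for a b
    proof -
      have "hfst a = hfst b" "hsnd a = hsnd b" using that(3) by (simp_all add: upair_eq_iff)
      then show ?thesis using ab by auto
    qed
  qed (use X in simp)
  then show "lepo M (hprod X X) X" by (rule lepo_trans[rotated, OF _ X(2)]) (use X in simp)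
  have "lepo M X (hprod hom X)"
  proof (rule lepoI)
    show "dtm M (\<lambda>e. hpair (omega_nat 0) (e 0))" by (intro dfnI) simp
  qed (use X in auto)
  from ctb_mono[OF X(1) this] show "lepo M (ctb X) X" by (rule lepo_trans[rotated, OF _ X(2)]) (use X in simp)
qed

lemma wcl_transport:
  assumes X: "wcl X" and Y: "Y \<in> M" "mems Y \<noteq> {}" and XY: "lepo M X Y" and YX: "lepo M Y X"
  shows "wcl Y"
proof -
  have XM: "X \<in> M" and c: "lepo M (ctb (hprod hom X)) X" using X by (auto simp: wcl_def)
  have "lepo M (hprod hom Y) (hprod hom X)" by (rule lepo_prod) (use Y YX lepo_refl in auto)
  then have "lepo M (ctb (hprod hom Y)) (ctb (hprod hom X))" by (rule ctb_mono[rotated]) (use Y in simp)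
  then have "lepo M (ctb (hprod hom Y)) X" by (rule lepo_trans[rotated, OF _ c]) (use Y in simp)
  then have "lepo M (ctb (hprod hom Y)) Y" by (rule lepo_trans[rotated, OF _ XY]) (use Y in simp)
  then show ?thesis using Y by (simp add: wcl_def)
qed

text \<open>Enumerate a countable set of pairs of a number and a real by \<open>h\<close>. Two
  subsets of \<open>hprod hom hom\<close> record it: \<open>c1\<close> the numbers and
  \<open>c2\<close> the reals, row by row. Decoding is definable and does not mention
  \<open>h\<close>, so it is a surjection onto the countable sets.\<close>

lemma wcl_reals: "wcl (hpow hom)"
proof -
  let ?W = "hprod hom hom"
  have WM: "?W \<in> M" by simp
  have PW: "lepo M (hpow ?W) (hpow hom)" by (rule hpow_mono[OF WM lepo_omega_square])
  have 1: "lepo M (ctb (hprod hom (hpow hom))) (hprod (hpow ?W) (hpow ?W))"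
  proof (rule lepo_surj)
    show "dtm M (\<lambda>e. hset ((\<lambda>u. hpair (hsnd u) (hset {m \<in> mems hom. hpair (hfst u) m \<epsilon> hsnd (e 0)})) ` mems (hfst (e 0))))"
      by (intro dfnI hom_in)
    fix S assume "S \<epsilon> ctb (hprod hom (hpow hom))"
    then have S: "S \<in> M" "mems S \<subseteq> mems (hprod hom (hpow hom))" "lepo M S hom" unfolding mem_ctb by auto
    obtain h where h: "h \<in> M" "\<And>a. a \<epsilon> S \<Longrightarrow> happ h a \<epsilon> hom" "\<And>a b. a \<epsilon> S \<Longrightarrow> b \<epsilon> S \<Longrightarrow> happ h a = happ h b \<Longrightarrow> a = b"
      using lepoE[OF S(3)] by blast
    have Sp: "\<exists>n a. s = hpair n a \<and> n \<epsilon> hom \<and> (\<forall>m. m \<epsilon> a \<longrightarrow> m \<epsilon> hom)" if "s \<epsilon> S" for s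
    proof -
      have "s \<in> mems (hprod hom (hpow hom))" using S(2) that by auto
      then obtain n a where "s = hpair n a" "n \<epsilon> hom" "mems a \<subseteq> mems hom" by auto
      then show ?thesis by (metis in_mems subsetD)
    qed
    define c1 where "c1 = hset ((\<lambda>s. hpair (happ h s) (hfst s)) ` mems S)"
    define c2 where "c2 = hset {w \<in> mems ?W. \<exists>s\<in>mems S. hfst w = happ h s \<and> hsnd w \<epsilon> hsnd s}"
    have c1M: "c1 \<in> M" unfolding c1_def by (rule hset_image_in[OF _ S(1)]) (intro dfnI h(1))
    have c2M: "c2 \<in> M" unfolding c2_def by (rule sep[OF _ WM]) (intro dfnI S(1) h(1))
    have mem1: "u \<epsilon> c1 \<longleftrightarrow> (\<exists>s. s \<epsilon> S \<and> u = hpair (happ h s) (hfst s))" for u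
      unfolding c1_def by (subst hmem_hset) auto
    have mem2: "w \<epsilon> c2 \<longleftrightarrow> w \<epsilon> ?W \<and> (\<exists>s. s \<epsilon> S \<and> hfst w = happ h s \<and> hsnd w \<epsilon> hsnd s)" for w
      by (simp only: c2_def hmem_sep) (simp only: Bex_def in_mems)
    have row: "hset {m \<in> mems hom. hpair (happ h s) m \<epsilon> c2} = hsnd s" if s: "s \<epsilon> S" for s
    proof (rule hcset_eqI)
      fix m
      have "m \<epsilon> hsnd s \<longrightarrow> m \<epsilon> hom" using Sp[OF s] by auto
      moreover have "hpair (happ h s) m \<epsilon> c2 \<longleftrightarrow> m \<epsilon> hom \<and> m \<epsilon> hsnd s"
        unfolding mem2 hfst_hpair hsnd_hpair using s h(2,3) by (auto simp del: mem_hom)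
      ultimately show "m \<epsilon> hset {m \<in> mems hom. hpair (happ h s) m \<epsilon> c2} \<longleftrightarrow> m \<epsilon> hsnd s"
        unfolding hmem_sep by blast
    qed
    have "hpair c1 c2 \<epsilon> hprod (hpow ?W) (hpow ?W)"
    proof -
      have "u \<epsilon> ?W" if "u \<epsilon> c1" for u using that h(2) Sp unfolding mem1 mem_hprod by force
      moreover have "u \<epsilon> ?W" if "u \<epsilon> c2" for u using that mem2 by blast
      ultimately have "c1 \<epsilon> hpow ?W" "c2 \<epsilon> hpow ?W" unfolding mem_hpow subset_iff in_mems using c1M c2M by blast+
      then show ?thesis unfolding mem_hprod by blast
    qed
    moreover have "hset ((\<lambda>u. hpair (hsnd u) (hset {m \<in> mems hom. hpair (hfst u) m \<epsilon> hsnd (hpair c1 c2)})) ` mems (hfst (hpair c1 c2))) = S"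
    proof (rule hcset_eqI)
      fix w
      have "w \<epsilon> hset ((\<lambda>u. hpair (hsnd u) (hset {m \<in> mems hom. hpair (hfst u) m \<epsilon> hsnd (hpair c1 c2)})) ` mems (hfst (hpair c1 c2)))
        \<longleftrightarrow> (\<exists>u. u \<epsilon> c1 \<and> w = hpair (hsnd u) (hset {m \<in> mems hom. hpair (hfst u) m \<epsilon> c2}))"
        by (subst hmem_hset) auto
      also have "\<dots> \<longleftrightarrow> (\<exists>s. s \<epsilon> S \<and> w = hpair (hfst s) (hset {m \<in> mems hom. hpair (happ h s) m \<epsilon> c2}))"
      proof -
        have "(\<exists>u. (\<exists>s. s \<epsilon> S \<and> u = H s) \<and> Q u) \<longleftrightarrow> (\<exists>s. s \<epsilon> S \<and> Q (H s))"
          for H :: "hcset \<Rightarrow> hcset" and Q by blast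
        then show ?thesis by (simp only: mem1 hfst_hpair hsnd_hpair)
      qed
      also have "\<dots> \<longleftrightarrow> (\<exists>s. s \<epsilon> S \<and> w = s)"
      proof (rule ex_cong1, rule conj_cong[OF refl])
        fix s assume s: "s \<epsilon> S"
        have "hpair (hfst s) (hsnd s) = s" using Sp[OF s] by auto
        then show "w = hpair (hfst s) (hset {m \<in> mems hom. hpair (happ h s) m \<epsilon> c2}) \<longleftrightarrow> w = s"
          by (simp only: row[OF s])
      qed
      also have "\<dots> \<longleftrightarrow> w \<epsilon> S" by blast
      finally show "w \<epsilon> hset ((\<lambda>u. hpair (hsnd u) (hset {m \<in> mems hom. hpair (hfst u) m \<epsilon> hsnd (hpair c1 c2)})) ` mems (hfst (hpair c1 c2))) \<longleftrightarrow> w \<epsilon> S" .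
    qed
    ultimately show "\<exists>u. u \<epsilon> hprod (hpow ?W) (hpow ?W) \<and>
      hset ((\<lambda>v. hpair (hsnd v) (hset {m \<in> mems hom. hpair (hfst v) m \<epsilon> hsnd u})) ` mems (hfst u)) = S" by blast
  qed simp_all
  have 2: "lepo M (hprod (hpow ?W) (hpow ?W)) (hprod (hpow hom) (hpow hom))"
    by (rule lepo_prod) (use PW in simp_all)
  \<comment> \<open>Two reals are stored in the rows 0 and 1 of a single subset of
    \<open>hprod hom hom\<close>.\<close>
  have 3: "lepo M (hprod (hpow hom) (hpow hom)) (hpow ?W)"
  proof (rule lepoI)
    show "dtm M (\<lambda>e. hset {w \<in> mems ?W. (hfst w = omega_nat 0 \<and> hsnd w \<epsilon> hfst (e 0)) \<or> (hfst w = omega_nat 1 \<and> hsnd w \<epsilon> hsnd (e 0))})"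
      by (intro dfnI hom_in omega_nat_in)
    fix c assume c: "c \<epsilon> hprod (hpow hom) (hpow hom)"
    have "c \<in> M" by (rule transM[OF _ c]) simp
    have "hset {w \<in> mems ?W. (hfst w = omega_nat 0 \<and> hsnd w \<epsilon> hfst c) \<or> (hfst w = omega_nat 1 \<and> hsnd w \<epsilon> hsnd c)} \<in> M"
      by (rule sep[OF _ WM]) (intro dfnI omega_nat_in \<open>c \<in> M\<close> hfst_in hsnd_in)
    then show "hset {w \<in> mems ?W. (hfst w = omega_nat 0 \<and> hsnd w \<epsilon> hfst c) \<or> (hfst w = omega_nat 1 \<and> hsnd w \<epsilon> hsnd c)} \<epsilon> hpow ?W"
      by (rule mem_hpowI) (simp only: hmem_sep)
  next
    fix c d assume c: "c \<epsilon> hprod (hpow hom) (hpow hom)" and d: "d \<epsilon> hprod (hpow hom) (hpow hom)"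
      and eq: "hset {w \<in> mems ?W. (hfst w = omega_nat 0 \<and> hsnd w \<epsilon> hfst c) \<or> (hfst w = omega_nat 1 \<and> hsnd w \<epsilon> hsnd c)}
        = hset {w \<in> mems ?W. (hfst w = omega_nat 0 \<and> hsnd w \<epsilon> hfst d) \<or> (hfst w = omega_nat 1 \<and> hsnd w \<epsilon> hsnd d)}"
    obtain a b where ab: "c = hpair a b" "mems a \<subseteq> mems hom" "mems b \<subseteq> mems hom" using c by auto
    obtain a' b' where ab': "d = hpair a' b'" "mems a' \<subseteq> mems hom" "mems b' \<subseteq> mems hom" using d by auto
    have e: "w \<epsilon> ?W \<and> ((hfst w = omega_nat 0 \<and> hsnd w \<epsilon> a) \<or> (hfst w = omega_nat 1 \<and> hsnd w \<epsilon> b))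
      \<longleftrightarrow> w \<epsilon> ?W \<and> ((hfst w = omega_nat 0 \<and> hsnd w \<epsilon> a') \<or> (hfst w = omega_nat 1 \<and> hsnd w \<epsilon> b'))" for w
      using arg_cong[OF eq, of "\<lambda>x. w \<epsilon> x"] unfolding hmem_sep ab(1) ab'(1) hfst_hpair hsnd_hpair .
    have "m \<epsilon> a \<longleftrightarrow> m \<epsilon> a'" "m \<epsilon> b \<longleftrightarrow> m \<epsilon> b'" if "m \<epsilon> hom" for m
      using e[of "hpair (omega_nat 0) m"] e[of "hpair (omega_nat 1) m"] that omega01 by (auto simp del: mem_hom simp: mem_hom[of "omega_nat _"])
    moreover have "m \<epsilon> a \<longrightarrow> m \<epsilon> hom" "m \<epsilon> a' \<longrightarrow> m \<epsilon> hom" "m \<epsilon> b \<longrightarrow> m \<epsilon> hom" "m \<epsilon> b' \<longrightarrow> m \<epsilon> hom" for m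
      using ab(2,3) ab'(2,3) unfolding subset_iff in_mems by blast+
    ultimately have "m \<epsilon> a \<longleftrightarrow> m \<epsilon> a'" "m \<epsilon> b \<longleftrightarrow> m \<epsilon> b'" for m by blast+
    then have "a = a'" "b = b'" by (auto intro: hcset_eqI)
    then show "c = d" using ab(1) ab'(1) by simp
  qed simp_all
  have 4: "lepo M (hprod (hpow ?W) (hpow ?W)) (hpow hom)"
    by (rule lepo_trans[OF _ lepo_trans[OF _ 2 3] PW]) simp_all
  have "lepo M (ctb (hprod hom (hpow hom))) (hpow hom)" by (rule lepo_trans[OF _ 1 4]) simp
  moreover have "hom \<epsilon> hpow hom" by simp
  ultimately show ?thesis unfolding wcl_def mems_nonempty using hpow_in[OF hom_in] by blast
qed

text \<open>An ordinal of the size of the power set does not inject into \<open>\<alpha>\<close> by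
  Cantor's theorem, so there is a least ordinal that does not.\<close>

lemma hartogs:
  assumes "\<alpha> \<in> M"
  shows "\<exists>\<mu>\<in>M. Ord \<mu> \<and> \<not> lepo M \<mu> \<alpha> \<and> (\<forall>\<beta>. \<beta> \<epsilon> \<mu> \<longrightarrow> lepo M \<beta> \<alpha>)"
proof -
  have pM: "hpow \<alpha> \<in> M" using assms by simp
  obtain \<epsilon>0 where e: "\<epsilon>0 \<in> M" "Ord \<epsilon>0" "lepo M (hpow \<alpha>) \<epsilon>0" using ordinal_lepo[OF pM] by blast
  have "\<not> lepo M \<epsilon>0 \<alpha>" using lepo_trans[OF pM e(3)] Cantor[OF assms] by blast
  then obtain \<mu> where "\<mu> \<in> M \<and> \<not> lepo M \<mu> \<alpha>" "Ord \<mu>" "\<And>z. z \<epsilon> \<mu> \<Longrightarrow> \<not> (z \<in> M \<and> \<not> lepo M z \<alpha>)"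
    using Ord_least[of "\<lambda>\<mu>. \<mu> \<in> M \<and> \<not> lepo M \<mu> \<alpha>" \<epsilon>0] e by blast
  then show ?thesis using transM by blast
qed

section \<open>The Hartogs number inherits closure under countable subsets\<close>

context
  fixes \<alpha> \<mu>
  assumes wa: "wcl \<alpha>" and oa: "Ord \<alpha>" and mM: "\<mu> \<in> M" and om: "Ord \<mu>"
    and nl: "\<not> lepo M \<mu> \<alpha>" and lm: "\<And>\<beta>. \<beta> \<epsilon> \<mu> \<Longrightarrow> lepo M \<beta> \<alpha>"
begin

lemma aM: "\<alpha> \<in> M" by (rule wcl_M[OF wa])

text \<open>The new element gets tag 1 and the old ones tag 0; \<open>\<alpha>\<close> absorbs the
  factor \<open>hom\<close> of tags.\<close>

lemma lepo_succ: assumes b: "\<beta> \<in> M" "lepo M \<beta> \<alpha>" shows "lepo M (hsucc \<beta>) \<alpha>"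
proof -
  obtain f where f: "f \<in> M" "\<And>a. a \<epsilon> \<beta> \<Longrightarrow> happ f a \<epsilon> \<alpha>" "\<And>a b. a \<epsilon> \<beta> \<Longrightarrow> b \<epsilon> \<beta> \<Longrightarrow> happ f a = happ f b \<Longrightarrow> a = b"
    using lepoE[OF b(2)] by blast
  obtain x0 where x0: "x0 \<epsilon> \<alpha>" using wa unfolding wcl_def mems_nonempty by blast
  have x0M: "x0 \<in> M" using transM[OF aM x0] .
  have "lepo M (hsucc \<beta>) (hprod hom \<alpha>)"
  proof (rule lepoI)
    show "dtm M (\<lambda>e. if e 0 = \<beta> then hpair (omega_nat 1) x0 else hpair (omega_nat 0) (happ f (e 0)))"
      by (intro dfnI f(1) b(1) omega_nat_in x0M hpair_in[THEN iffD2] conjI)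
  qed (use b f(2,3) x0 in \<open>auto split: if_splits\<close>)
  then show ?thesis by (rule lepo_trans[rotated, OF _ wcl_mult(1)[OF wa]]) (use b in simp)
qed

lemma below_mu: assumes "\<beta> \<in> M" "Ord \<beta>" "lepo M \<beta> \<alpha>" shows "\<beta> \<epsilon> \<mu>"
proof (rule ccontr)
  assume "\<not> \<beta> \<epsilon> \<mu>"
  then have "mems \<mu> \<subseteq> mems \<beta>" using Ord_linear[OF assms(2) om] Ord_subset_iff[OF om assms(2)] by blast
  then have "lepo M \<mu> \<alpha>" using lepo_trans[OF mM lepo_subset[OF mM] assms(3)] by blast
  then show False using nl by blast
qed

text \<open>Goedel-style pairing: the collapse of the lexicographic order on \<open>\<mu> \<times> \<alpha>\<close> has all proper initial
  segments of size at most \<open>\<alpha>\<close>, hence takes values below \<open>\<mu>\<close>.\<close>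

definition lex :: "hcset \<Rightarrow> hcset \<Rightarrow> bool" where
  "lex v u \<longleftrightarrow> v \<epsilon> hprod \<mu> \<alpha> \<and> u \<epsilon> hprod \<mu> \<alpha> \<and> (hfst v \<epsilon> hfst u \<or> hfst v = hfst u \<and> hsnd v \<epsilon> hsnd u)"

lemma mu_times: "lepo M (hprod \<mu> \<alpha>) \<mu>"
proof -
  have XM: "hprod \<mu> \<alpha> \<in> M" using mM aM by simp
  have wfl: "wf {(v, u). lex v u}"
  proof (rule wf_subset[OF wf_inv_image[OF wf_lex_prod[OF wf_hmem wf_hmem]]])
    show "{(v, u). lex v u} \<subseteq> inv_image ({(x, y). x \<epsilon> y} <*lex*> {(x, y). x \<epsilon> y}) (\<lambda>u. (hfst u, hsnd u))"
      by (auto simp: lex_def inv_image_def)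
  qed
  have cl: "countable {v. lex v u}" for u
    by (rule countable_subset[OF _ countable_mems[of "hprod \<mu> \<alpha>"]]) (auto simp: lex_def)
  obtain F where F: "\<And>u. F u = Rng (hgraph F {v. lex v u})"
    using wfrec_exists[OF wfl cl, of "\<lambda>x f. Rng f"] by blast
  have memF: "z \<epsilon> F u \<longleftrightarrow> (\<exists>v. lex v u \<and> z = F v)" for z u
    by (subst F) (auto simp: Rng_hgraph[OF cl] cl)
  have lexM: "y \<in> M" if "lex y x" "x \<in> M" for x y
    using that(1) transM[OF XM] unfolding lex_def by blast
  have dl: "dfn M (\<lambda>e. lex (t e) (s e))" if "dtm M t" "dtm M s" for t s
    unfolding lex_def by (intro dfnI XM that)
  have dl0: "dfn M (\<lambda>e. lex (e 0) (e 1))" by (intro dl dfnI)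
  have cover: "\<exists>t\<in>M. x \<epsilon> t \<and> (\<forall>z\<in>mems t. \<forall>y. lex y z \<longrightarrow> y \<epsilon> t)" if "x \<in> M" for x
    by (rule bexI[of _ "hun (upair x x) (hprod \<mu> \<alpha>)"]) (use that XM in \<open>auto simp: lex_def\<close>)
  have GM: "Rng f \<in> M" if "x \<in> M" "f \<in> M" for x f
    using dtm_closed[OF dtm_Rng[OF dtm_var[of 0]], of "\<lambda>_. f"] that by simp
  have dG: "dfn M (\<lambda>e. e 0 = Rng (e 2))" by (intro dfnI)
  have dF: "dtm M (\<lambda>e. F (t e))" if t: "dtm M t" for t
    by (rule wf_recursion(2)[of lex "\<lambda>x f. Rng f" F]) (fact wfl lexM dl0 cover GM dG t | rule F)+
  have ordp: "Ord a \<and> Ord b \<and> a \<epsilon> \<mu> \<and> b \<epsilon> \<alpha>" if "hpair a b \<epsilon> hprod \<mu> \<alpha>" for a b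
    using that Ord_mem[OF om] Ord_mem[OF oa] by auto
  have lex_trans: "lex w u" if wv: "lex w v" and vu: "lex v u" for u v w
  proof -
    obtain a b where u: "u = hpair a b" "hpair a b \<epsilon> hprod \<mu> \<alpha>" using vu unfolding lex_def by auto
    have o: "Ord a" "Ord b" using ordp[OF u(2)] by auto
    show ?thesis using wv vu Ord_trans[OF o(1), of "hfst v" "hfst w"] Ord_trans[OF o(2), of "hsnd v" "hsnd w"]
      unfolding lex_def u(1) hfst_hpair hsnd_hpair by metis
  qed
  have OF: "Ord (F u)" for u
  proof (induction u rule: wf_induct_rule[OF wfl])
    case (1 u)
    show ?case
    proof (rule Ord_transitive_set)
      show "Ord y" if "y \<epsilon> F u" for y using that 1 memF by auto
      have "z \<epsilon> F u" if y: "y \<epsilon> F u" and z: "z \<epsilon> y" for y z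
      proof -
        obtain v where v: "lex v u" "y = F v" using y memF by blast
        obtain w where w: "lex w v" "z = F w" using z v(2) memF by blast
        then show ?thesis using lex_trans[OF w(1) v(1)] memF by blast
      qed
      then show "Tr (F u)" unfolding Tr_iff by blast
    qed
  qed
  show ?thesis
  proof (rule lepoI[OF dF[OF dtm_var] XM])
    fix u assume u: "u \<epsilon> hprod \<mu> \<alpha>"
    then obtain a b where ab: "u = hpair a b" "a \<epsilon> \<mu>" "b \<epsilon> \<alpha>" by auto
    have uM: "u \<in> M" using transM[OF XM u] .
    have a: "a \<in> M" "lepo M a \<alpha>" using transM[OF mM ab(2)] lm[OF ab(2)] by auto
    define I where "I = hset {v \<in> mems (hprod \<mu> \<alpha>). lex v u}"
    have IM: "I \<in> M" unfolding I_def by (rule sep[OF _ XM]) (intro dl dfnI uM)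
    have memI: "v \<epsilon> I \<longleftrightarrow> lex v u" for v unfolding I_def hmem_sep by (auto simp: lex_def)
    have Fu: "F u = hset ((\<lambda>v. F v) ` mems I)"
    proof (rule hcset_eqI)
      fix z show "z \<epsilon> F u \<longleftrightarrow> z \<epsilon> hset ((\<lambda>v. F v) ` mems I)"
        unfolding memF by (subst hmem_hset) (auto simp: memI)
    qed
    have FuM: "F u \<in> M" unfolding Fu by (rule hset_image_in[OF dF[OF dtm_var] IM])
    \<comment> \<open>A lexicographic predecessor of the pair of \<open>a\<close> and
      \<open>b\<close> has its first component in \<open>hsucc a\<close>, and this still injects
      into \<open>\<alpha>\<close>.\<close>
    have "mems I \<subseteq> mems (hprod (hsucc a) \<alpha>)"
    proof
      fix v assume "v \<in> mems I"
      then have "lex v u" using memI by simp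
      then show "v \<in> mems (hprod (hsucc a) \<alpha>)" unfolding lex_def ab(1) by auto
    qed
    then have "lepo M I (hprod (hsucc a) \<alpha>)" by (rule lepo_subset[OF IM])
    moreover have "lepo M (hprod (hsucc a) \<alpha>) (hprod \<alpha> \<alpha>)"
      by (rule lepo_prod) (use a aM lepo_succ lepo_refl in auto)
    ultimately have "lepo M I \<alpha>" using wcl_mult(2)[OF wa] lepo_trans[OF IM] by blast
    then have "lepo M (F u) \<alpha>" using lepo_trans[OF FuM] lepo_image[OF dF[OF dtm_var] IM] Fu by metis
    then show "F u \<epsilon> \<mu>" by (rule below_mu[OF FuM OF])
  next
    fix u v assume u: "u \<epsilon> hprod \<mu> \<alpha>" and v: "v \<epsilon> hprod \<mu> \<alpha>" and eq: "F u = F v"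
    obtain a b where ab: "u = hpair a b" using u by auto
    obtain c d where cd: "v = hpair c d" using v by auto
    have o: "Ord a" "Ord b" "Ord c" "Ord d" using ordp u v ab cd by auto
    have "\<not> lex u v" "\<not> lex v u" using memF[of "F u" v] memF[of "F v" u] eq hmem_irrefl by metis+
    then show "u = v" using Ord_linear[OF o(1,3)] Ord_linear[OF o(2,4)] u v unfolding lex_def ab cd hfst_hpair hsnd_hpair by metis
  qed
qed

text \<open>Hausdorff's formula for the exponent \<open>\<omega>\<close>. A countable subset of
  \<open>hprod hom \<mu>\<close> is bounded, as otherwise \<open>\<mu>\<close> would be covered by
  countably many sets of size at most \<open>\<alpha>\<close>. So there are at most
  \<open>\<mu>\<close> times \<open>\<alpha>\<close> such subsets, and the pairing lemma
  finishes.\<close>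

lemma wcl_next: "wcl \<mu>"
proof -
  have bounded: "\<exists>\<beta>. \<beta> \<epsilon> \<mu> \<and> mems y \<subseteq> mems (hprod hom \<beta>)" if y: "y \<epsilon> ctb (hprod hom \<mu>)" for y
  proof (rule ccontr)
    assume *: "\<not> (\<exists>\<beta>. \<beta> \<epsilon> \<mu> \<and> mems y \<subseteq> mems (hprod hom \<beta>))"
    have y': "y \<in> M" "mems y \<subseteq> mems (hprod hom \<mu>)" "lepo M y hom" using y unfolding mem_ctb by auto
    have d: "dtm M (\<lambda>e. hsucc (hsnd (e 0)))" by (intro dfnI)
    define Z where "Z = hset ((\<lambda>u. hsucc (hsnd u)) ` mems y)"
    have ZM: "Z \<in> M" unfolding Z_def by (rule hset_image_in[OF d y'(1)])
    have yp: "\<exists>n \<gamma>. u = hpair n \<gamma> \<and> n \<epsilon> hom \<and> \<gamma> \<epsilon> \<mu>" if "u \<epsilon> y" for u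
    proof -
      have "u \<in> mems (hprod hom \<mu>)" using y'(2) that by auto
      then show ?thesis by (simp del: mem_hom) blast
    qed
    have memZ: "z \<epsilon> Z \<longleftrightarrow> (\<exists>u. u \<epsilon> y \<and> z = hsucc (hsnd u))" for z
      unfolding Z_def by (subst hmem_hset) auto
    have "lepo M Z hom" using lepo_trans[OF ZM _ y'(3)] lepo_image[OF d y'(1)] unfolding Z_def by blast
    moreover have "lepo M z \<alpha>" if z: "z \<epsilon> Z" for z
    proof -
      obtain u where u: "u \<epsilon> y" "z = hsucc (hsnd u)" using z memZ by blast
      then obtain n \<gamma> where "u = hpair n \<gamma>" "\<gamma> \<epsilon> \<mu>" using yp by blast
      then show ?thesis using u lepo_succ[OF transM[OF mM] lm] by simp
    qed
    ultimately have "lepo M (hUn Z) (hprod hom \<alpha>)" by (intro lepo_Union ZM hom_in aM)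
    then have L: "lepo M (hUn Z) \<alpha>" by (rule lepo_trans[rotated, OF _ wcl_mult(1)[OF wa]]) (use ZM in simp)
    have "\<beta> \<epsilon> hUn Z" if b: "\<beta> \<epsilon> \<mu>" for \<beta>
    proof -
      have "\<not> mems y \<subseteq> mems (hprod hom \<beta>)" using * b by blast
      then obtain u where u: "u \<epsilon> y" "\<not> u \<epsilon> hprod hom \<beta>" unfolding subset_iff in_mems by blast
      then obtain n \<gamma> where n: "u = hpair n \<gamma>" "n \<epsilon> hom" "\<gamma> \<epsilon> \<mu>" using yp by blast
      then have "\<not> \<gamma> \<epsilon> \<beta>" using u(2) unfolding mem_hprod by blast
      then have "\<beta> \<epsilon> hsucc \<gamma>" using Ord_mem_hsucc Ord_mem[OF om] n(3) b by blast
      moreover have "hsucc \<gamma> \<epsilon> Z" using memZ u(1) n(1) by auto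
      ultimately show ?thesis by auto
    qed
    then have "mems \<mu> \<subseteq> mems (hUn Z)" by auto
    then show False using nl lepo_trans[OF mM lepo_subset[OF mM] L] by blast
  qed
  have d: "dtm M (\<lambda>e. ctb (hprod hom (e 0)))" by (intro dfnI hom_in)
  define Z where "Z = hset ((\<lambda>\<beta>. ctb (hprod hom \<beta>)) ` mems \<mu>)"
  have ZM: "Z \<in> M" unfolding Z_def by (rule hset_image_in[OF d mM])
  have memZ: "z \<epsilon> Z \<longleftrightarrow> (\<exists>\<beta>. \<beta> \<epsilon> \<mu> \<and> z = ctb (hprod hom \<beta>))" for z
    unfolding Z_def by (subst hmem_hset) auto
  have zl: "lepo M z \<alpha>" if z: "z \<epsilon> Z" for z
  proof -
    obtain \<beta> where b: "\<beta> \<epsilon> \<mu>" "z = ctb (hprod hom \<beta>)" using z memZ by blast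
    have bM: "\<beta> \<in> M" using transM[OF mM b(1)] .
    have "lepo M (hprod hom \<beta>) (hprod hom \<alpha>)" by (rule lepo_prod) (use bM lm[OF b(1)] lepo_refl in auto)
    from ctb_mono[OF _ this] have "lepo M z (ctb (hprod hom \<alpha>))" unfolding b(2) using bM by simp
    then show ?thesis using lepo_trans[OF transM[OF ZM z]] wa unfolding wcl_def by blast
  qed
  have "lepo M (hUn Z) (hprod \<mu> \<alpha>)"
  proof (rule lepo_Union[OF ZM mM aM _ zl])
    show "lepo M Z \<mu>" unfolding Z_def by (rule lepo_image[OF d mM])
  qed
  then have U: "lepo M (hUn Z) \<mu>" by (rule lepo_trans[rotated, OF _ mu_times]) (use ZM in simp)
  have "mems (ctb (hprod hom \<mu>)) \<subseteq> mems (hUn Z)"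
  proof
    fix y assume "y \<in> mems (ctb (hprod hom \<mu>))"
    then have y: "y \<epsilon> ctb (hprod hom \<mu>)" by simp
    then obtain \<beta> where b: "\<beta> \<epsilon> \<mu>" "mems y \<subseteq> mems (hprod hom \<beta>)" using bounded by blast
    then have "y \<epsilon> ctb (hprod hom \<beta>)" using y unfolding mem_ctb by blast
    then show "y \<in> mems (hUn Z)" using memZ b(1) by auto
  qed
  then have "lepo M (ctb (hprod hom \<mu>)) \<mu>"
    using lepo_trans[OF _ lepo_subset U] mM by simp
  moreover have "\<alpha> \<epsilon> \<mu>" by (rule below_mu[OF aM oa lepo_refl[OF aM]])
  ultimately show ?thesis unfolding wcl_def mems_nonempty using mM by blast
qed

end

end

section \<open>Cohen forcing\<close>

text \<open>The combinatorial core of the countable chain condition: among conditions of bounded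
  size, antichains are even finite. Fix one member \<open>p\<close>; every other contains the
  opposite of one of the finitely many elements of \<open>p\<close>, and removing that element
  lowers the bound.\<close>

lemma finite_antichain:
  fixes opp :: "'a \<Rightarrow> 'a"
  assumes "\<And>p. p \<in> A \<Longrightarrow> finite p \<and> card p \<le> m \<and> (\<forall>x\<in>p. opp x \<notin> p)"
    "\<And>p q. p \<in> A \<Longrightarrow> q \<in> A \<Longrightarrow> p \<noteq> q \<Longrightarrow> \<exists>x\<in>p. opp x \<in> q"
  shows "finite A"
  using assms
proof (induction m arbitrary: A)
  case 0
  have "p = {}" if "p \<in> A" for p using 0(1)[OF that] card_0_eq by blast
  then have "A \<subseteq> {{}}" by blast
  then show ?case by (rule finite_subset) simp
next
  case (Suc m)
  show ?case
  proof (cases "A = {}")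
    case False
    then obtain p where p: "p \<in> A" by blast
    have fin: "finite {q \<in> A. y \<in> q}" for y
    proof -
      \<comment> \<open>Removing the common \<open>y\<close> keeps the members in conflict, because
        sets that both contain \<open>y\<close> and are consistent cannot conflict at
        \<open>y\<close>.\<close>
      let ?B = "(\<lambda>q. q - {y}) ` {q \<in> A. y \<in> q}"
      have "finite ?B"
      proof (rule Suc.IH)
        fix r assume "r \<in> ?B"
        then obtain q where "q \<in> A" "y \<in> q" "r = q - {y}" by auto
        then show "finite r \<and> card r \<le> m \<and> (\<forall>x\<in>r. opp x \<notin> r)" using Suc.prems(1)[of q] by auto
      next
        fix r r' assume r: "r \<in> ?B" "r' \<in> ?B" "r \<noteq> r'"
        then obtain q q' where q: "q \<in> A" "y \<in> q" "r = q - {y}" "q' \<in> A" "y \<in> q'" "r' = q' - {y}" by auto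
        then obtain z where z: "z \<in> q" "opp z \<in> q'" using Suc.prems(2)[of q q'] r(3) by blast
        have "z \<noteq> y" using z q Suc.prems(1)[of q'] by auto
        moreover have "opp z \<noteq> y" using z q Suc.prems(1)[of q] by auto
        ultimately show "\<exists>x\<in>r. opp x \<in> r'" using z q by auto
      qed
      moreover have "inj_on (\<lambda>q. q - {y}) {q \<in> A. y \<in> q}" by (rule inj_onI) auto
      ultimately show ?thesis by (rule finite_imageD)
    qed
    have "A \<subseteq> {p} \<union> (\<Union>x\<in>p. {q \<in> A. opp x \<in> q})" using Suc.prems(2)[OF p] by blast
    moreover have "finite ({p} \<union> (\<Union>x\<in>p. {q \<in> A. opp x \<in> q}))" using fin Suc.prems(1)[OF p] by auto
    ultimately show ?thesis by (rule finite_subset)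
  qed simp
qed

lemma mems_omega_nat: "mems (omega_nat n) = omega_nat ` {..<n}"
  by (auto simp: mem_omega_nat)

text \<open>The opposite bit at the same place. Two conditions conflict exactly when one contains
  the flip of an entry of the other.\<close>

definition flip :: "hcset \<Rightarrow> hcset" where
  "flip u = hpair (hfst u) (if hsnd u = omega_nat 0 then omega_nat 1 else omega_nat 0)"

lemma flip0 [simp]: "flip (hpair k (omega_nat 0)) = hpair k (omega_nat 1)" by (simp add: flip_def)
lemma flip1 [simp]: "flip (hpair k (omega_nat (Suc 0))) = hpair k (omega_nat 0)" by (simp add: flip_def)

lemma lepo_mono: "lepo M x y \<Longrightarrow> M \<subseteq> N \<Longrightarrow> lepo N x y" unfolding lepo_def by blast

context ctm
begin

lemma fin_in: "finite A \<Longrightarrow> A \<subseteq> M \<Longrightarrow> hset A \<in> M"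
proof (induction A rule: finite_induct)
  case empty
  then show ?case using hempty_in by (simp add: hempty_def)
next
  case (insert x A)
  have "hset (insert x A) = hun (hset A) (upair x x)"
    by (rule hcset_eqI) (use insert in \<open>auto simp: countable_finite\<close>)
  then show ?case using insert by simp
qed

lemma lepo_omega_nat:
  assumes "lepo M p (omega_nat n)" shows "finite (mems p) \<and> card (mems p) \<le> n"
proof -
  obtain f where f: "\<forall>a\<in>mems p. happ f a \<epsilon> omega_nat n" "\<forall>a\<in>mems p. \<forall>b\<in>mems p. happ f a = happ f b \<longrightarrow> a = b"
    using assms unfolding lepo_def by blast
  have i: "inj_on (happ f) (mems p)" unfolding inj_on_def by (rule f(2))
  have s: "happ f ` mems p \<subseteq> mems (omega_nat n)" unfolding image_subset_iff in_mems by (rule f(1))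
  have inj: "inj_on omega_nat {..<n}" by (rule inj_onI) (simp only: omega_nat_inject)
  have fin: "finite (mems (omega_nat n))" unfolding mems_omega_nat by (rule finite_imageI) (rule finite_lessThan)
  have c: "card (mems (omega_nat n)) = n" unfolding mems_omega_nat card_image[OF inj] by (rule card_lessThan)
  show ?thesis using inj_on_finite[OF i s fin] card_inj_on_le[OF i s fin] c by linarith
qed

lemma finite_lepo:
  assumes x: "x \<in> M" and fin: "finite (mems x)" shows "lepo M x (omega_nat (card (mems x)))"
proof -
  obtain h where h: "bij_betw h (mems x) {..<card (mems x)}"
    using ex_bij_betw_finite_nat[OF fin] by (auto simp: lessThan_atLeast0)
  let ?F = "\<lambda>u. omega_nat (h u)"
  have "hpair u (?F u) \<in> M" if "u \<in> mems x" for u using transM[OF x, of u] that omega_nat_in by simp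
  then have "hset ((\<lambda>u. hpair u (?F u)) ` mems x) \<in> M"
    by (intro fin_in finite_imageI fin image_subsetI)
  then have 1: "hgraph ?F (mems x) \<in> M" by (simp add: hgraph_def)
  have 2: "happ (hgraph ?F (mems x)) a = ?F a" if "a \<in> mems x" for a by (rule happ_hgraph) (use that in auto)
  show ?thesis unfolding lepo_def
  proof (rule bexI[OF _ 1], intro conjI ballI impI)
    show "happ (hgraph ?F (mems x)) a \<epsilon> omega_nat (card (mems x))" if "a \<in> mems x" for a
      unfolding 2[OF that] mem_omega_nat using h that unfolding bij_betw_def by auto
    show "a = b" if "a \<in> mems x" "b \<in> mems x" "happ (hgraph ?F (mems x)) a = happ (hgraph ?F (mems x)) b" for a b
      using that(3) h that(1,2) unfolding 2[OF that(1)] 2[OF that(2)] bij_betw_def inj_on_def by simp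
  qed
qed

lemma finite_lepo_hom: "x \<in> M \<Longrightarrow> finite (mems x) \<Longrightarrow> lepo M x hom"
proof -
  assume x: "x \<in> M" and f: "finite (mems x)"
  have "lepo M (omega_nat (card (mems x))) hom"
    by (rule lepo_subset) (auto simp: mem_omega_nat)
  then show ?thesis using lepo_trans[OF x finite_lepo[OF x f]] by blast
qed

lemma lepo_swap: "x \<in> M \<Longrightarrow> y \<in> M \<Longrightarrow> lepo M (hprod x y) (hprod y x)"
proof -
  assume xy: "x \<in> M" "y \<in> M"
  show ?thesis
  proof (rule lepoI)
    show "dtm M (\<lambda>e. hpair (hsnd (e 0)) (hfst (e 0)))" by (intro dfnI)
  qed (use xy in auto)
qed

text \<open>The reason for measuring size against products with \<open>hom\<close>: such a product
  absorbs further countable factors whatever \<open>\<alpha>\<close> is.\<close>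

lemma lepo_absorb: "\<alpha> \<in> M \<Longrightarrow> lepo M (hprod (hprod \<alpha> hom) hom) (hprod \<alpha> hom)"
proof -
  assume a: "\<alpha> \<in> M"
  have "lepo M (hprod (hprod \<alpha> hom) hom) (hprod \<alpha> (hprod hom hom))"
  proof (rule lepoI)
    show "dtm M (\<lambda>e. hpair (hfst (hfst (e 0))) (hpair (hsnd (hfst (e 0))) (hsnd (e 0))))" by (intro dfnI)
  qed (use a in auto)
  moreover have "lepo M (hprod \<alpha> (hprod hom hom)) (hprod \<alpha> hom)"
    by (rule lepo_prod) (use a lepo_refl lepo_omega_square in auto)
  ultimately show ?thesis using lepo_trans[of "hprod (hprod \<alpha> hom) hom"] a by simp
qed

definition cohen_dom :: "hcset \<Rightarrow> hcset" where "cohen_dom \<mu> = hprod (hprod \<mu> hom) (omega_nat 2)"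

text \<open>The finite partial functions from \<open>\<mu>\<close> times \<open>\<omega>\<close> to
  2 as sets of pairs; single-valuedness is expressed by the absence of flips, which fits the
  antichain lemma.\<close>

definition cohen :: "hcset \<Rightarrow> hcset" where
  "cohen \<mu> = hset {p \<in> mems (hpow (cohen_dom \<mu>)). (\<exists>n\<in>mems hom. lepo M p n) \<and> (\<forall>u\<in>mems p. \<not> flip u \<epsilon> p)}"

lemma mem_two: "b \<epsilon> omega_nat 2 \<longleftrightarrow> b = omega_nat 0 \<or> b = omega_nat 1"
  by (auto simp: mem_omega_nat numeral_2_eq_2 less_Suc_eq)

lemma mem_cohen: "p \<epsilon> cohen \<mu> \<longleftrightarrow> p \<in> M \<and> mems p \<subseteq> mems (cohen_dom \<mu>) \<and> finite (mems p) \<and> (\<forall>u. u \<epsilon> p \<longrightarrow> \<not> flip u \<epsilon> p)"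
proof -
  have "(\<exists>n\<in>mems hom. lepo M p n) \<longleftrightarrow> finite (mems p)" if "p \<in> M"
  proof
    assume "\<exists>n\<in>mems hom. lepo M p n"
    then show "finite (mems p)" using lepo_omega_nat by auto
  next
    assume "finite (mems p)"
    from finite_lepo[OF that this] show "\<exists>n\<in>mems hom. lepo M p n" by auto
  qed
  then show ?thesis unfolding cohen_def by (simp only: hmem_sep) auto
qed

lemma dtm_flip [dfnI]: "dtm M t \<Longrightarrow> dtm M (\<lambda>e. flip (t e))"
  unfolding flip_def by (intro dfnI omega_nat_in)

lemma cohen_dom_in: "\<mu> \<in> M \<Longrightarrow> cohen_dom \<mu> \<in> M" by (simp add: cohen_dom_def)

lemma cohen_in: "\<mu> \<in> M \<Longrightarrow> cohen \<mu> \<in> M"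
  unfolding cohen_def by (rule sep[OF _ hpow_in[OF cohen_dom_in]]) (intro dfnI hom_in)

lemma cohen_one: "hempty \<epsilon> cohen \<mu>" unfolding mem_cohen by (simp add: mems_def)

lemma flip_flip: "u \<epsilon> cohen_dom \<mu> \<Longrightarrow> flip (flip u) = u"
  by (auto simp: cohen_dom_def mem_two)

lemma cohen_compat:
  assumes p: "p \<epsilon> cohen \<mu>" and q: "q \<epsilon> cohen \<mu>" and c: "\<And>u. u \<epsilon> p \<Longrightarrow> \<not> flip u \<epsilon> q"
  shows "hun p q \<epsilon> cohen \<mu>"
proof -
  have c': "\<not> flip u \<epsilon> p" if "u \<epsilon> q" for u
  proof
    assume "flip u \<epsilon> p"
    then have "\<not> flip (flip u) \<epsilon> q" by (rule c)
    moreover have "u \<epsilon> cohen_dom \<mu>" using q that unfolding mem_cohen by auto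
    ultimately show False using flip_flip that by simp
  qed
  have "mems (hun p q) = mems p \<union> mems q" by auto
  then show ?thesis using p q c c' unfolding mem_cohen by auto
qed

text \<open>The set bounded here consists of the possible countable names of reals, so this limits
  the continuum of the extension.\<close>

lemma lepo_cohen:
  assumes w: "wcl \<mu>" shows "lepo M (ctb (hprod hom (cohen \<mu>))) \<mu>"
proof -
  have mM: "\<mu> \<in> M" by (rule wcl_M[OF w])
  have h: "lepo M (hprod \<mu> hom) \<mu>"
    by (rule lepo_trans[OF _ lepo_swap wcl_mult(1)[OF w]]) (use mM in simp_all)
  have "lepo M (cohen_dom \<mu>) (hprod \<mu> hom)" unfolding cohen_dom_def
    by (rule lepo_prod[OF _ _ h lepo_subset]) (use mM in \<open>auto simp: mem_omega_nat\<close>)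
  then have d: "lepo M (cohen_dom \<mu>) \<mu>" using lepo_trans[OF cohen_dom_in[OF mM] _ h] by blast
  have "mems (cohen \<mu>) \<subseteq> mems (ctb (cohen_dom \<mu>))"
  proof
    fix p assume "p \<in> mems (cohen \<mu>)"
    then have p: "p \<epsilon> cohen \<mu>" by simp
    then show "p \<in> mems (ctb (cohen_dom \<mu>))" using finite_lepo_hom[of p] unfolding in_mems mem_ctb mem_cohen by blast
  qed
  then have "lepo M (cohen \<mu>) (ctb (cohen_dom \<mu>))" by (rule lepo_subset[OF cohen_in[OF mM]])
  moreover have "lepo M (ctb (cohen_dom \<mu>)) (ctb \<mu>)" by (rule ctb_mono[OF cohen_dom_in[OF mM] d])
  ultimately have "lepo M (cohen \<mu>) \<mu>" using wcl_mult(3)[OF w] lepo_trans[OF cohen_in[OF mM]] lepo_trans[OF ctb_in[OF cohen_dom_in[OF mM]]] by blast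
  then have "lepo M (hprod hom (cohen \<mu>)) (hprod hom \<mu>)" by (intro lepo_prod lepo_refl) (use cohen_in[OF mM] in simp_all)
  then have "lepo M (ctb (hprod hom (cohen \<mu>))) (ctb (hprod hom \<mu>))" by (rule ctb_mono[rotated]) (use cohen_in[OF mM] in simp)
  then show ?thesis using w lepo_trans[of "ctb (hprod hom (cohen \<mu>))"] cohen_in[OF mM] unfolding wcl_def by simp
qed

end

locale cohen_ext = ctm +
  fixes \<mu> G
  assumes mu: "\<mu> \<in> M" and gen: "generic M (cohen \<mu>) G"

sublocale cohen_ext \<subseteq> generic M "cohen \<mu>" G by (rule gen)

sublocale cohen_ext \<subseteq> N: ctm MG by unfold_locales (rule MG_ctm)

section \<open>Covering by sets of the ground model, preservation of cardinals, counting
  reals\<close>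

context cohen_ext
begin

text \<open>The possible values at \<open>a\<close> are sorted by the size of a condition enforcing
  them. Conditions that enforce different values conflict, so only finitely many values belong to
  conditions of size at most \<open>n\<close>. The sorting is definable in \<open>M\<close> and
  involves no choice of antichains.\<close>

lemma cover:
  assumes d: "dfn MG (\<lambda>e. R (e 0) (e 1))" and b: "b \<in> M" and X: "X \<in> M"
    and fn: "\<And>a \<gamma> \<gamma>'. a \<epsilon> X \<Longrightarrow> \<gamma> \<epsilon> b \<Longrightarrow> \<gamma>' \<epsilon> b \<Longrightarrow> R \<gamma> a \<Longrightarrow> R \<gamma>' a \<Longrightarrow> \<gamma> = \<gamma>'"
  obtains S where "\<And>t s. dtm M t \<Longrightarrow> dtm M s \<Longrightarrow> dtm M (\<lambda>e. S (t e) (s e))"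
    "\<And>a n. finite (mems (S a (omega_nat n)))" "\<And>a m. mems (S a m) \<subseteq> mems b"
    "\<And>a \<gamma>. a \<epsilon> X \<Longrightarrow> \<gamma> \<epsilon> b \<Longrightarrow> R \<gamma> a \<Longrightarrow> \<exists>n. \<gamma> \<epsilon> S a (omega_nat n)"
proof -
  obtain F where F: "\<And>t s u. dtm M t \<Longrightarrow> dtm M s \<Longrightarrow> dtm M u \<Longrightarrow> dfn M (\<lambda>e. F (t e) (s e) (u e))"
    "\<And>y x. y \<in> M \<Longrightarrow> x \<in> M \<Longrightarrow> R (val y) (val x) \<longleftrightarrow> (\<exists>p\<in>G. F y x p)"
    "\<And>y x p q. F y x p \<Longrightarrow> q \<epsilon> cohen \<mu> \<Longrightarrow> le q p \<Longrightarrow> F y x q"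
    by (rule dfn_MG[OF d]) blast
  let ?P = "cohen \<mu>"
  \<comment> \<open>\<open>p\<close> forces the value \<open>\<gamma>\<close> and nothing below
    \<open>p\<close> forces another value. That \<open>R\<close> is functional is known only in this
    extension, not below every condition, so exclusivity is written into \<open>U\<close>.\<close>
  define U where "U \<gamma> a p \<longleftrightarrow> F (chk \<gamma>) (chk a) p \<and>
    (\<forall>\<gamma>'\<in>mems b. \<gamma>' \<noteq> \<gamma> \<longrightarrow> \<not> (\<exists>q\<in>mems ?P. le q p \<and> F (chk \<gamma>') (chk a) q))" for \<gamma> a p
  have dU: "dfn M (\<lambda>e. U (t e) (s e) (u e))" if "dtm M t" "dtm M s" "dtm M u" for t s u
  proof (rule dfn_subst3[OF _ that])
    show "dfn M (\<lambda>e. U (e 0) (e 1) (e 2))" unfolding U_def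
      by (intro dfnI F(1) chk_rec b PM)
  qed
  define S where "S a m = hset {\<gamma> \<in> mems b. \<exists>p\<in>mems ?P. lepo M p m \<and> U \<gamma> a p}" for a m
  have memS: "\<gamma> \<epsilon> S a m \<longleftrightarrow> \<gamma> \<epsilon> b \<and> (\<exists>p. p \<epsilon> ?P \<and> lepo M p m \<and> U \<gamma> a p)" for \<gamma> a m
    by (simp only: S_def hmem_sep) (simp only: Bex_def in_mems)
  show thesis
  proof (rule that[of S])
    show "dtm M (\<lambda>e. S (t e) (s e))" if "dtm M t" "dtm M s" for t s
    proof (rule dtm2_elems[of S "\<lambda>\<gamma> a m. \<gamma> \<epsilon> b \<and> (\<exists>p\<in>mems ?P. lepo M p m \<and> U \<gamma> a p)", OF _ _ _ that])
      show "S a m \<in> M" if "a \<in> M" "m \<in> M" for a m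
        unfolding S_def by (rule sep[OF _ b]) (intro dfnI dU PM that)
      show "dfn M (\<lambda>e. e 0 \<epsilon> b \<and> (\<exists>p\<in>mems ?P. lepo M p (e 2) \<and> U (e 0) (e 1) p))" by (intro dfnI dU PM b)
    qed (simp only: S_def hmem_sep)
    show "mems (S a m) \<subseteq> mems b" for a m using memS by auto
    show "finite (mems (S a (omega_nat n)))" for a n
    proof -
      have "\<forall>\<gamma>. \<exists>p. \<gamma> \<epsilon> S a (omega_nat n) \<longrightarrow> p \<epsilon> ?P \<and> lepo M p (omega_nat n) \<and> U \<gamma> a p" using memS by blast
      then obtain p where p: "\<And>\<gamma>. \<gamma> \<epsilon> S a (omega_nat n) \<Longrightarrow> p \<gamma> \<epsilon> ?P \<and> lepo M (p \<gamma>) (omega_nat n) \<and> U \<gamma> a (p \<gamma>)"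
        by metis
      have inc: "\<exists>u. u \<epsilon> p \<gamma> \<and> flip u \<epsilon> p \<gamma>'" if g: "\<gamma> \<epsilon> S a (omega_nat n)" "\<gamma>' \<epsilon> S a (omega_nat n)" "\<gamma> \<noteq> \<gamma>'" for \<gamma> \<gamma>'
      proof (rule ccontr)
        assume "\<not> ?thesis"
        then have r: "hun (p \<gamma>) (p \<gamma>') \<epsilon> ?P" using cohen_compat p g(1,2) by blast
        have l: "le (hun (p \<gamma>) (p \<gamma>')) (p \<gamma>)" "le (hun (p \<gamma>) (p \<gamma>')) (p \<gamma>')" by (auto simp: le_def)
        have "F (chk \<gamma>') (chk a) (hun (p \<gamma>) (p \<gamma>'))" using p[OF g(2)] F(3)[OF _ r l(2)] unfolding U_def by blast
        moreover have "\<gamma>' \<in> mems b" "hun (p \<gamma>) (p \<gamma>') \<in> mems ?P" using g(2) memS r by auto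
        moreover have "\<gamma>' \<noteq> \<gamma>" using g(3) by simp
        moreover have "U \<gamma> a (p \<gamma>)" using p[OF g(1)] by blast
        ultimately show False using l(1) unfolding U_def by blast
      qed
      have i: "inj_on (\<lambda>\<gamma>. mems (p \<gamma>)) (mems (S a (omega_nat n)))"
      proof (rule inj_onI, rule ccontr)
        fix \<gamma> \<gamma>' assume *: "\<gamma> \<in> mems (S a (omega_nat n))" "\<gamma>' \<in> mems (S a (omega_nat n))" "mems (p \<gamma>) = mems (p \<gamma>')" "\<gamma> \<noteq> \<gamma>'"
        then obtain u where "u \<epsilon> p \<gamma>" "flip u \<epsilon> p \<gamma>'" using inc[of \<gamma> \<gamma>'] by auto
        then have "u \<epsilon> p \<gamma>" "flip u \<epsilon> p \<gamma>" using *(3) by (auto simp: set_eq_iff)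
        then show False using p[of \<gamma>] *(1) unfolding mem_cohen by auto
      qed
      have "finite ((\<lambda>\<gamma>. mems (p \<gamma>)) ` mems (S a (omega_nat n)))"
      proof (rule finite_antichain[of _ n flip])
        fix q assume "q \<in> (\<lambda>\<gamma>. mems (p \<gamma>)) ` mems (S a (omega_nat n))"
        then obtain \<gamma> where "\<gamma> \<epsilon> S a (omega_nat n)" "q = mems (p \<gamma>)" by auto
        then show "finite q \<and> card q \<le> n \<and> (\<forall>x\<in>q. flip x \<notin> q)"
          using p[of \<gamma>] lepo_omega_nat[of "p \<gamma>" n] unfolding mem_cohen by auto
      next
        fix q q' assume "q \<in> (\<lambda>\<gamma>. mems (p \<gamma>)) ` mems (S a (omega_nat n))" "q' \<in> (\<lambda>\<gamma>. mems (p \<gamma>)) ` mems (S a (omega_nat n))" "q \<noteq> q'"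
        then obtain \<gamma> \<gamma>' where "\<gamma> \<epsilon> S a (omega_nat n)" "q = mems (p \<gamma>)" "\<gamma>' \<epsilon> S a (omega_nat n)" "q' = mems (p \<gamma>')" "\<gamma> \<noteq> \<gamma>'"
          unfolding image_iff Bex_def in_mems by blast
        then show "\<exists>x\<in>q. flip x \<in> q'" using inc[of \<gamma> \<gamma>'] in_mems by blast
      qed
      then show ?thesis using i by (rule finite_imageD)
    qed
    fix a \<gamma> assume a: "a \<epsilon> X" and g: "\<gamma> \<epsilon> b" and Rg: "R \<gamma> a"
    have aM: "a \<in> M" "\<gamma> \<in> M" using transM[OF X a] transM[OF b g] by auto
    have Fchk: "R c a \<longleftrightarrow> (\<exists>p\<in>G. F (chk c) (chk a) p)" if "c \<in> M" for c
      using F(2)[OF chk_rec(1)[OF that] chk_rec(1)[OF aM(1)]] by simp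
    \<comment> \<open>Below any condition, either \<open>U\<close> is attained, or another value is
      forced, or \<open>\<gamma>\<close> is never forced. In \<open>G\<close> the last two
      contradict that \<open>R\<close> is functional and that \<open>R \<gamma> a\<close>
      holds.\<close>
    have "\<exists>p\<in>G. U \<gamma> a p \<or> (\<exists>\<gamma>'\<in>mems b. \<gamma>' \<noteq> \<gamma> \<and> F (chk \<gamma>') (chk a) p) \<or> \<not> (\<exists>q\<in>mems ?P. le q p \<and> F (chk \<gamma>) (chk a) q)"
    proof (rule meet)
      show "dfn M (\<lambda>e. U \<gamma> a (e 0) \<or> (\<exists>\<gamma>'\<in>mems b. \<gamma>' \<noteq> \<gamma> \<and> F (chk \<gamma>') (chk a) (e 0)) \<or> \<not> (\<exists>q\<in>mems ?P. le q (e 0) \<and> F (chk \<gamma>) (chk a) q))"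
        by (intro dfnI dU F(1) chk_rec b PM aM)
      fix p assume p: "p \<epsilon> ?P"
      show "\<exists>q. q \<epsilon> ?P \<and> le q p \<and> (U \<gamma> a q \<or> (\<exists>\<gamma>'\<in>mems b. \<gamma>' \<noteq> \<gamma> \<and> F (chk \<gamma>') (chk a) q) \<or> \<not> (\<exists>q'\<in>mems ?P. le q' q \<and> F (chk \<gamma>) (chk a) q'))"
      proof (cases "\<exists>q\<in>mems ?P. le q p \<and> F (chk \<gamma>) (chk a) q")
        case True
        then obtain q where q: "q \<epsilon> ?P" "le q p" "F (chk \<gamma>) (chk a) q" by auto
        show ?thesis
        proof (cases "U \<gamma> a q")
          case False
          then obtain \<gamma>' q' where *: "\<gamma>' \<in> mems b" "\<gamma>' \<noteq> \<gamma>" "q' \<in> mems ?P" "le q' q" "F (chk \<gamma>') (chk a) q'"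
            using q(3) unfolding U_def by blast
          then have "q' \<epsilon> ?P" "le q' p" using le_trans[OF *(4) q(2)] by auto
          then show ?thesis using * by blast
        qed (use q in blast)
      qed (use p le_refl in blast)
    qed
    then obtain p where p: "p \<in> G" "U \<gamma> a p \<or> (\<exists>\<gamma>'\<in>mems b. \<gamma>' \<noteq> \<gamma> \<and> F (chk \<gamma>') (chk a) p) \<or> \<not> (\<exists>q\<in>mems ?P. le q p \<and> F (chk \<gamma>) (chk a) q)" by blast
    have "\<not> (\<exists>\<gamma>'\<in>mems b. \<gamma>' \<noteq> \<gamma> \<and> F (chk \<gamma>') (chk a) p)"
    proof
      assume "\<exists>\<gamma>'\<in>mems b. \<gamma>' \<noteq> \<gamma> \<and> F (chk \<gamma>') (chk a) p"
      then obtain \<gamma>' where *: "\<gamma>' \<epsilon> b" "\<gamma>' \<noteq> \<gamma>" "F (chk \<gamma>') (chk a) p" by auto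
      then have "R \<gamma>' a" using Fchk[OF transM[OF b *(1)]] p(1) by blast
      then show False using fn[OF a g *(1) Rg] *(2) by simp
    qed
    moreover have "\<exists>q\<in>mems ?P. le q p \<and> F (chk \<gamma>) (chk a) q"
    proof -
      obtain q where q: "q \<in> G" "F (chk \<gamma>) (chk a) q" using Fchk[OF aM(2)] Rg by blast
      obtain r where r: "r \<in> G" "le r p" "le r q" using G_dir[OF p(1) q(1)] by blast
      have "r \<in> mems ?P" using G_P[OF r(1)] by simp
      then show ?thesis using F(3)[OF q(2) G_P[OF r(1)] r(3)] r(2) by blast
    qed
    ultimately have "U \<gamma> a p" using p(2) by blast
    moreover have pP: "p \<epsilon> ?P" by (rule G_P[OF p(1)])
    moreover have "lepo M p (omega_nat (card (mems p)))" by (rule finite_lepo) (use pP in \<open>auto simp: mem_cohen\<close>)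
    ultimately show "\<exists>n. \<gamma> \<epsilon> S a (omega_nat n)" using memS g by blast
  qed
qed

text \<open>The finite pieces are indexed by \<open>hprod X hom\<close>, and their union stays below
  \<open>hprod X hom\<close> by absorption.\<close>

lemma cover_set:
  assumes d: "dfn MG (\<lambda>e. R (e 0) (e 1))" and b: "b \<in> M" and X: "X \<in> M"
    and fn: "\<And>a \<gamma> \<gamma>'. a \<epsilon> X \<Longrightarrow> \<gamma> \<epsilon> b \<Longrightarrow> \<gamma>' \<epsilon> b \<Longrightarrow> R \<gamma> a \<Longrightarrow> R \<gamma>' a \<Longrightarrow> \<gamma> = \<gamma>'"
  obtains E where "E \<in> M" "lepo M E (hprod X hom)" "mems E \<subseteq> mems b"
    "\<And>a \<gamma>. a \<epsilon> X \<Longrightarrow> \<gamma> \<epsilon> b \<Longrightarrow> R \<gamma> a \<Longrightarrow> \<gamma> \<epsilon> E"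
proof -
  obtain S where S: "\<And>t s. dtm M t \<Longrightarrow> dtm M s \<Longrightarrow> dtm M (\<lambda>e. S (t e) (s e))"
    "\<And>a n. finite (mems (S a (omega_nat n)))" "\<And>a m. mems (S a m) \<subseteq> mems b"
    "\<And>a \<gamma>. a \<epsilon> X \<Longrightarrow> \<gamma> \<epsilon> b \<Longrightarrow> R \<gamma> a \<Longrightarrow> \<exists>n. \<gamma> \<epsilon> S a (omega_nat n)"
    apply (rule cover[of R, OF d b X])
     apply (rule fn; assumption)
    subgoal premises p for S by (rule p(1)[OF p(2-)])
    done
  have dS: "dtm M (\<lambda>e. S (hfst (e 0)) (hsnd (e 0)))" by (intro S(1) dfnI)
  have XM: "hprod X hom \<in> M" using X by simp
  define Z where "Z = hset ((\<lambda>w. S (hfst w) (hsnd w)) ` mems (hprod X hom))"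
  have ZM: "Z \<in> M" unfolding Z_def by (rule hset_image_in[OF dS XM])
  have memZ: "z \<epsilon> Z \<longleftrightarrow> (\<exists>w. w \<epsilon> hprod X hom \<and> z = S (hfst w) (hsnd w))" for z
    unfolding Z_def by (subst hmem_hset) auto
  show thesis
  proof (rule that[of "hUn Z"])
    show UM: "hUn Z \<in> M" using ZM by simp
    have "lepo M (hUn Z) (hprod (hprod X hom) hom)"
    proof (rule lepo_Union[OF ZM XM hom_in])
      show "lepo M Z (hprod X hom)" unfolding Z_def by (rule lepo_image[OF dS XM])
      show "lepo M z hom" if z: "z \<epsilon> Z" for z
      proof -
        obtain x n where "z = S x (omega_nat n)" using z memZ by auto
        then show ?thesis using finite_lepo_hom[OF transM[OF ZM z]] S(2) by simp
      qed
    qed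
    then show "lepo M (hUn Z) (hprod X hom)" by (rule lepo_trans[OF UM _ lepo_absorb[OF X]])
    show "mems (hUn Z) \<subseteq> mems b" using S(3) memZ by fastforce
    fix a \<gamma> assume a: "a \<epsilon> X" and g: "\<gamma> \<epsilon> b" "R \<gamma> a"
    obtain n where n: "\<gamma> \<epsilon> S a (omega_nat n)" using S(4)[OF a g] by blast
    have "hpair a (omega_nat n) \<epsilon> hprod X hom" unfolding mem_hprod[of _ X] using a by auto
    then have "S a (omega_nat n) \<epsilon> Z" using memZ by (metis hfst_hpair hsnd_hpair)
    then show "\<gamma> \<epsilon> hUn Z" using n by auto
  qed
qed

text \<open>Apply the covering to the inverse of the injection: the possible preimages of points of
  \<open>hprod \<alpha> hom\<close> exhaust \<open>\<beta>\<close>, and they form a set of the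
  ground model that is no larger than the product.\<close>

lemma preserve:
  assumes a: "\<alpha> \<in> M" and b: "\<beta> \<in> M" and l: "lepo MG \<beta> (hprod \<alpha> hom)"
  shows "lepo M \<beta> (hprod \<alpha> hom)"
proof -
  obtain f where f: "f \<in> MG" "\<And>u. u \<epsilon> \<beta> \<Longrightarrow> happ f u \<epsilon> hprod \<alpha> hom" "\<And>u v. u \<epsilon> \<beta> \<Longrightarrow> v \<epsilon> \<beta> \<Longrightarrow> happ f u = happ f v \<Longrightarrow> u = v"
    by (rule N.lepoE[OF l]) blast
  let ?X = "hprod \<alpha> hom"
  have X: "?X \<in> M" using a by simp
  have d: "dfn MG (\<lambda>e. happ f (e 0) = e 1)" by (intro N.dfn_eq N.dtm_happ N.dtm_const N.dtm_var f(1))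
  obtain E where E: "E \<in> M" "lepo M E (hprod ?X hom)" "\<And>a \<gamma>. a \<epsilon> ?X \<Longrightarrow> \<gamma> \<epsilon> \<beta> \<Longrightarrow> happ f \<gamma> = a \<Longrightarrow> \<gamma> \<epsilon> E"
  proof (rule cover_set[of "\<lambda>\<gamma> a. happ f \<gamma> = a", OF d b X])
    show "\<gamma> = \<gamma>'" if "\<gamma> \<epsilon> \<beta>" "\<gamma>' \<epsilon> \<beta>" "happ f \<gamma> = a" "happ f \<gamma>' = a" for a \<gamma> \<gamma>'
      using f(3)[OF that(1,2)] that(3,4) by simp
  qed blast
  have "mems \<beta> \<subseteq> mems E"
  proof
    fix \<gamma> assume "\<gamma> \<in> mems \<beta>"
    then have g: "\<gamma> \<epsilon> \<beta>" by simp
    show "\<gamma> \<in> mems E" using E(3)[OF f(2)[OF g] g refl] by simp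
  qed
  then have "lepo M \<beta> E" by (rule lepo_subset[OF b])
  then show ?thesis using lepo_trans[OF b _ E(2)] lepo_trans[OF b _ lepo_absorb[OF a]] by blast
qed

text \<open>Counting of nice names. In the extension, choose for each \<open>n\<close> a condition
  of \<open>G\<close> that decides whether \<open>n\<close> belongs to the real. The choices lie in
  a countable set \<open>E\<close> of the ground model, and the pairs of \<open>n\<close> and a
  condition in \<open>E\<close> forcing \<open>n\<close> into the real form a countable set of
  \<open>M\<close>, from which \<open>G\<close> decodes the real.\<close>

lemma reals_upper: "lepo MG (N.hpow hom) (ctb (hprod hom (cohen \<mu>)))"
proof -
  let ?P = "cohen \<mu>"
  let ?Gs = "hset G"
  have cM: "ctb (hprod hom ?P) \<in> M" using PM by simp
  obtain F where F: "\<And>t s u. dtm M t \<Longrightarrow> dtm M s \<Longrightarrow> dtm M u \<Longrightarrow> dfn M (\<lambda>e. F (t e) (s e) (u e))"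
    "\<And>y x. y \<in> M \<Longrightarrow> x \<in> M \<Longrightarrow> (val y \<epsilon> val x) \<longleftrightarrow> (\<exists>p\<in>G. F y x p)"
    "\<And>y x p q. F y x p \<Longrightarrow> q \<epsilon> ?P \<Longrightarrow> le q p \<Longrightarrow> F y x q"
  proof (rule dfn_MG[of "\<lambda>y x. y \<epsilon> x"])
    show "dfn MG (\<lambda>e. e 0 \<epsilon> e 1)" by (intro N.dfn_mem N.dtm_var)
  qed blast
  have memG: "q \<epsilon> ?Gs \<longleftrightarrow> q \<in> G" for q by (simp add: countable_G)
  have dK: "dtm MG (\<lambda>e. hset {n \<in> mems hom. \<exists>q\<in>mems ?Gs. hpair n q \<epsilon> e 0})"
    by (intro dfnI N.hom_in G_in_MG)
  show ?thesis
  proof (rule N.lepo_surj[OF dK _ N.hpow_in[OF N.hom_in]])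
    show "ctb (hprod hom ?P) \<in> MG" using cM M_subset_MG by blast
    fix r assume r: "r \<epsilon> N.hpow hom"
    then have rN: "r \<in> MG" "mems r \<subseteq> mems hom" by auto
    obtain \<tau> where t: "\<tau> \<in> M" "r = val \<tau>" using rN(1) unfolding MG_def by blast
    have mr: "n \<epsilon> r \<longleftrightarrow> (\<exists>p\<in>G. F (chk n) \<tau> p)" if "n \<epsilon> hom" for n
      using F(2)[OF chk_rec(1)[OF transM[OF hom_in that]] t(1)] t(2) by simp
    \<comment> \<open>\<open>q\<close> decides \<open>n\<close>: it forces \<open>n\<close> into the
      real, or no stronger condition does.\<close>
    define dec where "dec n q \<longleftrightarrow> F (chk n) \<tau> q \<or> \<not> (\<exists>q'\<in>mems ?P. le q' q \<and> F (chk n) \<tau> q')" for n q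
    have ddec: "dfn M (\<lambda>e. dec (t e) (s e))" if "dtm M t" "dtm M s" for t s
    proof (rule dfn_subst2[OF _ that])
      show "dfn M (\<lambda>e. dec (e 0) (e 1))" unfolding dec_def by (intro dfnI F(1) chk_rec t PM)
    qed
    define D where "D = hset {w \<in> mems (hprod hom ?P). dec (hfst w) (hsnd w)}"
    have DM: "D \<in> M" unfolding D_def by (rule sep) (intro dfnI ddec, use PM in simp)
    have memD: "hpair n q \<epsilon> D \<longleftrightarrow> n \<epsilon> hom \<and> q \<epsilon> ?P \<and> dec n q" for n q
      by (simp only: D_def hmem_sep) (simp del: mem_hom)
    \<comment> \<open>The deciding conditions that lie in \<open>G\<close>. The selection among them
      is made in the extension, where \<open>G\<close> is available.\<close>
    define W where "W n = hset {q \<in> mems ?Gs. hpair n q \<epsilon> D}" for n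
    have memW: "q \<epsilon> W n \<longleftrightarrow> q \<in> G \<and> hpair n q \<epsilon> D" for q n
      by (simp only: W_def hmem_sep) (simp add: memG)
    have DN: "D \<in> MG" using DM M_subset_MG by blast
    have dW: "dtm MG (\<lambda>e. W (e 1))" unfolding W_def by (intro dfnI G_in_MG DN)
    have WN: "W n \<in> MG" if "n \<in> MG" for n using N.dtm_closed[OF dW, of "\<lambda>_. n"] that by simp
    obtain g where g: "g \<in> MG" "\<And>b. b \<epsilon> N.hpow ?Gs \<Longrightarrow> mems b \<noteq> {} \<Longrightarrow> happ g b \<epsilon> b"
      using N.choice_function[OF N.hpow_in[OF G_in_MG]] by blast
    have gW: "happ g (W n) \<epsilon> W n" if n: "n \<epsilon> hom" for n
    proof (rule g(2))
      have nM: "n \<in> M" by (rule transM[OF hom_in n])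
      have "n \<in> MG" using nM M_subset_MG by blast
      then show "W n \<epsilon> N.hpow ?Gs" using WN memW memG by (auto simp del: mem_hom)
      have "\<exists>p\<in>G. dec n p"
      proof (rule meet)
        show "dfn M (\<lambda>e. dec n (e 0))" by (intro ddec dfnI nM)
        show "\<exists>q. q \<epsilon> ?P \<and> le q p \<and> dec n q" if "p \<epsilon> ?P" for p
        proof (cases "dec n p")
          case True
          then show ?thesis using that le_refl by blast
        next
          case False
          then show ?thesis unfolding dec_def by (simp only: Bex_def in_mems) blast
        qed
      qed
      then show "mems (W n) \<noteq> {}" using memW memD n G_P by fastforce
    qed
    have dR: "dfn MG (\<lambda>e. happ g (W (e 1)) = e 0)" by (intro N.dfn_eq N.dtm_happ dW N.dtm_const N.dtm_var g(1))
    obtain E where E: "E \<in> M" "lepo M E (hprod hom hom)" "mems E \<subseteq> mems ?P"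
      "\<And>n q. n \<epsilon> hom \<Longrightarrow> q \<epsilon> ?P \<Longrightarrow> happ g (W n) = q \<Longrightarrow> q \<epsilon> E"
      by (rule cover_set[of "\<lambda>q n. happ g (W n) = q", OF dR PM hom_in]) blast+
    define C where "C = hset {w \<in> mems (hprod hom E). F (chk (hfst w)) \<tau> (hsnd w)}"
    have EP: "hprod hom E \<in> M" using E(1) by simp
    have CM: "C \<in> M" unfolding C_def by (rule sep[OF _ EP]) (intro dfnI F(1) chk_rec t)
    have memC: "hpair n q \<epsilon> C \<longleftrightarrow> n \<epsilon> hom \<and> q \<epsilon> E \<and> F (chk n) \<tau> q" for n q
      by (simp only: C_def hmem_sep) (simp del: mem_hom)
    have "w \<epsilon> C \<longleftrightarrow> w \<epsilon> hprod hom E \<and> F (chk (hfst w)) \<tau> (hsnd w)" for w by (simp only: C_def hmem_sep)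
    then have sub: "mems C \<subseteq> mems (hprod hom E)" unfolding subset_iff in_mems using in_mems by blast
    have "lepo M E hom" by (rule lepo_trans[OF E(1,2) lepo_omega_square])
    then have "lepo M (hprod hom E) (hprod hom hom)" by (intro lepo_prod lepo_refl) (use E(1) in simp_all)
    then have "lepo M (hprod hom E) hom" by (rule lepo_trans[OF EP _ lepo_omega_square])
    then have Ch: "lepo M C hom" by (rule lepo_trans[OF CM lepo_subset[OF CM sub]])
    have "mems C \<subseteq> mems (hprod hom ?P)" using sub E(3) by fastforce
    then have "C \<epsilon> ctb (hprod hom ?P)" using CM Ch mem_ctb by blast
    moreover have "hset {n \<in> mems hom. \<exists>q\<in>mems ?Gs. hpair n q \<epsilon> C} = r"
    proof (rule hcset_eqI)
      fix n
      have 1: "n \<epsilon> r" if "n \<epsilon> hom" "q \<in> G" "hpair n q \<epsilon> C" for q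
        using mr[OF that(1)] that(2,3) memC by blast
      have 2: "\<exists>q\<in>G. hpair n q \<epsilon> C" if n: "n \<epsilon> r"
      proof -
        have nh: "n \<epsilon> hom" using n rN(2) by auto
        let ?q = "happ g (W n)"
        have q: "?q \<in> G" "dec n ?q" using gW[OF nh] memW memD by blast+
        have "?q \<epsilon> E" using E(4)[OF nh G_P[OF q(1)] refl] .
        \<comment> \<open>The chosen condition decides \<open>n\<close>, and some common extension
          in \<open>G\<close> forces \<open>n\<close> into the real; so the negative decision is
          excluded.\<close>
        moreover have "F (chk n) \<tau> ?q"
        proof -
          obtain p where p: "p \<in> G" "F (chk n) \<tau> p" using mr[OF nh] n by blast
          obtain s where s: "s \<in> G" "le s ?q" "le s p" using G_dir[OF q(1) p(1)] by blast
          have "F (chk n) \<tau> s" by (rule F(3)[OF p(2) G_P[OF s(1)] s(3)])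
          then show ?thesis using q(2) s(2) G_P[OF s(1)] unfolding dec_def Bex_def in_mems by blast
        qed
        ultimately show ?thesis using q(1) nh memC by blast
      qed
      have 3: "n \<epsilon> hom" if "n \<epsilon> r" using that rN(2) by auto
      have "n \<epsilon> hset {n \<in> mems hom. \<exists>q\<in>mems ?Gs. hpair n q \<epsilon> C} \<longleftrightarrow> n \<epsilon> hom \<and> (\<exists>q. q \<in> G \<and> hpair n q \<epsilon> C)"
        by (simp only: hmem_sep) (simp only: Bex_def in_mems memG)
      then show "n \<epsilon> hset {n \<in> mems hom. \<exists>q\<in>mems ?Gs. hpair n q \<epsilon> C} \<longleftrightarrow> n \<epsilon> r" using 1 2 3 by blast
    qed
    ultimately show "\<exists>u. u \<epsilon> ctb (hprod hom ?P) \<and> hset {n \<in> mems hom. \<exists>q\<in>mems ?Gs. hpair n q \<epsilon> u} = r" by blast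
  qed
qed

text \<open>Row \<open>\<xi>\<close> of the generic function is a real \<open>F \<xi>\<close>. Rows
  are distinct by genericity: a finite condition leaves some column free, where two rows can be
  given different bits.\<close>

lemma reals_lower: "lepo MG \<mu> (N.hpow hom)"
proof -
  let ?P = "cohen \<mu>"
  let ?Gs = "hset G"
  let ?i = "\<lambda>\<xi> n k. hpair (hpair \<xi> n) (omega_nat k)"
  have memG: "q \<epsilon> ?Gs \<longleftrightarrow> q \<in> G" for q by (simp add: countable_G)
  define F where "F \<xi> = hset {n \<in> mems hom. \<exists>p\<in>mems ?Gs. ?i \<xi> n 1 \<epsilon> p}" for \<xi>
  have memF: "n \<epsilon> F \<xi> \<longleftrightarrow> n \<epsilon> hom \<and> (\<exists>p\<in>G. ?i \<xi> n 1 \<epsilon> p)" for n \<xi>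
    by (simp only: F_def hmem_sep) (simp only: Bex_def in_mems memG)
  have dF: "dtm MG (\<lambda>e. F (e 0))" unfolding F_def by (intro dfnI N.hom_in G_in_MG N.omega_nat_in)
  show ?thesis
  proof (rule N.lepoI[OF dF])
    show "\<mu> \<in> MG" using mu M_subset_MG by blast
    show "F \<xi> \<epsilon> N.hpow hom" if "\<xi> \<epsilon> \<mu>" for \<xi>
    proof -
      have "\<xi> \<in> MG" using transM[OF mu that] M_subset_MG by blast
      then have "F \<xi> \<in> MG" using N.dtm_closed[OF dF, of "\<lambda>_. \<xi>"] by simp
      then show ?thesis using memF by auto
    qed
    fix \<xi> \<eta> assume x: "\<xi> \<epsilon> \<mu>" and y: "\<eta> \<epsilon> \<mu>" and eq: "F \<xi> = F \<eta>"
    show "\<xi> = \<eta>"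
    proof (rule ccontr)
      assume ne: "\<xi> \<noteq> \<eta>"
      have xM: "\<xi> \<in> M" "\<eta> \<in> M" using transM[OF mu] x y by blast+
      have "\<exists>p\<in>G. \<exists>n\<in>mems hom. ?i \<xi> n 1 \<epsilon> p \<and> ?i \<eta> n 0 \<epsilon> p"
      proof (rule meet)
        show "dfn M (\<lambda>e. \<exists>n\<in>mems hom. ?i \<xi> n 1 \<epsilon> e 0 \<and> ?i \<eta> n 0 \<epsilon> e 0)" by (intro dfnI hom_in xM omega_nat_in)
        fix p assume p: "p \<epsilon> ?P"
        have pf: "finite (mems p)" "p \<in> M" using p by (auto simp: mem_cohen)
        have "finite ((\<lambda>u. hsnd (hfst u)) ` mems p)" using pf(1) by simp
        moreover have "infinite (range omega_nat)" by (rule range_inj_infinite) (simp add: inj_on_def)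
        ultimately have "\<not> range omega_nat \<subseteq> (\<lambda>u. hsnd (hfst u)) ` mems p"
          by (metis finite_subset)
        \<comment> \<open>A column that the finite condition \<open>p\<close> does not mention in
          any row.\<close>
        then obtain k where k: "omega_nat k \<notin> (\<lambda>u. hsnd (hfst u)) ` mems p" by (auto simp del: in_mems)
        let ?n = "omega_nat k"
        let ?a = "?i \<xi> ?n 1" and ?b = "?i \<eta> ?n 0"
        define q where "q = hset ({?a, ?b} \<union> mems p)"
        have memq: "u \<epsilon> q \<longleftrightarrow> u = ?a \<or> u = ?b \<or> u \<epsilon> p" for u
          unfolding q_def by (subst hmem_hset) (simp_all add: countable_finite pf)
        have "mems p \<subseteq> M" using transM[OF pf(2)] unfolding subset_iff in_mems by blast
        then have qM: "q \<in> M" unfolding q_def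
          by (intro fin_in) (use pf xM omega_nat_in in simp_all)
        have np: "\<not> u \<epsilon> p" if "hsnd (hfst u) = ?n" for u using k that unfolding image_iff Bex_def in_mems by metis
        have sn: "hsnd (hfst (flip u)) = hsnd (hfst u)" for u by (simp add: flip_def)
        have fa: "flip ?a = ?i \<xi> ?n 0" "flip ?b = ?i \<eta> ?n 1" by simp_all
        have "q \<epsilon> ?P" unfolding mem_cohen
        proof (intro conjI allI impI)
          show "q \<in> M" by (rule qM)
          have "?a \<epsilon> cohen_dom \<mu>" "?b \<epsilon> cohen_dom \<mu>" using x y by (auto simp: cohen_dom_def mem_two)
          then show "mems q \<subseteq> mems (cohen_dom \<mu>)" using p memq unfolding mem_cohen subset_iff in_mems by metis
          have "mems q = {?a, ?b} \<union> mems p" using memq by (simp add: set_eq_iff)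
          then show "finite (mems q)" using pf(1) by simp
          fix u assume u: "u \<epsilon> q"
          show "\<not> flip u \<epsilon> q"
          proof (cases "u \<epsilon> p")
            case True
            have 1: "\<not> flip u \<epsilon> p" using p True unfolding mem_cohen by blast
            have "hsnd (hfst u) \<noteq> ?n" using np True by blast
            then have "flip u \<noteq> ?a" "flip u \<noteq> ?b" using sn[of u] by (metis hfst_hpair hsnd_hpair)+
            then show ?thesis using 1 memq by blast
          next
            case False
            then have uab: "u = ?a \<or> u = ?b" using u memq by blast
            then have "hsnd (hfst (flip u)) = ?n" unfolding sn by auto
            then have "\<not> flip u \<epsilon> p" by (rule np)
            moreover have "flip u \<noteq> ?a \<and> flip u \<noteq> ?b" using uab
            proof
              assume "u = ?a"
              then have "flip u = ?i \<xi> ?n 0" using fa by simp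
              then show ?thesis using ne by (auto simp: omega_nat_inject)
            next
              assume "u = ?b"
              then have "flip u = ?i \<eta> ?n 1" using fa by simp
              then show ?thesis using ne by (auto simp: omega_nat_inject)
            qed
            ultimately show ?thesis using memq by blast
          qed
        qed
        moreover have "le q p" unfolding le_def using memq by auto
        moreover have "?n \<in> mems hom" by auto
        moreover have "?a \<epsilon> q" "?b \<epsilon> q" using memq by blast+
        ultimately show "\<exists>q. q \<epsilon> ?P \<and> le q p \<and> (\<exists>n\<in>mems hom. ?i \<xi> n 1 \<epsilon> q \<and> ?i \<eta> n 0 \<epsilon> q)"
          by blast
      qed
      then obtain p n where p: "p \<in> G" "n \<epsilon> hom" "?i \<xi> n 1 \<epsilon> p" "?i \<eta> n 0 \<epsilon> p"
        unfolding Bex_def in_mems by blast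
      then have "n \<epsilon> F \<xi>" using memF by blast
      then have "n \<epsilon> F \<eta>" by (simp only: eq)
      then obtain p' where p': "p' \<in> G" "?i \<eta> n 1 \<epsilon> p'" using memF by blast
      obtain s where s: "s \<in> G" "le s p" "le s p'" using G_dir[OF p(1) p'(1)] by blast
      have "?i \<eta> n 0 \<epsilon> s" "?i \<eta> n 1 \<epsilon> s" using s(2,3) p(4) p'(2) unfolding le_def subset_iff in_mems by blast+
      moreover have "flip (?i \<eta> n 0) = ?i \<eta> n 1" by simp
      ultimately show False using G_P[OF s(1)] unfolding mem_cohen by metis
    qed
  qed
qed

end

section \<open>Countable unions of worlds and the colour of the continuum\<close>

text \<open>The real codes the membership relation of an enumeration of \<open>A\<close>, pairs of
  indices being coded along \<open>pr\<close>. The coded relation is well-founded since the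
  enumeration maps it into membership, so the recursion theorem brings its collapse into the world
  that contains the real.\<close>

lemma covering:
  assumes reals: "\<forall>x. is_real x \<longrightarrow> (\<exists>M\<in>ctms. x \<in> M)"
    and A: "countable A" "transitive_set A"
  shows "\<exists>M\<in>ctms. A \<subseteq> M"
proof (cases "A = {}")
  case True
  have "is_real hempty" by (simp add: is_real_def)
  then show ?thesis using reals True by blast
next
  case False
  define a where "a = from_nat_into A"
  have ra: "range a = A" unfolding a_def by (rule range_from_nat_into[OF False A(1)])
  have cS: "countable (omega_nat ` K)" for K by simp
  define x where "x = hset (omega_nat ` {k. a (fst (pr k)) \<epsilon> a (snd (pr k))})"
  have mx: "y \<epsilon> x \<longleftrightarrow> (\<exists>k. y = omega_nat k \<and> a (fst (pr k)) \<epsilon> a (snd (pr k)))" for y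
    unfolding x_def hmem_hset[OF cS] by blast
  have "is_real x" unfolding is_real_def mx by blast
  then obtain M where M: "M \<in> ctms" "x \<in> M" using reals by blast
  interpret ctm M by unfold_locales (rule M(1))
  define E where "E = hset (Hh ` mems x)"
  have EM: "E \<in> M" unfolding E_def by (rule hset_image_in[OF _ M(2)]) (intro Hh_rec dtm_var)
  have memE0: "w \<epsilon> E \<longleftrightarrow> (\<exists>y. y \<epsilon> x \<and> w = Hh y)" for w
    unfolding E_def by (subst hmem_hset) auto
  have memE: "hpair u v \<epsilon> E \<longleftrightarrow> (\<exists>i j. u = omega_nat i \<and> v = omega_nat j \<and> a i \<epsilon> a j)" for u v
  proof
    assume "hpair u v \<epsilon> E"
    then obtain k where k: "hpair u v = Hh (omega_nat k)" "a (fst (pr k)) \<epsilon> a (snd (pr k))"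
      unfolding memE0 mx by blast
    then have "u = omega_nat (fst (pr k))" "v = omega_nat (snd (pr k))" unfolding Hh_omega_nat by simp_all
    then show "\<exists>i j. u = omega_nat i \<and> v = omega_nat j \<and> a i \<epsilon> a j" using k(2) by blast
  next
    assume "\<exists>i j. u = omega_nat i \<and> v = omega_nat j \<and> a i \<epsilon> a j"
    then obtain i j where ij: "u = omega_nat i" "v = omega_nat j" "a i \<epsilon> a j" by blast
    obtain k where k: "pr k = (i, j)" using pr_surj by blast
    have "omega_nat k \<epsilon> x" unfolding mx using k ij(3) by (intro exI[of _ k]) simp
    moreover have "hpair u v = Hh (omega_nat k)" unfolding Hh_omega_nat using k ij by simp
    ultimately show "hpair u v \<epsilon> E" unfolding memE0 by blast
  qed
  have inj: "inj omega_nat" by (rule injI) (simp only: omega_nat_inject)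
  \<comment> \<open>The collapse, known in advance: index \<open>i\<close> goes to
    \<open>a i\<close>. Sets that are not indices have no predecessors in \<open>E\<close>, so they
    must go to \<open>hempty\<close>.\<close>
  define F where "F v = (if v \<in> range omega_nat then a (inv omega_nat v) else hempty)" for v
  have Fa: "F (omega_nat i) = a i" for i by (simp add: F_def inv_f_f[OF inj])
  have dR: "dtm M (\<lambda>e. Rng (e 2))" by (intro dfnI)
  have Fin: "F v \<in> M" if v: "v \<in> M" for v
  proof (rule wf_recursion(1)[where R = "\<lambda>u v. hpair u v \<epsilon> E" and G = "\<lambda>v f. Rng f", OF _ _ _ _ _ _ _ v])
    show "wf {(u, v). hpair u v \<epsilon> E}"
    proof (rule wf_subset[OF wf_inv_image[OF wf_hmem, of F]])
      show "{(u, v). hpair u v \<epsilon> E} \<subseteq> inv_image {(x, y). x \<epsilon> y} F"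
      proof (rule subrelI)
        fix u v assume "(u, v) \<in> {(u, v). hpair u v \<epsilon> E}"
        then obtain i j where "u = omega_nat i" "v = omega_nat j" "a i \<epsilon> a j" using memE by blast
        then show "(u, v) \<in> inv_image {(x, y). x \<epsilon> y} F" using Fa by (simp add: inv_image_def)
      qed
    qed
    show "u \<in> M" if "hpair u v \<epsilon> E" for u v using pair_mem_in[OF EM that] by blast
    show "dfn M (\<lambda>e. hpair (e 0) (e 1) \<epsilon> E)" by (intro dfnI EM)
    show "\<exists>t\<in>M. v \<epsilon> t \<and> (\<forall>z\<in>mems t. \<forall>y. hpair y z \<epsilon> E \<longrightarrow> y \<epsilon> t)" if "v \<in> M" for v
    proof (rule bexI[of _ "hun hom (upair v v)"], intro conjI ballI allI impI)
      fix z y assume "hpair y z \<epsilon> E"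
      then obtain i where "y = omega_nat i" using memE by blast
      then show "y \<epsilon> hun hom (upair v v)" by simp
    qed (use that in simp_all)
    show "Rng f \<in> M" if "f \<in> M" for f using dtm_closed[OF dR, of "\<lambda>_. f"] that by simp
    show "dfn M (\<lambda>e. e 0 = Rng (e 2))" by (intro dfnI)
    fix v
    let ?U = "{u. hpair u v \<epsilon> E}"
    have "?U \<subseteq> range omega_nat" using memE by blast
    then have cU: "countable ?U" by (rule countable_subset) simp
    have "F v = hset (F ` ?U)"
    proof (rule hcset_eqI)
      fix z
      have "z \<epsilon> F v \<longleftrightarrow> z \<in> F ` ?U"
      proof (cases "v \<in> range omega_nat")
        case True
        then obtain j where j: "v = omega_nat j" by blast
        have "z \<epsilon> a j \<longleftrightarrow> (\<exists>i. z = a i \<and> a i \<epsilon> a j)"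
          using A(2) ra unfolding transitive_set_def by blast
        moreover have "z \<in> F ` ?U \<longleftrightarrow> (\<exists>i. z = a i \<and> a i \<epsilon> a j)"
        proof
          assume "z \<in> F ` ?U"
          then obtain u where u: "z = F u" "hpair u v \<epsilon> E" by blast
          then obtain i j' where "u = omega_nat i" "v = omega_nat j'" "a i \<epsilon> a j'" using memE by blast
          then show "\<exists>i. z = a i \<and> a i \<epsilon> a j" using u(1) j Fa by auto
        next
          assume "\<exists>i. z = a i \<and> a i \<epsilon> a j"
          then obtain i where i: "z = a i" "a i \<epsilon> a j" by blast
          then have "hpair (omega_nat i) v \<epsilon> E" unfolding memE j by blast
          then show "z \<in> F ` ?U" using i(1) Fa[of i] by (intro image_eqI[of _ _ "omega_nat i"]) simp_all
        qed
        ultimately show ?thesis unfolding j Fa by blast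
      next
        case v: False
        then have "?U = {}" using memE by blast
        then show ?thesis using v by (simp add: F_def)
      qed
      then show "z \<epsilon> F v \<longleftrightarrow> z \<epsilon> hset (F ` ?U)" unfolding hmem_hset[OF countable_image[OF cU]] .
    qed
    then show "F v = Rng (hgraph F ?U)" unfolding Rng_hgraph[OF cU] .
  qed
  have "A \<subseteq> M"
  proof
    fix y assume "y \<in> A"
    then obtain i where "y = a i" using ra by blast
    then show "y \<in> M" using Fin[OF omega_nat_in[of i]] Fa by simp
  qed
  then show ?thesis using M(1) by blast
qed

lemma union_of_ctms:
  fixes A :: "nat \<Rightarrow> hcset set"
  assumes reals: "\<forall>x. is_real x \<longrightarrow> (\<exists>M\<in>ctms. x \<in> M)" and A: "\<And>n. A n \<in> ctms"
  shows "\<exists>W\<in>ctms. (\<Union>n. A n) \<subseteq> W"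
proof (rule covering[OF reals])
  show "countable (\<Union>n. A n)" using A by (intro countable_UN) (auto simp: ctms_def)
  show "transitive_set (\<Union>n. A n)" using A unfolding ctms_def transitive_set_def by blast
qed

text \<open>In contrast to \<open>dfn\<close>, one formula works for all worlds and there are no
  parameters, as is required of notions that are to be expressed by a sentence.\<close>

definition udf :: "(hcset set \<Rightarrow> (nat \<Rightarrow> hcset) \<Rightarrow> bool) \<Rightarrow> bool" where
  "udf P \<longleftrightarrow> (\<exists>\<phi>. \<forall>M\<in>ctms. \<forall>e. range e \<subseteq> M \<longrightarrow> (P M e \<longleftrightarrow> ssat M e \<phi>))"

lemma udf_mem: "udf (\<lambda>M e. e i \<epsilon> e j)"
  unfolding udf_def by (rule exI[of _ "FMem i j"]) simp

lemma udf_eq: "udf (\<lambda>M e. e i = e j)"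
  unfolding udf_def by (rule exI[of _ "FEq i j"]) simp

lemma udf_false: "udf (\<lambda>M e. False)"
  unfolding udf_def by (rule exI[of _ FFls]) simp

lemma udf_imp: assumes "udf P" "udf Q" shows "udf (\<lambda>M e. P M e \<longrightarrow> Q M e)"
proof -
  obtain \<phi> where 1: "\<forall>M\<in>ctms. \<forall>e. range e \<subseteq> M \<longrightarrow> (P M e \<longleftrightarrow> ssat M e \<phi>)" using assms(1) unfolding udf_def ..
  obtain \<psi> where 2: "\<forall>M\<in>ctms. \<forall>e. range e \<subseteq> M \<longrightarrow> (Q M e \<longleftrightarrow> ssat M e \<psi>)" using assms(2) unfolding udf_def ..
  show ?thesis unfolding udf_def by (rule exI[of _ "FImp \<phi> \<psi>"]) (use 1 2 in simp)
qed

lemma udf_not: "udf P \<Longrightarrow> udf (\<lambda>M e. \<not> P M e)"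
  using udf_imp[OF _ udf_false, of P] by simp

lemma udf_or: assumes "udf P" "udf Q" shows "udf (\<lambda>M e. P M e \<or> Q M e)"
  using udf_imp[OF udf_not[OF assms(1)] assms(2)] by (simp add: disj_imp)

lemma udf_and: assumes "udf P" "udf Q" shows "udf (\<lambda>M e. P M e \<and> Q M e)"
  using udf_not[OF udf_imp[OF assms(1) udf_not[OF assms(2)]]] by simp

lemma udf_iff: assumes "udf P" "udf Q" shows "udf (\<lambda>M e. P M e \<longleftrightarrow> Q M e)"
  using udf_and[OF udf_imp[OF assms] udf_imp[OF assms(2,1)]] by (simp add: iff_conv_conj_imp)

lemma fv_fvars: "fv \<phi> \<subseteq> fvars \<phi>" by (induction \<phi>) auto

lemma udf_all:
  assumes "udf (\<lambda>M e. Q M (e 0) (\<lambda>i. e (Suc i)))"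
  shows "udf (\<lambda>M e. \<forall>x\<in>M. Q M x e)"
proof -
  obtain \<phi> where 1: "\<forall>M\<in>ctms. \<forall>e. range e \<subseteq> M \<longrightarrow> (Q M (e 0) (\<lambda>i. e (Suc i)) \<longleftrightarrow> ssat M e \<phi>)"
    using assms unfolding udf_def ..
  obtain N where N: "\<And>n. n \<in> fvars \<phi> \<Longrightarrow> n < N"
    using finite_nat_set_iff_bounded[of "fvars \<phi>"] by auto
  define g where "g n = (if n = 0 then N else n - 1)" for n
  have inj: "inj_on g (fvars \<phi>)"
  proof (rule inj_onI)
    fix m n assume "m \<in> fvars \<phi>" "n \<in> fvars \<phi>" "g m = g n"
    then show "m = n" using N[of m] N[of n] by (auto simp: g_def split: if_splits)
  qed
  have "(\<forall>x\<in>M. Q M x e) \<longleftrightarrow> ssat M e (FAll N (ren g \<phi>))" if M: "M \<in> ctms" and e: "range e \<subseteq> M" for M e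
  proof -
    have "Q M x e \<longleftrightarrow> ssat M (e(N := x)) (ren g \<phi>)" if x: "x \<in> M" for x
    proof -
      have "e n \<in> M" for n using e by auto
      then have "range (case_nat x e) \<subseteq> M" using x by (auto split: nat.splits)
      then have "Q M x e \<longleftrightarrow> ssat M (case_nat x e) \<phi>" using 1 M by fastforce
      also have "\<dots> \<longleftrightarrow> ssat M (e(N := x) \<circ> g) \<phi>"
      proof (rule ssat_cong_fv)
        fix n assume "n \<in> fv \<phi>"
        then have "n < N" using fv_fvars N by blast
        then show "case_nat x e n = (e(N := x) \<circ> g) n" by (cases n) (simp_all add: g_def)
      qed
      also have "\<dots> \<longleftrightarrow> ssat M (e(N := x)) (ren g \<phi>)" using ssat_ren[OF inj] ..
      finally show ?thesis .
    qed
    then show ?thesis by simp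
  qed
  then show ?thesis unfolding udf_def by blast
qed

lemma udf_ex:
  assumes "udf (\<lambda>M e. Q M (e 0) (\<lambda>i. e (Suc i)))"
  shows "udf (\<lambda>M e. \<exists>x\<in>M. Q M x e)"
  using udf_not[OF udf_all[of "\<lambda>M x e. \<not> Q M x e", OF udf_not[OF assms]]] by simp

lemma udf_ex_less:
  assumes "\<And>i :: nat. udf (Q i)" shows "udf (\<lambda>M e. \<exists>i<n. Q i M e)"
proof (induction n)
  case 0
  show ?case using udf_false by simp
next
  case (Suc n)
  have "(\<lambda>M e. \<exists>i<Suc n. Q i M e) = (\<lambda>M e. (\<exists>i<n. Q i M e) \<or> Q n M e)"
    by (intro ext) (auto simp: less_Suc_eq)
  then show ?case using udf_or[OF Suc assms[of n]] by simp
qed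

lemma udf_cong:
  assumes "udf P" "\<And>M e. ctm M \<Longrightarrow> (\<And>i. e i \<in> M) \<Longrightarrow> Q M e \<longleftrightarrow> P M e"
  shows "udf Q"
proof -
  have "Q M e \<longleftrightarrow> P M e" if "M \<in> ctms" "range e \<subseteq> M" for M e
    by (rule assms(2)) (use that in \<open>auto simp: ctm_def\<close>)
  then show ?thesis using assms(1) unfolding udf_def by simp
qed

lemmas udf_logic = udf_mem udf_eq udf_not udf_and udf_or udf_imp udf_iff udf_all udf_ex

context ctm
begin

lemma eq_iff: "a \<in> M \<Longrightarrow> b \<in> M \<Longrightarrow> a = b \<longleftrightarrow> (\<forall>w\<in>M. w \<epsilon> a \<longleftrightarrow> w \<epsilon> b)"
proof
  assume a: "a \<in> M" "b \<in> M" and *: "\<forall>w\<in>M. w \<epsilon> a \<longleftrightarrow> w \<epsilon> b"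
  show "a = b"
  proof (rule hcset_eqI)
    show "w \<epsilon> a \<longleftrightarrow> w \<epsilon> b" for w using * transM[OF a(1), of w] transM[OF a(2), of w] by blast
  qed
qed simp

lemma Ord_M: "x \<in> M \<Longrightarrow> Ord x \<longleftrightarrow> (\<forall>y\<in>M. y \<epsilon> x \<longrightarrow> (\<forall>z\<in>M. z \<epsilon> y \<longrightarrow> z \<epsilon> x)) \<and>
    (\<forall>y\<in>M. y \<epsilon> x \<longrightarrow> (\<forall>z\<in>M. z \<epsilon> y \<longrightarrow> (\<forall>w\<in>M. w \<epsilon> z \<longrightarrow> w \<epsilon> y)))"
  unfolding Ord_iff Tr_iff by (meson transM)

text \<open>A fixed point equation. It forces all natural numbers into \<open>z\<close>, and by
  induction on membership it lets in nothing else.\<close>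

lemma hom_iff:
  assumes z: "z \<in> M"
  shows "z = hom \<longleftrightarrow> (\<forall>n\<in>M. n \<epsilon> z \<longleftrightarrow> n = omega_nat 0 \<or> (\<exists>m\<in>M. m \<epsilon> z \<and> n = hsucc m))"
proof
  assume zh: "z = hom"
  show "\<forall>n\<in>M. n \<epsilon> z \<longleftrightarrow> n = omega_nat 0 \<or> (\<exists>m\<in>M. m \<epsilon> z \<and> n = hsucc m)"
  proof
    fix n
    show "n \<epsilon> z \<longleftrightarrow> n = omega_nat 0 \<or> (\<exists>m\<in>M. m \<epsilon> z \<and> n = hsucc m)"
    proof
      assume "n \<epsilon> z"
      then obtain i where i: "n = omega_nat i" unfolding zh by auto
      show "n = omega_nat 0 \<or> (\<exists>m\<in>M. m \<epsilon> z \<and> n = hsucc m)"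
      proof (cases i)
        case (Suc j)
        have "n = hsucc (omega_nat j)" using i Suc omega_nat_Suc by simp
        moreover have "omega_nat j \<epsilon> z" "omega_nat j \<in> M" unfolding zh by simp_all
        ultimately show ?thesis by blast
      qed (use i in simp)
    next
      assume "n = omega_nat 0 \<or> (\<exists>m\<in>M. m \<epsilon> z \<and> n = hsucc m)"
      then consider "n = omega_nat 0" | j where "n = hsucc (omega_nat j)" unfolding zh mem_hom by blast
      then show "n \<epsilon> z"
      proof cases
        case (2 j)
        then have "n = omega_nat (Suc j)" using omega_nat_Suc by simp
        then show ?thesis unfolding zh mem_hom by blast
      qed (simp add: zh)
    qed
  qed
next
  assume *: "\<forall>n\<in>M. n \<epsilon> z \<longleftrightarrow> n = omega_nat 0 \<or> (\<exists>m\<in>M. m \<epsilon> z \<and> n = hsucc m)"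
  have 1: "omega_nat i \<epsilon> z" for i
  proof (induction i)
    case 0
    show ?case using * omega_nat_in by blast
  next
    case (Suc i)
    have "omega_nat (Suc i) = hsucc (omega_nat i)" using omega_nat_Suc by simp
    then show ?case using * omega_nat_in Suc by blast
  qed
  have 2: "n \<epsilon> z \<longrightarrow> n \<in> range omega_nat" for n
  proof (induction n rule: hmem_induct)
    case (1 n)
    show ?case
    proof
      assume n: "n \<epsilon> z"
      then consider "n = omega_nat 0" | m where "m \<epsilon> z" "n = hsucc m" using * transM[OF z n] by blast
      then show "n \<in> range omega_nat"
      proof cases
        case (2 m)
        then obtain i where "m = omega_nat i" using 1[of m] by auto
        then have "n = omega_nat (Suc i)" using 2 omega_nat_Suc by simp
        then show ?thesis by blast
      qed simp
    qed
  qed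
  show "z = hom"
  proof (rule hcset_eqI)
    show "n \<epsilon> z \<longleftrightarrow> n \<epsilon> hom" for n unfolding mem_hom using 1 2 by blast
  qed
qed

text \<open>Expresses injectability by membership of pairs. The relation \<open>f\<close> may have
  several values at a point; it is enough that each \<open>a\<close> owns some \<open>b\<close>
  which is related to no other element of \<open>x\<close>.\<close>

lemma lepo_iff:
  assumes x: "x \<in> M" and y: "y \<in> M"
  shows "lepo M x y \<longleftrightarrow> (\<exists>f\<in>M. \<forall>a\<in>M. a \<epsilon> x \<longrightarrow>
    (\<exists>b\<in>M. b \<epsilon> y \<and> hpair a b \<epsilon> f \<and> (\<forall>a'\<in>M. a' \<epsilon> x \<longrightarrow> hpair a' b \<epsilon> f \<longrightarrow> a = a')))"
    (is "_ \<longleftrightarrow> ?r")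
proof
  assume "lepo M x y"
  then obtain f where fM: "f \<in> M" and f: "\<forall>a\<in>mems x. happ f a \<epsilon> y"
    "\<forall>a\<in>mems x. \<forall>b\<in>mems x. happ f a = happ f b \<longrightarrow> a = b"
    unfolding lepo_def by blast
  let ?g = "hgraph (happ f) (mems x)"
  have "dtm M (\<lambda>e. happ f (e 0))" by (intro dfnI fM)
  then have g: "?g \<in> M" by (rule dtm_graph[OF _ x])
  have mg: "hpair a b \<epsilon> ?g \<longleftrightarrow> a \<epsilon> x \<and> b = happ f a" for a b
    unfolding hgraph_def by (subst hmem_hset) auto
  have "\<exists>b\<in>M. b \<epsilon> y \<and> hpair a b \<epsilon> ?g \<and> (\<forall>a'\<in>M. a' \<epsilon> x \<longrightarrow> hpair a' b \<epsilon> ?g \<longrightarrow> a = a')" if a: "a \<epsilon> x" for a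
  proof (rule bexI[of _ "happ f a"], intro conjI ballI impI)
    show 1: "happ f a \<epsilon> y" using f(1) a by simp
    show "happ f a \<in> M" by (rule transM[OF y 1])
    show "hpair a (happ f a) \<epsilon> ?g" unfolding mg using a by blast
    show "a = a'" if "a' \<epsilon> x" "hpair a' (happ f a) \<epsilon> ?g" for a'
      using that(2) f(2) a that(1) unfolding mg Ball_def in_mems by blast
  qed
  then show ?r using g by blast
next
  assume ?r
  then obtain f where fM: "f \<in> M" and f: "\<And>a. a \<in> M \<Longrightarrow> a \<epsilon> x \<Longrightarrow>
    \<exists>b\<in>M. b \<epsilon> y \<and> hpair a b \<epsilon> f \<and> (\<forall>a'\<in>M. a' \<epsilon> x \<longrightarrow> hpair a' b \<epsilon> f \<longrightarrow> a = a')" by blast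
  \<comment> \<open>Where \<open>b\<close> has exactly one owner, the union of the singleton of
    owners is that owner; this gives a surjection onto \<open>x\<close>.\<close>
  have d: "dtm M (\<lambda>e. hUn (hset {a \<in> mems x. hpair a (e 0) \<epsilon> f}))" by (intro dfnI x fM)
  show "lepo M x y"
  proof (rule lepo_surj[OF d y x])
    fix v assume v: "v \<epsilon> x"
    obtain b where b: "b \<epsilon> y" "hpair v b \<epsilon> f" "\<forall>a'\<in>M. a' \<epsilon> x \<longrightarrow> hpair a' b \<epsilon> f \<longrightarrow> v = a'"
      using f[OF transM[OF x v] v] by blast
    have "{a \<in> mems x. hpair a b \<epsilon> f} = {v}"
    proof
      show "{a \<in> mems x. hpair a b \<epsilon> f} \<subseteq> {v}"
      proof
        fix a assume a: "a \<in> {a \<in> mems x. hpair a b \<epsilon> f}"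
        then have "a \<epsilon> x" "hpair a b \<epsilon> f" by simp_all
        then show "a \<in> {v}" using b(3) transM[OF x] by blast
      qed
    qed (use v b(2) in simp)
    then have "hUn (hset {a \<in> mems x. hpair a b \<epsilon> f}) = hUn (hset {v})" by simp
    also have "\<dots> = v" by (rule hcset_eqI) (simp add: hmem_hset)
    finally show "\<exists>u. u \<epsilon> y \<and> hUn (hset {a \<in> mems x. hpair a u \<epsilon> f}) = v" using b(1) by blast
  qed
qed

end

lemma udf_upair: "udf (\<lambda>M e. e k = upair (e i) (e j))"
proof (rule udf_cong)
  show "udf (\<lambda>M e. \<forall>w\<in>M. w \<epsilon> e k \<longleftrightarrow> w = e i \<or> w = e j)" by (intro udf_logic)
  fix M and e :: "nat \<Rightarrow> hcset" assume "ctm M" and e: "\<And>i. e i \<in> M"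
  then interpret ctm M by simp
  have "upair (e i) (e j) \<in> M" using e by simp
  from eq_iff[OF e this] show "e k = upair (e i) (e j) \<longleftrightarrow> (\<forall>w\<in>M. w \<epsilon> e k \<longleftrightarrow> w = e i \<or> w = e j)" by simp
qed

lemma udf_hsucc: "udf (\<lambda>M e. e k = hsucc (e i))"
proof (rule udf_cong)
  show "udf (\<lambda>M e. \<forall>w\<in>M. w \<epsilon> e k \<longleftrightarrow> w = e i \<or> w \<epsilon> e i)" by (intro udf_logic)
  fix M and e :: "nat \<Rightarrow> hcset" assume "ctm M" and e: "\<And>i. e i \<in> M"
  then interpret ctm M by simp
  have "dtm M (\<lambda>e. hsucc (e i))" by (intro dfnI)
  then have "hsucc (e i) \<in> M" by (rule dtm_closed) (rule e)
  from eq_iff[OF e this] show "e k = hsucc (e i) \<longleftrightarrow> (\<forall>w\<in>M. w \<epsilon> e k \<longleftrightarrow> w = e i \<or> w \<epsilon> e i)" by simp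
qed

lemma udf_omega_nat: "udf (\<lambda>M e. e k = omega_nat n)"
proof (induction n arbitrary: k)
  case 0
  show ?case
  proof (rule udf_cong)
    show "udf (\<lambda>M e. \<forall>w\<in>M. \<not> w \<epsilon> e k)" by (intro udf_logic)
    fix M and e :: "nat \<Rightarrow> hcset" assume "ctm M" and e: "\<And>i. e i \<in> M"
    then interpret ctm M by simp
    from eq_iff[OF e hempty_in] show "e k = omega_nat 0 \<longleftrightarrow> (\<forall>w\<in>M. \<not> w \<epsilon> e k)"
      by (simp add: omega_nat_0)
  qed
next
  case (Suc n)
  show ?case
  proof (rule udf_cong)
    show "udf (\<lambda>M e. \<exists>y\<in>M. y = omega_nat n \<and> e (k) = hsucc y)" by (intro udf_logic Suc udf_hsucc)
    fix M and e :: "nat \<Rightarrow> hcset" assume "ctm M"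
    then interpret ctm M by simp
    show "e k = omega_nat (Suc n) \<longleftrightarrow> (\<exists>y\<in>M. y = omega_nat n \<and> e k = hsucc y)"
      using omega_nat_in omega_nat_Suc by auto
  qed
qed

lemma udf_hpair: "udf (\<lambda>M e. e k = hpair (e i) (e j))"
proof (rule udf_cong)
  show "udf (\<lambda>M e. \<exists>u\<in>M. u = upair (e i) (e i) \<and> (\<exists>v\<in>M. v = upair (e i) (e j) \<and> e k = upair u v))"
    by (intro udf_logic udf_upair)
  fix M and e :: "nat \<Rightarrow> hcset" assume "ctm M" and e: "\<And>i. e i \<in> M"
  then interpret ctm M by simp
  show "e k = hpair (e i) (e j) \<longleftrightarrow> (\<exists>u\<in>M. u = upair (e i) (e i) \<and> (\<exists>v\<in>M. v = upair (e i) (e j) \<and> e k = upair u v))"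
    using e by (simp add: hpair_def)
qed

lemma udf_hpair_mem: "udf (\<lambda>M e. hpair (e i) (e j) \<epsilon> e k)"
proof (rule udf_cong)
  show "udf (\<lambda>M e. \<exists>p\<in>M. p = hpair (e i) (e j) \<and> p \<epsilon> e k)" by (intro udf_logic udf_hpair)
  fix M and e :: "nat \<Rightarrow> hcset" assume "ctm M" and e: "\<And>i. e i \<in> M"
  then interpret ctm M by simp
  show "hpair (e i) (e j) \<epsilon> e k \<longleftrightarrow> (\<exists>p\<in>M. p = hpair (e i) (e j) \<and> p \<epsilon> e k)" using e by simp
qed

lemma udf_hom: "udf (\<lambda>M e. e k = hom)"
proof (rule udf_cong)
  show "udf (\<lambda>M e. \<forall>n\<in>M. n \<epsilon> e k \<longleftrightarrow> n = omega_nat 0 \<or> (\<exists>m\<in>M. m \<epsilon> e k \<and> n = hsucc m))"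
    by (intro udf_logic udf_omega_nat udf_hsucc)
qed (rule ctm.hom_iff)

lemma udf_hprod: "udf (\<lambda>M e. e k = hprod (e i) (e j))"
proof (rule udf_cong)
  show "udf (\<lambda>M e. \<forall>w\<in>M. w \<epsilon> e k \<longleftrightarrow> (\<exists>a\<in>M. \<exists>b\<in>M. a \<epsilon> e i \<and> b \<epsilon> e j \<and> w = hpair a b))"
    by (intro udf_logic udf_hpair)
  fix M and e :: "nat \<Rightarrow> hcset" assume "ctm M" and e: "\<And>i. e i \<in> M"
  then interpret ctm M by simp
  have "w \<epsilon> hprod (e i) (e j) \<longleftrightarrow> (\<exists>a\<in>M. \<exists>b\<in>M. a \<epsilon> e i \<and> b \<epsilon> e j \<and> w = hpair a b)" for w
    unfolding mem_hprod using transM[OF e[of i]] transM[OF e[of j]] by blast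
  moreover have "hprod (e i) (e j) \<in> M" using e by simp
  ultimately show "e k = hprod (e i) (e j) \<longleftrightarrow> (\<forall>w\<in>M. w \<epsilon> e k \<longleftrightarrow> (\<exists>a\<in>M. \<exists>b\<in>M. a \<epsilon> e i \<and> b \<epsilon> e j \<and> w = hpair a b))"
    using eq_iff[OF e] by simp
qed

lemma udf_hpow: "udf (\<lambda>M e. e k = ctm.hpow M (e i))"
proof (rule udf_cong)
  show "udf (\<lambda>M e. \<forall>w\<in>M. w \<epsilon> e k \<longleftrightarrow> (\<forall>v\<in>M. v \<epsilon> w \<longrightarrow> v \<epsilon> e i))" by (intro udf_logic)
  fix M and e :: "nat \<Rightarrow> hcset" assume "ctm M" and e: "\<And>i. e i \<in> M"
  then interpret ctm M by simp
  have "w \<epsilon> hpow (e i) \<longleftrightarrow> (\<forall>v\<in>M. v \<epsilon> w \<longrightarrow> v \<epsilon> e i)" if w: "w \<in> M" for w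
    unfolding mem_hpow subset_iff in_mems using transM[OF w] w by blast
  then show "e k = hpow (e i) \<longleftrightarrow> (\<forall>w\<in>M. w \<epsilon> e k \<longleftrightarrow> (\<forall>v\<in>M. v \<epsilon> w \<longrightarrow> v \<epsilon> e i))"
    using eq_iff[OF e hpow_in[OF e]] by simp
qed

lemma udf_lepo: "udf (\<lambda>M e. lepo M (e i) (e j))"
proof (rule udf_cong)
  show "udf (\<lambda>M e. \<exists>f\<in>M. \<forall>a\<in>M. a \<epsilon> e i \<longrightarrow>
    (\<exists>b\<in>M. b \<epsilon> e j \<and> hpair a b \<epsilon> f \<and> (\<forall>a'\<in>M. a' \<epsilon> e i \<longrightarrow> hpair a' b \<epsilon> f \<longrightarrow> a = a')))"
    by (intro udf_logic udf_hpair_mem)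
qed (rule ctm.lepo_iff)

lemma udf_Ord: "udf (\<lambda>M e. Ord (e i))"
proof (rule udf_cong)
  show "udf (\<lambda>M e. (\<forall>y\<in>M. y \<epsilon> e i \<longrightarrow> (\<forall>z\<in>M. z \<epsilon> y \<longrightarrow> z \<epsilon> e i)) \<and>
    (\<forall>y\<in>M. y \<epsilon> e i \<longrightarrow> (\<forall>z\<in>M. z \<epsilon> y \<longrightarrow> (\<forall>w\<in>M. w \<epsilon> z \<longrightarrow> w \<epsilon> y))))"
    by (intro udf_logic)
qed (rule ctm.Ord_M)

text \<open>
  Cardinality is measured by \<open>lepo M \<beta> (hprod \<alpha> hom)\<close> instead of \<open>lepo M \<beta> \<alpha>\<close>, as this is what
  Cohen forcing preserves without any cardinal arithmetic; for infinite \<open>\<alpha>\<close> both agree.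
\<close>

definition lepo_hom :: "hcset set \<Rightarrow> hcset \<Rightarrow> hcset \<Rightarrow> bool" where
  "lepo_hom M \<beta> \<alpha> \<longleftrightarrow> lepo M \<beta> (hprod \<alpha> hom)"

text \<open>These are 0, 1 and the uncountable cardinals: a countable ordinal above 1 injects into
  \<open>hprod z hom\<close> already for \<open>z\<close> equal to 1.\<close>

definition crd :: "hcset set \<Rightarrow> hcset \<Rightarrow> bool" where
  "crd M y \<longleftrightarrow> Ord y \<and> (\<forall>z\<in>M. z \<epsilon> y \<longrightarrow> \<not> lepo_hom M y z)"

definition scrd :: "hcset set \<Rightarrow> hcset \<Rightarrow> hcset \<Rightarrow> bool" where
  "scrd M z y \<longleftrightarrow> crd M z \<and> crd M y \<and> z \<epsilon> y \<and> (\<forall>u\<in>M. z \<epsilon> u \<longrightarrow> u \<epsilon> y \<longrightarrow> \<not> crd M u)"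

text \<open>The quantifiers over \<open>h\<close> and \<open>p\<close> merely name
  \<open>\<omega>\<close> and its power set, so that each atom matches a rule for uniform
  definability.\<close>

definition continuum :: "hcset set \<Rightarrow> hcset \<Rightarrow> bool" where
  "continuum M x \<longleftrightarrow> (\<exists>h\<in>M. h = hom \<and> (\<exists>p\<in>M. p = ctm.hpow M h \<and> Ord x \<and> lepo M p x \<and> (\<forall>y\<in>M. y \<epsilon> x \<longrightarrow> \<not> lepo M p y)))"

definition nxt :: "nat \<Rightarrow> hcset \<Rightarrow> hcset \<Rightarrow> bool" where
  "nxt k u v \<longleftrightarrow> (\<exists>i<k. u = omega_nat i \<and> v = omega_nat (Suc i mod k))"

text \<open>Every entry has to be justified by an entry for the immediate predecessor, or by its
  absence. This local condition makes any two colourings agree where both are defined, by induction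
  on membership.\<close>

definition coloring :: "hcset set \<Rightarrow> nat \<Rightarrow> hcset \<Rightarrow> bool" where
  "coloring M k g \<longleftrightarrow> (\<forall>y\<in>M. \<forall>v\<in>M. hpair y v \<epsilon> g \<longrightarrow>
     (v = omega_nat 0 \<and> \<not> (\<exists>z\<in>M. scrd M z y)) \<or>
     (\<exists>z\<in>M. \<exists>u\<in>M. scrd M z y \<and> hpair z u \<epsilon> g \<and> nxt k u v))"

definition color :: "hcset set \<Rightarrow> nat \<Rightarrow> hcset \<Rightarrow> nat \<Rightarrow> bool" where
  "color M k y r \<longleftrightarrow> (\<exists>g\<in>M. \<exists>v\<in>M. v = omega_nat r \<and> hpair y v \<epsilon> g \<and> coloring M k g)"

definition continuum_color :: "hcset set \<Rightarrow> nat \<Rightarrow> nat \<Rightarrow> bool" where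
  "continuum_color M k r \<longleftrightarrow> (\<exists>x\<in>M. continuum M x \<and> color M k x r)"

lemma udf_lepo_hom: "udf (\<lambda>M e. lepo_hom M (e i) (e j))"
proof (rule udf_cong)
  show "udf (\<lambda>M e. \<exists>h\<in>M. h = hom \<and> (\<exists>p\<in>M. p = hprod (e j) h \<and> lepo M (e i) p))"
    by (intro udf_logic udf_hom udf_hprod udf_lepo)
  fix M and e :: "nat \<Rightarrow> hcset" assume "ctm M" and e: "\<And>i. e i \<in> M"
  then interpret ctm M by simp
  show "lepo_hom M (e i) (e j) \<longleftrightarrow> (\<exists>h\<in>M. h = hom \<and> (\<exists>p\<in>M. p = hprod (e j) h \<and> lepo M (e i) p))"
    using e by (simp add: lepo_hom_def)
qed

lemma udf_crd: "udf (\<lambda>M e. crd M (e i))"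
  unfolding crd_def by (intro udf_logic udf_Ord udf_lepo_hom)

lemma udf_scrd: "udf (\<lambda>M e. scrd M (e i) (e j))"
  unfolding scrd_def by (intro udf_logic udf_crd)

lemma udf_nxt: "udf (\<lambda>M e. nxt k (e i) (e j))"
  unfolding nxt_def by (intro udf_ex_less udf_logic udf_omega_nat)

lemma udf_continuum_color: "udf (\<lambda>M e. continuum_color M k r)"
  unfolding continuum_color_def continuum_def color_def coloring_def
  by (intro udf_logic udf_hom udf_hpow udf_Ord udf_lepo udf_omega_nat udf_hpair_mem udf_scrd udf_nxt)

lemma finite_fv: "finite (fv \<phi>)" by (induction \<phi>) auto

text \<open>The truth of the formula is independent of the assignment, so its free variables can be
  quantified away; worlds are nonempty, hence the universal closure keeps its meaning.\<close>

lemma udf_sentence: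
  assumes "udf (\<lambda>M e. S M)"
  obtains \<psi> where "fv \<psi> = {}" "\<And>M e. M \<in> ctms \<Longrightarrow> range e \<subseteq> M \<Longrightarrow> ssat M e \<psi> \<longleftrightarrow> S M"
proof -
  obtain \<phi> where \<phi>: "\<forall>M\<in>ctms. \<forall>e. range e \<subseteq> M \<longrightarrow> (S M \<longleftrightarrow> ssat M e \<phi>)" using assms unfolding udf_def ..
  obtain xs where xs: "set xs = fv \<phi>" using finite_list[OF finite_fv] by blast
  have f: "fv (foldr FAll ys \<phi>) = fv \<phi> - set ys" for ys by (induction ys) auto
  have "ssat M e (foldr FAll ys \<phi>) \<longleftrightarrow> S M" if M: "M \<in> ctms" and "range e \<subseteq> M" for M e ys
    using that(2)
  proof (induction ys arbitrary: e)
    case Nil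
    then show ?case using \<phi> M by simp
  next
    case (Cons n ys)
    have "ssat M (e(n := x)) (foldr FAll ys \<phi>) \<longleftrightarrow> S M" if "x \<in> M" for x
      by (rule Cons.IH) (use Cons.prems that in auto)
    moreover have "e 0 \<in> M" using Cons.prems by blast
    ultimately show ?case by auto
  qed
  then show thesis using that[of "foldr FAll xs \<phi>"] f xs by blast
qed

section \<open>Colours of cardinals in a world\<close>

context ctm
begin

lemma scrd_unique:
  assumes "scrd M z y" "scrd M z' y" "z \<in> M" "z' \<in> M" shows "z = z'"
  using Ord_linear[of z z'] assms unfolding scrd_def crd_def by blast

lemma coloring_unique:
  assumes "g \<in> M" "coloring M k g" "g' \<in> M" "coloring M k g'"
  shows "hpair y v \<epsilon> g \<Longrightarrow> hpair y v' \<epsilon> g' \<Longrightarrow> v = v'"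
proof (induction y arbitrary: v v' rule: hmem_induct)
  case (1 y)
  have M: "y \<in> M" "v \<in> M" "v' \<in> M" using pair_mem_in[OF assms(1) 1(2)] pair_mem_in[OF assms(3) 1(3)] by blast+
  have a: "(v = omega_nat 0 \<and> \<not> (\<exists>z\<in>M. scrd M z y)) \<or> (\<exists>z\<in>M. \<exists>u\<in>M. scrd M z y \<and> hpair z u \<epsilon> g \<and> nxt k u v)"
    using assms(2) M 1(2) unfolding coloring_def by blast
  have b: "(v' = omega_nat 0 \<and> \<not> (\<exists>z\<in>M. scrd M z y)) \<or> (\<exists>z\<in>M. \<exists>u\<in>M. scrd M z y \<and> hpair z u \<epsilon> g' \<and> nxt k u v')"
    using assms(4) M 1(3) unfolding coloring_def by blast
  show ?case
  proof (cases "\<exists>z\<in>M. scrd M z y")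
    case True
    then obtain z u where z: "z \<in> M" "scrd M z y" "hpair z u \<epsilon> g" "nxt k u v" using a by blast
    obtain z' u' where z': "z' \<in> M" "scrd M z' y" "hpair z' u' \<epsilon> g'" "nxt k u' v'" using b True by blast
    have "z' = z" by (rule scrd_unique[OF z'(2) z(2) z'(1) z(1)])
    moreover have "z \<epsilon> y" using z(2) unfolding scrd_def by blast
    ultimately have "u = u'" using 1(1) z(3) z'(3) by blast
    then show ?thesis using z(4) z'(4) unfolding nxt_def by auto
  qed (use a b in blast)
qed

lemma color_unique: "color M k y r \<Longrightarrow> color M k y r' \<Longrightarrow> r = r'"
  unfolding color_def using coloring_unique omega_nat_inject by metis

lemma continuum_unique: "continuum M x \<Longrightarrow> continuum M x' \<Longrightarrow> x \<in> M \<Longrightarrow> x' \<in> M \<Longrightarrow> x = x'"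
  using Ord_linear[of x x'] unfolding continuum_def by blast

lemma continuum_color_unique: "continuum_color M k r \<Longrightarrow> continuum_color M k r' \<Longrightarrow> r = r'"
  unfolding continuum_color_def using continuum_unique color_unique by metis

lemma color_insert:
  assumes g: "g \<in> M" "coloring M k g" and y: "y \<in> M"
    and r: "(r = 0 \<and> \<not> (\<exists>z\<in>M. scrd M z y)) \<or> (\<exists>z\<in>M. \<exists>u\<in>M. scrd M z y \<and> hpair z u \<epsilon> g \<and> nxt k u (omega_nat r))"
  shows "color M k y r"
proof -
  let ?p = "hpair y (omega_nat r)"
  let ?g = "hun g (upair ?p ?p)"
  have gM: "?g \<in> M" using g(1) y by simp
  have sub: "hpair a b \<epsilon> ?g \<longleftrightarrow> hpair a b \<epsilon> g \<or> (a = y \<and> b = omega_nat r)" for a b by auto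
  have "coloring M k ?g" unfolding coloring_def
  proof (intro ballI impI)
    fix a b assume M: "a \<in> M" "b \<in> M" and "hpair a b \<epsilon> ?g"
    then consider "hpair a b \<epsilon> g" | "a = y" "b = omega_nat r" using sub by blast
    then show "(b = omega_nat 0 \<and> \<not> (\<exists>z\<in>M. scrd M z a)) \<or> (\<exists>z\<in>M. \<exists>u\<in>M. scrd M z a \<and> hpair z u \<epsilon> ?g \<and> nxt k u b)"
    proof cases
      case 1
      then have "(b = omega_nat 0 \<and> \<not> (\<exists>z\<in>M. scrd M z a)) \<or> (\<exists>z\<in>M. \<exists>u\<in>M. scrd M z a \<and> hpair z u \<epsilon> g \<and> nxt k u b)"
        using g(2) M unfolding coloring_def by blast
      then show ?thesis unfolding sub by blast
    next
      case 2
      show ?thesis unfolding 2 sub using r by blast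
    qed
  qed
  moreover have "?p \<epsilon> ?g" by simp
  ultimately show ?thesis unfolding color_def using gM omega_nat_in by blast
qed

lemma color_step:
  assumes s: "scrd M z y" and z: "z \<in> M" and y: "y \<in> M" and c: "color M k z r" and r: "r < k"
  shows "color M k y (Suc r mod k)"
proof -
  obtain g where g: "g \<in> M" "hpair z (omega_nat r) \<epsilon> g" "coloring M k g" using c unfolding color_def by blast
  have "nxt k (omega_nat r) (omega_nat (Suc r mod k))" unfolding nxt_def using r by blast
  then show ?thesis using color_insert[OF g(1,3) y] g(2) s z omega_nat_in by blast
qed

lemma color_exists:
  assumes k: "k > 0" shows "y \<in> M \<Longrightarrow> \<exists>r<k. color M k y r"
proof (induction y rule: hmem_induct)
  case (1 y)
  show ?case
  proof (cases "\<exists>z\<in>M. scrd M z y")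
    case True
    then obtain z where z: "z \<in> M" "scrd M z y" by blast
    have "z \<epsilon> y" using z(2) unfolding scrd_def by blast
    then obtain r where "r < k" "color M k z r" using 1(1) z(1) by blast
    then have "color M k y (Suc r mod k)" using color_step[OF z(2,1) 1(2)] by blast
    then show ?thesis using k by (intro exI[of _ "Suc r mod k"]) simp
  next
    case False
    have "coloring M k hempty" unfolding coloring_def by simp
    then have "color M k y 0" using color_insert[OF hempty_in _ 1(2)] False by blast
    then show ?thesis using k by blast
  qed
qed

lemma lepo_hom_self: "\<alpha> \<in> M \<Longrightarrow> lepo M \<alpha> (hprod \<alpha> hom)"
proof -
  assume a: "\<alpha> \<in> M"
  show ?thesis
  proof (rule lepoI)
    show "dtm M (\<lambda>e. hpair (e 0) (omega_nat 0))" by (intro dfnI omega_nat_in)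
  qed (use a in auto)
qed

text \<open>\<open>\<mu>\<close> is the Hartogs number of \<open>\<alpha>\<close>. As
  \<open>\<alpha>\<close> absorbs the factor \<open>hom\<close>, failing to inject into
  \<open>\<alpha>\<close> and into \<open>hprod \<alpha> hom\<close> is the same, and nothing
  strictly between \<open>\<alpha>\<close> and \<open>\<mu>\<close> can satisfy
  \<open>crd\<close>.\<close>

lemma next_crd:
  assumes w: "wcl \<alpha>" and O: "Ord \<alpha>"
  obtains \<mu> where "wcl \<mu>" "crd M \<mu>" "crd M \<alpha> \<Longrightarrow> scrd M \<alpha> \<mu>"
proof -
  have aM: "\<alpha> \<in> M" by (rule wcl_M[OF w])
  obtain \<mu> where m: "\<mu> \<in> M" "Ord \<mu>" "\<not> lepo M \<mu> \<alpha>" and lm: "\<And>\<beta>. \<beta> \<epsilon> \<mu> \<Longrightarrow> lepo M \<beta> \<alpha>"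
    using hartogs[OF aM] by blast
  have wm: "wcl \<mu>" by (rule wcl_next[OF w O m(1,2,3) lm])
  have ah: "lepo M (hprod \<alpha> hom) \<alpha>"
    by (rule lepo_trans[OF _ lepo_swap[OF aM hom_in] wcl_mult(1)[OF w]]) (use aM in simp)
  have cm: "crd M \<mu>" unfolding crd_def
  proof (intro conjI ballI impI)
    fix z assume z: "z \<in> M" "z \<epsilon> \<mu>"
    show "\<not> lepo_hom M \<mu> z"
    proof
      assume "lepo_hom M \<mu> z"
      moreover have "lepo M (hprod z hom) (hprod \<alpha> hom)"
        by (rule lepo_prod[OF z(1) hom_in lm[OF z(2)] lepo_refl[OF hom_in]])
      ultimately have "lepo M \<mu> (hprod \<alpha> hom)" using lepo_trans[OF m(1)] unfolding lepo_hom_def by blast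
      then show False using lepo_trans[OF m(1) _ ah] m(3) by blast
    qed
  qed (rule m(2))
  have "scrd M \<alpha> \<mu>" if ca: "crd M \<alpha>" unfolding scrd_def
  proof (intro conjI ballI impI ca cm)
    have "\<not> mems \<mu> \<subseteq> mems \<alpha>" using lepo_subset[OF m(1)] m(3) by blast
    then have "\<not> (\<mu> \<epsilon> \<alpha> \<or> \<mu> = \<alpha>)" using Ord_subset_iff[OF m(2) O] by blast
    then show "\<alpha> \<epsilon> \<mu>" using Ord_linear[OF m(2) O] by blast
    fix u assume u: "u \<in> M" "\<alpha> \<epsilon> u" "u \<epsilon> \<mu>"
    have "lepo M u (hprod \<alpha> hom)" by (rule lepo_trans[OF u(1) lm[OF u(3)] lepo_hom_self[OF aM]])
    then show "\<not> crd M u" using u(2) aM unfolding crd_def lepo_hom_def by blast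
  qed
  then show thesis using that wm cm by blast
qed

lemma crd_all_colors:
  assumes r: "r < k" obtains \<mu> where "wcl \<mu>" "crd M \<mu>" "color M k \<mu> r"
proof -
  have RM: "hpow hom \<in> M" by simp
  obtain \<alpha> where a: "\<alpha> \<in> M" "Ord \<alpha>" "lepo M (hpow hom) \<alpha>" "lepo M \<alpha> (hpow hom)"
    using ordinal_lepo[OF RM] by blast
  have "\<exists>u. u \<epsilon> \<alpha>"
  proof -
    have "hempty \<epsilon> hpow hom" by (simp add: mems_def)
    then show ?thesis using a(3) unfolding lepo_def Ball_def in_mems by blast
  qed
  then have "mems \<alpha> \<noteq> {}" unfolding mems_nonempty .
  then have wa: "wcl \<alpha>" using wcl_transport[OF wcl_reals a(1) _ a(3,4)] by blast
  \<comment> \<open>\<open>\<alpha>\<close> is just some ordinal of the size of the reals and may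
    fail to be a cardinal; one Hartogs step leads to a \<open>crd\<close>.\<close>
  obtain \<mu>0 where m0: "wcl \<mu>0" "crd M \<mu>0" using next_crd[OF wa a(2)] by blast
  obtain c where c: "c < k" "color M k \<mu>0 c" using color_exists[OF _ wcl_M[OF m0(1)], of k] r by auto
  have "\<exists>\<mu>. wcl \<mu> \<and> crd M \<mu> \<and> color M k \<mu> ((c + n) mod k)" for n
  proof (induction n)
    case 0
    show ?case using m0 c by auto
  next
    case (Suc n)
    then obtain \<mu> where m: "wcl \<mu>" "crd M \<mu>" "color M k \<mu> ((c + n) mod k)" by blast
    have O: "Ord \<mu>" using m(2) unfolding crd_def by blast
    obtain \<nu> where n: "wcl \<nu>" "crd M \<nu>" "crd M \<mu> \<Longrightarrow> scrd M \<mu> \<nu>" using next_crd[OF m(1) O] by blast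
    have "(c + n) mod k < k" using r by simp
    from color_step[OF n(3)[OF m(2)] wcl_M[OF m(1)] wcl_M[OF n(1)] m(3) this]
    have "color M k \<nu> ((c + Suc n) mod k)" by (simp add: mod_Suc_eq)
    then show ?case using n(1,2) by blast
  qed
  \<comment> \<open>This many steps lead from colour \<open>c\<close> to colour \<open>r\<close>
    modulo \<open>k\<close>, also when \<open>r\<close> is smaller than \<open>c\<close>.\<close>
  from this[of "r + (k - c)"] obtain \<mu> where "wcl \<mu>" "crd M \<mu>" "color M k \<mu> ((c + (r + (k - c))) mod k)" by blast
  moreover have "(c + (r + (k - c))) mod k = r" using c(1) r by simp
  ultimately show thesis using that by simp
qed

end

section \<open>Cardinals, colours and the continuum in a Cohen extension\<close>

context cohen_ext
begin

lemma lepo_hom_MG: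
  assumes "\<alpha> \<in> M" "\<beta> \<in> M" shows "lepo_hom MG \<beta> \<alpha> \<longleftrightarrow> lepo_hom M \<beta> \<alpha>"
  unfolding lepo_hom_def using preserve[OF assms] lepo_mono[OF _ M_subset_MG] by blast

lemma crd_MG: assumes y: "y \<in> M" shows "crd MG y \<longleftrightarrow> crd M y"
proof -
  have "(\<forall>z\<in>MG. z \<epsilon> y \<longrightarrow> \<not> lepo_hom MG y z) \<longleftrightarrow> (\<forall>z\<in>M. z \<epsilon> y \<longrightarrow> \<not> lepo_hom M y z)"
    using lepo_hom_MG[OF _ y] transM[OF y] M_subset_MG by blast
  then show ?thesis unfolding crd_def by blast
qed

lemma scrd_MG: assumes y: "y \<in> M" shows "scrd MG z y \<longleftrightarrow> scrd M z y"
proof (cases "z \<epsilon> y")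
  case True
  then have z: "z \<in> M" by (rule transM[OF y])
  have "(\<forall>u\<in>MG. z \<epsilon> u \<longrightarrow> u \<epsilon> y \<longrightarrow> \<not> crd MG u) \<longleftrightarrow> (\<forall>u\<in>M. z \<epsilon> u \<longrightarrow> u \<epsilon> y \<longrightarrow> \<not> crd M u)"
    using crd_MG transM[OF y] M_subset_MG by blast
  then show ?thesis unfolding scrd_def crd_MG[OF z] crd_MG[OF y] by blast
qed (simp add: scrd_def)

text \<open>A colouring from the ground model remains one: immediate predecessors of its points lie
  in the ground model by transitivity, and being one is not changed by the extension.\<close>

lemma color_MG: assumes "color M k y r" shows "color MG k y r"
proof -
  obtain g where g: "g \<in> M" "hpair y (omega_nat r) \<epsilon> g" "coloring M k g" using assms unfolding color_def by blast
  have "coloring MG k g" unfolding coloring_def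
  proof (intro ballI impI)
    fix a v assume av: "hpair a v \<epsilon> g"
    then have M: "a \<in> M" "v \<in> M" using pair_mem_in[OF g(1)] by blast+
    then have "(v = omega_nat 0 \<and> \<not> (\<exists>z\<in>M. scrd M z a)) \<or> (\<exists>z\<in>M. \<exists>u\<in>M. scrd M z a \<and> hpair z u \<epsilon> g \<and> nxt k u v)"
      using g(3) av unfolding coloring_def by blast
    moreover have "z \<in> M" if "scrd M z a" for z using that transM[OF M(1)] unfolding scrd_def by blast
    ultimately show "(v = omega_nat 0 \<and> \<not> (\<exists>z\<in>MG. scrd MG z a)) \<or> (\<exists>z\<in>MG. \<exists>u\<in>MG. scrd MG z a \<and> hpair z u \<epsilon> g \<and> nxt k u v)"
      unfolding scrd_MG[OF M(1)] using M_subset_MG by blast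
  qed
  moreover have "g \<in> MG" using g(1) M_subset_MG by blast
  ultimately show ?thesis unfolding color_def using g(2) N.omega_nat_in by blast
qed

text \<open>The number of countable names bounds the continuum by \<open>\<mu>\<close>. A smaller
  bound would make \<open>\<mu>\<close>, which injects into the reals, small in the extension, hence
  by preservation small in the ground model, against \<open>crd M \<mu>\<close>.\<close>

lemma continuum_MG:
  assumes w: "wcl \<mu>" and c: "crd M \<mu>" shows "continuum MG \<mu>"
proof -
  have "lepo MG (N.hpow hom) \<mu>"
    by (rule N.lepo_trans[OF _ reals_upper lepo_mono[OF lepo_cohen[OF w] M_subset_MG]]) simp
  moreover have "\<not> lepo MG (N.hpow hom) y" if y: "y \<epsilon> \<mu>" for y
  proof
    assume l: "lepo MG (N.hpow hom) y"
    have yM: "y \<in> M" by (rule transM[OF mu y])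
    have mN: "\<mu> \<in> MG" "y \<in> MG" using mu yM M_subset_MG by blast+
    have "lepo MG \<mu> y" by (rule N.lepo_trans[OF mN(1) reals_lower l])
    then have "lepo MG \<mu> (hprod y hom)" by (rule N.lepo_trans[OF mN(1) _ N.lepo_hom_self[OF mN(2)]])
    then have "lepo_hom M \<mu> y" unfolding lepo_hom_def by (rule preserve[OF yM mu])
    then show False using c y yM unfolding crd_def by blast
  qed
  ultimately have 1: "Ord \<mu> \<and> lepo MG (N.hpow hom) \<mu> \<and> (\<forall>y\<in>MG. y \<epsilon> \<mu> \<longrightarrow> \<not> lepo MG (N.hpow hom) y)"
    using c unfolding crd_def by blast
  have "N.hpow hom \<in> MG" by simp
  then show ?thesis unfolding continuum_def using 1 N.hom_in by blast
qed

end

lemma continuum_color_reached: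
  assumes V: "V \<in> ctms" and r: "r < k"
  shows "\<exists>N\<in>ctms. V \<subseteq> N \<and> continuum_color N k r"
proof -
  interpret ctm V by unfold_locales (rule V)
  obtain \<mu> where m: "wcl \<mu>" "crd V \<mu>" "color V k \<mu> r" by (rule crd_all_colors[OF r])
  have mM: "\<mu> \<in> V" by (rule wcl_M[OF m(1)])
  interpret forcing V "cohen \<mu>" by unfold_locales (rule cohen_in[OF mM], rule cohen_one)
  obtain G where G: "generic V (cohen \<mu>) G" using generic_exists[OF cohen_one] by blast
  interpret E: cohen_ext V \<mu> G 
    by (intro cohen_ext.intro cohen_ext_axioms.intro) (rule ctm_axioms, rule mM, rule G)
  have "\<mu> \<in> E.MG" using mM E.M_subset_MG by blast
  then have "continuum_color E.MG k r" unfolding continuum_color_def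
    using E.continuum_MG[OF m(1,2)] E.color_MG[OF m(3)] by blast
  then show ?thesis using E.MG_ctm E.M_subset_MG by blast
qed

section \<open>The dials as sentences of the modal language\<close>

primrec mfm_of :: "sfm \<Rightarrow> ('r, 'f) mfm" where
  "mfm_of (FMem i j) = MMem (TVar i) (TVar j)"
| "mfm_of (FEq i j) = MEq (TVar i) (TVar j)"
| "mfm_of FFls = MFls"
| "mfm_of (FImp \<phi> \<psi>) = MImp (mfm_of \<phi>) (mfm_of \<psi>)"
| "mfm_of (FAll n \<phi>) = MAll n (mfm_of \<phi>)"

lemma msat_mfm_of: "msat L W e (mfm_of \<phi>) \<longleftrightarrow> ssat W e \<phi>"
  by (induction \<phi> arbitrary: e) simp_all

lemma mfm_of_sentence:
  fixes L :: "('r, 'f) lang"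
  shows "fv \<phi> = {} \<Longrightarrow> mfm_of \<phi> \<in> sentences L"
proof -
  have "mfv (mfm_of \<phi> :: ('r, 'f) mfm) = fv \<phi>" by (induction \<phi>) auto
  moreover have "wf_mfm L (mfm_of \<phi>)" by (induction \<phi>) simp_all
  ultimately show "fv \<phi> = {} \<Longrightarrow> mfm_of \<phi> \<in> sentences L" by (simp add: sentences_def)
qed

lemma dial_exists:
  fixes L :: "('r, 'f) lang"
  shows "\<exists>s. dial L k s"
proof -
  have "\<exists>\<psi>. fv \<psi> = {} \<and> (\<forall>M\<in>ctms. \<forall>e. range e \<subseteq> M \<longrightarrow> (ssat M e \<psi> \<longleftrightarrow> continuum_color M k r))" for r
    by (rule udf_sentence[OF udf_continuum_color[of k r]]) blast
  then obtain \<psi> where \<psi>: "\<And>r. fv (\<psi> r) = {}"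
    "\<And>r M e. M \<in> ctms \<Longrightarrow> range e \<subseteq> M \<Longrightarrow> ssat M e (\<psi> r) \<longleftrightarrow> continuum_color M k r" by metis
  have "dial L k (\<lambda>r. mfm_of (\<psi> r))" unfolding dial_def msat_mfm_of
  proof (intro conjI allI impI ballI)
    show "mfm_of (\<psi> r) \<in> sentences L" for r by (rule mfm_of_sentence[OF \<psi>(1)])
    fix V and e :: "nat \<Rightarrow> hcset" assume V: "V \<in> ctms" "range e \<subseteq> V"
    show "r = r'" if "ssat V e (\<psi> r)" "ssat V e (\<psi> r')" for r r'
      using that ctm.continuum_color_unique[OF ctm.intro[OF V(1)]] unfolding \<psi>(2)[OF V] by blast
    show "\<exists>N\<in>ctms. V \<subseteq> N \<and> ssat N e (\<psi> r)" if r: "r < k" for r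
    proof -
      obtain N where N: "N \<in> ctms" "V \<subseteq> N" "continuum_color N k r"
        using continuum_color_reached[OF V(1) r] by blast
      have "range e \<subseteq> N" using V(2) N(2) by blast
      then show ?thesis using N \<psi>(2)[OF N(1)] by blast
    qed
  qed
  then show ?thesis by blast
qed

theorem theorem33:
  fixes L :: "('r, 'f) lang"
  assumes reals: "\<forall>x. is_real x \<longrightarrow> (\<exists>M\<in>ctms. x \<in> M)"
    and "countable_lang L"
    and "interpreted_in_worlds L"
    and "U \<in> ctms"
  shows "\<exists>W\<in>ctms. U \<subseteq> W \<and> Val W L = S5"
  by (rule S5_from_dials[OF assms(2,4) union_of_ctms[OF reals] dial_exists])

end
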